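(* Let $\alpha,\beta\in[0,\infty)\setminus\{1\}$. Suppose $g$ is a non-CSC HCMU metric (with finite area and finite Calabi energy) on the K-surface $S^{2}_{\{\alpha,\beta\}}$, and let $K$ be the Gaussian curvature of $g$. Then the following classification holds. (1) If the two singularities are extremal points of $K$, then $g$ is a rotationally symmetric metric that is uniquely determined by the total area and the angles $2\pi\alpha,2\pi\beta$, i.e., $g$ is a football. (2) Suppose one singularity is the saddle point of $K$ and the other is an extremal point of $K$; without loss of generality, let the singularity of conical angle $2\pi\alpha$ ($2\le\alpha\in\mathbb{Z}$) be the saddle point of $K$. Then the following statements hold. (A) If $2\le\beta\in\mathbb{Z}$, there are two cases. (A-1) If the singularity of singular angle $2\pi\beta$ is a maximum point of $K$, then $K$ has $I_{1}+1\geq 1$ maximum points and $I_{2}\geq 1$ minimum points, where $I_{1}$ and $I_{2}$ satisfy $I_{1}+I_{2}=\alpha$ and one of the following conditions holds: (a-1-1) $I_{2}=1$; (a-1-2) $I_{2}\geq 2$, $I_{2}\mid (I_{1}+\beta)$ and $I_{1}+\beta>\alpha-1$; (a-1-3) $I_{2}\geq 2$ and $I_{2}\nmid (I_{1}+\beta)$. (A-2) If the singularity of singular angle $2\pi\beta$ is a minimum point of $K$, then $K$ has $I_{1}\geq 1$ maximum points and $I_{2}+1\geq 1$ minimum points, where $I_{1}$ and $I_{2}$ satisfy $I_{1}+I_{2}=\alpha$ and one of the following conditions holds: (a-2-1) $I_{2}=0$; (a-2-2) $I_{2}\geq 1$, $(I_{2}+\beta)\nmid I_{1}$ and $I_{1}(I_{2}+\beta)\geq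 (\alpha-1)\,\mathrm{GCD}(I_{2}+\beta,I_{1})$. (B) If $\beta\notin\mathbb{Z}$, there are two cases. (B-1) If the singularity of singular angle $2\pi\beta$ is a maximum point of $K$, then $K$ has $I_{1}+1\geq 1$ maximum points and $I_{2}\geq 1$ minimum points, where $I_{1}$ and $I_{2}$ satisfy $I_{1}+I_{2}=\alpha$ and $I_{1}+\beta>I_{2}$. (B-2) If the singularity of singular angle $2\pi\beta$ is a minimum point of $K$, then $K$ has $I_{1}\geq 1$ maximum points and $I_{2}+1\geq 1$ minimum points, where $I_{1}$ and $I_{2}$ satisfy $I_{1}+I_{2}=\alpha$ and $I_{1}>I_{2}+\beta$. (3) If both singularities are saddle points of $K$, then $\alpha,\beta$ are integers with $\alpha,\beta\geq 2$, and $K$ has $I_{1}\geq 1$ maximum points and $I_{2}\geq 1$ minimum points, where $I_{1}$ and $I_{2}$ satisfy $I_{1}>I_{2}$, $I_{1}+I_{2}=\alpha+\beta$, and one of the following conditions holds: (3-1) $I_{2}=1$; (3-2) $I_{2}\geq 2$, $I_{2}\mid I_{1}$ and $I_{1}\geq \max\{\alpha,\beta\}$; (3-3) $I_{2}\geq 2$ and $I_{2}\nmid I_{1}$.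
   Context: K-surface: for $\alpha_1,\dots,\alpha_N\in[0,\infty)\setminus\{1\}$, $S^2_{\{\alpha_1,\dots,\alpha_N\}}$ denotes the Riemann sphere $S^2=\mathbb{C}\cup\{\infty\}$ with $N$ distinct marked points $p_1,\dots,p_N$, where a metric on it is understood to be a smooth conformal metric on $S^2\setminus\{p_1,\dots,p_N\}$ having a singularity of singular angle $2\pi\alpha_j$ at $p_j$ for each $j$. Singular angle: if in a local complex coordinate $z=re^{\sqrt{-1}\theta}$ centred at the point, on a punctured disk, $g=e^{2\psi}|dz|^2$, the singular angle is $2\pi\alpha$ ($\alpha\ge 0$) if $\lim_{r\to 0}\frac{1}{2\pi}\int_0^{2\pi}\left(r\frac{\partial\psi(r,\theta)}{\partial r}+1-\alpha\right)d\theta=0$. For $\alpha>0$ the point is called a conical singularity; for $\alpha=0$ it is called a (weak) cusp. HCMU metric: a conformal metric $g$ on $S^2\setminus\{p_1,\dots,p_N\}$ whose Gaussian curvature $K$ satisfies $K_{,zz}=0$, where $K_{,zz}$ is the $(2,0)$ part of the second covariant derivative of $K$; writing $g=e^{2\varphi}|dz|^2$ locally, this is $K_{zz}-2\varphi_zK_z=0$. Equivalently, $\nabla K=\sqrt{-1}e^{-2\varphi}K_{\bar z}\frac{\partial}{\partial z}$ is a holomorphic vector field there. Throughout it is assumed that $\int dg<+\infty$ and $\int K^2\,dg<+\infty$ over $S^2\setminus\{p_1,\dots,p_N\}$. Non-CSC means that $K$ is not constant. It is known that under these assumptions $K$ extends continuously to $S^2$. Maximum points and minimum points of $K$ are the points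 of $S^2$ at which this extension attains its global maximum $K_1$ and its global minimum $K_2$; extremal points are the maximum and minimum points. A saddle point of $K$ is a critical point (possibly a singularity of $g$, where $dK$ extends by $0$) that is not an extremal point. Rotationally symmetric means that, for some conformal identification of the sphere with $\mathbb{C}\cup\{\infty\}$, $g$ is invariant under $z\mapsto e^{\sqrt{-1}\theta}z$ for all real $\theta$. A football is a rotationally symmetric non-CSC HCMU metric on $S^2$ whose curvature $K$ has no saddle points and exactly two extremal points. "Uniquely determined" by given data means: any two such metrics with the same data are isometric. $\mathrm{GCD}$ is the greatest common divisor; the numbers $I_1,I_2$ are integers. *)

theory Defs
  imports "HOL-Complex_Analysis.Complex_Analysis"
begin

section \<open>Smooth functions of one complex variable\<close>

definition pd_x :: "(complex \<Rightarrow> 'b::real_normed_vector) \<Rightarrow> complex \<Rightarrow> 'b" where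
  "pd_x f z = frechet_derivative f (at z) 1"

definition pd_y :: "(complex \<Rightarrow> 'b::real_normed_vector) \<Rightarrow> complex \<Rightarrow> 'b" where
  "pd_y f z = frechet_derivative f (at z) \<i>"

fun Ck_on :: "nat \<Rightarrow> complex set \<Rightarrow> (complex \<Rightarrow> 'b::real_normed_vector) \<Rightarrow> bool" where
  "Ck_on 0 S f \<longleftrightarrow> continuous_on S f"
| "Ck_on (Suc k) S f \<longleftrightarrow>
     (\<forall>z\<in>S. f differentiable (at z)) \<and> Ck_on k S (pd_x f) \<and> Ck_on k S (pd_y f)"

text \<open>Only used on open sets.\<close>
definition smooth_on :: "complex set \<Rightarrow> (complex \<Rightarrow> 'b::real_normed_vector) \<Rightarrow> bool" where
  "smooth_on S f \<longleftrightarrow> (\<forall>k. Ck_on k S f)"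

definition laplacian :: "(complex \<Rightarrow> real) \<Rightarrow> complex \<Rightarrow> real" where
  "laplacian f z = pd_x (pd_x f) z + pd_y (pd_y f) z"

text \<open>The Wirtinger derivative \<open>\<partial>/\<partial>z = (\<partial>/\<partial>x - \<i> \<partial>/\<partial>y)/2\<close>.\<close>
definition d_z :: "(complex \<Rightarrow> complex) \<Rightarrow> complex \<Rightarrow> complex" where
  "d_z f z = (pd_x f z - \<i> * pd_y f z) / 2"


section \<open>The Riemann sphere\<close>

text \<open>Points are \<open>Some z\<close> for \<open>z\<close> in the plane, and \<open>None\<close> is the point at infinity.\<close>

type_synonym sphere = "complex option"

definition riemann_sphere :: "sphere topology" where
  "riemann_sphere = Alexandroff_compactification euclidean"

text \<open>
  The standard holomorphic coordinate \<open>\<zeta>\<close> centred at a point: \<open>\<zeta> = z - a\<close> at a finite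
  point \<open>a\<close>, and \<open>\<zeta> = 1/z\<close> at infinity.  \<open>param p\<close> is the inverse of \<open>coord p\<close>.  The value of
  \<open>coord p\<close> at the single point outside the chart is irrelevant.
\<close>
fun param :: "sphere \<Rightarrow> complex \<Rightarrow> sphere" where
  "param (Some a) \<zeta> = Some (a + \<zeta>)"
| "param None \<zeta> = (if \<zeta> = 0 then None else Some (1 / \<zeta>))"

fun coord :: "sphere \<Rightarrow> sphere \<Rightarrow> complex" where
  "coord (Some a) (Some z) = z - a"
| "coord (Some a) None = 0"
| "coord None (Some z) = 1 / z"
| "coord None None = 0"

definition conformal_automorphism :: "(sphere \<Rightarrow> sphere) \<Rightarrow> bool" where
  "conformal_automorphism f \<longleftrightarrow>
     bij f \<and> (\<forall>x. (\<lambda>\<zeta>. coord (f x) (f (param x \<zeta>))) analytic_on {0})"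

definition rotation :: "real \<Rightarrow> sphere \<Rightarrow> sphere" where
  "rotation \<theta> = map_option (\<lambda>z. cis \<theta> * z)"


section \<open>Conformal metrics\<close>

text \<open>
  A conformal metric on the complement of a finite set is encoded by the function \<open>u\<close> with
  \<open>g = e\<^sup>2\<^sup>u g\<^sub>0\<close>, where \<open>g\<^sub>0 = 4 |dz|\<^sup>2 / (1 + |z|\<^sup>2)\<^sup>2\<close> is the round metric, which has the same
  form in the coordinate \<open>1/z\<close>.  The values of \<open>u\<close> at the removed points carry no information.
  In the standard coordinate \<open>\<zeta>\<close> at \<open>p\<close> the metric is \<open>e\<^sup>2\<^sup>\<phi> |d\<zeta>|\<^sup>2\<close> with \<open>\<phi> = conf_factor u p\<close>.
\<close>
type_synonym conf_metric = "sphere \<Rightarrow> real"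

fun round_factor :: "sphere \<Rightarrow> complex \<Rightarrow> real" where
  "round_factor (Some a) \<zeta> = ln (2 / (1 + (cmod (a + \<zeta>))\<^sup>2))"
| "round_factor None \<zeta> = ln (2 / (1 + (cmod \<zeta>)\<^sup>2))"

definition conf_factor :: "conf_metric \<Rightarrow> sphere \<Rightarrow> complex \<Rightarrow> real" where
  "conf_factor u p \<zeta> = u (param p \<zeta>) + round_factor p \<zeta>"

text \<open>The transformation rule of \<open>\<phi>\<close> under \<open>z = 1/\<zeta>\<close>, where \<open>|dz/d\<zeta>| = |\<zeta>|\<^sup>-\<^sup>2\<close>.\<close>
lemma conf_factor_at_infinity:
  assumes "\<zeta> \<noteq> 0"
  shows "conf_factor u None \<zeta> = conf_factor u (Some 0) (1 / \<zeta>) + ln (1 / (cmod \<zeta>)\<^sup>2)"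
proof -
  have pos: "(cmod \<zeta>)\<^sup>2 > 0" using assms by simp
  have "2 / (1 + (cmod \<zeta>)\<^sup>2) = 2 / (1 + (cmod (1 / \<zeta>))\<^sup>2) * (1 / (cmod \<zeta>)\<^sup>2)"
    using pos by (simp add: norm_divide power_divide field_simps)
  moreover have "2 / (1 + (cmod (1 / \<zeta>))\<^sup>2) > 0"
    by (simp add: add_pos_nonneg)
  ultimately have "ln (2 / (1 + (cmod \<zeta>)\<^sup>2))
      = ln (2 / (1 + (cmod (1 / \<zeta>))\<^sup>2)) + ln (1 / (cmod \<zeta>)\<^sup>2)"
    using pos by (metis ln_mult_pos zero_less_divide_1_iff)
  then show ?thesis using assms by (simp add: conf_factor_def)
qed

definition conformal_metric :: "conf_metric \<Rightarrow> sphere set \<Rightarrow> bool" where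
  "conformal_metric u P \<longleftrightarrow>
     finite P \<and> (\<forall>x. x \<notin> P \<longrightarrow> (\<exists>e>0. smooth_on (ball 0 e) (conf_factor u x)))"

text \<open>
  Any local coordinate \<open>w\<close> centred at \<open>p\<close> is admitted: \<open>h\<close> expresses the standard coordinate
  through it, \<open>\<zeta> = h w\<close>, so that the metric is \<open>e\<^sup>2\<^sup>\<psi> |dw|\<^sup>2\<close> with
  \<open>\<psi> w = conf_factor u p (h w) + ln |h' w|\<close>.
\<close>
definition singular_angle_factor :: "conf_metric \<Rightarrow> sphere \<Rightarrow> real \<Rightarrow> bool" where
  "singular_angle_factor u p \<alpha> \<longleftrightarrow>
     (\<exists>h e. e > 0 \<and> h holomorphic_on ball 0 e \<and> inj_on h (ball 0 e) \<and> h 0 = 0 \<and>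
        (let \<psi> = (\<lambda>w. conf_factor u p (h w) + ln (cmod (deriv h w))) in
          ((\<lambda>r. 1 / (2 * pi) *
               integral {0..2 * pi}
                 (\<lambda>\<theta>. r * deriv (\<lambda>s. \<psi> (complex_of_real s * cis \<theta>)) r + 1 - \<alpha>))
            \<longlongrightarrow> 0) (at_right 0)))"

text \<open>
  The marked points together with their angles (in units of \<open>2\<pi>\<close>) form a finite partial function
  \<open>A\<close>; a metric on this K-surface lives on the complement of \<open>dom A\<close>.
\<close>
definition K_surface_metric :: "conf_metric \<Rightarrow> (sphere \<rightharpoonup> real) \<Rightarrow> bool" where
  "K_surface_metric u A \<longleftrightarrow>
     conformal_metric u (dom A) \<and>
     (\<forall>x \<alpha>. A x = Some \<alpha> \<longrightarrow> 0 \<le> \<alpha> \<and> \<alpha> \<noteq> 1 \<and> singular_angle_factor u x \<alpha>)"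

definition gauss_curvature :: "conf_metric \<Rightarrow> sphere \<Rightarrow> real" where
  "gauss_curvature u x = - exp (- 2 * conf_factor u x 0) * laplacian (conf_factor u x) 0"

text \<open>The plane misses only the point at infinity, which is a null set for the area measure.\<close>
definition area_density :: "conf_metric \<Rightarrow> complex \<Rightarrow> real" where
  "area_density u z = exp (2 * conf_factor u (Some 0) z)"

definition finite_area :: "conf_metric \<Rightarrow> sphere set \<Rightarrow> bool" where
  "finite_area u P \<longleftrightarrow> set_integrable lborel {z. Some z \<notin> P} (area_density u)"

definition area :: "conf_metric \<Rightarrow> sphere set \<Rightarrow> real" where
  "area u P = set_lebesgue_integral lborel {z. Some z \<notin> P} (area_density u)"

definition finite_energy :: "conf_metric \<Rightarrow> sphere set \<Rightarrow> bool" where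
  "finite_energy u P \<longleftrightarrow>
     set_integrable lborel {z. Some z \<notin> P}
       (\<lambda>z. (gauss_curvature u (Some z))\<^sup>2 * area_density u z)"

definition is_isometry ::
    "conf_metric \<Rightarrow> sphere set \<Rightarrow> conf_metric \<Rightarrow> sphere set \<Rightarrow> (sphere \<Rightarrow> sphere) \<Rightarrow> bool" where
  "is_isometry u P u' P' f \<longleftrightarrow>
     bij_betw f (- P) (- P') \<and>
     (\<forall>x. x \<notin> P \<longrightarrow>
        (let h = (\<lambda>\<zeta>. coord (f x) (f (param x \<zeta>))) in
          (\<exists>e>0. smooth_on (ball 0 e) h) \<and>
          (\<forall>v. exp (conf_factor u' (f x) 0) * cmod (frechet_derivative h (at 0) v)
                = exp (conf_factor u x 0) * cmod v)))"

text \<open>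
  An isometry is smooth with invertible differential, so its inverse is smooth too; orientation may
  be reversed.
\<close>
definition isometric ::
    "conf_metric \<Rightarrow> sphere set \<Rightarrow> conf_metric \<Rightarrow> sphere set \<Rightarrow> bool" where
  "isometric u P u' P' \<longleftrightarrow> (\<exists>f. is_isometry u P u' P' f)"

definition rotationally_symmetric :: "conf_metric \<Rightarrow> sphere set \<Rightarrow> bool" where
  "rotationally_symmetric u P \<longleftrightarrow>
     (\<exists>f. conformal_automorphism f \<and>
        (\<forall>\<theta>. is_isometry u P u P (inv f \<circ> rotation \<theta> \<circ> f)))"


section \<open>Non-CSC HCMU metrics\<close>

definition HCMU_equation :: "conf_metric \<Rightarrow> sphere set \<Rightarrow> bool" where
  "HCMU_equation u P \<longleftrightarrow>
     (\<forall>x. x \<notin> P \<longrightarrow>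
        (let K = (\<lambda>\<zeta>. complex_of_real (gauss_curvature u (param x \<zeta>)));
             \<phi> = (\<lambda>\<zeta>. complex_of_real (conf_factor u x \<zeta>))
         in d_z (d_z K) 0 - 2 * d_z \<phi> 0 * d_z K 0 = 0))"

definition nonCSC_HCMU :: "conf_metric \<Rightarrow> (sphere \<rightharpoonup> real) \<Rightarrow> bool" where
  "nonCSC_HCMU u A \<longleftrightarrow>
     K_surface_metric u A \<and> HCMU_equation u (dom A) \<and>
     finite_area u (dom A) \<and> finite_energy u (dom A) \<and>
     \<not> (\<exists>c. \<forall>x. x \<notin> dom A \<longrightarrow> gauss_curvature u x = c)"

text \<open>The continuous extension of the Gaussian curvature to the whole sphere.\<close>
definition curvature_ext :: "conf_metric \<Rightarrow> sphere set \<Rightarrow> sphere \<Rightarrow> real" where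
  "curvature_ext u P =
     (THE k. continuous_map riemann_sphere euclideanreal k \<and>
             (\<forall>x. x \<notin> P \<longrightarrow> k x = gauss_curvature u x))"

definition max_points :: "(sphere \<Rightarrow> real) \<Rightarrow> sphere set" where
  "max_points K = {x. \<forall>y. K y \<le> K x}"

definition min_points :: "(sphere \<Rightarrow> real) \<Rightarrow> sphere set" where
  "min_points K = {x. \<forall>y. K x \<le> K y}"

definition extremal_points :: "(sphere \<Rightarrow> real) \<Rightarrow> sphere set" where
  "extremal_points K = max_points K \<union> min_points K"

text \<open>
  At a singularity in \<open>P\<close> the differential of \<open>K\<close>, defined on a punctured neighbourhood, is required
  to extend continuously by \<open>0\<close>; this does not depend on the coordinate.
\<close>
definition critical_point :: "sphere set \<Rightarrow> (sphere \<Rightarrow> real) \<Rightarrow> sphere \<Rightarrow> bool" where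
  "critical_point P K x \<longleftrightarrow>
     (if x \<in> P
      then ((pd_x (K \<circ> param x)) \<longlongrightarrow> 0) (at 0) \<and> ((pd_y (K \<circ> param x)) \<longlongrightarrow> 0) (at 0)
      else ((K \<circ> param x) has_derivative (\<lambda>_. 0)) (at 0))"

definition saddle_points :: "sphere set \<Rightarrow> (sphere \<Rightarrow> real) \<Rightarrow> sphere set" where
  "saddle_points P K = {x. critical_point P K x \<and> x \<notin> extremal_points K}"

definition football :: "conf_metric \<Rightarrow> (sphere \<rightharpoonup> real) \<Rightarrow> bool" where
  "football u A \<longleftrightarrow>
     nonCSC_HCMU u A \<and> rotationally_symmetric u (dom A) \<and>
     saddle_points (dom A) (curvature_ext u (dom A)) = {} \<and>
     card (extremal_points (curvature_ext u (dom A))) = 2"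

text \<open>Excludes the infinite sets, to which \<open>card\<close> assigns \<open>0\<close>.\<close>
definition has_points :: "sphere set \<Rightarrow> int \<Rightarrow> bool" where
  "has_points S n \<longleftrightarrow> finite S \<and> int (card S) = n"

end

theory Submission
  imports Defs
begin

text \<open>
 Locally the vector field dual to \<open>dK\<close> has a holomorphic component \<open>F\<close>, and \<open>e\<^sup>2\<^sup>\<phi> |F|\<^sup>2\<close> is a cubic
 polynomial \<open>G\<close> of \<open>K\<close>.  Jensen's formula on small circles, together with the finite area and energy and the
 singular angle, shows that \<open>v / F v\<close> extends over every puncture.  Hence \<open>dz / F\<close> is a meromorphic 1-form on the
 sphere with simple poles of real residue.  Its poles are the extremal points of \<open>K\<close>, the residue being the angle
 divided by \<open>G' (K)\<close>, negative at the maxima; at a saddle of angle \<open>\<alpha>\<close> it vanishes to order \<open>\<alpha> - 1\<close>.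
 The degree of the canonical divisor counts the extremal points and the residue theorem balances their angles.
 If the ratio of the two slopes of \<open>G\<close> is rational, the form is a multiple of \<open>dR / R\<close> for a rational function \<open>R\<close>,
 and \<open>R\<close> takes its value at the saddle with multiplicity \<open>\<alpha>\<close>, so that \<open>\<alpha>\<close> is at most the degree of \<open>R\<close>.
 Without saddles the form is \<open>c dw / w\<close>: then \<open>K\<close> depends only on \<open>|w|\<close>, the two angles determine the metric
 up to a homothety, and the area fixes the scale.
\<close>

text \<open>The obstacle at a puncture is that the singular angle controls only circle means of the
  radial derivative of the conformal factor: neither \<open>K\<close> nor the factor is known
  pointwise there, and \<open>F\<close> might have an essential singularity or zeros accumulating at
  the puncture. So everything local is extracted from circle integrals. A primitive of
  \<open>1 / G\<close> composed with \<open>K\<close> is harmonic off the zeros of \<open>F\<close>,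
  and a one-sided bound on it turns its circle mean into a mean of its absolute value. That bound
  depends on whether the positivity interval of \<open>G\<close> that contains the values of
  \<open>K\<close> has a finite left end. An infinite left end cannot be excluded locally; it is
  ruled out globally, because all residues would then be negative. A cusp is the case in which the
  left end is a double root of \<open>G\<close>, which is why no logarithmic lower bound is ever
  asked for. Orders are counted with a shift: \<open>n\<close> is the order of \<open>dz / F\<close>
  plus one, so that 0 is a simple pole, 1 a regular point, and at a saddle \<open>n\<close> is the
  angle itself.\<close>

abbreviation (input) tends_to :: "('a => 'b::topological_space) => 'b => 'a filter => bool" (infixr "--->" 55) where
 "tends_to \<equiv> tendsto"

abbreviation (input) cr :: "real \<Rightarrow> complex" where
  "cr \<equiv> of_real"

lemmas hol_cont = holomorphic_on_imp_continuous_on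

section \<open>Circle integrals, the mean value property and Jensen's inequality on annuli\<close>

definition annulus :: "real => real => complex set" where
 "annulus a b = {v. a < cmod v \<and> cmod v < b}"

text \<open>Not normalised: a constant \<open>c\<close> integrates to \<open>2 * pi * c\<close>. It
  is the contour integral of \<open>f v / (\<i> * v)\<close>, written over the angle so that it also
  makes sense for real-valued and merely continuous integrands.\<close>

definition cint :: "(complex => 'b::euclidean_space) => real => 'b" where
 "cint f r = integral {0..2 * pi} (\<lambda>\<theta>. f (cr r * cis \<theta>))"

lemma open_annulus [simp, intro]: "open (annulus a b)"
proof -
 have "annulus a b = cmod -` {a<..<b}" by (auto simp: annulus_def)
 then show ?thesis by (simp add: open_vimage continuous_on_norm)
qed

lemma annulus_punctured_ball: "annulus 0 b = ball 0 b - {0}"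
 by (auto simp: annulus_def)

lemma circle_in_annulus [simp]: "0 < r ==> cr r * cis t \<in> annulus a b \<longleftrightarrow> a < r \<and> r < b"
 by (simp add: annulus_def norm_mult)

lemma continuous_on_circle_param:
 assumes "continuous_on S f" "\<And>t. cr r * cis t \<in> S"
 shows "continuous_on T (\<lambda>t. f (cr r * cis t))"
 by (rule continuous_on_compose2[OF assms(1)]) (use assms(2) in \<open>auto intro!: continuous_intros\<close>)

lemma cintegrable:
 fixes f :: "complex => 'b::euclidean_space"
 assumes "continuous_on S f" "\<And>t. cr r * cis t \<in> S"
 shows "(\<lambda>t. f (cr r * cis t)) integrable_on {0..2*pi}"
 by (rule integrable_continuous_real[OF continuous_on_circle_param[OF assms]])

lemma cint_continuous:
 assumes "continuous_on S f" "\<And>r t. r \<in> U ==> cr r * cis t \<in> S"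
 shows "continuous_on U (cint f)"
 unfolding cint_def interval_cbox
 by (rule integral_continuous_on_param)
  (auto simp: split_beta intro!: continuous_on_compose2[OF assms(1)] continuous_intros assms(2))

lemma cint_add:
 assumes "continuous_on S f" "continuous_on S g" "\<And>t. cr r * cis t \<in> S"
 shows "cint (\<lambda>v. f v + g v) r = cint f r + cint g r"
 unfolding cint_def
 by (rule integral_add) (use assms cintegrable in blast)+

lemma cint_diff:
 assumes "continuous_on S f" "continuous_on S g" "\<And>t. cr r * cis t \<in> S"
 shows "cint (\<lambda>v. f v - g v) r = cint f r - cint g r"
 unfolding cint_def
 by (rule integral_diff) (use assms cintegrable in blast)+

lemma cint_cmul: "cint (\<lambda>v. c * f v) r = c * cint f r" for c :: real
 unfolding cint_def by simp

lemma cint_cmulc: "cint (\<lambda>v. c * f v) r = c * cint f r" for c :: complex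
 unfolding cint_def by simp

lemma cint_const: "cint (\<lambda>v. c) r = (2*pi) *\<^sub>R c"
 unfolding cint_def by simp

lemma cint_cong:
 assumes "\<And>t. f (cr r * cis t) = g (cr r * cis t)"
 shows "cint f r = cint g r"
 unfolding cint_def by (simp add: assms)

lemma cint_mono:
 fixes f g :: "complex => real"
 assumes "continuous_on S f" "continuous_on S g" "\<And>t. cr r * cis t \<in> S"
  and "\<And>v. v \<in> S ==> f v \<le> g v"
 shows "cint f r \<le> cint g r"
 unfolding cint_def
 by (rule integral_le) (use assms cintegrable in blast)+

lemma cint_norm_le:
 fixes f :: "complex => 'b::euclidean_space"
 assumes "continuous_on S f" "continuous_on S g" "\<And>t. cr r * cis t \<in> S"
  and "\<And>v. v \<in> S ==> norm (f v) \<le> g v"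
 shows "norm (cint f r) \<le> cint g r"
 unfolding cint_def
 by (rule integral_norm_bound_integral) (use assms cintegrable in blast)+

lemma cint_Re:
 assumes "continuous_on S f" "\<And>t. cr r * cis t \<in> S"
 shows "cint (\<lambda>v. Re (f v)) r = Re (cint f r)"
 unfolding cint_def
 using integral_linear[OF cintegrable[OF assms] bounded_linear_Re] by (simp add: o_def)

lemma cint_cnj:
 assumes "continuous_on S f" "\<And>t. cr r * cis t \<in> S"
 shows "cint (\<lambda>v. cnj (f v)) r = cnj (cint f r)"
 unfolding cint_def
 using integral_linear[OF cintegrable[OF assms] bounded_linear_cnj] by (simp add: o_def)

lemma cint_has_derivative:
 fixes f :: "complex => 'b::euclidean_space"
 assumes der: "\<And>v. v \<in> annulus a b ==> (f has_derivative D v) (at v)"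
  and cont: "continuous_on (annulus a b \<times> UNIV) (\<lambda>(v,d). D v d)"
  and r: "0 \<le> a" "a < r" "r < b"
 shows "(cint f has_vector_derivative integral {0..2*pi} (\<lambda>t. D (cr r * cis t) (cis t))) (at r)"
proof -
 have in_ann: "cr x * cis t \<in> annulus a b" if "x \<in> {a<..<b}" for x t
  using that r by (auto simp: annulus_def norm_mult)
 have f_cont: "continuous_on (annulus a b) f"
  using der by (meson has_derivative_continuous_on has_derivative_at_withinI)
 have "((\<lambda>x. integral (cbox 0 (2*pi)) (\<lambda>t. f (cr x * cis t))) has_vector_derivative
   integral (cbox 0 (2*pi)) (\<lambda>t. D (cr r * cis t) (cis t))) (at r within {a<..<b})"
 proof (rule leibniz_rule_vector_derivative)
  fix x t assume x: "x \<in> {a<..<b}"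
  have "((\<lambda>x. cr x * cis t) has_vector_derivative cis t) (at x within {a<..<b})"
   by (auto intro!: derivative_eq_intros simp: has_vector_derivative_def scaleR_conv_of_real)
  from vector_derivative_diff_chain_within[OF this, of f "D (cr x * cis t)"]
  show "((\<lambda>x. f (cr x * cis t)) has_vector_derivative D (cr x * cis t) (cis t)) (at x within {a<..<b})"
   using der[OF in_ann[OF x]] by (simp add: o_def has_derivative_at_withinI)
 next
  fix x assume x: "x \<in> {a<..<b}"
  show "(\<lambda>t. f (cr x * cis t)) integrable_on cbox 0 (2 * pi)"
   using cintegrable[OF f_cont in_ann[OF x]] by simp
 next
  have *: "continuous_on ({a<..<b} \<times> cbox 0 (2*pi)) (\<lambda>(x,t). (\<lambda>(v,d). D v d) (cr x * cis t, cis t))"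
   unfolding split_beta
   by (rule continuous_on_compose2[OF cont[unfolded split_beta]]) (auto intro!: continuous_intros in_ann)
  then show "continuous_on ({a<..<b} \<times> cbox 0 (2*pi)) (\<lambda>(x, t). D (cr x * cis t) (cis t))"
   by (simp add: split_beta)
 qed (use r in auto)
 moreover have "at r within {a<..<b} = at r" using r by (intro at_within_open) auto
 ultimately show ?thesis unfolding cint_def[abs_def] by simp
qed

text \<open>\<open>P\<close> is twice the \<open>z\<close>-derivative of \<open>f\<close>, so
  \<open>Re (P v * v)\<close> is the radius times the derivative of \<open>f\<close> along the ray;
  the operator \<open>r * d/dr\<close> commutes with the circle integral.\<close>

lemma cint_has_derivative_Re:
 assumes der: "\<And>v. v \<in> annulus a b ==> (f has_derivative (\<lambda>d. Re (P v * d))) (at v)"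
  and P: "continuous_on (annulus a b) P" and r: "0 \<le> a" "a < r" "r < b"
 shows "(cint f has_real_derivative cint (\<lambda>v. Re (P v * v)) r / r) (at r)"
proof -
 have "(cint f has_vector_derivative integral {0..2*pi} (\<lambda>t. Re (P (cr r * cis t) * cis t))) (at r)"
  by (rule cint_has_derivative[OF der _ r])
   (auto simp: split_beta intro!: continuous_intros continuous_on_compose2[OF P])
 moreover have "integral {0..2*pi} (\<lambda>t. Re (P (cr r * cis t) * cis t)) = cint (\<lambda>v. Re (P v * v)) r / r"
 proof -
  have "cint (\<lambda>v. Re (P v * v)) r = integral {0..2*pi} (\<lambda>t. r * Re (P (cr r * cis t) * cis t))"
   unfolding cint_def by (intro arg_cong[of _ _ "integral _"]) (auto simp: algebra_simps)
  then show ?thesis using r by simp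
 qed
 ultimately show ?thesis by (simp add: has_real_derivative_iff_has_vector_derivative)
qed

text \<open>For holomorphic \<open>H\<close> the radial derivative on a circle is the angular
  derivative divided by \<open>\<i> * r\<close>, and the angular derivative integrates to 0 over a
  full turn. No homotopy of paths is involved, so the hole of the annulus is harmless.\<close>

lemma holomorphic_cint_const:
 assumes H: "H holomorphic_on annulus a b" and "0 \<le> a"
 obtains c where "\<And>r. a < r ==> r < b ==> cint H r = c"
proof -
 have "(cint H has_vector_derivative 0) (at r within {a<..<b})" if "r \<in> {a<..<b}" for r
 proof -
  have r: "0 < r" "a < r" "r < b" using that \<open>0 \<le> a\<close> by auto
  have der: "(H has_field_derivative deriv H v) (at v)" if "v \<in> annulus a b" for v
   using holomorphic_derivI[OF H open_annulus that] by simp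
  have cd: "continuous_on (annulus a b) (deriv H)"
   by (intro hol_cont holomorphic_deriv[OF H]) auto
  have "(cint H has_vector_derivative integral {0..2*pi} (\<lambda>t. deriv H (cr r * cis t) * cis t)) (at r)"
   by (rule cint_has_derivative[of a b])
    (use der r \<open>0 \<le> a\<close> in \<open>auto simp: has_field_derivative_def split_beta intro!: continuous_intros continuous_on_compose2[OF cd]\<close>)
  moreover have "((\<lambda>t. deriv H (cr r * cis t) * cis t) has_integral
    H (cr r * cis (2*pi)) / (\<i> * r) - H (cr r * cis 0) / (\<i> * r)) {0..2*pi}"
  proof (rule fundamental_theorem_of_calculus)
   fix t :: real
   have "((\<lambda>t. cr r * cis t) has_vector_derivative cr r * (\<i> * cis t)) (at t within {0..2*pi})"
    by (auto intro!: derivative_eq_intros simp: has_vector_derivative_def scaleR_conv_of_real)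
   from field_vector_diff_chain_within[OF this, of H "deriv H (cr r * cis t)"]
   have "((\<lambda>t. H (cr r * cis t)) has_vector_derivative (cr r * (\<i> * cis t)) * deriv H (cr r * cis t)) (at t within {0..2*pi})"
    using der[of "cr r * cis t"] r by (auto simp: o_def intro: has_field_derivative_at_within)
   from has_vector_derivative_mult_left[OF this, of "1 / (\<i> * r)"]
   show "((\<lambda>t. H (cr r * cis t) / (\<i> * r)) has_vector_derivative deriv H (cr r * cis t) * cis t) (at t within {0..2*pi})"
    using r by (simp add: field_simps)
  qed auto
  then have "integral {0..2*pi} (\<lambda>t. deriv H (cr r * cis t) * cis t) = 0"
   by (simp add: integral_unique)
  ultimately show ?thesis by (simp add: has_vector_derivative_at_within)
 qed
 from has_vector_derivative_zero_constant[OF _ this] obtain c where "\<And>r. r \<in> {a<..<b} ==> cint H r = c"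
  by blast
 then show ?thesis using that by auto
qed

text \<open>The constant belonging to \<open>annulus 0 b\<close> is identified by letting the radius
  tend to 0, where the circle collapses to the centre.\<close>

lemma holomorphic_cint_center:
 fixes H :: "complex => complex"
 assumes H: "H holomorphic_on ball 0 b" and r: "0 \<le> r" "r < b"
 shows "cint H r = 2 * pi * H 0"
proof -
 have "H holomorphic_on annulus 0 b"
  by (rule holomorphic_on_subset[OF H]) (auto simp: annulus_def)
 then obtain c where c: "\<And>r. 0 < r ==> r < b ==> cint H r = c"
  by (rule holomorphic_cint_const) auto
 have cont: "continuous_on {0..<b} (cint H)"
  by (rule cint_continuous[OF hol_cont[OF H]]) (auto simp: norm_mult)
 have b: "0 < b" using r by auto
 have "continuous_on {0..b/2} (cint H)"
  by (rule continuous_on_subset[OF cont]) (use b in auto)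
 then have "(cint H ---> cint H 0) (at 0 within {0..b/2})"
  using b by (simp add: continuous_on_def)
 then have "(cint H ---> cint H 0) (at_right 0)"
  using b by (simp add: at_within_Icc_at_right)
 moreover have "(cint H ---> c) (at_right 0)"
  by (rule tendsto_eventually) (use c b in \<open>auto simp: eventually_at_right_field\<close>)
 ultimately have "cint H 0 = c" by (meson tendsto_unique trivial_limit_at_right_real)
 moreover have "cint H 0 = 2 * pi * H 0" by (simp add: cint_def scaleR_conv_of_real)
 ultimately show ?thesis using c r by (cases "r = 0") auto
qed

text \<open>For \<open>cmod v < cmod z\<close> the number \<open>1 - v / z\<close> has positive real
  part, so its principal logarithm is holomorphic on the whole disk and vanishes at the centre; the
  mean value property does the rest.\<close>

lemma cint_ln_outside:
 assumes "0 < r" "r < cmod z"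
 shows "cint (\<lambda>v. ln (cmod (v - z))) r = 2 * pi * ln (cmod z)"
proof -
 have z: "z \<noteq> 0" using assms by auto
 have *: "1 - v / z \<notin> \<real>\<^sub>\<le>\<^sub>0" "1 - v / z \<noteq> 0" if "v \<in> ball 0 (cmod z)" for v
 proof -
  have "Re (v / z) \<le> cmod (v / z)" by (rule complex_Re_le_cmod)
  also have "\<dots> < 1" using that z by (simp add: norm_divide)
  finally have "0 < Re (1 - v / z)" by simp
  then show "1 - v / z \<notin> \<real>\<^sub>\<le>\<^sub>0" "1 - v / z \<noteq> 0" by (auto simp: complex_nonpos_Reals_iff)
 qed
 have H: "(\<lambda>v. Ln (1 - v / z)) holomorphic_on ball 0 (cmod z)"
  by (intro holomorphic_intros) (use z * in auto)
 have "cint (\<lambda>v. ln (cmod (v - z))) r = cint (\<lambda>v. ln (cmod z) + Re (Ln (1 - v / z))) r"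
 proof (rule cint_cong)
  fix t
  let ?v = "cr r * cis t"
  have "?v \<in> ball 0 (cmod z)" using assms by (simp add: norm_mult)
  from *[OF this] have "1 - ?v / z \<noteq> 0" by simp
  moreover have "cmod (?v - z) = cmod z * cmod (1 - ?v / z)"
  proof -
   have "?v - z = - (z * (1 - ?v / z))" using z by (simp add: field_simps)
   then show ?thesis by (metis norm_minus_cancel norm_mult)
  qed
  ultimately show "ln (cmod (?v - z)) = ln (cmod z) + Re (Ln (1 - ?v / z))"
   using z by (simp add: ln_mult)
 qed
 also have "\<dots> = cint (\<lambda>v. ln (cmod z)) r + cint (\<lambda>v. Re (Ln (1 - v / z))) r"
  by (rule cint_add[of "ball 0 (cmod z)"])
   (use assms hol_cont[OF H] in \<open>auto simp: norm_mult intro: continuous_intros\<close>)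
 also have "cint (\<lambda>v. Re (Ln (1 - v / z))) r = Re (cint (\<lambda>v. Ln (1 - v / z)) r)"
  by (rule cint_Re[OF hol_cont[OF H]]) (use assms in \<open>auto simp: norm_mult\<close>)
 also have "cint (\<lambda>v. Ln (1 - v / z)) r = 0"
  using holomorphic_cint_center[OF H, of r] assms by simp
 finally show ?thesis by (simp add: cint_const)
qed

text \<open>Reflection reduces this to the outer case: on the circle, \<open>cmod (v - z)\<close>
  equals \<open>cmod (v - y) * cmod z / r\<close> for the mirror image \<open>y\<close> of
  \<open>z\<close>, which lies outside. The centre has no mirror image and is treated
  directly.\<close>

lemma cint_ln_inside:
 assumes "cmod z < r"
 shows "cint (\<lambda>v. ln (cmod (v - z))) r = 2 * pi * ln r"
proof (cases "z = 0")
 case True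
 have r: "0 < r" using assms norm_ge_zero[of z] by linarith
 have "cint (\<lambda>v. ln (cmod (v - z))) r = cint (\<lambda>v. ln r) r"
  by (rule cint_cong) (use True r in \<open>simp add: norm_mult\<close>)
 then show ?thesis by (simp add: cint_const)
next
 case False
 have r: "0 < r" using assms norm_ge_zero[of z] by linarith
 define y where "y = cr (r\<^sup>2) / cnj z"
 have y: "r < cmod y" using assms False r
  by (simp add: y_def norm_divide field_simps power2_eq_square norm_mult norm_power)
 have "cint (\<lambda>v. ln (cmod (v - z))) r = cint (\<lambda>v. ln (cmod (v - y)) + (ln (cmod z) - ln r)) r"
 proof (rule cint_cong)
  fix t
  let ?v = "cr r * cis t"
  have vv: "?v * cnj ?v = cr (r\<^sup>2)"
   by (metis complex_norm_square norm_mult norm_of_real norm_cis abs_of_pos r mult.right_neutral of_real_power)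
  have "?v \<noteq> y" using y r by (metis norm_mult norm_of_real norm_cis abs_of_pos mult.right_neutral less_irrefl)
  have "cmod (?v - z) = cmod (cnj ?v - cnj z)" by (metis complex_cnj_diff complex_mod_cnj)
  then have "r * cmod (?v - z) = cmod (?v * (cnj ?v - cnj z))" using r by (simp only: norm_mult norm_of_real norm_cis)
  also have "?v * (cnj ?v - cnj z) = (y - ?v) * cnj z"
   using False vv by (simp add: y_def algebra_simps)
  finally have eq: "r * cmod (?v - z) = cmod (?v - y) * cmod z" by (simp add: norm_mult norm_minus_commute)
  have "cmod (?v - z) = cmod (?v - y) * cmod z / r"
   using eq r by (metis nonzero_mult_div_cancel_left less_irrefl)
  then have "ln (cmod (?v - z)) = ln (cmod (?v - y) * cmod z / r)" by simp
  then show "ln (cmod (?v - z)) = ln (cmod (?v - y)) + (ln (cmod z) - ln r)"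
   using \<open>?v \<noteq> y\<close> False r by (simp add: ln_div ln_mult)
 qed
 also have "\<dots> = cint (\<lambda>v. ln (cmod (v - y))) r + cint (\<lambda>v. (ln (cmod z) - ln r)) r"
  by (rule cint_add[of "ball 0 (cmod y)"]) (use y r in \<open>auto simp: norm_mult intro!: continuous_intros\<close>)
 also have "\<dots> = 2 * pi * ln (cmod y) + 2 * pi * (ln (cmod z) - ln r)"
  using cint_ln_outside[OF r y] by (simp add: cint_const)
 also have "ln (cmod y) = 2 * ln r - ln (cmod z)"
  using r False by (simp add: y_def norm_divide ln_div norm_power ln_realpow)
 finally show ?thesis by (simp add: algebra_simps)
qed

lemma ln_norm_has_derivative:
 assumes "(F has_field_derivative F') (at v)" "F v \<noteq> 0"
 shows "((\<lambda>v. ln (cmod (F v))) has_derivative (\<lambda>d. Re (F' / F v * d))) (at v)"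
proof -
 have "((\<lambda>v. cmod (F v)) has_derivative (\<lambda>d. (F' * d) \<bullet> sgn (F v))) (at v)"
  by (rule has_derivative_compose[OF assms(1)[unfolded has_field_derivative_def] has_derivative_norm[OF assms(2)]])
 from has_derivative_ln[OF _ this]
 have "((\<lambda>v. ln (cmod (F v))) has_derivative (\<lambda>d. (F' * d) \<bullet> sgn (F v) * inverse (cmod (F v)))) (at v)"
  using assms(2) by simp
 moreover have "(F' * d) \<bullet> sgn (F v) * inverse (cmod (F v)) = Re (F' / F v * d)" for d
 proof -
  have "F' / F v * d = (F' * d) * cnj (F v) / (cmod (F v))\<^sup>2"
   using assms(2) complex_norm_square[of "F v"] by (simp add: field_simps)
  also have "Re \<dots> = ((F' * d) \<bullet> F v) / (cmod (F v))\<^sup>2"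
   by (simp add: inner_complex_def flip: of_real_power)
  finally show ?thesis by (simp add: sgn_div_norm power2_eq_square field_simps)
 qed
 ultimately show ?thesis by simp
qed

text \<open>The logarithmic derivative is holomorphic, so its integral is the same on all circles;
  \<open>W\<close> is \<open>2 * pi\<close> times the winding number of \<open>F\<close>. Hence the
  integral of \<open>ln (cmod (F v))\<close> is affine in \<open>ln r\<close>.\<close>

lemma cint_ln_zero_free:
 assumes F: "F holomorphic_on annulus a b" and nz: "\<And>v. v \<in> annulus a b ==> F v \<noteq> 0" and "0 \<le> a"
 obtains W where "\<And>r. a < r ==> r < b ==> Re (cint (\<lambda>v. v * deriv F v / F v) r) = W"
  and "\<And>r. a < r ==> r < b ==> (cint (\<lambda>v. ln (cmod (F v))) has_real_derivative W / r) (at r)"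
proof -
 have hol: "(\<lambda>v. v * deriv F v / F v) holomorphic_on annulus a b"
  by (intro holomorphic_intros holomorphic_deriv[OF F] F) (use nz in auto)
 obtain c where c: "\<And>r. a < r ==> r < b ==> cint (\<lambda>v. v * deriv F v / F v) r = c"
  using holomorphic_cint_const[OF hol \<open>0 \<le> a\<close>] by blast
 show ?thesis
 proof (rule that[of "Re c"])
  fix r assume r: "a < r" "r < b"
  then show "Re (cint (\<lambda>v. v * deriv F v / F v) r) = Re c" using c by simp
  have in_ann: "cr r * cis t \<in> annulus a b" for t
   using r \<open>0 \<le> a\<close> by simp
  have "(cint (\<lambda>v. ln (cmod (F v))) has_real_derivative cint (\<lambda>v. Re (deriv F v / F v * v)) r / r) (at r)"
  proof (rule cint_has_derivative_Re[OF ln_norm_has_derivative _ \<open>0 \<le> a\<close> r])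
   show "(F has_field_derivative deriv F v) (at v)" if "v \<in> annulus a b" for v
    using holomorphic_derivI[OF F open_annulus that] by simp
   show "continuous_on (annulus a b) (\<lambda>v. deriv F v / F v)"
    by (intro continuous_intros hol_cont F holomorphic_deriv[OF F]) (use nz in auto)
  qed (use nz in auto)
  moreover have "cint (\<lambda>v. Re (deriv F v / F v * v)) r = Re (cint (\<lambda>v. v * deriv F v / F v) r)"
   using cint_Re[OF hol_cont[OF hol] in_ann] by (simp add: mult.commute)
  ultimately show "(cint (\<lambda>v. ln (cmod (F v))) has_real_derivative Re c / r) (at r)"
   using c[OF r] by simp
 qed
qed

lemma DERIV_ln_diff_const:
 fixes f :: "real => real"
 assumes "0 < r" "r < R" "continuous_on {r..R} f" "\<And>x. r < x ==> x < R ==> (f has_real_derivative W / x) (at x)"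
 shows "f R - f r = W * ln (R / r)"
proof -
 have "f R - W * ln R = f r - W * ln r"
 proof (rule DERIV_isconst_end[OF \<open>r < R\<close>])
  show "continuous_on {r..R} (\<lambda>x. f x - W * ln x)"
   using assms by (intro continuous_intros) auto
  show "((\<lambda>x. f x - W * ln x) has_real_derivative 0) (at x)" if "r < x" "x < R" for x
   using assms that by (auto intro!: derivative_eq_intros assms(4))
 qed
 then show ?thesis using assms by (simp add: ln_div algebra_simps)
qed

text \<open>The local factorisation gives the cofactor near \<open>z\<close> only; away from
  \<open>z\<close> it is \<open>F v / (v - z) ^ n\<close>, and the two pieces agree on the overlap.
  The cofactor must live on all of \<open>S\<close> so that zeros can be divided out one after the
  other.\<close>

lemma holomorphic_factor_zero:
 assumes F: "F holomorphic_on S" and S: "open S" "connected S" and z: "z \<in> S" "F z = 0"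
  and w: "w \<in> S" "F w \<noteq> 0"
 obtains G n where "0 < n" "G holomorphic_on S" "G z \<noteq> 0" "\<And>v. v \<in> S ==> F v = (v - z) ^ n * G v"
proof -
 have "\<not> F constant_on S" using z w unfolding constant_on_def by metis
 then show ?thesis
 proof (rule holomorphic_factor_zero_nonconstant[OF F S z])
 fix g r and n :: nat
 assume n: "0 < n" and r: "0 < r" "ball z r \<subseteq> S" and g: "g holomorphic_on ball z r"
  "\<And>w. w \<in> ball z r ==> F w = (w - z) ^ n * g w" "\<And>w. w \<in> ball z r ==> g w \<noteq> 0"
 define G where "G = (\<lambda>v. if v \<in> ball z r then g v else F v / (v - z) ^ n)"
 have 1: "G v = F v / (v - z) ^ n" if "v \<noteq> z" for v
  using g(2)[of v] that by (auto simp: G_def)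
 have "G holomorphic_on ball z r \<union> (S - {z})"
 proof (rule holomorphic_on_Un)
  show "G holomorphic_on ball z r"
   by (rule holomorphic_transform[OF g(1)]) (auto simp: G_def)
  have "(\<lambda>v. F v / (v - z) ^ n) holomorphic_on S - {z}"
   by (intro holomorphic_intros holomorphic_on_subset[OF F]) auto
  then show "G holomorphic_on S - {z}"
   by (rule holomorphic_transform) (use 1 in auto)
 qed (use S in auto)
 moreover have "ball z r \<union> (S - {z}) = S" using r z by auto
 ultimately have "G holomorphic_on S" by simp
 moreover have "G z \<noteq> 0" using g(3)[of z] r by (simp add: G_def)
 moreover have "F v = (v - z) ^ n * G v" for v
 proof (cases "v = z")
  case True then show ?thesis using z n by simp
 next
  case False then show ?thesis using 1[of v] by simp
 qed
 ultimately show thesis using that[OF n] by blast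
 qed
qed

text \<open>On the circle of radius \<open>R\<close> the kernel is the conjugate of
  \<open>R\<^sup>2 / (R\<^sup>2 - cnj z * v)\<close>, a function holomorphic on a larger disk with
  value 1 at the centre. This is the contribution of one enclosed zero to the winding
  number.\<close>

lemma cint_kernel:
 assumes "cmod z < R"
 shows "cint (\<lambda>v. v / (v - z)) R = 2 * pi"
proof -
 have R: "0 < R" using assms norm_ge_zero[of z] by linarith
 have inC: "cr R * cis t \<in> {v. cmod v = R}" for t using R by (auto simp: norm_mult)
 define b' where "b' = (if z = 0 then R + 1 else R\<^sup>2 / cmod z)"
 have b': "R < b'"
 proof (cases "z = 0")
  case False
  then have "R * cmod z < R\<^sup>2" using assms R by (simp add: power2_eq_square)
  then show ?thesis using False by (simp add: b'_def pos_less_divide_eq)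
 qed (simp add: b'_def)
 let ?H = "\<lambda>v. cr (R\<^sup>2) / (cr (R\<^sup>2) - cnj z * v)"
 have nz2: "cr (R\<^sup>2) - cnj z * v \<noteq> 0" if "v \<in> ball 0 b'" for v
 proof
  assume "cr (R\<^sup>2) - cnj z * v = 0"
  then have "cmod z * cmod v = R\<^sup>2" by (metis complex_mod_cnj eq_iff_diff_eq_0 norm_mult norm_of_real abs_of_nonneg zero_le_power2)
  then show False using that R by (cases "z = 0") (auto simp: b'_def pos_less_divide_eq mult.commute)
 qed
 have hol: "?H holomorphic_on ball 0 b'" by (intro holomorphic_intros) (use nz2 in auto)
 have c0: "cint ?H R = 2 * pi" using holomorphic_cint_center[OF hol, of R] R b' by simp
 have "cint (\<lambda>v. v / (v - z)) R = cint (\<lambda>v. cnj (?H v)) R"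
 proof (rule cint_cong)
  fix t let ?v = "cr R * cis t"
  have vv: "?v * cnj ?v = cr (R\<^sup>2)"
   by (metis complex_norm_square norm_mult norm_of_real norm_cis abs_of_pos R mult.right_neutral of_real_power)
  have "?v \<noteq> 0" using R by simp
  have "cnj (?H ?v) = cr (R\<^sup>2) / (cr (R\<^sup>2) - z * cnj ?v)" by simp
  also have "\<dots> = (?v * cnj ?v) / ((?v - z) * cnj ?v)" unfolding vv[symmetric] by (simp add: algebra_simps)
  also have "\<dots> = ?v / (?v - z)" using \<open>?v \<noteq> 0\<close> by (subst mult_divide_mult_cancel_right) auto
  finally show "?v / (?v - z) = cnj (?H ?v)" by simp
 qed
 also have "\<dots> = cnj (cint ?H R)"
  by (rule cint_cnj[OF hol_cont[OF hol]]) (use b' R in \<open>auto simp: norm_mult\<close>)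
 finally show ?thesis using c0 by simp
qed

text \<open>Zeros are split off one at a time. Up to the factor \<open>2 * pi\<close>, a factor
  \<open>v - z\<close> adds \<open>ln (cmod z)\<close> on the inner circle, \<open>ln R\<close> on
  the outer one, and 1 to the winding number at \<open>R\<close>. The result is an inequality
  because the zeros are listed as a set: a zero of multiplicity \<open>n\<close> is counted once,
  and \<open>ln (cmod z / r)\<close> is nonnegative.\<close>

lemma jensen_annulus:
 assumes "finite Z" "F holomorphic_on annulus a b" "0 \<le> a" "a < r" "r < R" "R < b"
  and "Z \<subseteq> annulus r R" "connected (annulus a b)"
  and "\<And>v. r \<le> cmod v ==> cmod v \<le> R ==> F v = 0 \<longleftrightarrow> v \<in> Z"
 shows "cint (\<lambda>v. ln (cmod (F v))) r \<ge> cint (\<lambda>v. ln (cmod (F v))) R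
   - Re (cint (\<lambda>v. v * deriv F v / F v) R) * ln (R / r) + 2 * pi * (\<Sum>z\<in>Z. ln (cmod z / r))"
 using assms
proof (induction Z arbitrary: F rule: finite_induct)
 case empty
 have F: "F holomorphic_on annulus r R"
  by (rule holomorphic_on_subset[OF empty.prems(1)]) (use empty.prems in \<open>auto simp: annulus_def\<close>)
 have nz: "F v \<noteq> 0" if "v \<in> annulus r R" for v using empty.prems(8)[of v] that by (auto simp: annulus_def)
 have r: "0 < r" using empty.prems by auto
 obtain W where W: "\<And>x. r < x ==> x < R ==> Re (cint (\<lambda>v. v * deriv F v / F v) x) = W"
  "\<And>x. r < x ==> x < R ==> (cint (\<lambda>v. ln (cmod (F v))) has_real_derivative W / x) (at x)"
  using cint_ln_zero_free[OF F nz] r by (metis less_eq_real_def)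
 let ?S = "{v. r \<le> cmod v \<and> cmod v \<le> R}"
 have sub: "?S \<subseteq> annulus a b" using empty.prems by (auto simp: annulus_def)
 have nz': "F v \<noteq> 0" if "v \<in> ?S" for v using empty.prems(8)[of v] that by auto
 have cF: "continuous_on ?S F" "continuous_on ?S (deriv F)"
  using continuous_on_subset[OF hol_cont sub] holomorphic_deriv[OF empty.prems(1)] empty.prems(1)
  by auto
 have c1: "continuous_on {r..R} (cint (\<lambda>v. ln (cmod (F v))))"
  by (rule cint_continuous[of ?S]) (use nz' r in \<open>auto intro!: continuous_intros cF simp: norm_mult\<close>)
 have "continuous_on {r..R} (cint (\<lambda>v. v * deriv F v / F v))"
  by (rule cint_continuous[of ?S]) (use nz' r in \<open>auto intro!: continuous_intros cF simp: norm_mult\<close>)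
 then have c2: "continuous_on {r..R} (\<lambda>x. Re (cint (\<lambda>v. v * deriv F v / F v) x))"
  by (intro continuous_intros)
 \<comment> \<open>\<open>W\<close> is obtained on the open annulus only; continuity up to the outer
   circle identifies it with the value that the statement mentions.\<close>
 have "W = Re (cint (\<lambda>v. v * deriv F v / F v) R)"
 proof (rule tendsto_unique[of "at_left R"])
  show "((\<lambda>x. Re (cint (\<lambda>v. v * deriv F v / F v) x)) ---> W) (at_left R)"
   by (rule tendsto_eventually) (use W \<open>r < R\<close> in \<open>auto simp: eventually_at_left_field\<close>)
  show "((\<lambda>x. Re (cint (\<lambda>v. v * deriv F v / F v) x)) ---> Re (cint (\<lambda>v. v * deriv F v / F v) R)) (at_left R)"
   using c2 \<open>r < R\<close> at_within_Icc_at_left[OF \<open>r < R\<close>] by (auto simp: continuous_on_def dest!: bspec[of _ _ R])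
 qed auto
 moreover have "cint (\<lambda>v. ln (cmod (F v))) R - cint (\<lambda>v. ln (cmod (F v))) r = W * ln (R / r)"
  by (rule DERIV_ln_diff_const[OF r \<open>r < R\<close> c1 W(2)])
 ultimately show ?case by simp
next
 case (insert z Z)
 have z: "r < cmod z" "cmod z < R" using insert.prems(6) by (auto simp: annulus_def)
 have r: "0 < r" using insert.prems by auto
 have zA: "z \<in> annulus a b" using z insert.prems by (auto simp: annulus_def)
 have rA: "cr r \<in> annulus a b" "F (cr r) \<noteq> 0"
  using insert.prems(8)[of "cr r"] r insert.prems insert.hyps by (auto simp: annulus_def)
 have "F z = 0" using insert.prems(8)[of z] z by simp
 then obtain G n where n: "0 < n" and G: "G holomorphic_on annulus a b" "G z \<noteq> 0"
  and FG: "\<And>v. v \<in> annulus a b ==> F v = (v - z) ^ n * G v"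
  using holomorphic_factor_zero[OF insert.prems(1) open_annulus insert.prems(7) zA _ rA] by metis
 have GZ: "G v = 0 \<longleftrightarrow> v \<in> Z" if "r \<le> cmod v" "cmod v \<le> R" for v
 proof -
  have "v \<in> annulus a b" using that insert.prems by (auto simp: annulus_def)
  then show ?thesis using insert.prems(8)[OF that] FG[of v] G(2) insert.hyps n by auto
 qed
 have IH: "cint (\<lambda>v. ln (cmod (G v))) r \<ge> cint (\<lambda>v. ln (cmod (G v))) R
   - Re (cint (\<lambda>v. v * deriv G v / G v) R) * ln (R / r) + 2 * pi * (\<Sum>z\<in>Z. ln (cmod z / r))"
  by (rule insert.IH[OF G(1)]) (use insert.prems GZ in auto)
 have *: "cint (\<lambda>v. ln (cmod (F v))) x = n * cint (\<lambda>v. ln (cmod (v - z))) x + cint (\<lambda>v. ln (cmod (G v))) x"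
  if x: "x = r \<or> x = R" for x
 proof -
  let ?C = "{v. cmod v = x}"
  have inC: "cr x * cis t \<in> ?C" for t using x r insert.prems by (auto simp: norm_mult)
  have sub: "?C \<subseteq> annulus a b" using x insert.prems by (auto simp: annulus_def)
  have nz: "G v \<noteq> 0" "v \<noteq> z" if "v \<in> ?C" for v using GZ[of v] that x insert.prems z by (auto simp: annulus_def)
  have cont: "continuous_on ?C (\<lambda>v. n * ln (cmod (v - z)))" "continuous_on ?C (\<lambda>v. ln (cmod (G v)))"
   using nz by (auto intro!: continuous_intros continuous_on_subset[OF hol_cont[OF G(1)] sub])
  have "cint (\<lambda>v. ln (cmod (F v))) x = cint (\<lambda>v. n * ln (cmod (v - z)) + ln (cmod (G v))) x"
  proof (rule cint_cong)
   fix t let ?v = "cr x * cis t"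
   have v: "?v \<in> annulus a b" "G ?v \<noteq> 0" "?v - z \<noteq> 0" using nz[OF inC] sub inC[of t] by auto
   have "ln (cmod (F ?v)) = ln (cmod (?v - z) ^ n * cmod (G ?v))"
    unfolding FG[OF v(1)] by (simp add: norm_mult norm_power)
   also have "\<dots> = ln (cmod (?v - z) ^ n) + ln (cmod (G ?v))" using v by (intro ln_mult_pos) auto
   finally show "ln (cmod (F ?v)) = n * ln (cmod (?v - z)) + ln (cmod (G ?v))"
    using v by (simp add: ln_realpow)
  qed
  also have "\<dots> = n * cint (\<lambda>v. ln (cmod (v - z))) x + cint (\<lambda>v. ln (cmod (G v))) x"
   using cint_add[OF cont inC] cint_cmul[of "real n" "\<lambda>v. ln (cmod (v - z))"] by simp
  finally show ?thesis .
 qed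
 have 1: "cint (\<lambda>v. ln (cmod (F v))) r = n * (2 * pi * ln (cmod z)) + cint (\<lambda>v. ln (cmod (G v))) r"
  using *[of r] cint_ln_outside[OF r z(1)] by simp
 have 2: "cint (\<lambda>v. ln (cmod (F v))) R = n * (2 * pi * ln R) + cint (\<lambda>v. ln (cmod (G v))) R"
  using *[of R] cint_ln_inside[OF z(2)] by simp
 have 3: "cint (\<lambda>v. v * deriv F v / F v) R = cr (2 * pi * n) + cint (\<lambda>v. v * deriv G v / G v) R"
 proof -
  let ?C = "{v. cmod v = R}"
  have R: "0 < R" using r insert.prems by linarith
  have inC: "cr R * cis t \<in> ?C" for t using R by (auto simp: norm_mult)
  have sub: "?C \<subseteq> annulus a b" using insert.prems by (auto simp: annulus_def)
  have nz: "G v \<noteq> 0" "v \<noteq> z" if "v \<in> ?C" for v using GZ[of v] that insert.prems z by (auto simp: annulus_def)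
  have cont: "continuous_on ?C (\<lambda>v. n * (v / (v - z)))" "continuous_on ?C (\<lambda>v. v * deriv G v / G v)"
  proof -
   have "continuous_on ?C G" "continuous_on ?C (deriv G)"
    using continuous_on_subset[OF hol_cont sub] holomorphic_deriv[OF G(1)] G(1) by auto
   then show "continuous_on ?C (\<lambda>v. n * (v / (v - z)))" "continuous_on ?C (\<lambda>v. v * deriv G v / G v)"
    using nz by (auto intro!: continuous_intros)
  qed
  have "cint (\<lambda>v. v * deriv F v / F v) R = cint (\<lambda>v. n * (v / (v - z)) + v * deriv G v / G v) R"
  proof (rule cint_cong)
   fix t let ?v = "cr R * cis t"
   have v: "?v \<in> annulus a b" "G ?v \<noteq> 0" "?v \<noteq> z" using nz[OF inC] sub inC[of t] by auto
   have "((\<lambda>v. (v - z) ^ n * G v) has_field_derivative (?v - z) ^ n * deriv G ?v + n * (?v - z) ^ (n - 1) * G ?v) (at ?v)"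
   proof -
    have "((\<lambda>v. (v - z) ^ n) has_field_derivative n * (?v - z) ^ (n - 1)) (at ?v)"
     by (auto intro!: derivative_eq_intros)
    from DERIV_mult[OF this holomorphic_derivI[OF G(1) open_annulus v(1)]]
    show ?thesis by (simp add: add_ac mult_ac)
   qed
   then have "(F has_field_derivative (?v - z) ^ n * deriv G ?v + n * (?v - z) ^ (n - 1) * G ?v) (at ?v)"
    by (rule has_field_derivative_transform_within_open[OF _ open_annulus v(1)]) (simp add: FG)
   then have "deriv F ?v = (?v - z) ^ n * deriv G ?v + n * (?v - z) ^ (n - 1) * G ?v"
    by (rule DERIV_imp_deriv)
   moreover have "(?v - z) ^ n = (?v - z) ^ (n - 1) * (?v - z)" using n by (metis power_minus_mult)
   moreover have "v * (p * d * dG + n * p * g) / (p * d * g) = n * (v / d) + v * dG / g"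
    if "p \<noteq> 0" "d \<noteq> 0" "g \<noteq> 0" for v p d g dG :: complex
   proof -
    have "v * (p * d * dG + n * p * g) / (p * d * g) = (v * dG) * (p * d) / (g * (p * d)) + (n * v) * (p * g) / (d * (p * g))"
     by (simp only: ring_distribs add_divide_distrib mult_ac)
    also have "\<dots> = v * dG / g + n * v / d" using that by (simp only: mult_divide_mult_cancel_right mult_eq_0_iff simp_thms)
    finally show ?thesis by simp
   qed
   ultimately show "?v * deriv F ?v / F ?v = n * (?v / (?v - z)) + ?v * deriv G ?v / G ?v"
    using FG[OF v(1)] v by (simp only: right_minus_eq power_not_zero simp_thms)
  qed
  also have "\<dots> = n * cint (\<lambda>v. v / (v - z)) R + cint (\<lambda>v. v * deriv G v / G v) R"
   using cint_add[OF cont inC] cint_cmulc[of "of_nat n" "\<lambda>v. v / (v - z)"] by simp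
  also have "cint (\<lambda>v. v / (v - z)) R = 2 * pi" by (rule cint_kernel[OF z(2)])
  finally show ?thesis by simp
 qed
 \<comment> \<open>Here the multiplicity \<open>n\<close> is replaced by 1.\<close>
 have "ln (cmod z / r) \<ge> 0" using z r by simp
 then have "n * (2 * pi * ln (cmod z / r)) \<ge> 1 * (2 * pi * ln (cmod z / r))"
  using n by (intro mult_right_mono) auto
 moreover have "n * (2 * pi * ln (cmod z)) = n * (2 * pi * ln r) + n * (2 * pi * ln (cmod z / r))"
  "n * (2 * pi * ln R) = n * (2 * pi * ln r) + n * (2 * pi * ln (R / r))"
  using z r insert.prems by (auto simp: ln_div algebra_simps)
 moreover have "Re (cr (2 * pi * n) + cint (\<lambda>v. v * deriv G v / G v) R) * ln (R / r)
   = n * (2 * pi * ln (R / r)) + Re (cint (\<lambda>v. v * deriv G v / G v) R) * ln (R / r)"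
  by (simp add: algebra_simps)
 moreover have "2 * pi * (\<Sum>z\<in>insert z Z. ln (cmod z / r)) = 2 * pi * ln (cmod z / r) + 2 * pi * (\<Sum>z\<in>Z. ln (cmod z / r))"
  using insert.hyps by (simp add: algebra_simps)
 ultimately show ?case using IH unfolding 1 2 3 by linarith
qed

lemma connected_annulus_ball: "connected (annulus a b)"
proof -
 have "annulus a b = {x. a < norm (x - 0) \<and> norm (x - 0) < b}" by (auto simp: annulus_def)
 also have "connected \<dots>" by (rule connected_annulus) simp
 finally show ?thesis .
qed

section \<open>Removable singularities from vanishing moments, and growth of circle means\<close>

lemma circle_bound:
 assumes "continuous_on {v. cmod v = r} q" shows "\<exists>B\<ge>0. \<forall>v\<in>{v. cmod v = r}. cmod (q v) \<le> B"
proof -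
 have "compact {v. cmod v = r}" using compact_sphere[of "0::complex" r] by (simp add: sphere_def dist_norm)
 then have "bounded (q ` {v. cmod v = r})" using assms by (intro compact_imp_bounded compact_continuous_image)
 then show ?thesis unfolding bounded_pos by (auto intro: less_imp_le)
qed

text \<open>The hypothesis says that the Laurent coefficients of negative index vanish. Cauchy's
  formula on a ring then reduces to its outer circle, because the kernel on the inner circle is a
  geometric series in \<open>z / w\<close> whose terms integrate to moments. The outer integral
  stays bounded as \<open>w\<close> tends to 0, so the singularity is removable.\<close>

lemma vanishing_moments_extend:
 assumes q: "q holomorphic_on annulus 0 b" and b: "0 < b"
  and mom: "\<And>n r. 0 < r ==> r < b ==> cint (\<lambda>v. q v * v ^ Suc n) r = 0"
 obtains Q where "Q holomorphic_on ball 0 b" "\<And>v. v \<in> annulus 0 b ==> Q v = q v"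
proof -
 define R where "R = b / 2"
 have R: "0 < R" "R < b" using b by (auto simp: R_def)
 have qc: "continuous_on (annulus 0 b) q" by (rule hol_cont[OF q])
 have repr: "2 * pi * q w = cint (\<lambda>z. q z * (z / (z - w))) R" if w: "0 < cmod w" "cmod w < R" for w
 proof -
  have wA: "w \<in> annulus 0 b" using w R by (simp add: annulus_def)
  \<comment> \<open>The difference quotient at \<open>w\<close>, with the removable value filled in,
    is holomorphic across the circle through \<open>w\<close>, so its integral is the same on both
    sides of that circle; the inner side shows that it is 0.\<close>
  define g where "g = (\<lambda>z. if z = w then w * deriv q w else z * ((q z - q w) / (z - w)))"
  have "g holomorphic_on annulus 0 b"
   unfolding g_def
  proof (rule removable_singularity)
   show "(\<lambda>z. z * ((q z - q w) / (z - w))) holomorphic_on annulus 0 b - {w}"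
    by (intro holomorphic_intros holomorphic_on_subset[OF q]) auto
   have "((\<lambda>z. (q z - q w) / (z - w)) ---> deriv q w) (at w)"
    using holomorphic_derivI[OF q open_annulus wA] by (simp add: has_field_derivative_iff)
   then show "((\<lambda>z. z * ((q z - q w) / (z - w))) ---> w * deriv q w) (at w)"
    by (intro tendsto_intros)
  qed auto
  then obtain c where c: "\<And>r. 0 < r ==> r < b ==> cint g r = c"
   using holomorphic_cint_const[of g 0 b] by blast
  have split: "cint g r = cint (\<lambda>z. q z * (z / (z - w))) r - q w * cint (\<lambda>z. z / (z - w)) r"
   if r: "0 < r" "r < b" "r \<noteq> cmod w" for r
  proof -
   let ?C = "{v. cmod v = r}"
   have inC: "cr r * cis t \<in> ?C" for t using r by (auto simp: norm_mult)
   have sub: "?C \<subseteq> annulus 0 b" using r by (auto simp: annulus_def)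
   have "cint g r = cint (\<lambda>z. q z * (z / (z - w)) - q w * (z / (z - w))) r"
   proof (rule cint_cong)
    fix t
    have "cr r * cis t \<noteq> w" using inC[of t] r by auto
    then show "g (cr r * cis t) = q (cr r * cis t) * (cr r * cis t / (cr r * cis t - w)) -
     q w * (cr r * cis t / (cr r * cis t - w))"
     by (simp add: g_def diff_divide_distrib ring_distribs mult.commute)
   qed
   also have "\<dots> = cint (\<lambda>z. q z * (z / (z - w))) r - cint (\<lambda>z. q w * (z / (z - w))) r"
    by (rule cint_diff[of ?C]) (use r inC in \<open>auto intro!: continuous_intros continuous_on_subset[OF qc sub]\<close>)
   finally show ?thesis by (simp only: cint_cmulc)
  qed
  have "c = 0"
  proof -
   \<comment> \<open>Half the modulus makes the ratio of the geometric series exactly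
     \<open>1/2\<close>.\<close>
   define r where "r = cmod w / 2"
   have r: "0 < r" "r < cmod w" "r < b" using w R by (auto simp: r_def)
   let ?C = "{v. cmod v = r}"
   have inC: "cr r * cis t \<in> ?C" for t using r by (auto simp: norm_mult)
   have sub: "?C \<subseteq> annulus 0 b" using r by (auto simp: annulus_def)
   have wC: "v \<noteq> w" if "v \<in> ?C" for v using that r by auto
   have qcC: "continuous_on ?C q" by (rule continuous_on_subset[OF qc sub])
   have 1: "cint (\<lambda>z. z / (z - w)) r = 0"
   proof -
    have "(\<lambda>z. z / (z - w)) holomorphic_on ball 0 (cmod w)"
     by (intro holomorphic_intros) auto
    from holomorphic_cint_center[OF this, of r] r show ?thesis by simp
   qed
   obtain B where B0: "0 \<le> B" and B: "\<And>v. v \<in> ?C ==> cmod (q v) \<le> B" using circle_bound[OF qcC] by blast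
   \<comment> \<open>Each round replaces the kernel by \<open>z / w\<close> times itself minus one
     pure power, and that power integrates to a moment.\<close>
   have it: "cint (\<lambda>z. q z * (z / (z - w))) r = cint (\<lambda>z. q z * (z / w) ^ M * (z / (z - w))) r" for M
   proof (induction M)
    case 0 then show ?case by simp
   next
    case (Suc M)
    have "cint (\<lambda>z. q z * (z / w) ^ M * (z / (z - w))) r
     = cint (\<lambda>z. q z * (z / w) ^ Suc M * (z / (z - w)) - (1 / w ^ Suc M) * (q z * z ^ Suc M)) r"
    proof (rule cint_cong)
     fix t let ?v = "cr r * cis t"
     have nw: "?v \<noteq> w" using wC[OF inC] .
     have w0: "w \<noteq> 0" using w by auto
     have "?v / (?v - w) = ?v / w * (?v / (?v - w)) - ?v / w" using nw w0 by (simp add: field_simps)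
     then have "q ?v * (?v / w) ^ M * (?v / (?v - w)) = q ?v * (?v / w) ^ M * (?v / w * (?v / (?v - w)) - ?v / w)"
      by (rule arg_cong[where f = "\<lambda>x. q ?v * (?v / w) ^ M * x"])
     also have "\<dots> = q ?v * (?v / w) ^ Suc M * (?v / (?v - w)) - q ?v * (?v / w) ^ Suc M"
      by (simp add: algebra_simps)
     finally have e: "q ?v * (?v / w) ^ M * (?v / (?v - w)) = q ?v * (?v / w) ^ Suc M * (?v / (?v - w)) - q ?v * (?v / w) ^ Suc M" .
     have e2: "(1 / w ^ Suc M) * (q ?v * ?v ^ Suc M) = q ?v * (?v / w) ^ Suc M" by (simp add: power_divide)
     show "q ?v * (?v / w) ^ M * (?v / (?v - w)) = q ?v * (?v / w) ^ Suc M * (?v / (?v - w)) - (1 / w ^ Suc M) * (q ?v * ?v ^ Suc M)"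
      unfolding e2 by (rule e)
    qed
    also have "\<dots> = cint (\<lambda>z. q z * (z / w) ^ Suc M * (z / (z - w))) r - cint (\<lambda>z. (1 / w ^ Suc M) * (q z * z ^ Suc M)) r"
     by (rule cint_diff[of ?C]) (use wC w inC in \<open>auto intro!: continuous_intros qcC\<close>)
    also have "cint (\<lambda>z. (1 / w ^ Suc M) * (q z * z ^ Suc M)) r = 0"
     using mom[OF r(1) r(3), of M] by (simp only: cint_cmulc) simp
    finally show ?case using Suc by simp
   qed
   have bd: "cmod (cint (\<lambda>z. q z * (z / (z - w))) r) \<le> 2 * pi * (B * (r / (cmod w - r))) * (1/2) ^ M" for M
   proof -
    have "cmod (cint (\<lambda>z. q z * (z / w) ^ M * (z / (z - w))) r) \<le> cint (\<lambda>z. B * (1/2) ^ M * (r / (cmod w - r))) r"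
    proof (rule cint_norm_le[of ?C])
     fix v assume v: "v \<in> ?C"
     have "cmod (v - w) \<ge> cmod w - r" using v norm_triangle_ineq2[of w v] by (simp add: norm_minus_commute)
     then have "cmod (v / (v - w)) \<le> r / (cmod w - r)" using v r by (auto simp: norm_divide intro!: frac_le)
     moreover have "cmod ((v / w) ^ M) = (1/2) ^ M"
     proof -
      have "cmod (v / w) = 1 / 2" using v w by (simp add: norm_divide r_def field_simps)
      then show ?thesis by (simp only: norm_power)
     qed
     ultimately show "cmod (q v * (v / w) ^ M * (v / (v - w))) \<le> B * (1/2) ^ M * (r / (cmod w - r))"
      unfolding norm_mult by (intro mult_mono B[OF v]) (use B0 r in auto)
    qed (use wC w inC in \<open>auto intro!: continuous_intros qcC\<close>)
    then show ?thesis using it[of M] by (simp add: cint_const mult_ac)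
   qed
   have "(\<lambda>M. 2 * pi * (B * (r / (cmod w - r))) * (1/2) ^ M) \<longlonglongrightarrow> 2 * pi * (B * (r / (cmod w - r))) * 0"
    by (intro tendsto_intros LIMSEQ_power_zero) auto
   then have "cmod (cint (\<lambda>z. q z * (z / (z - w))) r) \<le> 2 * pi * (B * (r / (cmod w - r))) * 0"
    by (rule LIMSEQ_le_const) (use bd in auto)
   then have 2: "cint (\<lambda>z. q z * (z / (z - w))) r = 0" by simp
   show ?thesis using split[of r] c[of r] r 1 2 by simp
  qed
  then show ?thesis using split[of R] c[of R] R w cint_kernel[OF w(2)] by (simp add: mult_ac)
 qed
 let ?C = "{v. cmod v = R}"
 have inC: "cr R * cis t \<in> ?C" for t using R by (auto simp: norm_mult)
 have sub: "?C \<subseteq> annulus 0 b" using R by (auto simp: annulus_def)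
 have qcC: "continuous_on ?C q" by (rule continuous_on_subset[OF qc sub])
 obtain B where B0: "0 \<le> B" and B: "\<And>v. v \<in> ?C ==> cmod (q v) \<le> B" using circle_bound[OF qcC] by blast
 have "cmod (q w) \<le> 2 * B" if w: "0 < cmod w" "cmod w < R / 2" for w
 proof -
  have wC: "v \<noteq> w" if "v \<in> ?C" for v using that w R by auto
  have "cmod (cint (\<lambda>z. q z * (z / (z - w))) R) \<le> cint (\<lambda>z. B * 2) R"
  proof (rule cint_norm_le[of ?C])
   fix v assume v: "v \<in> ?C"
   have "cmod (v - w) \<ge> R / 2" using v w norm_triangle_ineq2[of v w] by simp
   then have "cmod (v / (v - w)) \<le> R / (R / 2)" using v R by (auto simp: norm_divide simp del: divide_divide_eq_right intro!: frac_le)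
   then show "cmod (q v * (v / (v - w))) \<le> B * 2"
    unfolding norm_mult by (intro mult_mono B[OF v]) (use B0 R in auto)
  qed (use wC w inC in \<open>auto intro!: continuous_intros qcC\<close>)
  moreover have "cmod (cint (\<lambda>z. q z * (z / (z - w))) R) = 2 * pi * cmod (q w)"
  proof -
   have e: "cint (\<lambda>z. q z * (z / (z - w))) R = cr (2 * pi) * q w"
    using repr[of w] w R by simp
   show ?thesis unfolding e norm_mult by simp
  qed
  ultimately show ?thesis by (simp add: cint_const mult_ac)
 qed
 then have ev: "\<forall>\<^sub>F w in at 0. cmod (q w) \<le> 2 * B"
  unfolding eventually_at using R by (intro exI[of _ "R/2"]) auto
 have "q holomorphic_on ball 0 b - {0}" using q by (simp add: annulus_punctured_ball)
 from holomorphic_on_extend_bounded[OF this, THEN iffD2, OF _ exI, OF _ ev] b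
 obtain Q where "Q holomorphic_on ball 0 b" "\<forall>z\<in>ball 0 b - {0}. Q z = q z" by auto
 then show ?thesis using that by (auto simp: annulus_punctured_ball)
qed

lemma log_growth:
 fixes f :: "real => real"
 assumes der: "\<And>r. 0 < r ==> r < r0 ==> (f has_real_derivative f' r / r) (at r)"
  and B: "\<And>r. 0 < r ==> r < r0 ==> \<bar>f' r\<bar> \<le> B" and "0 < r0"
 shows "\<exists>C. \<forall>r. 0 < r --> r \<le> r0 / 2 --> \<bar>f r\<bar> \<le> C + B * ln (1 / r)"
proof -
 define r1 where "r1 = r0 / 2"
 have r1: "0 < r1" "r1 < r0" using \<open>0 < r0\<close> by (auto simp: r1_def)
 have "\<bar>f r\<bar> \<le> \<bar>f r1\<bar> + B * ln r1 + B * ln (1 / r)" if r: "0 < r" "r \<le> r1" for r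
 proof -
  have "f r + B * ln r \<le> f r1 + B * ln r1"
  proof (rule DERIV_nonneg_imp_nondecreasing[OF r(2)])
   fix x assume x: "r \<le> x" "x \<le> r1"
   have "((\<lambda>x. f x + B * ln x) has_real_derivative f' x / x + B * (1 / x)) (at x)"
    by (rule derivative_eq_intros der refl | use x r r1 in simp)+
   moreover have "0 \<le> f' x / x + B * (1 / x)" using B[of x] x r r1 by (simp add: field_simps)
   ultimately show "\<exists>y. ((\<lambda>x. f x + B * ln x) has_real_derivative y) (at x) \<and> 0 \<le> y" by blast
  qed
  moreover have "f r - B * ln r \<ge> f r1 - B * ln r1"
  proof (rule DERIV_nonpos_imp_nonincreasing[OF r(2)])
   fix x assume x: "r \<le> x" "x \<le> r1"
   have "((\<lambda>x. f x - B * ln x) has_real_derivative f' x / x - B * (1 / x)) (at x)"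
    by (rule derivative_eq_intros der refl | use x r r1 in simp)+
   moreover have "f' x / x - B * (1 / x) \<le> 0" using B[of x] x r r1 by (simp add: field_simps)
   ultimately show "\<exists>y. ((\<lambda>x. f x - B * ln x) has_real_derivative y) (at x) \<and> y \<le> 0" by blast
  qed
  ultimately show ?thesis using r by (simp add: ln_div)
 qed
 then show ?thesis unfolding r1_def by (intro exI[of _ "\<bar>f r1\<bar> + B * ln r1"]) (simp add: r1_def)
qed

lemma cint_tendsto:
 fixes f :: "complex => real"
 assumes cont: "continuous_on (annulus 0 b) f" and lim: "(f ---> l) (at 0)" and b: "0 < b"
 shows "(cint f ---> 2 * pi * l) (at_right 0)"
proof (rule tendstoI)
 fix e :: real assume e: "0 < e"
 \<comment> \<open>The margin \<open>e / 8\<close> pays for the total angle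
   \<open>2 * pi < 8\<close>.\<close>
 have "\<forall>\<^sub>F v in at 0. dist (f v) l < e / 8" using lim e by (intro tendstoD) auto
 then obtain d where d: "0 < d" "\<And>v. v \<noteq> 0 ==> cmod v < d ==> dist (f v) l < e / 8"
  unfolding eventually_at by auto
 have "dist (cint f r) (2 * pi * l) < e" if r: "0 < r" "r < min b d" for r
 proof -
  let ?C = "{v. cmod v = r}"
  have inC: "cr r * cis t \<in> ?C" for t using r by (auto simp: norm_mult)
  have fc: "continuous_on ?C f" by (rule continuous_on_subset[OF cont]) (use r in \<open>auto simp: annulus_def\<close>)
  have "cint f r - 2 * pi * l = cint (\<lambda>v. f v - l) r"
   using cint_diff[OF fc continuous_on_const inC, of l] by (simp add: cint_const)
  also have "norm (cint (\<lambda>v. f v - l) r) \<le> cint (\<lambda>v. e / 8) r"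
  proof (rule cint_norm_le[of ?C])
   show "norm (f v - l) \<le> e / 8" if "v \<in> ?C" for v using d(2)[of v] that r by (auto simp: dist_norm)
  qed (use inC in \<open>auto intro!: continuous_intros fc\<close>)
  also have "\<dots> < e"
  proof -
   have "pi * e < 4 * e" using e pi_less_4 by (intro mult_strict_right_mono)
   then show ?thesis by (simp add: cint_const)
  qed
  finally show ?thesis by (simp add: dist_real_def)
 qed
 then show "\<forall>\<^sub>F r in at_right 0. dist (cint f r) (2 * pi * l) < e"
  unfolding eventually_at_right_field using b d(1) by (intro exI[of _ "min b d"]) auto
qed

section \<open>The vector field at a puncture\<close>

text \<open>\<open>F\<close> is the component of the holomorphic field, \<open>k\<close> the
  curvature and \<open>\<psi>\<close> half the logarithm of the metric in a coordinate centred at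
  the point; \<open>P\<close> is twice the \<open>z\<close>-derivative of \<open>\<psi>\<close>, and
  \<open>h\<close> is a primitive of \<open>1 / G\<close> on the set \<open>J\<close> of curvature
  values. Finite area and energy enter through \<open>energy\<close>, which offers arbitrarily small
  radii outside a given countable set. The first half of \<open>h_bd\<close> is for a
  \<open>J\<close> between two roots of \<open>G\<close>, the second for a \<open>J\<close>
  unbounded below.\<close>

locale punctured_hcmu =
 fixes b :: real and F P :: "complex => complex" and k \<psi> :: "complex => real"
  and G h :: "real => real" and J :: "real set" and \<alpha> :: real
 assumes b: "0 < b"
  and F: "F holomorphic_on annulus 0 b"
  and F_nz: "\<exists>v\<in>annulus 0 b. F v \<noteq> 0"
  and k_der: "\<And>v. v \<in> annulus 0 b ==>
   (k has_derivative (\<lambda>d. Re (2 * exp (2 * \<psi> v) * cnj (F v) * d))) (at v)"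
  and psi_der: "\<And>v. v \<in> annulus 0 b ==> (\<psi> has_derivative (\<lambda>d. Re (P v * d))) (at v)"
  and P_cont: "continuous_on (annulus 0 b) P"
  and metric: "\<And>v. v \<in> annulus 0 b ==> exp (2 * \<psi> v) * (cmod (F v))\<^sup>2 = G (k v)"
  and G_cont: "continuous_on UNIV G"
  and G_le: "\<exists>C>0. \<forall>x. G x \<le> C * (1 + x\<^sup>2)\<^sup>2"
  and angle: "((\<lambda>r. cint (\<lambda>v. Re (P v * v) + 1 - \<alpha>) r) ---> 0) (at_right 0)"
  and energy: "\<And>\<delta> N. 0 < \<delta> ==> countable N ==>
   \<exists>r. 0 < r \<and> r < \<delta> \<and> r \<notin> N \<and> r\<^sup>2 * cint (\<lambda>v. (1 + (k v)\<^sup>2) * exp (2 * \<psi> v)) r \<le> 1"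
  and J: "\<And>v. v \<in> annulus 0 b ==> F v \<noteq> 0 ==> k v \<in> J"
  and h_der: "\<And>x. x \<in> J ==> (h has_real_derivative 1 / G x) (at x)"
  and h_bd: "(\<exists>C\<ge>0. \<forall>x\<in>J. h x \<le> C * (C - ln (G x)) \<and> ln (G x) \<le> C) \<or> (\<exists>C. \<forall>x\<in>J. - h x \<le> C)"
begin

lemma k_cont: "continuous_on (annulus 0 b) k"
 by (intro continuous_at_imp_continuous_on ballI has_derivative_continuous[OF k_der])

lemma psi_cont: "continuous_on (annulus 0 b) \<psi>"
 by (intro continuous_at_imp_continuous_on ballI has_derivative_continuous[OF psi_der])

lemma F_cont: "continuous_on (annulus 0 b) F"
 by (rule hol_cont[OF F])

lemma G_pos: "v \<in> annulus 0 b ==> F v \<noteq> 0 ==> 0 < G (k v)"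
 using metric[of v] by (metis exp_gt_zero mult_pos_pos norm_ge_zero zero_less_norm_iff zero_less_power)

lemma psi_eq: "v \<in> annulus 0 b ==> F v \<noteq> 0 ==> 2 * ln (cmod (F v)) = ln (G (k v)) - 2 * \<psi> v"
proof -
 assume v: "v \<in> annulus 0 b" "F v \<noteq> 0"
 have "ln (G (k v)) = ln (exp (2 * \<psi> v) * (cmod (F v))\<^sup>2)" using metric[OF v(1)] by simp
 also have "\<dots> = ln (exp (2 * \<psi> v)) + ln ((cmod (F v))\<^sup>2)" using v by (intro ln_mult_pos) auto
 also have "\<dots> = 2 * \<psi> v + 2 * ln (cmod (F v))" using v by (simp add: ln_realpow)
 finally show ?thesis by simp
qed

text \<open>The angle condition bounds the circle integral of \<open>Re (P v * v)\<close>, which is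
  \<open>r\<close> times the derivative of the circle integral of \<open>\<psi>\<close>; integrating
  a bound \<open>B / r\<close> gives \<open>B * ln (1 / r)\<close>.\<close>

lemma psi_growth: "\<exists>r0 B C. 0 < r0 \<and> r0 < 1 \<and> r0 < b \<and> 0 \<le> B \<and> (\<forall>r. 0 < r --> r \<le> r0 --> \<bar>cint \<psi> r\<bar> \<le> C + B * ln (1 / r))"
proof -
 have "\<forall>\<^sub>F r in at_right 0. \<bar>cint (\<lambda>v. Re (P v * v) + 1 - \<alpha>) r\<bar> < 1"
  using tendstoD[OF angle, of 1] by (simp add: dist_real_def)
 then obtain d where d: "0 < d" "\<And>r. 0 < r ==> r < d ==> \<bar>cint (\<lambda>v. Re (P v * v) + 1 - \<alpha>) r\<bar> < 1"
  unfolding eventually_at_right_field by auto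
 define r0 where "r0 = min (min d b) 1"
 have r0: "0 < r0" using d b by (simp add: r0_def)
 have "\<exists>C. \<forall>r. 0 < r --> r \<le> r0 / 2 --> \<bar>cint \<psi> r\<bar> \<le> C + (1 + 2 * pi * \<bar>\<alpha> - 1\<bar>) * ln (1 / r)"
 proof (rule log_growth[OF _ _ r0])
  fix r assume r: "0 < r" "r < r0"
  then have rb: "r < b" by (simp add: r0_def)
  show "(cint \<psi> has_real_derivative cint (\<lambda>v. Re (P v * v)) r / r) (at r)"
   by (rule cint_has_derivative_Re[OF psi_der P_cont _ r(1) rb]) auto
  have inC: "cr r * cis t \<in> annulus 0 b" for t using r rb by simp
  have "cint (\<lambda>v. Re (P v * v) + (1 - \<alpha>)) r = cint (\<lambda>v. Re (P v * v)) r + 2 * pi * (1 - \<alpha>)"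
   by (subst cint_add[OF _ _ inC]) (auto intro!: continuous_intros P_cont simp: cint_const)
  moreover have "\<bar>cint (\<lambda>v. Re (P v * v) + (1 - \<alpha>)) r\<bar> < 1"
   using d(2)[of r] r by (simp add: r0_def add_diff_eq)
  moreover have "\<bar>2 * pi * (1 - \<alpha>)\<bar> = 2 * pi * \<bar>\<alpha> - 1\<bar>" by (simp add: abs_mult abs_minus_commute)
  ultimately show "\<bar>cint (\<lambda>v. Re (P v * v)) r\<bar> \<le> 1 + 2 * pi * \<bar>\<alpha> - 1\<bar>"
   by linarith
 qed
 then obtain C where "\<forall>r. 0 < r --> r \<le> r0 / 2 --> \<bar>cint \<psi> r\<bar> \<le> C + (1 + 2 * pi * \<bar>\<alpha> - 1\<bar>) * ln (1 / r)" by blast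
 then show ?thesis using r0
  by (intro exI[of _ "r0/2"] exI[of _ "1 + 2 * pi * \<bar>\<alpha> - 1\<bar>"] exI[of _ C]) (auto simp: r0_def)
qed

lemma F_nonconst_zero:
 assumes "v \<in> annulus 0 b" "F v = 0" shows "\<not> F constant_on annulus 0 b"
 using assms F_nz unfolding constant_on_def by metis

text \<open>Countability is what is available before the zeros are known to be finite near 0; it
  lets a radius be chosen whose circle carries no zero.\<close>

lemma countable_zeros: "countable {v \<in> annulus 0 b. F v = 0}"
proof (cases "{v \<in> annulus 0 b. F v = 0} = {}")
 case False
 then have "\<not> F constant_on annulus 0 b" using F_nonconst_zero by blast
 moreover have "fsigma (annulus 0 b)"
 proof -
  obtain C :: "nat => complex set" where C: "\<And>n. compact (C n)" "\<Union> (range C) = annulus 0 b"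
   using open_Union_compact_subsets[OF open_annulus[of 0 b]] by metis
  then show ?thesis unfolding fsigma_Union_compact by (intro exI[of _ C]) auto
 qed
 ultimately show ?thesis
  using holomorphic_countable_zeros[OF F open_annulus connected_annulus_ball] by blast
qed (metis countable_empty)

lemma good_radius:
 assumes "0 < \<delta>"
 obtains r where "0 < r" "r < \<delta>" "\<And>v. cmod v = r ==> r < b ==> F v \<noteq> 0"
  "r\<^sup>2 * cint (\<lambda>v. (1 + (k v)\<^sup>2) * exp (2 * \<psi> v)) r \<le> 1"
proof -
 have "countable (cmod ` {v \<in> annulus 0 b. F v = 0})" using countable_zeros by simp
 from energy[OF assms this] obtain r where r: "0 < r" "r < \<delta>" "r \<notin> cmod ` {v \<in> annulus 0 b. F v = 0}"
  "r\<^sup>2 * cint (\<lambda>v. (1 + (k v)\<^sup>2) * exp (2 * \<psi> v)) r \<le> 1" by blast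
 have "F v \<noteq> 0" if "cmod v = r" "r < b" for v
 proof
  assume "F v = 0"
  then have "v \<in> {v \<in> annulus 0 b. F v = 0}" using that r(1) by (auto simp: annulus_def)
  then show False using r(3) that by blast
 qed
 then show ?thesis using that r by blast
qed

text \<open>On a good circle the energy bound dominates the mean of \<open>ln (1 + k\<^sup>2)\<close> because \<open>ln x \<le> x\<close>.\<close>
lemma log_F_upper: "\<exists>r0 B C. 0 < r0 \<and> r0 < 1 \<and> r0 < b \<and> 0 \<le> B \<and> (\<forall>r. 0 < r --> r \<le> r0 -->
  (\<forall>v. cmod v = r --> F v \<noteq> 0) --> r\<^sup>2 * cint (\<lambda>v. (1 + (k v)\<^sup>2) * exp (2 * \<psi> v)) r \<le> 1 -->
  cint (\<lambda>v. ln (cmod (F v))) r \<le> C + B * ln (1 / r))"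
proof -
 obtain r0 B C where r0: "0 < r0" "r0 < 1" "r0 < b" "0 \<le> B"
  and M: "\<And>r. 0 < r ==> r \<le> r0 ==> \<bar>cint \<psi> r\<bar> \<le> C + B * ln (1 / r)"
  using psi_growth by blast
 obtain D where D: "0 < D" "\<And>x. G x \<le> D * (1 + x\<^sup>2)\<^sup>2" using G_le by blast
 have "cint (\<lambda>v. ln (cmod (F v))) r \<le> (pi * ln D + 1 + 3 * C) + (3 * B + 4 * pi) * ln (1 / r)"
  if r: "0 < r" "r \<le> r0" and nz: "\<And>v. cmod v = r ==> F v \<noteq> 0"
   and en: "r\<^sup>2 * cint (\<lambda>v. (1 + (k v)\<^sup>2) * exp (2 * \<psi> v)) r \<le> 1" for r
 proof -
  let ?C = "{v. cmod v = r}"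
  have inC: "cr r * cis t \<in> ?C" for t using r by (auto simp: norm_mult)
  have sub: "?C \<subseteq> annulus 0 b" using r r0 by (auto simp: annulus_def)
  have kc: "continuous_on ?C k" "continuous_on ?C \<psi>" "continuous_on ?C F"
   using continuous_on_subset[OF k_cont sub] continuous_on_subset[OF psi_cont sub] continuous_on_subset[OF F_cont sub] by auto
  let ?e = "\<lambda>v. r\<^sup>2 * ((1 + (k v)\<^sup>2) * exp (2 * \<psi> v))"
  \<comment> \<open>Of the \<open>3 * \<psi> v\<close>, one comes from \<open>psi_eq\<close> and two
    from solving the energy density for \<open>1 + (k v)\<^sup>2\<close>.\<close>
  have "cint (\<lambda>v. ln (cmod (F v))) r \<le> cint (\<lambda>v. ((ln D / 2 - 2 * ln r) + ?e v) - 3 * \<psi> v) r"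
  proof (rule cint_mono[of ?C])
   fix v assume v: "v \<in> ?C"
   have vA: "v \<in> annulus 0 b" using v sub by blast
   have Fv: "F v \<noteq> 0" using nz v by simp
   have p: "0 < 1 + (k v)\<^sup>2" by (simp add: add_pos_nonneg)
   have "ln (G (k v)) \<le> ln (D * (1 + (k v)\<^sup>2)\<^sup>2)" using D G_pos[OF vA Fv] by (intro ln_mono) auto
   also have "\<dots> = ln D + ln ((1 + (k v)\<^sup>2)\<^sup>2)" using D p by (intro ln_mult_pos) auto
   also have "\<dots> = ln D + 2 * ln (1 + (k v)\<^sup>2)" using p by (simp add: ln_realpow)
   finally have 1: "ln (G (k v)) \<le> ln D + 2 * ln (1 + (k v)\<^sup>2)" .
   have "ln (?e v) = ln (r\<^sup>2) + ln ((1 + (k v)\<^sup>2) * exp (2 * \<psi> v))" using r p by (intro ln_mult_pos) auto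
   also have "\<dots> = 2 * ln r + (ln (1 + (k v)\<^sup>2) + ln (exp (2 * \<psi> v)))" using r p by (subst ln_mult_pos) (auto simp: ln_realpow)
   finally have "ln (1 + (k v)\<^sup>2) = ln (?e v) - 2 * \<psi> v - 2 * ln r" by simp
   moreover have "ln (?e v) \<le> ?e v" using r p by (intro less_imp_le ln_less_self) auto
   ultimately have 2: "ln (1 + (k v)\<^sup>2) \<le> ?e v - 2 * \<psi> v - 2 * ln r" by linarith
   show "ln (cmod (F v)) \<le> ((ln D / 2 - 2 * ln r) + ?e v) - 3 * \<psi> v"
    using 1 2 psi_eq[OF vA Fv] by linarith
  qed (use nz inC in \<open>auto intro!: continuous_intros kc\<close>)
  also have "\<dots> = cint (\<lambda>v. (ln D / 2 - 2 * ln r) + ?e v) r - cint (\<lambda>v. 3 * \<psi> v) r"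
   by (rule cint_diff[of ?C]) (use inC in \<open>auto intro!: continuous_intros kc\<close>)
  also have "cint (\<lambda>v. (ln D / 2 - 2 * ln r) + ?e v) r = 2 * pi * (ln D / 2 - 2 * ln r) + cint ?e r"
   by (subst cint_add[of ?C]) (use inC in \<open>auto intro!: continuous_intros kc simp: cint_const\<close>)
  also have "cint ?e r = r\<^sup>2 * cint (\<lambda>v. (1 + (k v)\<^sup>2) * exp (2 * \<psi> v)) r" by (rule cint_cmul)
  also have "cint (\<lambda>v. 3 * \<psi> v) r = 3 * cint \<psi> r" by (rule cint_cmul)
  finally have "cint (\<lambda>v. ln (cmod (F v))) r \<le> 2 * pi * (ln D / 2 - 2 * ln r) + 1 - 3 * cint \<psi> r"
   using en by linarith
  moreover have "- cint \<psi> r \<le> C + B * ln (1 / r)" using M[OF r] by linarith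
  moreover have "ln (1 / r) = - ln r" using r by (simp add: ln_div)
  ultimately show ?thesis by (simp add: algebra_simps)
 qed
 then show ?thesis using r0 pi_gt_zero
  by (intro exI[of _ r0] exI[of _ "3 * B + 4 * pi"] exI[of _ "pi * ln D + 1 + 3 * C"]) auto
qed

text \<open>By Jensen, every zero forces the integral of \<open>ln (cmod (F v))\<close> to grow by
  \<open>2 * pi * ln (1 / r)\<close> as \<open>r\<close> shrinks, whereas \<open>log_F_upper\<close>
  allows at most \<open>B * ln (1 / r)\<close> on good circles. Up to the slope \<open>W\<close> at
  the outer circle, this bounds the size of every finite set of zeros by the same number.\<close>

lemma finite_zeros: "\<exists>R. 0 < R \<and> R < b \<and> R < 1 \<and> finite {v \<in> annulus 0 R. F v = 0}"
proof -
 obtain r0 B C where r0: "0 < r0" "r0 < 1" "r0 < b" "0 \<le> B"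
  and up: "\<And>r. 0 < r ==> r \<le> r0 ==> (\<forall>v. cmod v = r --> F v \<noteq> 0) ==>
   r\<^sup>2 * cint (\<lambda>v. (1 + (k v)\<^sup>2) * exp (2 * \<psi> v)) r \<le> 1 ==>
   cint (\<lambda>v. ln (cmod (F v))) r \<le> C + B * ln (1 / r)"
  using log_F_upper by blast
 obtain R where R: "0 < R" "R < r0" "\<And>v. cmod v = R ==> R < b ==> F v \<noteq> 0"
  using good_radius[OF r0(1)] by metis
 have Rb: "R < b" "R < 1" using R r0 by auto
 define W where "W = Re (cint (\<lambda>v. v * deriv F v / F v) R)"
 define E where "E = cint (\<lambda>v. ln (cmod (F v))) R"
 have bound: "2 * pi * card S \<le> B + \<bar>W\<bar>" if S: "finite S" "S \<subseteq> {v \<in> annulus 0 R. F v = 0}" for S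
 proof (rule ccontr)
  assume "\<not> 2 * pi * card S \<le> B + \<bar>W\<bar>"
  then have gt: "B + \<bar>W\<bar> < 2 * pi * card S" by simp
  then have "S \<noteq> {}" using r0 by auto
  define \<rho> where "\<rho> = Min (cmod ` S)"
  have \<rho>: "0 < \<rho>" "\<And>z. z \<in> S ==> \<rho> \<le> cmod z"
   using S \<open>S \<noteq> {}\<close> by (auto simp: \<rho>_def annulus_def)
  \<comment> \<open>\<open>e\<close> is the surplus in the coefficient of \<open>ln (1 / r)\<close>
    and \<open>K\<close> collects the terms that do not depend on \<open>r\<close>; the last entry
    of \<open>\<delta>\<close> makes \<open>e * ln (1 / r)\<close> exceed \<open>K\<close>.\<close>
  define e where "e = 2 * pi * card S - B - \<bar>W\<bar>"
  have e: "0 < e" using gt by (simp add: e_def)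
  define K where "K = C - E + \<bar>W\<bar> * \<bar>ln R\<bar> + 2 * pi * card S * \<bar>ln \<rho>\<bar>"
  define \<delta> where "\<delta> = min (min \<rho> R) (exp (- ((K + 1) / e)))"
  have \<delta>: "0 < \<delta>" using \<rho> R by (simp add: \<delta>_def)
  obtain r where r: "0 < r" "r < \<delta>" "\<And>v. cmod v = r ==> r < b ==> F v \<noteq> 0"
   "r\<^sup>2 * cint (\<lambda>v. (1 + (k v)\<^sup>2) * exp (2 * \<psi> v)) r \<le> 1"
   using good_radius[OF \<delta>] by metis
  have rR: "r < R" "r < \<rho>" "r < exp (- ((K + 1) / e))" using r by (auto simp: \<delta>_def)
  let ?Z = "{v \<in> annulus r R. F v = 0}"
  have finZ: "finite ?Z"
  proof (cases "?Z = {}")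
   case False
   have sub: "annulus r R \<subseteq> annulus 0 b" using r Rb by (auto simp: annulus_def)
   then have nc: "\<not> F constant_on annulus 0 b" using False F_nonconst_zero by blast
   have "compact (cball 0 R - ball (0::complex) r)" by (intro compact_diff) auto
   moreover have "cball 0 R - ball (0::complex) r \<subseteq> annulus 0 b" using r Rb by (auto simp: annulus_def)
   ultimately have "finite {z \<in> cball 0 R - ball 0 r. F z = 0}"
    using holomorphic_compact_finite_zeros[OF F open_annulus connected_annulus_ball _ _ nc] by blast
   then show ?thesis by (rule finite_subset[rotated]) (auto simp: annulus_def)
  qed (metis finite.emptyI)
  have "cint (\<lambda>v. ln (cmod (F v))) r \<ge> E - W * ln (R / r) + 2 * pi * (\<Sum>z\<in>?Z. ln (cmod z / r))"
   unfolding E_def W_def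
  proof (rule jensen_annulus[OF finZ F order_refl r(1) rR(1) Rb(1) _ connected_annulus_ball])
   fix v assume v: "r \<le> cmod v" "cmod v \<le> R"
   show "F v = 0 \<longleftrightarrow> v \<in> ?Z"
   proof (cases "cmod v = r \<or> cmod v = R")
    case True then show ?thesis using r(3)[of v] R(3)[of v] rR Rb by (auto simp: annulus_def)
   next
    case False then show ?thesis using v by (auto simp: annulus_def)
   qed
  qed auto
  moreover have "(\<Sum>z\<in>?Z. ln (cmod z / r)) \<ge> (\<Sum>z\<in>S. ln (cmod z / r))"
  proof (rule sum_mono2[OF finZ])
   show "S \<subseteq> ?Z" using S \<rho> rR by (force simp: annulus_def)
   show "0 \<le> ln (cmod z / r)" if "z \<in> ?Z - S" for z using that r(1) by (auto simp: annulus_def)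
  qed
  moreover have "(\<Sum>z\<in>S. ln (cmod z / r)) \<ge> (\<Sum>z\<in>S. ln (\<rho> / r))"
   by (intro sum_mono ln_mono) (use \<rho> r in \<open>auto intro: divide_right_mono\<close>)
  ultimately have low: "cint (\<lambda>v. ln (cmod (F v))) r \<ge> E - W * ln (R / r) + 2 * pi * (card S * ln (\<rho> / r))"
  proof -
   assume a: "E - W * ln (R / r) + 2 * pi * (\<Sum>z\<in>?Z. ln (cmod z / r)) \<le> cint (\<lambda>v. ln (cmod (F v))) r"
    "(\<Sum>z\<in>S. ln (cmod z / r)) \<le> (\<Sum>z\<in>?Z. ln (cmod z / r))" "(\<Sum>z\<in>S. ln (\<rho> / r)) \<le> (\<Sum>z\<in>S. ln (cmod z / r))"
   then have "2 * pi * (card S * ln (\<rho> / r)) \<le> 2 * pi * (\<Sum>z\<in>?Z. ln (cmod z / r))"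
    by (intro mult_left_mono) auto
   then show ?thesis using a by linarith
  qed
  have high: "cint (\<lambda>v. ln (cmod (F v))) r \<le> C + B * ln (1 / r)"
   using r rR R Rb r0 by (intro up) auto
  define l where "l = - ln r"
  have l: "ln (1 / r) = l" "ln (R / r) = ln R + l" "ln (\<rho> / r) = ln \<rho> + l"
   using r \<rho> R by (auto simp: ln_div l_def)
  have lpos: "0 < l" using r rR R Rb by (simp add: l_def)
  have "E - W * (ln R + l) + 2 * pi * (card S * (ln \<rho> + l)) \<le> C + B * l"
   using low high unfolding l by linarith
  then have "(2 * pi * card S - B - W) * l \<le> C - E + W * ln R - 2 * pi * card S * ln \<rho>"
   by (simp add: algebra_simps)
  moreover have "e * l \<le> (2 * pi * card S - B - W) * l" using lpos by (intro mult_right_mono) (auto simp: e_def)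
  moreover have "W * ln R \<le> \<bar>W\<bar> * \<bar>ln R\<bar>" by (metis abs_ge_self abs_mult)
  moreover have "- (2 * pi * card S * ln \<rho>) \<le> 2 * pi * card S * \<bar>ln \<rho>\<bar>"
  proof -
   have "2 * pi * card S * (- ln \<rho>) \<le> 2 * pi * card S * \<bar>ln \<rho>\<bar>" by (intro mult_left_mono) auto
   then show ?thesis by simp
  qed
  ultimately have "e * l \<le> K" unfolding K_def by linarith
  moreover have "e * l > K"
  proof -
   have "ln r < - ((K + 1) / e)" using rR(3) r(1) by (metis exp_gt_zero ln_exp ln_less_cancel_iff)
   then have "(K + 1) / e < l" by (simp add: l_def)
   then show ?thesis using e by (simp add: pos_divide_less_eq mult.commute)
  qed
  ultimately show False by linarith
 qed
 have "finite {v \<in> annulus 0 R. F v = 0}"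
 proof (rule ccontr)
  assume inf: "infinite {v \<in> annulus 0 R. F v = 0}"
  obtain n :: nat where n: "B + \<bar>W\<bar> < n" using reals_Archimedean2 by blast
  obtain S where S: "S \<subseteq> {v \<in> annulus 0 R. F v = 0}" "finite S" "card S = n"
   using infinite_arbitrarily_large[OF inf, of n] by blast
  have "real n \<le> 2 * pi * n" using pi_gt3 by (simp add: mult_le_cancel_right1)
  then show False using bound[OF S(2,1)] S(3) n by simp
 qed
 then show ?thesis using R Rb by blast
qed

lemma zero_free: "\<exists>\<delta>. 0 < \<delta> \<and> \<delta> < b \<and> \<delta> < 1 \<and> (\<forall>v\<in>annulus 0 \<delta>. F v \<noteq> 0)"
proof -
 obtain R where R: "0 < R" "R < b" "R < 1" and fin: "finite {v \<in> annulus 0 R. F v = 0}"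
  using finite_zeros by blast
 let ?Z = "{v \<in> annulus 0 R. F v = 0}"
 define \<delta> where "\<delta> = Min (insert R (cmod ` ?Z))"
 have "0 < \<delta>" unfolding \<delta>_def using fin R by (auto simp: annulus_def)
 moreover have "\<delta> \<le> R" unfolding \<delta>_def using fin by auto
 moreover have "F v \<noteq> 0" if v: "v \<in> annulus 0 \<delta>" for v
 proof
  assume "F v = 0"
  then have "v \<in> ?Z" using v \<open>\<delta> \<le> R\<close> by (auto simp: annulus_def)
  then have "\<delta> \<le> cmod v" unfolding \<delta>_def using fin by auto
  then show False using v by (simp add: annulus_def)
 qed
 ultimately show ?thesis using R by (intro exI[of _ \<delta>]) auto
qed

end

section \<open>The harmonic primitive of the field and its asymptotics at the puncture\<close>

context punctured_hcmu
begin

text \<open>With \<open>q v = v / F v\<close> and \<open>u = h \<circ> k\<close> one has \<open>du = 2 Re (q dv / v)\<close>, so \<open>u\<close> is harmonic.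
 Its circle means of absolute values are \<open>O(ln (1/r))\<close>, which kills the negative Laurent coefficients of \<open>q\<close>.\<close>

lemma u_der:
 assumes v: "v \<in> annulus 0 b" "F v \<noteq> 0"
 shows "((\<lambda>v. h (k v)) has_derivative (\<lambda>d. Re (2 / F v * d))) (at v)"
proof -
 have G0: "0 < G (k v)" by (rule G_pos[OF v])
 have "((\<lambda>v. h (k v)) has_derivative (\<lambda>d. 1 / G (k v) * Re (2 * exp (2 * \<psi> v) * cnj (F v) * d))) (at v)"
  by (rule has_derivative_compose[OF k_der[OF v(1)] h_der[OF J[OF v], unfolded has_field_derivative_def]])
 moreover have "1 / G (k v) * Re (2 * exp (2 * \<psi> v) * cnj (F v) * d) = Re (2 / F v * d)" for d
 proof -
  have "2 / F v = 2 * cnj (F v) / cr ((cmod (F v))\<^sup>2)"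
   unfolding complex_norm_square using v(2) by simp
  also have "\<dots> = cr (1 / G (k v)) * (2 * exp (2 * \<psi> v) * cnj (F v))"
   using v by (simp add: metric[OF v(1), symmetric])
  finally have "2 / F v * d = cr (1 / G (k v)) * (2 * exp (2 * \<psi> v) * cnj (F v) * d)" by simp
  moreover have "Re (cr x * w) = x * Re w" for x w by simp
  ultimately show ?thesis by (simp only:)
 qed
 ultimately show ?thesis by simp
qed

text \<open>\<open>ln (G (k v))\<close> is \<open>2 * ln (cmod (F v)) + 2 * \<psi> v\<close>, and
  both circle integrals grow at most logarithmically: the first because \<open>F\<close> has no
  zeros near 0, the second because of the angle.\<close>

lemma log_G_lower: "\<exists>r0 B C. 0 < r0 \<and> r0 < 1 \<and> r0 < b \<and> 0 \<le> B \<and> (\<forall>v\<in>annulus 0 r0. F v \<noteq> 0) \<and>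
  (\<forall>r. 0 < r --> r < r0 --> - cint (\<lambda>v. ln (G (k v))) r \<le> C + B * ln (1 / r))"
proof -
 obtain r0 B C where r0: "0 < r0" "r0 < 1" "r0 < b" "0 \<le> B"
  and M: "\<And>r. 0 < r ==> r \<le> r0 ==> \<bar>cint \<psi> r\<bar> \<le> C + B * ln (1 / r)"
  using psi_growth by blast
 obtain \<delta> where \<delta>: "0 < \<delta>" "\<delta> < b" "\<delta> < 1" and nz: "\<And>v. v \<in> annulus 0 \<delta> ==> F v \<noteq> 0"
  using zero_free by blast
 have sub: "annulus 0 \<delta> \<subseteq> annulus 0 b" using \<delta> by (auto simp: annulus_def)
 obtain W where "\<And>r. 0 < r ==> r < \<delta> ==> Re (cint (\<lambda>v. v * deriv F v / F v) r) = W"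
  and W: "\<And>r. 0 < r ==> r < \<delta> ==> (cint (\<lambda>v. ln (cmod (F v))) has_real_derivative W / r) (at r)"
  by (rule cint_ln_zero_free[OF holomorphic_on_subset[OF F sub] nz order_refl]) (assumption | rule that)+
 obtain C' where C': "\<And>r. 0 < r ==> r \<le> \<delta> / 2 ==> \<bar>cint (\<lambda>v. ln (cmod (F v))) r\<bar> \<le> C' + \<bar>W\<bar> * ln (1 / r)"
  using log_growth[OF W, of \<delta> "\<bar>W\<bar>"] \<delta> by auto
 define r1 where "r1 = min r0 (\<delta> / 2)"
 have r1: "0 < r1" "r1 < \<delta>" using r0 \<delta> by (auto simp: r1_def)
 have "- cint (\<lambda>v. ln (G (k v))) r \<le> (2 * C + 2 * C') + (2 * B + 2 * \<bar>W\<bar>) * ln (1 / r)" if r: "0 < r" "r < r1" for r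
 proof -
  have inC: "cr r * cis t \<in> annulus 0 \<delta>" for t using r r1 by simp
  have cont: "continuous_on (annulus 0 \<delta>) F" "continuous_on (annulus 0 \<delta>) \<psi>"
   using continuous_on_subset[OF F_cont sub] continuous_on_subset[OF psi_cont sub] by auto
  have "cint (\<lambda>v. ln (G (k v))) r = cint (\<lambda>v. 2 * ln (cmod (F v)) + 2 * \<psi> v) r"
  proof (rule cint_cong)
   fix t show "ln (G (k (cr r * cis t))) = 2 * ln (cmod (F (cr r * cis t))) + 2 * \<psi> (cr r * cis t)"
    using psi_eq[of "cr r * cis t"] inC[of t] nz sub by auto
  qed
  also have "\<dots> = 2 * cint (\<lambda>v. ln (cmod (F v))) r + 2 * cint \<psi> r"
   by (subst cint_add[of "annulus 0 \<delta>"]) (use inC nz in \<open>auto intro!: continuous_intros cont simp: cint_cmul\<close>)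
  finally show ?thesis using M[of r] C'[of r] r by (auto simp: r1_def algebra_simps)
 qed
 then show ?thesis using r1 r0 \<delta> nz
  by (intro exI[of _ r1] exI[of _ "2 * B + 2 * \<bar>W\<bar>"] exI[of _ "2 * C + 2 * C'"]) (auto simp: annulus_def)
qed

text \<open>The integral of \<open>u\<close> itself is affine in \<open>ln r\<close>, and a
  one-sided bound converts this into a bound for \<open>\<bar>u\<bar>\<close>: from
  \<open>u \<le> M\<close> with \<open>0 \<le> M\<close> follows
  \<open>\<bar>u\<bar> \<le> 2 * M - u\<close>, and from \<open>- u \<le> D\<close> follows
  \<open>\<bar>u\<bar> \<le> 2 * \<bar>D\<bar> + u\<close>. In the first case \<open>M\<close> is
  itself an unbounded function, but its integral is controlled by
  \<open>log_G_lower\<close>.\<close>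

lemma mean_abs_u: "\<exists>r0 B C. 0 < r0 \<and> r0 < 1 \<and> r0 < b \<and> 0 \<le> B \<and> (\<forall>v\<in>annulus 0 r0. F v \<noteq> 0) \<and>
  (\<forall>r. 0 < r --> r < r0 --> cint (\<lambda>v. \<bar>h (k v)\<bar>) r \<le> C + B * ln (1 / r))"
proof -
 obtain r0 B C where r0: "0 < r0" "r0 < 1" "r0 < b" "0 \<le> B" and nz: "\<And>v. v \<in> annulus 0 r0 ==> F v \<noteq> 0"
  and low: "\<And>r. 0 < r ==> r < r0 ==> - cint (\<lambda>v. ln (G (k v))) r \<le> C + B * ln (1 / r)"
  using log_G_lower by blast
 have sub: "annulus 0 r0 \<subseteq> annulus 0 b" using r0 by (auto simp: annulus_def)
 let ?u = "\<lambda>v. h (k v)"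
 have ud: "(?u has_derivative (\<lambda>d. Re (2 / F v * d))) (at v)" if "v \<in> annulus 0 r0" for v
  using u_der[of v] nz[OF that] that sub by blast
 have uc: "continuous_on (annulus 0 r0) ?u"
  by (intro continuous_at_imp_continuous_on ballI has_derivative_continuous[OF ud])
 have fc: "continuous_on (annulus 0 r0) (\<lambda>v. 2 / F v)"
  by (intro continuous_intros continuous_on_subset[OF F_cont sub]) (use nz in auto)
 have qh: "(\<lambda>v. 2 / F v * v) holomorphic_on annulus 0 r0"
  by (intro holomorphic_intros holomorphic_on_subset[OF F sub]) (use nz in auto)
 obtain c where c: "\<And>r. 0 < r ==> r < r0 ==> cint (\<lambda>v. 2 / F v * v) r = c"
  using holomorphic_cint_const[OF qh order_refl] by blast
 have "(cint ?u has_real_derivative Re c / r) (at r)" if r: "0 < r" "r < r0" for r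
 proof -
  have "(cint ?u has_real_derivative cint (\<lambda>v. Re (2 / F v * v)) r / r) (at r)"
   by (rule cint_has_derivative_Re[OF ud fc order_refl r])
  moreover have "cint (\<lambda>v. Re (2 / F v * v)) r = Re c"
   using cint_Re[OF hol_cont[OF qh], of r] c[OF r] r by simp
  ultimately show ?thesis by simp
 qed
 then obtain C' where C': "\<And>r. 0 < r ==> r \<le> r0 / 2 ==> \<bar>cint ?u r\<bar> \<le> C' + \<bar>Re c\<bar> * ln (1 / r)"
  using log_growth[of r0 "cint ?u" "\<lambda>_. Re c" "\<bar>Re c\<bar>"] r0 by auto
 define r1 where "r1 = r0 / 2"
 have r1: "0 < r1" "r1 < r0" using r0 by (auto simp: r1_def)
 have Gc: "continuous_on (annulus 0 r0) (\<lambda>v. ln (G (k v)))"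
 proof (rule continuous_on_ln)
  show "continuous_on (annulus 0 r0) (\<lambda>v. G (k v))"
   by (rule continuous_on_compose2[OF G_cont continuous_on_subset[OF k_cont sub]]) auto
  show "\<forall>v\<in>annulus 0 r0. G (k v) \<noteq> 0" using G_pos sub nz by (metis less_irrefl subsetD)
 qed
 have "\<exists>B' C''. 0 \<le> B' \<and> (\<forall>r. 0 < r --> r < r1 --> cint (\<lambda>v. \<bar>?u v\<bar>) r \<le> C'' + B' * ln (1 / r))"
  using h_bd
 proof
  assume "\<exists>D\<ge>0. \<forall>x\<in>J. h x \<le> D * (D - ln (G x)) \<and> ln (G x) \<le> D"
  then obtain D where D: "0 \<le> D" "\<And>x. x \<in> J ==> h x \<le> D * (D - ln (G x))" "\<And>x. x \<in> J ==> ln (G x) \<le> D" by blast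
  have "cint (\<lambda>v. \<bar>?u v\<bar>) r \<le> (4 * pi * D * D + 2 * D * C + C') + (2 * D * B + \<bar>Re c\<bar>) * ln (1 / r)"
   if r: "0 < r" "r < r1" for r
  proof -
   have inC: "cr r * cis t \<in> annulus 0 r0" for t using r r1 by simp
   have "cint (\<lambda>v. \<bar>?u v\<bar>) r \<le> cint (\<lambda>v. 2 * (D * (D - ln (G (k v)))) - ?u v) r"
   proof (rule cint_mono[of "annulus 0 r0"])
    fix v assume v: "v \<in> annulus 0 r0"
    then have kJ: "k v \<in> J" using J sub nz by blast
    have "0 \<le> D * (D - ln (G (k v)))" using D(1) D(3)[OF kJ] by simp
    then show "\<bar>?u v\<bar> \<le> 2 * (D * (D - ln (G (k v)))) - ?u v" using D(2)[OF kJ] by linarith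
   qed (use inC in \<open>auto intro!: continuous_intros uc Gc\<close>)
   also have "\<dots> = cint (\<lambda>v. 2 * (D * (D - ln (G (k v))))) r - cint ?u r"
    by (rule cint_diff[of "annulus 0 r0"]) (use inC in \<open>auto intro!: continuous_intros uc Gc\<close>)
   also have "cint (\<lambda>v. 2 * (D * (D - ln (G (k v))))) r = 2 * (D * cint (\<lambda>v. D - ln (G (k v))) r)"
    by (simp only: cint_cmul)
   also have "cint (\<lambda>v. D - ln (G (k v))) r = 2 * pi * D - cint (\<lambda>v. ln (G (k v))) r"
    by (subst cint_diff[of "annulus 0 r0"]) (use inC in \<open>auto intro!: continuous_intros Gc simp: cint_const\<close>)
   finally have "cint (\<lambda>v. \<bar>?u v\<bar>) r \<le> 2 * (D * (2 * pi * D - cint (\<lambda>v. ln (G (k v))) r)) - cint ?u r" .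
   moreover have "D * (2 * pi * D - cint (\<lambda>v. ln (G (k v))) r) \<le> D * (2 * pi * D + (C + B * ln (1 / r)))"
    using low[of r] r r1 D(1) by (intro mult_left_mono) auto
   moreover have "- cint ?u r \<le> C' + \<bar>Re c\<bar> * ln (1 / r)" using C'[of r] r by (auto simp: r1_def)
   ultimately have "cint (\<lambda>v. \<bar>?u v\<bar>) r \<le> 2 * (D * (2 * pi * D + (C + B * ln (1 / r)))) + (C' + \<bar>Re c\<bar> * ln (1 / r))" by linarith
   then show ?thesis by (simp add: algebra_simps)
  qed
  then show ?thesis using D(1) r0(4)
   by (intro exI[of _ "2 * D * B + \<bar>Re c\<bar>"] exI[of _ "4 * pi * D * D + 2 * D * C + C'"]) auto
 next
  assume "\<exists>D. \<forall>x\<in>J. - h x \<le> D"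
  then obtain D where D: "\<And>x. x \<in> J ==> - h x \<le> D" by blast
  have "cint (\<lambda>v. \<bar>?u v\<bar>) r \<le> (4 * pi * \<bar>D\<bar> + C') + \<bar>Re c\<bar> * ln (1 / r)"
   if r: "0 < r" "r < r1" for r
  proof -
   have inC: "cr r * cis t \<in> annulus 0 r0" for t using r r1 by simp
   have "cint (\<lambda>v. \<bar>?u v\<bar>) r \<le> cint (\<lambda>v. 2 * \<bar>D\<bar> + ?u v) r"
   proof (rule cint_mono[of "annulus 0 r0"])
    fix v assume v: "v \<in> annulus 0 r0"
    then have kJ: "k v \<in> J" using J sub nz by blast
    then show "\<bar>?u v\<bar> \<le> 2 * \<bar>D\<bar> + ?u v" using D[OF kJ] by linarith
   qed (use inC in \<open>auto intro!: continuous_intros uc\<close>)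
   also have "\<dots> = 4 * pi * \<bar>D\<bar> + cint ?u r"
    by (subst cint_add[of "annulus 0 r0"]) (use inC in \<open>auto intro!: continuous_intros uc simp: cint_const\<close>)
   finally show ?thesis using C'[of r] r by (auto simp: r1_def)
  qed
  then show ?thesis
   by (intro exI[of _ "\<bar>Re c\<bar>"] exI[of _ "4 * pi * \<bar>D\<bar> + C'"]) auto
 qed
 then obtain B' C'' where "0 \<le> B'" "\<And>r. 0 < r ==> r < r1 ==> cint (\<lambda>v. \<bar>?u v\<bar>) r \<le> C'' + B' * ln (1 / r)"
  by blast
 then show ?thesis using r1 r0 nz
  by (intro exI[of _ r1] exI[of _ B'] exI[of _ C'']) (auto simp: annulus_def)
qed

text \<open>With \<open>u = h (k v)\<close> and \<open>q = v / F v\<close>, the angular derivative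
  of \<open>u * v ^ n\<close> is \<open>\<i>\<close> times
  \<open>(q - cnj q) * v ^ n + n * u * v ^ n\<close>, and it integrates to 0 around the circle. For
  \<open>n = 0\<close> this says that the integral of \<open>q\<close> is real.\<close>

lemma angular_identity:
 assumes r: "0 < r" "r < b" and nz: "\<And>v. cmod v = r ==> F v \<noteq> 0"
 shows "cint (\<lambda>v. v / F v * v ^ n) r = cint (\<lambda>v. cnj (v / F v) * v ^ n) r - of_nat n * cint (\<lambda>v. cr (h (k v)) * v ^ n) r"
proof -
 let ?C = "{v. cmod v = r}"
 have inC: "cr r * cis t \<in> ?C" for t using r by (auto simp: norm_mult)
 have sub: "?C \<subseteq> annulus 0 b" using r by (auto simp: annulus_def)
 have nzC: "F v \<noteq> 0" if "v \<in> ?C" for v using nz that by simp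
 have ud: "((\<lambda>v. h (k v)) has_derivative (\<lambda>d. Re (2 / F v * d))) (at v)" if "v \<in> ?C" for v
  using u_der[of v] nzC[OF that] that sub by blast
 have uc: "continuous_on ?C (\<lambda>v. h (k v))"
  by (intro continuous_at_imp_continuous_on ballI has_derivative_continuous[OF ud])
 have fc: "continuous_on ?C F" by (rule continuous_on_subset[OF F_cont sub])
 let ?D = "\<lambda>v. \<i> * (v / F v * v ^ n - cnj (v / F v) * v ^ n + of_nat n * (cr (h (k v)) * v ^ n))"
 have "((\<lambda>t. ?D (cr r * cis t)) has_integral
   cr (h (k (cr r * cis (2 * pi)))) * (cr r * cis (2 * pi)) ^ n -
   cr (h (k (cr r * cis 0))) * (cr r * cis 0) ^ n) {0..2*pi}"
 proof (rule fundamental_theorem_of_calculus)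
  fix t :: real
  let ?v = "cr r * cis t"
  have v: "((\<lambda>t. cr r * cis t) has_derivative (\<lambda>d. d *\<^sub>R (\<i> * ?v))) (at t)"
   by (auto intro!: derivative_eq_intros simp: scaleR_conv_of_real)
  have 1: "((\<lambda>t. cr (h (k (cr r * cis t)))) has_derivative
    (\<lambda>d. cr (Re (2 / F ?v * (d *\<^sub>R (\<i> * ?v)))))) (at t)"
   by (rule has_derivative_of_real[OF has_derivative_compose[OF v ud[OF inC]]])
  have "((\<lambda>v. v ^ n) has_field_derivative n * ?v ^ (n - 1)) (at ?v)"
   by (auto intro!: derivative_eq_intros)
  then have 2: "((\<lambda>t. (cr r * cis t) ^ n) has_derivative (\<lambda>d. n * ?v ^ (n - 1) * (d *\<^sub>R (\<i> * ?v)))) (at t)"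
   by (intro has_derivative_compose[OF v]) (simp add: has_field_derivative_def)
  have pw: "of_nat n * ?v ^ (n - 1) * ?v = of_nat n * ?v ^ n" by (cases n) auto
  have re: "cr (Re (2 / F ?v * (\<i> * ?v))) = \<i> * (?v / F ?v) - \<i> * cnj (?v / F ?v)"
  proof -
   have "2 / F ?v * (\<i> * ?v) = 2 * (\<i> * (?v / F ?v))" by simp
   moreover have "cr (Re (2 * (\<i> * q))) = \<i> * q - \<i> * cnj q" for q
    by (simp add: complex_eq_iff)
   ultimately show ?thesis by (simp only:)
  qed
  have "((\<lambda>t. cr (h (k (cr r * cis t))) * (cr r * cis t) ^ n) has_derivative
   (\<lambda>d. cr (h (k ?v)) * (n * ?v ^ (n - 1) * (d *\<^sub>R (\<i> * ?v))) + cr (Re (2 / F ?v * (d *\<^sub>R (\<i> * ?v)))) * ?v ^ n)) (at t)"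
   by (rule has_derivative_mult[OF 1 2])
  moreover have "cr (h (k ?v)) * (n * ?v ^ (n - 1) * (d *\<^sub>R (\<i> * ?v))) + cr (Re (2 / F ?v * (d *\<^sub>R (\<i> * ?v)))) * ?v ^ n
    = d *\<^sub>R ?D ?v" for d
  proof -
   have "cr (Re (2 / F ?v * (d *\<^sub>R (\<i> * ?v)))) = cr d * cr (Re (2 / F ?v * (\<i> * ?v)))"
    by (simp only: mult_scaleR_right complex_scaleR of_real_mult scaleR_complex.simps)
   moreover have "n * ?v ^ (n - 1) * (d *\<^sub>R (\<i> * ?v)) = cr d * (\<i> * (n * ?v ^ n))"
    unfolding pw[symmetric] by (simp add: scaleR_conv_of_real)
   moreover have "u * (d * (\<i> * (m * w))) + d * (\<i> * q - \<i> * q') * w = d * (\<i> * (q * w - q' * w + m * (u * w)))"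
    for u d m w q q' :: complex by (simp add: algebra_simps)
   ultimately show ?thesis unfolding re scaleR_conv_of_real[of d "?D ?v"] by (simp only:)
  qed
  ultimately show "((\<lambda>t. cr (h (k (cr r * cis t))) * (cr r * cis t) ^ n)
   has_vector_derivative ?D ?v) (at t within {0..2*pi})"
   by (simp add: has_vector_derivative_def has_derivative_at_withinI)
 qed auto
 from integral_unique[OF this] have "cint ?D r = 0" unfolding cint_def by (rule trans) simp
 moreover have "cint ?D r = \<i> * (cint (\<lambda>v. v / F v * v ^ n) r - cint (\<lambda>v. cnj (v / F v) * v ^ n) r + of_nat n * cint (\<lambda>v. cr (h (k v)) * v ^ n) r)"
 proof -
  have c1: "continuous_on ?C (\<lambda>v. v / F v * v ^ n)" "continuous_on ?C (\<lambda>v. cnj (v / F v) * v ^ n)"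
   "continuous_on ?C (\<lambda>v. cr (h (k v)) * v ^ n)"
   using nzC by (auto intro!: continuous_intros fc uc)
  show ?thesis
   unfolding cint_cmulc
   by (subst cint_add[OF continuous_on_diff[OF c1(1,2)] continuous_on_mult_left[OF c1(3)] inC],
     subst cint_diff[OF c1(1,2) inC]) (simp only: cint_cmulc)
 qed
 ultimately have "cint (\<lambda>v. v / F v * v ^ n) r - cint (\<lambda>v. cnj (v / F v) * v ^ n) r + of_nat n * cint (\<lambda>v. cr (h (k v)) * v ^ n) r = 0"
  by simp
 then show ?thesis by (simp add: algebra_simps)
qed

end

context punctured_hcmu
begin

text \<open>The moment does not depend on the radius, so it is enough that the other side of
  \<open>angular_identity\<close> tends to 0 with \<open>x\<close>. On the circle the conjugate term
  is \<open>x ^ (2 * n)\<close> times a constant, and the term with \<open>u\<close> is at most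
  \<open>x ^ n\<close> times a constant plus a multiple of \<open>ln (1 / x)\<close>.\<close>

lemma moments: "\<exists>r0. 0 < r0 \<and> r0 < 1 \<and> r0 < b \<and> (\<forall>v\<in>annulus 0 r0. F v \<noteq> 0) \<and>
 (\<forall>n r. 0 < r --> r < r0 --> cint (\<lambda>v. v / F v * v ^ Suc n) r = 0)"
proof -
 obtain r0 B C where r0: "0 < r0" "r0 < 1" "r0 < b" "0 \<le> B" and nz: "\<And>v. v \<in> annulus 0 r0 ==> F v \<noteq> 0"
  and mean: "\<And>r. 0 < r ==> r < r0 ==> cint (\<lambda>v. \<bar>h (k v)\<bar>) r \<le> C + B * ln (1 / r)"
  using mean_abs_u by blast
 have sub: "annulus 0 r0 \<subseteq> annulus 0 b" using r0 by (auto simp: annulus_def)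
 have Fh: "F holomorphic_on annulus 0 r0" by (rule holomorphic_on_subset[OF F sub])
 have ud: "((\<lambda>v. h (k v)) has_derivative (\<lambda>d. Re (2 / F v * d))) (at v)" if "v \<in> annulus 0 r0" for v
  using u_der[of v] nz[OF that] that sub by blast
 have uc: "continuous_on (annulus 0 r0) (\<lambda>v. h (k v))"
  by (intro continuous_at_imp_continuous_on ballI has_derivative_continuous[OF ud])
 have "cint (\<lambda>v. v / F v * v ^ Suc m) r = 0" if r: "0 < r" "r < r0" for m r
 proof -
  define n where "n = Suc m"
  have h1: "(\<lambda>v. v / F v * v ^ n) holomorphic_on annulus 0 r0"
   by (intro holomorphic_intros Fh) (use nz in auto)
  have h2: "(\<lambda>v. v / F v / v ^ n) holomorphic_on annulus 0 r0"
   by (intro holomorphic_intros Fh) (use nz in \<open>auto simp: annulus_def\<close>)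
  obtain c where c: "\<And>r. 0 < r ==> r < r0 ==> cint (\<lambda>v. v / F v * v ^ n) r = c"
   using holomorphic_cint_const[OF h1 order_refl] by blast
  obtain e where e: "\<And>r. 0 < r ==> r < r0 ==> cint (\<lambda>v. v / F v / v ^ n) r = e"
   using holomorphic_cint_const[OF h2 order_refl] by blast
  define K where "K = cmod e + n * (\<bar>C\<bar> + 2 * B)"
  have bd: "cmod c \<le> K * sqrt x" if x: "0 < x" "x < r0" for x
  proof -
   let ?C = "{v. cmod v = x}"
   have inC: "cr x * cis t \<in> ?C" for t using x by (auto simp: norm_mult)
   have inA: "cr x * cis t \<in> annulus 0 r0" for t using x by simp
   have subC: "?C \<subseteq> annulus 0 r0" using x by (auto simp: annulus_def)
   have xb: "x < b" using x r0 by simp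
   have 1: "c = cint (\<lambda>v. cnj (v / F v) * v ^ n) x - of_nat n * cint (\<lambda>v. cr (h (k v)) * v ^ n) x"
    using angular_identity[OF x(1) xb, of n] nz subC c[OF x] by auto
   have "cint (\<lambda>v. cnj (v / F v) * v ^ n) x = cint (\<lambda>v. cr (x ^ (2 * n)) * cnj (v / F v / v ^ n)) x"
   proof (rule cint_cong)
    fix t let ?v = "cr x * cis t"
    have v0: "?v \<noteq> 0" using x by simp
    have "?v * cnj ?v = cr (x\<^sup>2)"
     by (metis complex_norm_square norm_mult norm_of_real norm_cis abs_of_pos x(1) mult.right_neutral of_real_power)
    then have "cr (x ^ (2 * n)) = ?v ^ n * cnj ?v ^ n"
     by (metis power_mult power_mult_distrib of_real_power)
    then show "cnj (?v / F ?v) * ?v ^ n = cr (x ^ (2 * n)) * cnj (?v / F ?v / ?v ^ n)"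
     using v0 by (simp only: complex_cnj_divide complex_cnj_power) (simp add: field_simps)
   qed
   also have "\<dots> = cr (x ^ (2 * n)) * cnj e"
    unfolding cint_cmulc
    by (subst cint_cnj[OF hol_cont[OF h2] inA]) (simp only: e[OF x])
   finally have 2: "cint (\<lambda>v. cnj (v / F v) * v ^ n) x = cr (x ^ (2 * n)) * cnj e" .
   have "cmod (cint (\<lambda>v. cr (h (k v)) * v ^ n) x) \<le> cint (\<lambda>v. x ^ n * \<bar>h (k v)\<bar>) x"
    by (rule cint_norm_le[of ?C])
     (use inC in \<open>auto intro!: continuous_intros continuous_on_subset[OF uc subC] simp: norm_mult norm_power\<close>)
   also have "\<dots> = x ^ n * cint (\<lambda>v. \<bar>h (k v)\<bar>) x" by (rule cint_cmul)
   also have "\<dots> \<le> x ^ n * (C + B * ln (1 / x))" using mean[OF x] x by (intro mult_left_mono) auto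
   also have "\<dots> \<le> x ^ n * (\<bar>C\<bar> + B * (2 / sqrt x))"
   proof -
    \<comment> \<open>The logarithm is traded for a square root, so that in the end every term is a
      multiple of \<open>sqrt x\<close>.\<close>
    have "ln (1 / x) = 2 * ln (1 / sqrt x)" using x by (simp add: ln_div ln_sqrt)
    also have "ln (1 / sqrt x) \<le> 1 / sqrt x" using x by (intro less_imp_le ln_less_self) simp
    finally have "B * ln (1 / x) \<le> B * (2 / sqrt x)" using r0(4) by (intro mult_left_mono) auto
    then show ?thesis using x by (intro mult_left_mono) auto
   qed
   also have "\<dots> \<le> x * (\<bar>C\<bar> + B * (2 / sqrt x))"
   proof (intro mult_right_mono)
    show "x ^ n \<le> x" using power_decreasing[of 1 n x] x r0 by (simp add: n_def)
   qed (use r0(4) x in auto)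
   also have "\<dots> = \<bar>C\<bar> * x + 2 * B * sqrt x" using x by (simp add: field_simps)
   also have "\<dots> \<le> \<bar>C\<bar> * sqrt x + 2 * B * sqrt x"
   proof -
    have "x \<le> sqrt x" using x r0 by (simp add: real_le_rsqrt power2_eq_square mult_left_le)
    then show ?thesis using r0(4) by (intro add_mono mult_left_mono) auto
   qed
   finally have 3: "cmod (cint (\<lambda>v. cr (h (k v)) * v ^ n) x) \<le> (\<bar>C\<bar> + 2 * B) * sqrt x"
    by (simp add: algebra_simps)
   have xs: "x ^ (2 * n) \<le> sqrt x"
   proof -
    have "x ^ (2 * n) \<le> x ^ 1" using x r0 by (intro power_decreasing) (auto simp: n_def)
    also have "x ^ 1 \<le> sqrt x" using x r0 by (simp add: real_le_rsqrt power2_eq_square mult_left_le)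
    finally show ?thesis .
   qed
   have "cmod c \<le> cmod (cr (x ^ (2 * n)) * cnj e) + cmod (of_nat n * cint (\<lambda>v. cr (h (k v)) * v ^ n) x)"
    unfolding 1 2 by (rule norm_triangle_ineq4)
   also have "\<dots> = x ^ (2 * n) * cmod e + n * cmod (cint (\<lambda>v. cr (h (k v)) * v ^ n) x)"
    using x by (simp add: norm_mult norm_power)
   also have "\<dots> \<le> sqrt x * cmod e + n * ((\<bar>C\<bar> + 2 * B) * sqrt x)"
    using 3 xs by (intro add_mono mult_left_mono mult_right_mono) auto
   finally show ?thesis by (simp add: K_def algebra_simps)
  qed
  have "((\<lambda>x. K * sqrt x) ---> K * sqrt 0) (at_right 0)" by (intro tendsto_intros)
  moreover have "\<forall>\<^sub>F x in at_right 0. cmod c \<le> K * sqrt x"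
   unfolding eventually_at_right_field using bd r0(1) by (intro exI[of _ r0]) auto
  ultimately have "cmod c \<le> K * sqrt 0"
   by (rule tendsto_lowerbound) auto
  then show ?thesis using c[OF r] by (simp add: n_def)
 qed
 then show ?thesis using r0 nz by blast
qed

text \<open>The vanishing moments remove the singularity of \<open>v / F v\<close>; the value at 0
  is its circle mean, hence real by the case \<open>n = 0\<close> of
  \<open>angular_identity\<close>.\<close>

lemma extension:
 obtains \<delta> Q where "0 < \<delta>" "\<delta> < b" "\<delta> < 1" "Q holomorphic_on ball 0 \<delta>"
  "\<And>v. v \<in> annulus 0 \<delta> ==> F v \<noteq> 0" "\<And>v. v \<in> annulus 0 \<delta> ==> Q v = v / F v" "Im (Q 0) = 0"
proof -
 obtain r0 where r0: "0 < r0" "r0 < 1" "r0 < b" and nz: "\<And>v. v \<in> annulus 0 r0 ==> F v \<noteq> 0"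
  and mom: "\<And>n r. 0 < r ==> r < r0 ==> cint (\<lambda>v. v / F v * v ^ Suc n) r = 0"
  using moments by blast
 have sub: "annulus 0 r0 \<subseteq> annulus 0 b" using r0 by (auto simp: annulus_def)
 have qh: "(\<lambda>v. v / F v) holomorphic_on annulus 0 r0"
  by (intro holomorphic_intros holomorphic_on_subset[OF F sub]) (use nz in auto)
 obtain Q where Q: "Q holomorphic_on ball 0 r0" "\<And>v. v \<in> annulus 0 r0 ==> Q v = v / F v"
  using vanishing_moments_extend[OF qh r0(1) mom] by blast
 define r where "r = r0 / 2"
 have r: "0 < r" "r < r0" using r0 by (auto simp: r_def)
 have inA: "cr r * cis t \<in> annulus 0 r0" for t using r by simp
 have "cint (\<lambda>v. v / F v) r = cint Q r" by (rule cint_cong) (use Q(2) inA in simp)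
 also have "\<dots> = 2 * pi * Q 0" using holomorphic_cint_center[OF Q(1), of r] r by simp
 finally have 1: "cint (\<lambda>v. v / F v) r = 2 * pi * Q 0" .
 have "cint (\<lambda>v. v / F v) r = cint (\<lambda>v. cnj (v / F v)) r"
 proof -
  have "F v \<noteq> 0" if "cmod v = r" for v
   by (rule nz) (use that r in \<open>auto simp: annulus_def\<close>)
  then show ?thesis using angular_identity[of r 0] r r0 by simp
 qed
 also have "\<dots> = cnj (cint (\<lambda>v. v / F v) r)"
  by (rule cint_cnj[OF hol_cont[OF qh] inA])
 finally have "Im (cint (\<lambda>v. v / F v) r) = 0" by (metis Im_complex_of_real Reals_cnj_iff complex_is_Real_iff)
 then have "Im (Q 0) = 0" unfolding 1 by simp
 then show ?thesis using that[OF r0(1,3,2) Q(1) nz Q(2)] by blast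
qed

text \<open>The differential of \<open>u\<close> is the real part of \<open>2 * Q v / v\<close>, so
  subtracting the logarithmic part leaves the real part of a holomorphic primitive. A value
  \<open>Q 0\<close> that is not real would bring in a multiple of the argument.\<close>

lemma u_asymptotics:
 obtains \<delta> Q H C where "0 < \<delta>" "\<delta> < b" "\<delta> < 1" "Q holomorphic_on ball 0 \<delta>" "H holomorphic_on ball 0 \<delta>"
  "\<And>v. v \<in> annulus 0 \<delta> ==> F v \<noteq> 0" "\<And>v. v \<in> annulus 0 \<delta> ==> Q v = v / F v" "Im (Q 0) = 0"
  "\<And>v. v \<in> annulus 0 \<delta> ==> h (k v) = 2 * Re (Q 0) * ln (cmod v) + (Re (H v) + C)"
proof -
 obtain \<delta> Q where \<delta>: "0 < \<delta>" "\<delta> < b" "\<delta> < 1" and Q: "Q holomorphic_on ball 0 \<delta>"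
  and nz: "\<And>v. v \<in> annulus 0 \<delta> ==> F v \<noteq> 0" and Qv: "\<And>v. v \<in> annulus 0 \<delta> ==> Q v = v / F v" and im: "Im (Q 0) = 0"
  using extension by blast
 define D where "D = (\<lambda>v. if v = 0 then deriv Q 0 else (Q v - Q 0) / (v - 0))"
 have "D holomorphic_on ball 0 \<delta>" unfolding D_def
 proof (rule removable_singularity)
  show "(\<lambda>v. (Q v - Q 0) / (v - 0)) holomorphic_on ball 0 \<delta> - {0}"
   by (intro holomorphic_intros holomorphic_on_subset[OF Q]) auto
  show "((\<lambda>v. (Q v - Q 0) / (v - 0)) ---> deriv Q 0) (at 0)"
   using holomorphic_derivI[OF Q open_ball, of 0] \<delta> by (simp add: has_field_derivative_iff)
 qed auto
 then obtain g where g: "\<And>v. v \<in> ball 0 \<delta> ==> (g has_field_derivative D v) (at v within ball 0 \<delta>)"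
  using holomorphic_convex_primitive'[OF convex_ball open_ball] by metis
 have gd: "(g has_field_derivative D v) (at v)" if "v \<in> ball 0 \<delta>" for v
  using g[OF that] that by (simp add: at_within_open[OF that])
 define H where "H = (\<lambda>v. 2 * g v)"
 have Hd: "(H has_field_derivative 2 * D v) (at v)" if "v \<in> ball 0 \<delta>" for v
  unfolding H_def by (rule DERIV_cmult[OF gd[OF that]])
 have Hh: "H holomorphic_on ball 0 \<delta>"
  using Hd by (meson has_field_derivative_at_within holomorphic_on_def field_differentiable_def)
 let ?W = "\<lambda>v. h (k v) - 2 * Re (Q 0) * ln (cmod v) - Re (H v)"
 have "\<exists>C. \<forall>v\<in>annulus 0 \<delta>. ?W v = C"
 proof -
  have der: "(?W has_derivative (\<lambda>_. 0)) (at v)" if v: "v \<in> annulus 0 \<delta>" for v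
  proof -
   have vb: "v \<in> annulus 0 b" "v \<in> ball 0 \<delta>" "v \<noteq> 0" using v \<delta> by (auto simp: annulus_def)
   have 1: "((\<lambda>v. ln (cmod v)) has_derivative (\<lambda>d. Re (1 / v * d))) (at v)"
    using ln_norm_has_derivative[OF DERIV_ident] vb by simp
   have 2: "((\<lambda>v. Re (H v)) has_derivative (\<lambda>d. Re (2 * D v * d))) (at v)"
    using has_derivative_Re[OF Hd[OF vb(2), unfolded has_field_derivative_def]] by simp
   have "(?W has_derivative (\<lambda>d. Re (2 / F v * d) - 2 * Re (Q 0) * Re (1 / v * d) - Re (2 * D v * d))) (at v)"
    by (intro has_derivative_diff u_der[OF vb(1) nz[OF v]] 2 has_derivative_mult_right 1)
   moreover have "Re (2 / F v * d) - 2 * Re (Q 0) * Re (1 / v * d) - Re (2 * D v * d) = 0" for d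
   proof -
    have Q0: "Q 0 = cr (Re (Q 0))" using im by (simp add: complex_eq_iff)
    have "2 / F v = 2 * Q v / v" using Qv[OF v] vb by simp
    also have "Q v = cr (Re (Q 0)) + v * D v"
     using vb Q0[symmetric] by (simp add: D_def)
    also have "2 * (cr (Re (Q 0)) + v * D v) / v = 2 * cr (Re (Q 0)) * (1 / v) + 2 * D v"
     using vb(3) by (simp add: field_simps)
    finally have "2 / F v = 2 * cr (Re (Q 0)) * (1 / v) + 2 * D v" .
    then have "2 / F v * d = cr (2 * Re (Q 0)) * (1 / v * d) + 2 * D v * d"
     by (simp add: algebra_simps)
    then have "Re (2 / F v * d) = Re (cr (2 * Re (Q 0)) * (1 / v * d)) + Re (2 * D v * d)" by simp
    also have "Re (cr (2 * Re (Q 0)) * (1 / v * d)) = 2 * Re (Q 0) * Re (1 / v * d)"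
     by (simp only: Re_complex_of_real times_complex.sel Im_complex_of_real)
    finally show ?thesis by simp
   qed
   ultimately show ?thesis by simp
  qed
  define v0 where "v0 = cr (\<delta> / 2)"
  have v0: "v0 \<in> annulus 0 \<delta>" using \<delta> by (simp add: v0_def annulus_def)
  have "?W v = ?W v0" if "v \<in> annulus 0 \<delta>" for v
   by (rule has_derivative_zero_unique_connected[OF open_annulus connected_annulus_ball der that v0])
  then show ?thesis by blast
 qed
 then obtain C where C: "\<And>v. v \<in> annulus 0 \<delta> ==> ?W v = C" by blast
 show ?thesis
  by (rule that[OF \<delta> Q Hh nz Qv im, of C]) (use C in \<open>auto simp: algebra_simps\<close>)
qed

text \<open>\<open>n\<close> is the order of \<open>dv / F\<close> at the point plus one: 0 for a
  simple pole, 1 for a finite nonzero value, and \<open>n \<ge> 2\<close> for a zero of order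
  \<open>n - 1\<close>. For \<open>n = 0\<close> the value \<open>Q 0\<close> is the residue, and
  only then does the logarithm survive in the asymptotics of \<open>u\<close>.\<close>

lemma order_data:
 obtains \<delta> Q H n C where "0 < \<delta>" "\<delta> < b" "\<forall>\<^sub>F v in at 0. v \<in> annulus 0 \<delta>" "Q holomorphic_on ball 0 \<delta>" "Q 0 \<noteq> 0"
  "\<And>v. v \<in> annulus 0 \<delta> ==> F v \<noteq> 0" "\<And>v. v \<in> annulus 0 \<delta> ==> v / F v = v ^ n * Q v" "n = 0 ==> Im (Q 0) = 0"
  "(Q ---> Q 0) (at 0)" "((\<lambda>v. v / F v / v ^ n) ---> Q 0) (at 0)" "(H ---> H 0) (at 0)"
  "\<And>v. v \<in> annulus 0 \<delta> ==> h (k v) = 2 * (if n = 0 then Re (Q 0) else 0) * ln (cmod v) + (Re (H v) + C)"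
proof -
 obtain \<delta> R H C where \<delta>: "0 < \<delta>" "\<delta> < b" and R: "R holomorphic_on ball 0 \<delta>" and H: "H holomorphic_on ball 0 \<delta>"
  and nz: "\<And>v. v \<in> annulus 0 \<delta> ==> F v \<noteq> 0" and Rv: "\<And>v. v \<in> annulus 0 \<delta> ==> R v = v / F v" and im: "Im (R 0) = 0"
  and u: "\<And>v. v \<in> annulus 0 \<delta> ==> h (k v) = 2 * Re (R 0) * ln (cmod v) + (Re (H v) + C)"
  by (rule u_asymptotics) (rule that)
 have z: "0 \<in> ball 0 \<delta>" using \<delta> by simp
 have "\<exists>Q n. Q holomorphic_on ball 0 \<delta> \<and> Q 0 \<noteq> 0 \<and> (\<forall>v\<in>ball 0 \<delta>. R v = v ^ n * Q v)"
 proof (cases "R 0 = 0")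
  case False
  then show ?thesis using R by (intro exI[of _ R] exI[of _ 0]) simp
 next
  case True
  define v0 where "v0 = cr (\<delta> / 2)"
  have v0: "v0 \<in> annulus 0 \<delta>" "v0 \<in> ball 0 \<delta>" using \<delta> by (auto simp: v0_def annulus_def)
  then have "R v0 \<noteq> 0" using Rv nz by (auto simp: annulus_def)
  obtain Q n where "0 < n" "Q holomorphic_on ball 0 \<delta>" "Q 0 \<noteq> 0" "\<And>v. v \<in> ball 0 \<delta> ==> R v = (v - 0) ^ n * Q v"
   by (rule holomorphic_factor_zero[OF R open_ball connected_ball z True v0(2) \<open>R v0 \<noteq> 0\<close>]) (rule that)
  then show ?thesis by (intro exI[of _ Q] exI[of _ n]) simp
 qed
 then obtain Q n where Q: "Q holomorphic_on ball 0 \<delta>" "Q 0 \<noteq> 0" "\<And>v. v \<in> ball 0 \<delta> ==> R v = v ^ n * Q v" by blast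
 have fac: "v / F v = v ^ n * Q v" if "v \<in> annulus 0 \<delta>" for v
  using Q(3)[of v] Rv[OF that] that by (simp add: annulus_def)
 have R0: "R 0 = (if n = 0 then Q 0 else 0)" using Q(3)[OF z] by simp
 have lims: "(Q ---> Q 0) (at 0)" "(H ---> H 0) (at 0)"
  using hol_cont[OF Q(1)] hol_cont[OF H] z
  unfolding continuous_on_eq_continuous_at[OF open_ball] isCont_def by blast+
 have evA: "\<forall>\<^sub>F v in at 0. v \<in> annulus 0 \<delta>"
  unfolding eventually_at using \<delta> by (intro exI[of _ \<delta>]) (auto simp: annulus_def)
 have lim: "((\<lambda>v. v / F v / v ^ n) ---> Q 0) (at 0)"
 proof (rule Lim_transform_eventually[OF lims(1)])
  show "\<forall>\<^sub>F v in at 0. Q v = v / F v / v ^ n"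
   using evA
  proof eventually_elim
   case (elim v)
   then have "v \<noteq> 0" by (auto simp: annulus_def)
   then show ?case unfolding fac[OF elim] by simp
  qed
 qed
 show ?thesis
  by (rule that[OF \<delta> evA Q(1,2) nz fac _ lims(1) lim lims(2), of C]) (use im u R0 in auto)
qed

text \<open>A positive residue would drive \<open>u\<close> to minus infinity, which a lower bound
  on \<open>h\<close> forbids. This sign is what later excludes an interval of curvature values that
  is unbounded below.\<close>

lemma order_limit:
 obtains n L where "L \<noteq> 0" "((\<lambda>v. v / F v / v ^ n) ---> L) (at 0)" "n = 0 ==> Im L = 0"
  "\<forall>\<^sub>F v in at 0. F v \<noteq> 0" "(\<exists>C. \<forall>x\<in>J. - h x \<le> C) ==> n = 0 ==> Re L < 0"
proof -
 obtain \<delta> Q H n C where \<delta>: "0 < \<delta>" "\<delta> < b" "\<forall>\<^sub>F v in at 0. v \<in> annulus 0 \<delta>" and Q0: "Q 0 \<noteq> 0"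
  and nz: "\<And>v. v \<in> annulus 0 \<delta> ==> F v \<noteq> 0" and im: "n = 0 ==> Im (Q 0) = 0"
  and lim: "((\<lambda>v. v / F v / v ^ n) ---> Q 0) (at 0)" and Ht: "(H ---> H 0) (at 0)"
  and u: "\<And>v. v \<in> annulus 0 \<delta> ==> h (k v) = 2 * (if n = 0 then Re (Q 0) else 0) * ln (cmod v) + (Re (H v) + C)"
  by (rule order_data) (rule that)
 have neg: "Re (Q 0) < 0" if bd: "\<exists>C. \<forall>x\<in>J. - h x \<le> C" and n: "n = 0"
 proof (rule ccontr)
  assume "\<not> Re (Q 0) < 0"
  moreover have "Re (Q 0) \<noteq> 0" using Q0 im[OF n] by (auto simp: complex_eq_iff)
  ultimately have pos: "0 < 2 * Re (Q 0)" by simp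
  obtain D where D: "\<And>x. x \<in> J ==> - h x \<le> D" using bd by blast
  have "filterlim (\<lambda>v::complex. ln (cmod v)) at_bot (at 0)"
   by (rule filterlim_compose[OF ln_at_0]) (auto simp: filterlim_at eventually_at_filter intro!: tendsto_eq_intros)
  then have "filterlim (\<lambda>v::complex. 2 * Re (Q 0) * ln (cmod v)) at_bot (at 0)"
   by (rule filterlim_tendsto_pos_mult_at_bot[OF tendsto_const pos])
  moreover have "((\<lambda>v. Re (H v) + C) ---> Re (H 0) + C) (at 0)" by (intro tendsto_intros Ht)
  ultimately have "filterlim (\<lambda>v. (Re (H v) + C) + 2 * Re (Q 0) * ln (cmod v)) at_bot (at 0)"
   by (simp add: filterlim_tendsto_add_at_bot_iff)
  then have "\<forall>\<^sub>F v in at 0. (Re (H v) + C) + 2 * Re (Q 0) * ln (cmod v) < - D"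
   by (auto simp: filterlim_at_bot_dense)
  then have "\<forall>\<^sub>F v::complex in at 0. False"
   using \<delta>(3)
  proof eventually_elim
   case (elim v)
   have "k v \<in> J" using J[of v] nz[OF elim(2)] elim(2) \<delta> by (auto simp: annulus_def)
   from D[OF this] u[OF elim(2)] elim(1) n show False by simp
  qed
  then show False by simp
 qed
 show ?thesis
  by (rule that[OF Q0 lim im _ neg]) (use \<delta>(3) nz in \<open>auto elim: eventually_mono\<close>)
qed

end

section \<open>Limit of the curvature and the cone angle when the curvature lies between two
  roots\<close>

locale punctured_hcmu_bdd = punctured_hcmu b F P k \<psi> G h "{a1<..<b1}" \<alpha>
 for b F P k \<psi> G h a1 b1 \<alpha> +
 fixes G' :: "real => real"
 assumes h_surj: "\<And>y. \<exists>x\<in>{a1<..<b1}. h x = y"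
  and G_Jpos: "\<And>x. x \<in> {a1<..<b1} ==> 0 < G x"
  and G_der: "\<And>x. (G has_real_derivative G' x) (at x)"
  and G'_cont: "\<And>x. isCont G' x"
begin

lemma h_less:
 assumes "x \<in> {a1<..<b1}" "y \<in> {a1<..<b1}"
 shows "h x < h y \<longleftrightarrow> x < y"
proof -
 have *: "h x < h y" if "x \<in> {a1<..<b1}" "y \<in> {a1<..<b1}" "x < y" for x y
 proof (rule DERIV_pos_imp_increasing[OF that(3)])
  fix z assume "x \<le> z" "z \<le> y"
  then have "z \<in> {a1<..<b1}" using that by auto
  then show "\<exists>d. (h has_real_derivative d) (at z) \<and> 0 < d" using h_der G_Jpos by (metis zero_less_divide_1_iff)
 qed
 show ?thesis using *[OF assms] *[OF assms(2,1)] by (metis less_asym less_irrefl linorder_neqE_linordered_idom)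
qed

text \<open>\<open>h\<close> is an increasing bijection of the interval onto the reals, so the limit
  of \<open>u\<close> (infinite of either sign or finite, according to the residue) determines a
  limit of \<open>k\<close>. Writing \<open>\<psi>\<close> as
  \<open>ln (G k) / 2 + (n - 1) * ln (cmod v) + ln (cmod Q)\<close> makes its radial derivative
  converge pointwise, and this limit must agree with the angle, which is prescribed only in the
  mean.\<close>

lemma local_data:
 obtains n L \<kappa> where "L \<noteq> 0" "((\<lambda>v. v / F v / v ^ n) ---> L) (at 0)" "(k ---> \<kappa>) (at 0)"
  "\<forall>\<^sub>F v in at 0. F v \<noteq> 0" "n = 0 ==> Im L = 0" "n = 0 ==> Re L < 0 ==> \<kappa> = b1" "n = 0 ==> 0 < Re L ==> \<kappa> = a1"
  "0 < n ==> \<kappa> \<in> {a1<..<b1}" "\<alpha> = G' \<kappa> * (if n = 0 then Re L else 0) + n"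
proof -
 obtain \<delta> Q H n C where \<delta>: "0 < \<delta>" "\<delta> < b" and evA: "\<forall>\<^sub>F v in at 0. v \<in> annulus 0 \<delta>"
  and Q: "Q holomorphic_on ball 0 \<delta>" "Q 0 \<noteq> 0" and nz: "\<And>v. v \<in> annulus 0 \<delta> ==> F v \<noteq> 0"
  and Qv: "\<And>v. v \<in> annulus 0 \<delta> ==> v / F v = v ^ n * Q v" and im: "n = 0 ==> Im (Q 0) = 0"
  and Qt: "(Q ---> Q 0) (at 0)" and lim: "((\<lambda>v. v / F v / v ^ n) ---> Q 0) (at 0)" and H0: "(H ---> H 0) (at 0)"
  and u': "\<And>v. v \<in> annulus 0 \<delta> ==> h (k v) = 2 * (if n = 0 then Re (Q 0) else 0) * ln (cmod v) + (Re (H v) + C)"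
  by (rule order_data) (rule that)
 define c where "c = (if n = 0 then Re (Q 0) else 0)"
 have u: "h (k v) = 2 * c * ln (cmod v) + (Re (H v) + C)" if "v \<in> annulus 0 \<delta>" for v
  using u'[OF that] by (simp add: c_def)
 have kJ: "k v \<in> {a1<..<b1}" if "v \<in> annulus 0 \<delta>" for v
  using J[of v] nz[OF that] that \<delta> by (auto simp: annulus_def)
 have lnb: "filterlim (\<lambda>v::complex. ln (cmod v)) at_bot (at 0)"
  by (rule filterlim_compose[OF ln_at_0]) (auto simp: filterlim_at eventually_at_filter intro!: tendsto_eq_intros)
 have Ht: "((\<lambda>v. Re (H v) + C) ---> Re (H 0) + C) (at 0)" by (intro tendsto_intros H0)
 have up: "\<forall>\<^sub>F v in at 0. x < k v" if x: "x \<in> {a1<..<b1}" and ev: "\<forall>\<^sub>F v in at 0. h x < 2 * c * ln (cmod v) + (Re (H v) + C)" for x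
  using ev evA by eventually_elim (metis h_less u kJ x)
 have dn: "\<forall>\<^sub>F v in at 0. k v < x" if x: "x \<in> {a1<..<b1}" and ev: "\<forall>\<^sub>F v in at 0. 2 * c * ln (cmod v) + (Re (H v) + C) < h x" for x
  using ev evA by eventually_elim (metis h_less u kJ x)
 have ab: "a1 < b1" using h_surj[of 0] by auto
 have "\<exists>\<kappa>. (k ---> \<kappa>) (at 0) \<and> (c < 0 --> \<kappa> = b1) \<and> (0 < c --> \<kappa> = a1) \<and> (c = 0 --> \<kappa> \<in> {a1<..<b1})"
 proof (cases c "0::real" rule: linorder_cases)
  \<comment> \<open>A negative multiple of \<open>ln (cmod v)\<close> tends to plus infinity, which
    \<open>h\<close> attains in the limit at the upper end \<open>b1\<close>.\<close>
  case less
  have "filterlim (\<lambda>v::complex. 2 * c * ln (cmod v)) at_top (at 0)"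
  proof -
   have "filterlim (\<lambda>v::complex. - (2 * c) * ln (cmod v)) at_bot (at 0)"
    by (rule filterlim_tendsto_pos_mult_at_bot[OF tendsto_const _ lnb]) (use less in simp)
   then show ?thesis by (simp add: filterlim_uminus_at_top)
  qed
  from filterlim_tendsto_add_at_top[OF Ht this]
  have top: "\<forall>\<^sub>F v in at 0. M < 2 * c * ln (cmod v) + (Re (H v) + C)" for M
   by (simp add: filterlim_at_top_dense add_ac)
  have "(k ---> b1) (at 0)"
  proof (rule order_tendstoI)
   fix y assume "y < b1"
   define x where "x = (max y a1 + b1) / 2"
   have "x \<in> {a1<..<b1}" "y < x" using \<open>y < b1\<close> ab by (auto simp: x_def)
   from up[OF this(1) top] \<open>y < x\<close> show "\<forall>\<^sub>F v in at 0. y < k v" by (auto elim: eventually_mono)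
  next
   fix y assume "b1 < y"
   show "\<forall>\<^sub>F v in at 0. k v < y" using evA by eventually_elim (use kJ \<open>b1 < y\<close> in force)
  qed
  then show ?thesis using less by auto
 next
  case greater
  have "filterlim (\<lambda>v::complex. 2 * c * ln (cmod v)) at_bot (at 0)"
   by (rule filterlim_tendsto_pos_mult_at_bot[OF tendsto_const _ lnb]) (use greater in simp)
  from filterlim_tendsto_add_at_bot_iff[OF Ht, THEN iffD2, OF this]
  have bot: "\<forall>\<^sub>F v in at 0. 2 * c * ln (cmod v) + (Re (H v) + C) < M" for M
   by (simp add: filterlim_at_bot_dense add_ac)
  have "(k ---> a1) (at 0)"
  proof (rule order_tendstoI)
   fix y assume "a1 < y"
   define x where "x = (min y b1 + a1) / 2"
   have "x \<in> {a1<..<b1}" "x < y" using \<open>a1 < y\<close> ab by (auto simp: x_def)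
   from dn[OF this(1) bot] \<open>x < y\<close> show "\<forall>\<^sub>F v in at 0. k v < y" by (auto elim: eventually_mono)
  next
   fix y assume "y < a1"
   show "\<forall>\<^sub>F v in at 0. y < k v" using evA by eventually_elim (use kJ \<open>y < a1\<close> in force)
  qed
  then show ?thesis using greater by auto
 next
  case equal
  obtain \<kappa> where \<kappa>: "\<kappa> \<in> {a1<..<b1}" "h \<kappa> = Re (H 0) + C" using h_surj by blast
  have ev: "((\<lambda>v::complex. 2 * c * ln (cmod v) + (Re (H v) + C)) ---> h \<kappa>) (at 0)"
   using Ht equal \<kappa> by simp
  have "(k ---> \<kappa>) (at 0)"
  proof (rule order_tendstoI)
   fix y assume "y < \<kappa>"
   define x where "x = (max y a1 + \<kappa>) / 2"
   have x: "x \<in> {a1<..<b1}" "y < x" "x < \<kappa>" using \<open>y < \<kappa>\<close> \<kappa> by (auto simp: x_def)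
   then have "h x < h \<kappa>" using h_less \<kappa> by blast
   from up[OF x(1) order_tendstoD(1)[OF ev this]] x(2) show "\<forall>\<^sub>F v in at 0. y < k v" by (auto elim: eventually_mono)
  next
   fix y assume "\<kappa> < y"
   define x where "x = (min y b1 + \<kappa>) / 2"
   have x: "x \<in> {a1<..<b1}" "x < y" "\<kappa> < x" using \<open>\<kappa> < y\<close> \<kappa> by (auto simp: x_def)
   then have "h \<kappa> < h x" using h_less \<kappa> by blast
   from dn[OF x(1) order_tendstoD(2)[OF ev this]] x(2) show "\<forall>\<^sub>F v in at 0. k v < y" by (auto elim: eventually_mono)
  qed
  then show ?thesis using equal \<kappa> by auto
 qed
 then obtain \<kappa> where \<kappa>: "(k ---> \<kappa>) (at 0)" "c < 0 ==> \<kappa> = b1" "0 < c ==> \<kappa> = a1" "c = 0 ==> \<kappa> \<in> {a1<..<b1}"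
  by blast
 have ang: "\<alpha> = G' \<kappa> * c + n"
 proof -
  have rad: "Re (P v * v) + 1 - \<alpha> = G' (k v) * Re (v ^ n * Q v) + n + Re (v * deriv Q v / Q v) - \<alpha>" if v: "v \<in> annulus 0 \<delta>" for v
  proof -
   have vv: "v \<in> annulus 0 b" "v \<noteq> 0" "v \<in> ball 0 \<delta>" using v \<delta> by (auto simp: annulus_def)
   have Fv: "F v \<noteq> 0" by (rule nz[OF v])
   have Qnz: "Q v \<noteq> 0" using Qv[OF v] Fv vv(2) by auto
   have nzb: "\<forall>\<^sub>F w in nhds v. w \<in> annulus 0 \<delta>"
    using v open_annulus eventually_nhds by blast
   have psieq: "\<psi> w = ln (G (k w)) / 2 + (real n - 1) * ln (cmod w) + ln (cmod (Q w))" if w: "w \<in> annulus 0 \<delta>" for w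
   proof -
    have ww: "w \<in> annulus 0 b" "w \<noteq> 0" "w \<in> ball 0 \<delta>" using w \<delta> by (auto simp: annulus_def)
    have Fw: "F w \<noteq> 0" by (rule nz[OF w])
    have e: "cmod w = cmod (F w) * (cmod w ^ n * cmod (Q w))" using Qv[OF w] Fw by (simp add: field_simps flip: norm_mult norm_power)
    have Qw: "Q w \<noteq> 0" using e ww by auto
    have "ln (cmod w) = ln (cmod (F w)) + ln (cmod w ^ n * cmod (Q w))"
     by (subst e, rule ln_mult_pos) (use Fw Qw ww in auto)
    also have "ln (cmod w ^ n * cmod (Q w)) = n * ln (cmod w) + ln (cmod (Q w))"
     by (subst ln_mult_pos) (use Qw ww in \<open>auto simp: ln_realpow\<close>)
    finally show ?thesis using psi_eq[OF ww(1) Fw] by (simp add: algebra_simps)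
   qed
   \<comment> \<open>Half of \<open>dk / G (k v)\<close> is the real part of
     \<open>dv / F v\<close>; this is the harmonic function of \<open>u_der\<close> again.\<close>
   have d1: "((\<lambda>w. ln (G (k w)) / 2) has_derivative (\<lambda>d. G' (k v) * Re (1 / F v * d))) (at v)"
   proof -
    have Gp: "0 < G (k v)" by (rule G_pos[OF vv(1) Fv])
    have "((\<lambda>w. G (k w)) has_derivative (\<lambda>d. G' (k v) * Re (2 * exp (2 * \<psi> v) * cnj (F v) * d))) (at v)"
     by (rule has_derivative_compose[OF k_der[OF vv(1)] G_der[unfolded has_field_derivative_def]])
    from has_derivative_ln[OF Gp this]
    have "((\<lambda>w. ln (G (k w)) / 2) has_derivative (\<lambda>d. G' (k v) * Re (2 * exp (2 * \<psi> v) * cnj (F v) * d) * inverse (G (k v)) / 2)) (at v)"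
     by (rule bounded_linear.has_derivative[OF bounded_linear_divide])
    moreover have "Re (2 * exp (2 * \<psi> v) * cnj (F v) * d) * inverse (G (k v)) / 2 = Re (1 / F v * d)" for d
    proof -
     have "((\<lambda>v. h (k v)) has_derivative (\<lambda>d. 1 / G (k v) * Re (2 * exp (2 * \<psi> v) * cnj (F v) * d))) (at v)"
      by (rule has_derivative_compose[OF k_der[OF vv(1)] h_der[OF J[OF vv(1) Fv], unfolded has_field_derivative_def]])
     from has_derivative_unique[OF this u_der[OF vv(1) Fv]]
     have "1 / G (k v) * Re (2 * exp (2 * \<psi> v) * cnj (F v) * d) = Re (2 / F v * d)" by (rule fun_cong)
     moreover have "Re (2 / F v * d) = 2 * Re (1 / F v * d)"
     proof -
      have "2 / F v * d = 2 * (1 / F v * d)" by simp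
      then show ?thesis by (simp only: times_complex.sel) simp
     qed
     ultimately show ?thesis by (simp add: field_simps)
    qed
    ultimately show ?thesis by (simp add: mult.assoc)
   qed
   have d2: "((\<lambda>w. (real n - 1) * ln (cmod w)) has_derivative (\<lambda>d. (real n - 1) * Re (1 / v * d))) (at v)"
    using has_derivative_mult_right[OF ln_norm_has_derivative[OF DERIV_ident vv(2)]] by simp
   have d3: "((\<lambda>w. ln (cmod (Q w))) has_derivative (\<lambda>d. Re (deriv Q v / Q v * d))) (at v)"
    by (rule ln_norm_has_derivative[OF holomorphic_derivI[OF Q(1) open_ball vv(3)] Qnz])
   have "((\<lambda>w. ln (G (k w)) / 2 + (real n - 1) * ln (cmod w) + ln (cmod (Q w))) has_derivative
    (\<lambda>d. G' (k v) * Re (1 / F v * d) + (real n - 1) * Re (1 / v * d) + Re (deriv Q v / Q v * d))) (at v)"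
    by (intro has_derivative_add d1 d2 d3)
   then have "(\<psi> has_derivative (\<lambda>d. G' (k v) * Re (1 / F v * d) + (real n - 1) * Re (1 / v * d) + Re (deriv Q v / Q v * d))) (at v)"
    by (rule has_derivative_transform_within_open[OF _ open_annulus v]) (use psieq in simp)
   from has_derivative_unique[OF this psi_der[OF vv(1)]]
   have "Re (P v * v) = G' (k v) * Re (1 / F v * v) + (real n - 1) * Re (1 / v * v) + Re (deriv Q v / Q v * v)"
    by (rule fun_cong[THEN sym])
   then show ?thesis using vv(2) Qv[OF v] by (simp add: mult.commute)
  qed
  have Rc: "Re (0 ^ n * Q 0) = c" by (simp add: c_def power_0_left)
  have Gt: "((\<lambda>v. G' (k v)) ---> G' \<kappa>) (at 0)" using \<kappa>(1) G'_cont by (rule isCont_tendsto_compose[rotated])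
  have dq: "(deriv Q ---> deriv Q 0) (at 0)"
   using hol_cont[OF holomorphic_deriv[OF Q(1) open_ball]] \<delta>
   by (auto simp: continuous_on_eq_continuous_at isCont_def)
  have "((\<lambda>v. G' (k v) * Re (v ^ n * Q v) + n + Re (v * deriv Q v / Q v) - \<alpha>) ---> G' \<kappa> * Re (0 ^ n * Q 0) + n + Re (0 * deriv Q 0 / Q 0) - \<alpha>) (at 0)"
   by (intro tendsto_intros Gt Qt dq Q(2))
  then have "((\<lambda>v. Re (P v * v) + 1 - \<alpha>) ---> G' \<kappa> * Re (0 ^ n * Q 0) + n + Re (0 * deriv Q 0 / Q 0) - \<alpha>) (at 0)"
   by (rule Lim_transform_eventually) (use evA in eventually_elim, use rad in auto)
  then have "((\<lambda>v. Re (P v * v) + 1 - \<alpha>) ---> G' \<kappa> * c + n - \<alpha>) (at 0)" unfolding Rc by simp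
  moreover have "continuous_on (annulus 0 b) (\<lambda>v. Re (P v * v) + 1 - \<alpha>)"
   by (intro continuous_intros P_cont)
  ultimately have "(cint (\<lambda>v. Re (P v * v) + 1 - \<alpha>) ---> 2 * pi * (G' \<kappa> * c + n - \<alpha>)) (at_right 0)"
   by (intro cint_tendsto[OF _ _ b])
  from tendsto_unique[OF _ this angle] have "2 * pi * (G' \<kappa> * c + n - \<alpha>) = 0" by simp
  then show ?thesis by simp
 qed
 show ?thesis
  by (rule that[OF Q(2) lim \<kappa>(1)])
   (use evA nz im \<kappa> ang in \<open>auto simp: c_def elim: eventually_mono\<close>)
qed

end

section \<open>Change of variables\<close>

text \<open>The plane as \<open>real ^ 2\<close>, the type over which determinants and the change of
  variables for absolute integrals are formulated.\<close>

definition cvec :: "complex => real ^ 2" where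
 "cvec z = (\<chi> i. if i = 1 then Re z else Im z)"

definition vecc :: "real ^ 2 => complex" where
 "vecc x = Complex (x $ 1) (x $ 2)"

lemma vecc_cvec [simp]: "vecc (cvec z) = z" and cvec_vecc [simp]: "cvec (vecc x) = x"
 by (simp_all add: vecc_def cvec_def vec_eq_iff forall_2)

lemma linear_cvec: "linear cvec" and linear_vecc: "linear vecc"
 by (auto simp: linear_iff cvec_def vecc_def vec_eq_iff complex_eq_iff)

lemma bounded_linear_cvec: "bounded_linear cvec" and bounded_linear_vecc: "bounded_linear vecc"
 using linear_cvec linear_vecc by (simp_all add: linear_conv_bounded_linear)

lemma vecc_measurable [measurable]: "vecc \<in> borel_measurable borel"
 by (intro borel_measurable_continuous_onI linear_continuous_on bounded_linear_vecc)

lemma lborel_vecc: "lborel = distr lborel borel vecc"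
proof (rule lborel_eqI)
 fix l u :: complex
 assume lu: "\<And>b. b \<in> Basis ==> l \<bullet> b \<le> u \<bullet> b"
 have le: "Re l \<le> Re u" "Im l \<le> Im u"
  using lu[of 1] lu[of \<i>] by (simp_all add: Basis_complex_def inner_complex_def)
 have "vecc -` box l u = box (cvec l) (cvec u)"
  by (auto simp: mem_box_cart in_box_complex_iff cvec_def vecc_def forall_2)
 moreover have "\<And>b. b \<in> Basis ==> cvec l \<bullet> b \<le> cvec u \<bullet> b"
  using le by (auto simp: Basis_vec_def inner_axis cvec_def)
 ultimately show "emeasure (distr lborel borel vecc) (box l u) = (\<Prod>b\<in>Basis. (u - l) \<bullet> b)"
  using lu by (simp add: emeasure_distr emeasure_lborel_box_eq)
   (simp add: Basis_vec_def prod.UNION_disjoint cvec_def inner_axis Basis_complex_def axis_eq_axis UNION_singleton_eq_range prod.reindex inj_def UNIV_2 mult.commute)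
qed simp

text \<open>Gives Fubini for integrals over the plane with the real part as outer variable.\<close>

lemma lborel_Complex: "lborel = distr (lborel \<Otimes>\<^sub>M lborel) borel (\<lambda>(x, y). Complex x y)"
proof (rule lborel_eqI)
 fix l u :: complex
 assume lu: "\<And>b. b \<in> Basis ==> l \<bullet> b \<le> u \<bullet> b"
 have le: "Re l \<le> Re u" "Im l \<le> Im u"
  using lu[of 1] lu[of \<i>] by (simp_all add: Basis_complex_def inner_complex_def)
 have m: "(\<lambda>(x, y). Complex x y) \<in> borel_measurable (lborel \<Otimes>\<^sub>M lborel)"
  unfolding lborel_prod split_beta by (simp, intro borel_measurable_continuous_onI continuous_intros)
 have "(\<lambda>(x, y). Complex x y) -` box l u \<inter> space (lborel \<Otimes>\<^sub>M lborel) = {Re l<..<Re u} \<times> {Im l<..<Im u}"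
  by (auto simp: in_box_complex_iff space_pair_measure)
 then show "emeasure (distr (lborel \<Otimes>\<^sub>M lborel) borel (\<lambda>(x, y). Complex x y)) (box l u) = (\<Prod>b\<in>Basis. (u - l) \<bullet> b)"
  using le m by (simp add: emeasure_distr lborel.emeasure_pair_measure_Times Basis_complex_def ennreal_mult)
qed simp

lemma det_cvec: "det (matrix (\<lambda>x. cvec (c * vecc x))) = (cmod c)\<^sup>2"
 by (simp add: det_2 matrix_def cvec_def vecc_def axis_def cmod_def power2_eq_square)

text \<open>The Jacobian determinant of multiplication by \<open>c\<close> is
  \<open>(cmod c)\<^sup>2\<close>. Values are wrapped into \<open>real ^ 1\<close> because the
  general theorem concerns vector-valued integrands, and \<open>conv\<close> passes between the
  Lebesgue integral over the plane and the absolute integral over \<open>real ^ 2\<close>.\<close>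

lemma holomorphic_change_of_variables:
 fixes f :: "complex => real"
 assumes S: "open S" and g: "g holomorphic_on S" and inj: "inj_on g S" and f: "continuous_on (g ` S) f"
 shows "set_integrable lborel S (\<lambda>z. (cmod (deriv g z))\<^sup>2 * f (g z)) \<longleftrightarrow> set_integrable lborel (g ` S) f"
  and "set_integrable lborel (g ` S) f ==>
   set_lebesgue_integral lborel S (\<lambda>z. (cmod (deriv g z))\<^sup>2 * f (g z)) = set_lebesgue_integral lborel (g ` S) f"
proof -
 let ?V = "vec :: real => real ^ 1"
 define S' where "S' = vecc -` S"
 define g' where "g' = (\<lambda>x. cvec (g (vecc x)))"
 define f' where "f' = (\<lambda>x. ?V (f (vecc x)))"
 define F where "F = (\<lambda>z. (cmod (deriv g z))\<^sup>2 * f (g z))"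
 have cvv: "continuous_on A vecc" "continuous_on B cvec" for A B
  by (intro linear_continuous_on bounded_linear_vecc bounded_linear_cvec)+
 have S': "open S'" unfolding S'_def by (rule open_vimage[OF S cvv(1)])
 have og: "open (g ` S)" by (rule open_mapping_thm3[OF g S inj])
 have gS: "g' ` S' = vecc -` (g ` S)"
  unfolding S'_def g'_def by (auto intro!: image_eqI[of _ _ "cvec _"]) (metis cvec_vecc)
 have ogS: "open (g' ` S')" unfolding gS by (rule open_vimage[OF og cvv(1)])
 have gc: "continuous_on S g" "continuous_on S (deriv g)"
  using hol_cont g holomorphic_deriv[OF g S] by auto
 have Fc: "continuous_on S F" unfolding F_def
  by (intro continuous_intros gc continuous_on_compose2[OF f gc(1)]) auto
 have inj': "inj_on g' S'"
 proof (rule inj_onI)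
  fix x y assume xy: "x \<in> S'" "y \<in> S'" "g' x = g' y"
  have "vecc (g' x) = vecc (g' y)" using xy(3) by simp
  then have "g (vecc x) = g (vecc y)" by (simp add: g'_def)
  then have "vecc x = vecc y" by (rule inj_onD[OF inj]) (use xy in \<open>auto simp: S'_def\<close>)
  then have "cvec (vecc x) = cvec (vecc y)" by simp
  then show "x = y" by simp
 qed
 have der: "(g' has_derivative (\<lambda>d. cvec (deriv g (vecc x) * vecc d))) (at x within S')" if "x \<in> S'" for x
 proof -
  have "(g has_derivative (\<lambda>d. deriv g (vecc x) * d)) (at (vecc x))"
   using holomorphic_derivI[OF g S, of "vecc x"] that by (simp add: S'_def has_field_derivative_def)
  from has_derivative_compose[OF bounded_linear_imp_has_derivative[OF bounded_linear_vecc] this]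
  have "((\<lambda>x. g (vecc x)) has_derivative (\<lambda>d. deriv g (vecc x) * vecc d)) (at x)" .
  from bounded_linear.has_derivative[OF bounded_linear_cvec this]
  show ?thesis unfolding g'_def by (rule has_derivative_at_withinI)
 qed
 have cov: "(\<lambda>x. \<bar>det (matrix (\<lambda>d. cvec (deriv g (vecc x) * vecc d)))\<bar> *\<^sub>R f' (g' x)) absolutely_integrable_on S' \<and>
    integral S' (\<lambda>x. \<bar>det (matrix (\<lambda>d. cvec (deriv g (vecc x) * vecc d)))\<bar> *\<^sub>R f' (g' x)) = c
  \<longleftrightarrow> f' absolutely_integrable_on (g' ` S') \<and> integral (g' ` S') f' = c" for c
  by (rule has_absolute_integral_change_of_variables[OF _ der inj']) (use S' in auto)
 have FV: "\<bar>det (matrix (\<lambda>d. cvec (deriv g (vecc x) * vecc d)))\<bar> *\<^sub>R f' (g' x) = ?V (F (vecc x))" for x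
  unfolding det_cvec by (simp add: f'_def g'_def F_def vec_eq_iff)
 have conv: "set_integrable lborel A h \<longleftrightarrow> (\<lambda>x. ?V (h (vecc x))) absolutely_integrable_on (vecc -` A)"
  "set_integrable lborel A h ==> integral (vecc -` A) (\<lambda>x. ?V (h (vecc x))) = ?V (set_lebesgue_integral lborel A h)"
  if A: "open A" and h: "continuous_on A h" for A and h :: "complex => real"
 proof -
  let ?i = "\<lambda>z. indicator A z *\<^sub>R h z"
  have m: "?i \<in> borel_measurable borel"
   using borel_measurable_continuous_on_indicator[OF _ h] A by simp
  have A': "open (vecc -` A)" by (rule open_vimage[OF A cvv(1)])
  have hv: "continuous_on (vecc -` A) (\<lambda>x. h (vecc x))"
   by (rule continuous_on_compose2[OF h cvv(1)]) auto
  have i1: "integrable lborel ?i \<longleftrightarrow> integrable lborel (\<lambda>x. ?i (vecc x))"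
   by (subst lborel_vecc, rule integrable_distr_eq) (use m in auto)
  have i2: "integral\<^sup>L lborel ?i = integral\<^sup>L lborel (\<lambda>x. ?i (vecc x))"
   by (subst lborel_vecc, rule integral_distr) (use m in auto)
  have ind: "?i (vecc x) = indicator (vecc -` A) x *\<^sub>R h (vecc x)" for x by (auto simp: indicator_def)
  have m2: "(\<lambda>x. indicator (vecc -` A) x *\<^sub>R h (vecc x)) \<in> borel_measurable lborel"
   using borel_measurable_continuous_on_indicator[OF _ hv] A' by simp
  have e1: "set_integrable lborel A h \<longleftrightarrow> (\<lambda>x. h (vecc x)) absolutely_integrable_on (vecc -` A)"
   unfolding set_integrable_def i1 ind by (simp only: integrable_completion[OF m2])
  then show "set_integrable lborel A h \<longleftrightarrow> (\<lambda>x. ?V (h (vecc x))) absolutely_integrable_on (vecc -` A)"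
   by (simp add: absolutely_integrable_on_1_iff)
  assume "set_integrable lborel A h"
  with e1 have ab: "(\<lambda>x. h (vecc x)) absolutely_integrable_on (vecc -` A)" by simp
  have "set_lebesgue_integral lborel A h = set_lebesgue_integral lebesgue (vecc -` A) (\<lambda>x. h (vecc x))"
   unfolding set_lebesgue_integral_def i2 ind by (simp only: integral_completion[OF m2])
  also have "\<dots> = integral (vecc -` A) (\<lambda>x. h (vecc x))"
   by (rule set_lebesgue_integral_eq_integral(2)[OF ab])
  finally show "integral (vecc -` A) (\<lambda>x. ?V (h (vecc x))) = ?V (set_lebesgue_integral lborel A h)"
   using ab by (simp add: integral_on_1_eq vec_eq_iff set_lebesgue_integral_eq_integral(1))
 qed
 have fg: "f' = (\<lambda>x. ?V (f (vecc x)))" by (simp add: f'_def)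
 show iff: "set_integrable lborel S (\<lambda>z. (cmod (deriv g z))\<^sup>2 * f (g z)) \<longleftrightarrow> set_integrable lborel (g ` S) f"
  using cov conv(1)[OF S Fc] conv(1)[OF og f] unfolding FV gS S'_def[symmetric] fg[symmetric] F_def[symmetric] by blast
 assume si: "set_integrable lborel (g ` S) f"
 then have si': "set_integrable lborel S F" using iff unfolding F_def by simp
 have "integral S' (\<lambda>x. ?V (F (vecc x))) = integral (g' ` S') f'"
  using cov[of "integral S' (\<lambda>x. ?V (F (vecc x)))"] si' conv(1)[OF S Fc] unfolding FV S'_def[symmetric] by metis
 then have "?V (set_lebesgue_integral lborel S F) = ?V (set_lebesgue_integral lborel (g ` S) f)"
  using conv(2)[OF S Fc si'] conv(2)[OF og f si] unfolding gS S'_def[symmetric] fg[symmetric] by simp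
 then show "set_lebesgue_integral lborel S (\<lambda>z. (cmod (deriv g z))\<^sup>2 * f (g z)) = set_lebesgue_integral lborel (g ` S) f"
  by (simp add: vec_eq_iff F_def)
qed

lemma inj_on_exp_strip: "inj_on exp {t. 0 < Im t \<and> Im t < 2 * pi}"
proof (rule inj_onI)
 fix s t :: complex
 assume st: "s \<in> {t. 0 < Im t \<and> Im t < 2 * pi}" "t \<in> {t. 0 < Im t \<and> Im t < 2 * pi}" "exp s = exp t"
 then obtain n :: int where n: "s = t + (of_int (2 * n) * pi) * \<i>" unfolding exp_eq by blast
 have "\<bar>Im s - Im t\<bar> < 2 * pi" using st by auto
 moreover have "Im s - Im t = 2 * n * pi" using n by simp
 ultimately have "\<bar>real_of_int n\<bar> < 1" by (simp add: abs_mult)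
 then have "n = 0" by linarith
 then show "s = t" using n by simp
qed

text \<open>In the logarithmic coordinate \<open>t = s + \<i> \<theta>\<close> the circle integrals become integrable in \<open>s\<close>
 over a half-line, so they must be small for arbitrarily small radii.\<close>
lemma small_circle_energy:
 fixes f :: "complex => real"
 assumes z: "z holomorphic_on annulus 0 b" and inj: "inj_on z (annulus 0 b)" and b: "0 < b"
  and f: "continuous_on (z ` annulus 0 b) f" and int: "set_integrable lborel (z ` annulus 0 b) f"
  and pos: "\<And>w. w \<in> z ` annulus 0 b ==> 0 \<le> f w"
  and \<delta>: "0 < \<delta>" and N: "countable N"
 shows "\<exists>r. 0 < r \<and> r < \<delta> \<and> r \<notin> N \<and> r\<^sup>2 * cint (\<lambda>v. (cmod (deriv z v))\<^sup>2 * f (z v)) r \<le> 1"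
proof (rule ccontr)
 assume neg: "\<not> ?thesis"
 define E where "E = (\<lambda>v. (cmod (deriv z v))\<^sup>2 * f (z v))"
 have big: "1 < r\<^sup>2 * cint E r" if "0 < r" "r < \<delta>" "r \<notin> N" for r
  using neg that unfolding E_def by force
 \<comment> \<open>\<open>exp\<close> maps this half-strip injectively into the punctured disk,
   missing only the positive axis.\<close>
 define S where "S = {t. Re t < ln b \<and> 0 < Im t \<and> Im t < 2 * pi}"
 have S: "open S"
 proof -
  have "S = {t. Re t < ln b} \<inter> ({t. 0 < Im t} \<inter> {t. Im t < 2 * pi})" by (auto simp: S_def)
  then show ?thesis by (auto intro!: open_Int open_halfspace_Re_lt open_halfspace_Im_lt open_halfspace_Im_gt)
 qed
 have eS: "exp t \<in> annulus 0 b" if "t \<in> S" for t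
  using that b by (auto simp: S_def annulus_def) (metis exp_less_cancel_iff exp_ln)
 let ?g = "\<lambda>t. z (exp t)"
 have gh: "?g holomorphic_on S"
  using holomorphic_on_compose_gen[of exp S z "annulus 0 b"] z eS by (auto simp: o_def holomorphic_on_exp)
 have gi: "inj_on ?g S"
 proof -
  have "inj_on exp S" by (rule inj_on_subset[OF inj_on_exp_strip]) (auto simp: S_def)
  moreover have "inj_on z (exp ` S)" by (rule inj_on_subset[OF inj]) (use eS in auto)
  ultimately show ?thesis using comp_inj_on[of exp S z] by (simp add: o_def)
 qed
 have sub: "?g ` S \<subseteq> z ` annulus 0 b" using eS by auto
 have "set_integrable lborel (?g ` S) f"
  by (rule set_integrable_subset[OF int _ sub]) (use open_mapping_thm3[OF gh S gi] in auto)
 then have si: "set_integrable lborel S (\<lambda>t. (cmod (deriv ?g t))\<^sup>2 * f (?g t))"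
  using holomorphic_change_of_variables(1)[OF S gh gi continuous_on_subset[OF f sub]] by simp
 \<comment> \<open>The derivative of \<open>exp\<close> contributes
   \<open>(exp (Re t))\<^sup>2\<close>, which is the factor \<open>r\<^sup>2\<close> of the
   claim.\<close>
 have dg: "(cmod (deriv ?g t))\<^sup>2 * f (?g t) = (exp (Re t))\<^sup>2 * E (exp t)" if "t \<in> S" for t
 proof -
  have "(?g has_field_derivative deriv z (exp t) * exp t) (at t)"
   by (rule DERIV_chain2[OF holomorphic_derivI[OF z open_annulus eS[OF that]] DERIV_exp])
  then have "deriv ?g t = deriv z (exp t) * exp t" by (rule DERIV_imp_deriv)
  then show ?thesis by (simp add: E_def norm_mult power_mult_distrib)
 qed
 define e where "e = (\<lambda>t. indicator S t *\<^sub>R ((exp (Re t))\<^sup>2 * E (exp t)))"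
 have "integrable lborel (\<lambda>t. indicator S t *\<^sub>R ((cmod (deriv ?g t))\<^sup>2 * f (?g t)))"
  using si by (simp only: set_integrable_def)
 also have "(\<lambda>t. indicator S t *\<^sub>R ((cmod (deriv ?g t))\<^sup>2 * f (?g t))) = e"
  unfolding e_def by (rule ext) (use dg in \<open>auto simp: indicator_def\<close>)
 finally have ie: "integrable lborel e" .
 have m: "(\<lambda>(x, y). Complex x y) \<in> borel_measurable (lborel \<Otimes>\<^sub>M lborel)"
  unfolding lborel_prod split_beta by (simp, intro borel_measurable_continuous_onI continuous_intros)
 have em: "e \<in> borel_measurable borel" using borel_measurable_integrable[OF ie] by simp
 have "integrable (distr (lborel \<Otimes>\<^sub>M lborel) borel (\<lambda>(x, y). Complex x y)) e"
  using ie by (simp flip: lborel_Complex)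
 then have "integrable (lborel \<Otimes>\<^sub>M lborel) (\<lambda>p. e (case p of (x, y) => Complex x y))"
  using integrable_distr_eq[OF m em] by simp
 then have "integrable (lborel \<Otimes>\<^sub>M lborel) (\<lambda>(x, y). e (Complex x y))"
  by (simp add: split_beta')
 from lborel_pair.integrable_fst[OF this]
 have ix: "integrable lborel (\<lambda>x. LINT y|lborel. e (Complex x y))" .
 have zc: "continuous_on (annulus 0 b) z" "continuous_on (annulus 0 b) (deriv z)"
  using hol_cont z holomorphic_deriv[OF z open_annulus] by auto
 have Ec: "continuous_on (annulus 0 b) E" unfolding E_def
  by (intro continuous_intros zc continuous_on_compose2[OF f zc(1)]) auto
 have inner: "(LINT y|lborel. e (Complex x y)) = (exp x)\<^sup>2 * cint E (exp x)" if x: "x < ln b" for x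
 proof -
  have xb: "exp x < b" using x b by (metis exp_less_cancel_iff exp_ln)
  have inA: "cr (exp x) * cis t \<in> annulus 0 b" for t using xb by simp
  have ex: "exp (Complex x y) = cr (exp x) * cis y" for y by (simp add: exp_eq_polar)
  let ?h = "\<lambda>y. (exp x)\<^sup>2 * E (cr (exp x) * cis y)"
  have "(\<lambda>y. e (Complex x y)) = (\<lambda>y. indicator {0<..<2*pi} y *\<^sub>R ?h y)"
   unfolding e_def using x by (auto simp: S_def indicator_def ex)
  then have "(LINT y|lborel. e (Complex x y)) = set_lebesgue_integral lborel {0<..<2*pi} ?h"
   unfolding set_lebesgue_integral_def by (rule arg_cong)
  also have "\<dots> = set_lebesgue_integral lborel {0..2*pi} ?h"
  proof -
   have "AE y in lborel. y \<noteq> 0 \<and> y \<noteq> 2 * pi"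
    using AE_lborel_singleton[of "0::real"] AE_lborel_singleton[of "2*pi::real"] by eventually_elim auto
   then have "AE y in lborel. indicator {0<..<2*pi} y *\<^sub>R ?h y = indicator {0..2*pi} y *\<^sub>R ?h y"
    by eventually_elim (auto simp: indicator_def)
   moreover have hm: "(\<lambda>y. indicator A y *\<^sub>R ?h y) \<in> borel_measurable lborel" if "A \<in> sets borel" for A :: "real set"
   proof -
    have "continuous_on A ?h" by (intro continuous_intros continuous_on_circle_param[OF Ec inA])
    from borel_measurable_continuous_on_indicator[OF that this] show ?thesis by (simp only: measurable_lborel2)
   qed
   ultimately show ?thesis unfolding set_lebesgue_integral_def
    by (intro integral_cong_AE hm) auto
  qed
  also have "\<dots> = integral {0..2*pi} ?h"
  proof (rule set_borel_integral_eq_integral(2))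
   show "set_integrable lborel {0..2 * pi} ?h"
    by (rule borel_integrable_atLeastAtMost') (intro continuous_intros continuous_on_circle_param[OF Ec inA])
  qed
  also have "\<dots> = (exp x)\<^sup>2 * cint E (exp x)" unfolding cint_def by simp
  finally show ?thesis .
 qed
 define s1 where "s1 = min (ln b) (ln \<delta>)"
 define I where "I = (LINT x|lborel. (LINT y|lborel. e (Complex x y)))"
 have epos: "0 \<le> e t" for t
  unfolding e_def E_def using pos eS by (auto simp: indicator_def intro!: mult_nonneg_nonneg)
 have Npre: "AE x in lborel. exp x \<notin> N"
 proof -
  have "countable (ln ` N)" using N by simp
  then have "AE x in lborel. x \<notin> ln ` N" by (intro AE_not_in countable_imp_null_set_lborel)
  then show ?thesis by (rule eventually_mono) (metis image_eqI ln_exp)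
 qed
 \<comment> \<open>Under the negated claim the inner integral is at least 1 for almost every
   \<open>x < s1\<close>, so a window of length \<open>n\<close> to the left of \<open>s1\<close>
   alone contributes \<open>n\<close>.\<close>
 have "real n \<le> I" for n
 proof -
  have ii: "integrable lborel (indicat_real {s1 - n..<s1})" by simp
  have "(LINT x|lborel. indicat_real {s1 - n..<s1} x) \<le> I"
   unfolding I_def
  proof (rule integral_mono_AE[OF ii ix])
   show "AE x in lborel. indicat_real {s1 - n..<s1} x \<le> (LINT y|lborel. e (Complex x y))"
    using Npre
   proof eventually_elim
    case (elim x)
    show ?case
    proof (cases "x \<in> {s1 - n..<s1}")
     case True
     then have x: "x < ln b" "exp x < \<delta>" using \<delta> by (auto simp: s1_def) (metis exp_less_cancel_iff exp_ln)
     then show ?thesis using inner[OF x(1)] big[of "exp x"] elim True by simp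
    next
     case False
     then show ?thesis using epos by (simp add: integral_nonneg_AE)
    qed
   qed
  qed
  then show ?thesis by simp
 qed
 then show False using reals_Archimedean2[of I] by (meson not_less)
qed

section \<open>Wirtinger calculus and the first integral\<close>

lemma frechet_derivative_shift:
 "frechet_derivative (\<lambda>\<zeta>. f (z + \<zeta>)) (at w) = frechet_derivative f (at (z + w :: complex))"
proof -
 have "((\<lambda>\<zeta>. f (z + \<zeta>)) has_derivative D) (at w) \<longleftrightarrow> (f has_derivative D) (at (z + w))" for D
 proof
  assume D: "((\<lambda>\<zeta>. f (z + \<zeta>)) has_derivative D) (at w)"
  have "((\<lambda>\<zeta>. \<zeta> - z) has_derivative (\<lambda>d. d)) (at (z + w))"
   by (auto intro!: derivative_eq_intros)
  from has_derivative_compose[OF this, of "\<lambda>\<zeta>. f (z + \<zeta>)" D] D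
  show "(f has_derivative D) (at (z + w))" by simp
 next
  assume D: "(f has_derivative D) (at (z + w))"
  have "((\<lambda>\<zeta>. z + \<zeta>) has_derivative (\<lambda>d. d)) (at w)"
   by (auto intro!: derivative_eq_intros)
  from has_derivative_compose[OF this D]
  show "((\<lambda>\<zeta>. f (z + \<zeta>)) has_derivative D) (at w)" .
 qed
 then show ?thesis unfolding frechet_derivative_def by simp
qed

lemma differentiable_shift:
 "(\<lambda>\<zeta>. f (z + \<zeta>)) differentiable (at w) \<longleftrightarrow> f differentiable (at (z + w :: complex))"
proof
 assume "(\<lambda>\<zeta>. f (z + \<zeta>)) differentiable (at w)"
 moreover have "(\<lambda>\<zeta>. \<zeta> - z) differentiable (at (z + w))" by simp
 ultimately show "f differentiable (at (z + w))"
  using differentiable_chain_at[of "\<lambda>\<zeta>. \<zeta> - z" "z + w" "\<lambda>\<zeta>. f (z + \<zeta>)"] by (simp add: o_def)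
next
 assume "f differentiable (at (z + w))"
 moreover have "(\<lambda>\<zeta>. z + \<zeta>) differentiable (at w)" by simp
 ultimately show "(\<lambda>\<zeta>. f (z + \<zeta>)) differentiable (at w)"
  using differentiable_chain_at[of "\<lambda>\<zeta>. z + \<zeta>" w f] by (simp add: o_def)
qed

lemma pd_shift: "pd_x (\<lambda>\<zeta>. f (z + \<zeta>)) w = pd_x f (z + w)" "pd_y (\<lambda>\<zeta>. f (z + \<zeta>)) w = pd_y f (z + w)"
 unfolding pd_x_def pd_y_def frechet_derivative_shift by simp_all

lemma pd_shift_fun: "pd_x (\<lambda>\<zeta>. f (z + \<zeta>)) = (\<lambda>w. pd_x f (z + w))" "pd_y (\<lambda>\<zeta>. f (z + \<zeta>)) = (\<lambda>w. pd_y f (z + w))"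
 by (rule ext, rule pd_shift)+

lemma laplacian_shift: "laplacian (\<lambda>\<zeta>. f (z + \<zeta>)) w = laplacian f (z + w)"
 by (simp add: laplacian_def pd_shift_fun pd_shift)

lemma d_z_shift: "d_z (\<lambda>\<zeta>. f (z + \<zeta>)) = (\<lambda>w. d_z f (z + w))"
 by (rule ext) (simp add: d_z_def pd_shift)

lemma Ck_on_shift: "Ck_on n (ball 0 e) (\<lambda>\<zeta>. f (z + \<zeta>)) \<longleftrightarrow> Ck_on n (ball z e) f"
proof (induction n arbitrary: f)
 case 0
 show ?case
 proof
  assume c: "Ck_on 0 (ball 0 e) (\<lambda>\<zeta>. f (z + \<zeta>))"
  have "continuous_on (ball z e) (\<lambda>x. (\<lambda>\<zeta>. f (z + \<zeta>)) (x - z))"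
   by (rule continuous_on_compose2[of "ball 0 e"]) (use c in \<open>auto intro!: continuous_intros simp: dist_norm norm_minus_commute\<close>)
  then show "Ck_on 0 (ball z e) f" by simp
 next
  assume c: "Ck_on 0 (ball z e) f"
  have "continuous_on (ball 0 e) (\<lambda>x. f (z + x))"
   by (rule continuous_on_compose2[of "ball z e"]) (use c in \<open>auto intro!: continuous_intros simp: dist_norm\<close>)
  then show "Ck_on 0 (ball 0 e) (\<lambda>\<zeta>. f (z + \<zeta>))" by simp
 qed
next
 case (Suc n)
 have "(\<forall>w\<in>ball 0 e. f differentiable at (z + w)) \<longleftrightarrow> (\<forall>w\<in>ball z e. f differentiable at w)"
 proof safe
  fix w assume a: "\<forall>w\<in>ball 0 e. f differentiable at (z + w)" "w \<in> ball z e"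
  have "w - z \<in> ball 0 e" using a(2) by (simp add: dist_norm norm_minus_commute)
  with a(1) show "f differentiable at w" by fastforce
 qed (auto simp: dist_norm)
 then show ?case by (simp add: pd_shift_fun differentiable_shift Suc.IH)
qed

lemma Ck_on_cong:
 assumes "open S" "\<And>z. z \<in> S ==> f z = g z"
 shows "Ck_on n S f \<longleftrightarrow> Ck_on n S g"
 using assms(2)
proof (induction n arbitrary: f g)
 case 0
 then show ?case by (simp cong: continuous_on_cong)
next
 case (Suc n)
 have D: "(f has_derivative D) (at z) \<longleftrightarrow> (g has_derivative D) (at z)" if "z \<in> S" for z D
 proof
  assume "(f has_derivative D) (at z)"
  then show "(g has_derivative D) (at z)"
   by (rule has_derivative_transform_within_open[OF _ \<open>open S\<close> that]) (use Suc.prems in simp)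
 next
  assume "(g has_derivative D) (at z)"
  then show "(f has_derivative D) (at z)"
   by (rule has_derivative_transform_within_open[OF _ \<open>open S\<close> that]) (use Suc.prems in simp)
 qed
 then have "frechet_derivative f (at z) = frechet_derivative g (at z)" if "z \<in> S" for z
  unfolding frechet_derivative_def using that by simp
 then have "pd_x f z = pd_x g z" "pd_y f z = pd_y g z" if "z \<in> S" for z
  using that by (simp_all add: pd_x_def pd_y_def)
 then have "Ck_on n S (pd_x f) \<longleftrightarrow> Ck_on n S (pd_x g)" "Ck_on n S (pd_y f) \<longleftrightarrow> Ck_on n S (pd_y g)"
  by (auto intro!: Suc.IH)
 moreover have "(\<forall>z\<in>S. f differentiable at z) \<longleftrightarrow> (\<forall>z\<in>S. g differentiable at z)"
  unfolding differentiable_def using D by simp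
 ultimately show ?case by simp
qed

lemma Ck_on_local:
 assumes "open S" "\<And>z. z \<in> S ==> \<exists>T. open T \<and> z \<in> T \<and> Ck_on n T f"
 shows "Ck_on n S f"
 using assms(2)
proof (induction n arbitrary: f)
 case 0
 have "isCont f z" if zS: "z \<in> S" for z
 proof -
  obtain T where T: "open T \<and> z \<in> T \<and> Ck_on 0 T f" using 0[OF zS] ..
  then have "continuous_on T f" by simp
  then show ?thesis using T by (simp add: continuous_on_eq_continuous_at)
 qed
 then show ?case by (simp add: continuous_at_imp_continuous_on)
next
 case (Suc n)
 have *: "\<exists>T. open T \<and> z \<in> T \<and> (\<forall>w\<in>T. f differentiable at w) \<and> Ck_on n T (pd_x f) \<and> Ck_on n T (pd_y f)" if "z \<in> S" for z
  using Suc.prems[OF that] by simp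
 have "Ck_on n S (pd_x f)" by (rule Suc.IH) (use * in blast)
 moreover have "Ck_on n S (pd_y f)" by (rule Suc.IH) (use * in blast)
 moreover have "\<forall>z\<in>S. f differentiable at z" using * by blast
 ultimately show ?case by simp
qed

lemma Ck_on_SucD: "Ck_on (Suc n) S f ==> Ck_on n S f"
proof (induction n arbitrary: f)
 case 0
 then show ?case
  by (auto intro!: continuous_at_imp_continuous_on differentiable_imp_continuous_within)
next
 case (Suc n)
 have "(\<forall>z\<in>S. f differentiable at z) \<and> Ck_on (Suc n) S (pd_x f) \<and> Ck_on (Suc n) S (pd_y f)"
  using Suc.prems unfolding Ck_on.simps(2)[of "Suc n" S f] .
 then show ?case using Suc.IH unfolding Ck_on.simps(2)[of n S f] by blast
qed

lemma has_derivative_pd: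
 assumes "f differentiable (at z)"
 shows "(f has_derivative (\<lambda>d. Re d *\<^sub>R pd_x f z + Im d *\<^sub>R pd_y f z)) (at z)"
proof -
 let ?D = "frechet_derivative f (at z)"
 have D: "(f has_derivative ?D) (at z)" using assms by (simp add: frechet_derivative_works)
 have "?D d = Re d *\<^sub>R pd_x f z + Im d *\<^sub>R pd_y f z" for d
 proof -
  have "d = Re d *\<^sub>R 1 + Im d *\<^sub>R \<i>" by (simp add: complex_eq_iff)
  then have "?D d = ?D (Re d *\<^sub>R 1 + Im d *\<^sub>R \<i>)" by simp
  also have "\<dots> = Re d *\<^sub>R ?D 1 + Im d *\<^sub>R ?D \<i>"
   using has_derivative_linear[OF D] by (simp add: linear_add linear_cmul)
  finally show ?thesis by (simp add: pd_x_def pd_y_def)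
 qed
 then have "?D = (\<lambda>d. Re d *\<^sub>R pd_x f z + Im d *\<^sub>R pd_y f z)" by (rule ext)
 with D show ?thesis by simp
qed

lemma pd_eqI: "(f has_derivative D) (at z) ==> pd_x f z = D 1" "(f has_derivative D) (at z) ==> pd_y f z = D \<i>"
 using frechet_derivative_at[of f D z] by (simp_all add: pd_x_def pd_y_def)

lemma Ck_on_add:
 assumes S: "open S" and "Ck_on n S f" "Ck_on n S g"
 shows "Ck_on n S (\<lambda>z. f z + g z)"
 using assms(2,3)
proof (induction n arbitrary: f g)
 case 0 then show ?case by (auto intro: continuous_intros)
next
 case (Suc n)
 have d: "((\<lambda>z. f z + g z) has_derivative (\<lambda>d. frechet_derivative f (at z) d + frechet_derivative g (at z) d)) (at z)" if "z \<in> S" for z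
  by (intro has_derivative_add) (use Suc.prems that in \<open>auto simp: frechet_derivative_works\<close>)
 have "pd_x (\<lambda>z. f z + g z) z = pd_x f z + pd_x g z" "pd_y (\<lambda>z. f z + g z) z = pd_y f z + pd_y g z" if "z \<in> S" for z
  using pd_eqI[OF d[OF that]] by (simp_all add: pd_x_def pd_y_def)
 then have "Ck_on n S (pd_x (\<lambda>z. f z + g z)) \<longleftrightarrow> Ck_on n S (\<lambda>z. pd_x f z + pd_x g z)"
  "Ck_on n S (pd_y (\<lambda>z. f z + g z)) \<longleftrightarrow> Ck_on n S (\<lambda>z. pd_y f z + pd_y g z)"
  by (auto intro!: Ck_on_cong S)
 then show ?case using Suc.IH Suc.prems by auto
qed

lemma Ck_on_mult:
 fixes f g :: "complex => real"
 assumes S: "open S" and "Ck_on n S f" "Ck_on n S g"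
 shows "Ck_on n S (\<lambda>z. f z * g z)"
 using assms(2,3)
proof (induction n arbitrary: f g)
 case 0 then show ?case by (auto intro: continuous_intros)
next
 case (Suc n)
 have d: "((\<lambda>z. f z * g z) has_derivative (\<lambda>d. f z * frechet_derivative g (at z) d + frechet_derivative f (at z) d * g z)) (at z)" if "z \<in> S" for z
  by (intro has_derivative_mult) (use Suc.prems that in \<open>auto simp: frechet_derivative_works\<close>)
 have "pd_x (\<lambda>z. f z * g z) z = f z * pd_x g z + pd_x f z * g z" "pd_y (\<lambda>z. f z * g z) z = f z * pd_y g z + pd_y f z * g z" if "z \<in> S" for z
  using pd_eqI[OF d[OF that]] by (simp_all add: pd_x_def pd_y_def)
 then have "Ck_on n S (pd_x (\<lambda>z. f z * g z)) \<longleftrightarrow> Ck_on n S (\<lambda>z. f z * pd_x g z + pd_x f z * g z)"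
  "Ck_on n S (pd_y (\<lambda>z. f z * g z)) \<longleftrightarrow> Ck_on n S (\<lambda>z. f z * pd_y g z + pd_y f z * g z)"
  by (auto intro!: Ck_on_cong S)
 moreover have "Ck_on n S f" "Ck_on n S g" using Suc.prems Ck_on_SucD by blast+
 moreover have "\<forall>z\<in>S. (\<lambda>z. f z * g z) differentiable at z" using d unfolding differentiable_def by blast
 ultimately show ?case using Suc.prems by (simp add: Suc.IH Ck_on_add[OF S])
qed

lemma Ck_on_const: "Ck_on n S (\<lambda>_. c)"
proof (induction n arbitrary: c)
 case (Suc n)
 have "pd_x (\<lambda>_::complex. c) = (\<lambda>_. 0)" "pd_y (\<lambda>_::complex. c) = (\<lambda>_. 0)"
  by (auto simp: fun_eq_iff intro!: pd_eqI[THEN trans])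
 then show ?case using Suc by simp
qed simp

lemma Ck_on_exp:
 fixes f :: "complex => real"
 assumes S: "open S" and "Ck_on n S f"
 shows "Ck_on n S (\<lambda>z. exp (f z))"
 using assms(2)
proof (induction n)
 case 0 then show ?case by (auto intro: continuous_intros)
next
 case (Suc n)
 have d: "((\<lambda>z. exp (f z)) has_derivative (\<lambda>d. frechet_derivative f (at z) d * exp (f z))) (at z)" if "z \<in> S" for z
  by (intro has_derivative_exp) (use Suc.prems that in \<open>auto simp: frechet_derivative_works\<close>)
 have "pd_x (\<lambda>z. exp (f z)) z = pd_x f z * exp (f z)" "pd_y (\<lambda>z. exp (f z)) z = pd_y f z * exp (f z)" if "z \<in> S" for z
  using pd_eqI[OF d[OF that]] by (simp_all add: pd_x_def pd_y_def)
 then have "Ck_on n S (pd_x (\<lambda>z. exp (f z))) \<longleftrightarrow> Ck_on n S (\<lambda>z. pd_x f z * exp (f z))"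
  "Ck_on n S (pd_y (\<lambda>z. exp (f z))) \<longleftrightarrow> Ck_on n S (\<lambda>z. pd_y f z * exp (f z))"
  by (auto intro!: Ck_on_cong S)
 moreover have "\<forall>z\<in>S. (\<lambda>z. exp (f z)) differentiable at z" using d unfolding differentiable_def by blast
 ultimately show ?case using Suc Ck_on_SucD[of n S f] by (auto intro!: Ck_on_mult[OF S])
qed

lemma Ck_on_holomorphic:
 assumes S: "open S" and "f holomorphic_on S"
 shows "Ck_on n S f"
 using assms(2)
proof (induction n arbitrary: f)
 case 0 then show ?case by (simp add: hol_cont)
next
 case (Suc n)
 have d: "(f has_derivative (\<lambda>d. deriv f z * d)) (at z)" if "z \<in> S" for z
  using holomorphic_derivI[OF Suc.prems S that] by (simp add: has_field_derivative_def)
 have "pd_x f z = deriv f z" "pd_y f z = deriv f z * \<i>" if "z \<in> S" for z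
  using pd_eqI[OF d[OF that]] by simp_all
 then have "Ck_on n S (pd_x f) \<longleftrightarrow> Ck_on n S (deriv f)" "Ck_on n S (pd_y f) \<longleftrightarrow> Ck_on n S (\<lambda>z. deriv f z * \<i>)"
  by (auto intro!: Ck_on_cong S)
 moreover have "deriv f holomorphic_on S" by (rule holomorphic_deriv[OF Suc.prems S])
 moreover from this have "(\<lambda>z. deriv f z * \<i>) holomorphic_on S" by (rule holomorphic_on_mult[OF _ holomorphic_on_const])
 moreover have "\<forall>z\<in>S. f differentiable at z" using d unfolding differentiable_def by blast
 ultimately show ?case by (simp only: Ck_on.simps Suc.IH simp_thms)
qed

lemma smooth_on_holomorphic: "open S ==> f holomorphic_on S ==> smooth_on S f"
 by (simp add: smooth_on_def Ck_on_holomorphic)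

text \<open>Schwarz's theorem. The second difference of \<open>f\<close> over a square of side
  \<open>t\<close> at \<open>z\<close> is expressed by the mean value theorem in both orders, and
  the two mixed derivatives are compared as \<open>t\<close> shrinks.\<close>

lemma mixed_partials:
 fixes f :: "complex => real"
 assumes S: "open S" and f: "Ck_on 2 S f" and z: "z \<in> S"
 shows "pd_x (pd_y f) z = pd_y (pd_x f) z"
proof -
 have f2: "\<And>w. w \<in> S ==> f differentiable at w" "\<And>w. w \<in> S ==> pd_x f differentiable at w"
  "\<And>w. w \<in> S ==> pd_y f differentiable at w"
  "continuous_on S (pd_x (pd_y f))" "continuous_on S (pd_y (pd_x f))"
  using f by (auto simp: numeral_2_eq_2)
 obtain e where e: "0 < e" "ball z e \<subseteq> S" using S z openE by blast
 have inb: "z + Complex a b \<in> S" if "0 \<le> a" "a < e / 2" "0 \<le> b" "b < e / 2" for a b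
 proof -
  have "cmod (Complex a b) \<le> \<bar>a\<bar> + \<bar>b\<bar>" using cmod_le[of "Complex a b"] by simp
  then have "z + Complex a b \<in> ball z e" using that by (simp add: dist_norm)
  then show ?thesis using e by blast
 qed
 have dx: "((\<lambda>s. g (z + Complex s y)) has_real_derivative pd_x g (z + Complex s y)) (at s)"
  if "g differentiable at (z + Complex s y)" for g :: "complex => real" and s y
 proof -
  have "((\<lambda>s. z + Complex s y) has_derivative (\<lambda>d. cr d)) (at s)"
  proof -
   have "((\<lambda>s. z + (cr s + \<i> * y)) has_derivative (\<lambda>d. cr d)) (at s)"
    by (auto intro!: derivative_eq_intros)
   then show ?thesis by (simp add: Complex_eq)
  qed
  from has_derivative_compose[OF this has_derivative_pd[OF that]]
  show ?thesis unfolding has_field_derivative_def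
   by (rule has_derivative_eq_rhs) (simp add: fun_eq_iff)
 qed
 have dy: "((\<lambda>s. g (z + Complex x s)) has_real_derivative pd_y g (z + Complex x s)) (at s)"
  if "g differentiable at (z + Complex x s)" for g :: "complex => real" and s x
 proof -
  have "((\<lambda>s. z + Complex x s) has_derivative (\<lambda>d. \<i> * cr d)) (at s)"
  proof -
   have "((\<lambda>s. z + (cr x + \<i> * cr s)) has_derivative (\<lambda>d. \<i> * cr d)) (at s)"
    by (auto intro!: derivative_eq_intros)
   then show ?thesis by (simp add: Complex_eq)
  qed
  from has_derivative_compose[OF this has_derivative_pd[OF that]]
  show ?thesis unfolding has_field_derivative_def
   by (rule has_derivative_eq_rhs) (simp add: fun_eq_iff)
 qed
 have key: "\<exists>a b a' b'. 0 < a \<and> a < t \<and> 0 < b \<and> b < t \<and> 0 < a' \<and> a' < t \<and> 0 < b' \<and> b' < t \<and>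
   pd_y (pd_x f) (z + Complex a b) = pd_x (pd_y f) (z + Complex a' b')" if t: "0 < t" "t < e / 2" for t
 proof -
  let ?D = "f (z + Complex t t) - f (z + Complex t 0) - f (z + Complex 0 t) + f (z + Complex 0 0)"
  have "\<exists>a>0. a < t \<and> (f (z + Complex t t) - f (z + Complex t 0)) - (f (z + Complex 0 t) - f (z + Complex 0 0))
   = (t - 0) * (pd_x f (z + Complex a t) - pd_x f (z + Complex a 0))"
   by (rule MVT2[OF t(1)]) (intro DERIV_diff dx f2(1) inb; use t in simp)
  then obtain a where a: "0 < a" "a < t" "?D = t * (pd_x f (z + Complex a t) - pd_x f (z + Complex a 0))" by auto
  have "\<exists>b>0. b < t \<and> pd_x f (z + Complex a t) - pd_x f (z + Complex a 0) = (t - 0) * pd_y (pd_x f) (z + Complex a b)"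
   by (rule MVT2[OF t(1)]) (intro dy f2(2) inb; use t a in simp)
  then obtain b where b: "0 < b" "b < t" "pd_x f (z + Complex a t) - pd_x f (z + Complex a 0) = t * pd_y (pd_x f) (z + Complex a b)" by auto
  have "\<exists>b>0. b < t \<and> (f (z + Complex t t) - f (z + Complex 0 t)) - (f (z + Complex t 0) - f (z + Complex 0 0))
   = (t - 0) * (pd_y f (z + Complex t b) - pd_y f (z + Complex 0 b))"
   by (rule MVT2[OF t(1)]) (intro DERIV_diff dy f2(1) inb; use t in simp)
  then obtain b' where b': "0 < b'" "b' < t" "?D = t * (pd_y f (z + Complex t b') - pd_y f (z + Complex 0 b'))" by auto
  have "\<exists>a>0. a < t \<and> pd_y f (z + Complex t b') - pd_y f (z + Complex 0 b') = (t - 0) * pd_x (pd_y f) (z + Complex a b')"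
   by (rule MVT2[OF t(1)]) (intro dx f2(3) inb; use t b' in simp)
  then obtain a' where a': "0 < a'" "a' < t" "pd_y f (z + Complex t b') - pd_y f (z + Complex 0 b') = t * pd_x (pd_y f) (z + Complex a' b')" by auto
  have "t * (t * pd_y (pd_x f) (z + Complex a b)) = t * (t * pd_x (pd_y f) (z + Complex a' b'))"
   using a(3) b(3) b'(3) a'(3) by metis
  then have "pd_y (pd_x f) (z + Complex a b) = pd_x (pd_y f) (z + Complex a' b')" using t by simp
  then show ?thesis using a b a' b' by blast
 qed
 show ?thesis
 proof (rule ccontr)
  assume ne: "pd_x (pd_y f) z \<noteq> pd_y (pd_x f) z"
  define r where "r = dist (pd_x (pd_y f) z) (pd_y (pd_x f) z) / 2"
  have r: "0 < r" using ne by (simp add: r_def)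
  have "isCont (pd_x (pd_y f)) z" "isCont (pd_y (pd_x f)) z"
   using f2(4,5) S z by (simp_all add: continuous_on_eq_continuous_at)
  then obtain d1 d2 where d: "0 < d1" "\<And>w. dist w z < d1 ==> dist (pd_x (pd_y f) w) (pd_x (pd_y f) z) < r"
   "0 < d2" "\<And>w. dist w z < d2 ==> dist (pd_y (pd_x f) w) (pd_y (pd_x f) z) < r"
   using r unfolding continuous_at_eps_delta by metis
  define t where "t = min (min d1 d2) e / 4"
  have t: "0 < t" "t < e / 2" "2 * t < d1" "2 * t < d2" using d e by (auto simp: t_def)
  obtain a b a' b' where ab: "0 < a" "a < t" "0 < b" "b < t" "0 < a'" "a' < t" "0 < b'" "b' < t"
   and eq: "pd_y (pd_x f) (z + Complex a b) = pd_x (pd_y f) (z + Complex a' b')"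
   using key[OF t(1,2)] by blast
  have "dist (z + Complex a b) z < 2 * t" "dist (z + Complex a' b') z < 2 * t"
   using cmod_le[of "Complex a b"] cmod_le[of "Complex a' b'"] ab by (simp_all add: dist_norm)
  then have "dist (pd_x (pd_y f) (z + Complex a' b')) (pd_x (pd_y f) z) < r"
   "dist (pd_y (pd_x f) (z + Complex a b)) (pd_y (pd_x f) z) < r"
   using d t by (meson less_trans)+
  then show False unfolding eq r_def by (metis dist_commute dist_triangle_half_r less_irrefl)
 qed
qed

text \<open>\<open>A\<close> and \<open>B\<close> are the derivatives with respect to
  \<open>z\<close> and \<open>cnj z\<close>. Carrying both keeps the rules for products, conjugation
  and composition purely algebraic; complex differentiability is \<open>B = 0\<close>.\<close>

definition has_wirtinger :: "(complex => complex) => complex => complex => complex => bool" where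
 "has_wirtinger f A B z \<longleftrightarrow> (f has_derivative (\<lambda>d. A * d + B * cnj d)) (at z)"

lemma has_wirtinger_cong: "has_wirtinger f A B z ==> A = A' ==> B = B' ==> has_wirtinger f A' B' z"
 by simp

lemma has_wirtinger_mult:
 assumes "has_wirtinger f A B z" "has_wirtinger g A' B' z"
 shows "has_wirtinger (\<lambda>z. f z * g z) (f z * A' + A * g z) (f z * B' + B * g z) z"
proof -
 have "((\<lambda>z. f z * g z) has_derivative (\<lambda>d. f z * (A' * d + B' * cnj d) + (A * d + B * cnj d) * g z)) (at z)"
  using has_derivative_mult assms unfolding has_wirtinger_def by blast
 then show ?thesis unfolding has_wirtinger_def by (rule has_derivative_eq_rhs) (simp add: fun_eq_iff algebra_simps)
qed

lemma has_wirtinger_add: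
 assumes "has_wirtinger f A B z" "has_wirtinger g A' B' z"
 shows "has_wirtinger (\<lambda>z. f z + g z) (A + A') (B + B') z"
proof -
 have "((\<lambda>z. f z + g z) has_derivative (\<lambda>d. (A * d + B * cnj d) + (A' * d + B' * cnj d))) (at z)"
  using has_derivative_add assms unfolding has_wirtinger_def by blast
 then show ?thesis unfolding has_wirtinger_def by (rule has_derivative_eq_rhs) (simp add: fun_eq_iff algebra_simps)
qed

lemma has_wirtinger_cmul:
 assumes "has_wirtinger f A B z"
 shows "has_wirtinger (\<lambda>z. c * f z) (c * A) (c * B) z"
proof -
 have "((\<lambda>z. c * f z) has_derivative (\<lambda>d. c * (A * d + B * cnj d))) (at z)"
  using has_derivative_mult_right assms unfolding has_wirtinger_def by blast
 then show ?thesis unfolding has_wirtinger_def by (rule has_derivative_eq_rhs) (simp add: fun_eq_iff algebra_simps)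
qed

lemma has_wirtinger_cnj:
 assumes "has_wirtinger f A B z"
 shows "has_wirtinger (\<lambda>z. cnj (f z)) (cnj B) (cnj A) z"
proof -
 have "((\<lambda>z. cnj (f z)) has_derivative (\<lambda>d. cnj (A * d + B * cnj d))) (at z)"
  by (rule bounded_linear.has_derivative[OF bounded_linear_cnj assms[unfolded has_wirtinger_def]])
 then show ?thesis unfolding has_wirtinger_def by (rule has_derivative_eq_rhs) (simp add: fun_eq_iff algebra_simps)
qed

lemma has_wirtinger_exp:
 assumes "has_wirtinger f A B z"
 shows "has_wirtinger (\<lambda>z. exp (f z)) (exp (f z) * A) (exp (f z) * B) z"
proof -
 have "((\<lambda>z. exp (f z)) has_derivative (\<lambda>d. exp (f z) * (A * d + B * cnj d))) (at z)"
  by (rule has_derivative_compose[OF assms[unfolded has_wirtinger_def] DERIV_exp[unfolded has_field_derivative_def]])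
 then show ?thesis unfolding has_wirtinger_def by (rule has_derivative_eq_rhs) (simp add: fun_eq_iff algebra_simps)
qed

lemma has_wirtinger_holomorphic: "(f has_field_derivative A) (at z) \<longleftrightarrow> has_wirtinger f A 0 z"
 by (simp add: has_wirtinger_def has_field_derivative_def)

lemma has_wirtinger_transform:
 "has_wirtinger f A B z ==> open S ==> z \<in> S ==> (\<And>w. w \<in> S ==> f w = g w) ==> has_wirtinger g A B z"
 unfolding has_wirtinger_def by (rule has_derivative_transform_within_open)

text \<open>A holomorphic function with real values is locally constant: the imaginary part of
  \<open>A z * d\<close> vanishes for \<open>d = 1\<close> and for \<open>d = \<i>\<close>.\<close>

lemma has_wirtinger_real_const:
 assumes S: "open S" "connected S" and w: "\<And>z. z \<in> S ==> has_wirtinger f (A z) 0 z"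
  and re: "\<And>z. z \<in> S ==> Im (f z) = 0"
 obtains c where "\<And>z. z \<in> S ==> f z = cr c"
proof -
 have der: "(f has_derivative (\<lambda>_. 0)) (at z)" if z: "z \<in> S" for z
 proof -
  have d: "(f has_derivative (\<lambda>d. A z * d)) (at z)" using w[OF z] by (simp add: has_wirtinger_def)
  have "((\<lambda>z. Im (f z)) has_derivative (\<lambda>d. Im (A z * d))) (at z)"
   by (rule has_derivative_Im[OF d])
  moreover have "((\<lambda>z. Im (f z)) has_derivative (\<lambda>d. 0)) (at z)"
   by (rule has_derivative_transform_within_open[OF has_derivative_const S(1) z]) (use re in simp)
  ultimately have e: "(\<lambda>d. Im (A z * d)) = (\<lambda>d. 0)" by (rule has_derivative_unique)
  have "Im (A z * 1) = 0" "Im (A z * \<i>) = 0" using fun_cong[OF e, of 1] fun_cong[OF e, of \<i>] by simp_all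
  then have "A z = 0" by (simp add: complex_eq_iff)
  then show ?thesis using d by simp
 qed
 show ?thesis
 proof (cases "S = {}")
  case True then show ?thesis using that by blast
 next
  case False
  then obtain z0 where z0: "z0 \<in> S" by blast
  have "f z = cr (Re (f z0))" if "z \<in> S" for z
   using has_derivative_zero_unique_connected[OF S der that z0] re[OF z0] by (simp add: complex_eq_iff)
  then show ?thesis using that by blast
 qed
qed

text \<open>The \<open>z\<close>-derivative of a real function; its differential is
  \<open>Re (2 * grad_z f z * d)\<close>.\<close>

definition grad_z :: "(complex => real) => complex => complex" where
 "grad_z f z = Complex (pd_x f z / 2) (- pd_y f z / 2)"

lemma has_derivative_grad_z:
 assumes "f differentiable (at z)"
 shows "(f has_derivative (\<lambda>d. Re (2 * grad_z f z * d))) (at z)"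
proof -
 have "Re (2 * grad_z f z * d) = Re d *\<^sub>R pd_x f z + Im d *\<^sub>R pd_y f z" for d
  by (simp add: grad_z_def)
 then show ?thesis using has_derivative_pd[OF assms] by simp
qed

lemma has_wirtinger_of_real:
 assumes "f differentiable (at z)"
 shows "has_wirtinger (\<lambda>z. cr (f z)) (grad_z f z) (cnj (grad_z f z)) z"
proof -
 have "((\<lambda>z. cr (f z)) has_derivative (\<lambda>d. cr (Re (2 * grad_z f z * d)))) (at z)"
  by (rule has_derivative_of_real[OF has_derivative_grad_z[OF assms]])
 then show ?thesis unfolding has_wirtinger_def
  by (rule has_derivative_eq_rhs) (simp add: fun_eq_iff complex_eq_iff)
qed

lemma d_z_wirtinger:
 assumes "has_wirtinger f A B z" shows "d_z f z = A"
proof -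
 have pd: "pd_x f z = A + B" "pd_y f z = \<i> * (A - B)"
  using pd_eqI[OF assms[unfolded has_wirtinger_def]] by (simp_all add: algebra_simps)
 show ?thesis unfolding d_z_def pd by simp
qed

text \<open>Differentiating by \<open>z\<close> and \<open>cnj z\<close> in turn gives a quarter of
  the Laplacian; equality of the mixed partials is what makes the result real.\<close>

lemma has_wirtinger_grad_z:
 assumes S: "open S" and f: "Ck_on 2 S f" and z: "z \<in> S"
 shows "has_wirtinger (grad_z f) (d_z (grad_z f) z) (cr (laplacian f z / 4)) z"
proof -
 have d: "pd_x f differentiable at z" "pd_y f differentiable at z"
  using f z by (auto simp: numeral_2_eq_2)
 have eq: "grad_z f = (\<lambda>w. (1 / 2) * cr (pd_x f w) + (- \<i> / 2) * cr (pd_y f w))"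
  by (rule ext) (simp add: grad_z_def complex_eq_iff)
 let ?a = "grad_z (pd_x f) z" and ?b = "grad_z (pd_y f) z"
 have w: "has_wirtinger (grad_z f) ((1 / 2) * ?a + (- \<i> / 2) * ?b) ((1 / 2) * cnj ?a + (- \<i> / 2) * cnj ?b) z"
  unfolding eq by (intro has_wirtinger_add has_wirtinger_cmul has_wirtinger_of_real d)
 have "(1 / 2) * cnj ?a + (- \<i> / 2) * cnj ?b = cr (laplacian f z / 4)"
  using mixed_partials[OF S f z] by (simp add: grad_z_def laplacian_def complex_eq_iff)
 from has_wirtinger_cong[OF w d_z_wirtinger[OF w, symmetric] this] show ?thesis .
qed

text \<open>\<open>F\<close> below is the component of the holomorphic field \<open>K\<^sup>,\<^sup>z \<partial>/\<partial>z\<close>.  Both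
 \<open>F' + 2 \<phi>\<^sub>z F + \<kappa>\<^sup>2/4\<close> and \<open>F \<kappa>\<^sub>z - c\<^sub>0 \<kappa> + \<kappa>\<^sup>3/12\<close> are real with vanishing \<open>\<partial>/\<partial>cnj z\<close>.\<close>
lemma hcmu_first_integral:
 fixes \<phi> \<kappa> :: "complex => real"
 assumes S: "open S" "connected S" and phi: "Ck_on 4 S \<phi>"
  and \<kappa>: "\<And>z. z \<in> S ==> \<kappa> z = - exp (- 2 * \<phi> z) * laplacian \<phi> z"
  and eq: "\<And>z. z \<in> S ==> d_z (d_z (\<lambda>z. cr (\<kappa> z))) z
    - 2 * d_z (\<lambda>z. cr (\<phi> z)) z * d_z (\<lambda>z. cr (\<kappa> z)) z = 0"
 obtains F c0 c1 where "F holomorphic_on S"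
  "\<And>z. z \<in> S ==> (\<kappa> has_derivative (\<lambda>d. Re (2 * exp (2 * \<phi> z) * cnj (F z) * d))) (at z)"
  "\<And>z. z \<in> S ==> exp (2 * \<phi> z) * (cmod (F z))\<^sup>2 = - ((\<kappa> z) ^ 3) / 12 + c0 * \<kappa> z + c1"
proof -
 have C: "Ck_on (Suc (Suc (Suc (Suc 0)))) S \<phi>" using phi by (simp add: eval_nat_numeral)
 have lap: "Ck_on 2 S (laplacian \<phi>)"
 proof -
  have "Ck_on 2 S (\<lambda>z. pd_x (pd_x \<phi>) z + pd_y (pd_y \<phi>) z)"
   by (rule Ck_on_add[OF S(1)]) (use C in \<open>simp_all add: numeral_2_eq_2\<close>)
  then show ?thesis by (simp add: laplacian_def[abs_def])
 qed
 have phi2: "Ck_on 2 S \<phi>"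
  using Ck_on_SucD[OF Ck_on_SucD[OF C]] by (simp only: numeral_2_eq_2)
 have "Ck_on 2 S (\<lambda>z. - exp (- 2 * \<phi> z) * laplacian \<phi> z)"
  using Ck_on_mult[OF S(1) Ck_on_mult[OF S(1) Ck_on_const[of 2 S "- 1::real"] Ck_on_exp[OF S(1) Ck_on_mult[OF S(1) Ck_on_const[of 2 S "- 2::real"] phi2]]] lap]
  by simp
 then have k2: "Ck_on 2 S \<kappa>"
  using Ck_on_cong[OF S(1), of \<kappa> "\<lambda>z. - exp (- 2 * \<phi> z) * laplacian \<phi> z" 2] \<kappa> by simp
 have diff: "\<phi> differentiable at z" "\<kappa> differentiable at z" if "z \<in> S" for z
  using phi2 k2 that by (auto simp: numeral_2_eq_2)
 define p where "p = grad_z \<phi>"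
 define q where "q = grad_z \<kappa>"
 have wphi: "has_wirtinger (\<lambda>z. cr (\<phi> z)) (p z) (cnj (p z)) z" if "z \<in> S" for z
  unfolding p_def by (rule has_wirtinger_of_real[OF diff(1)[OF that]])
 have wk: "has_wirtinger (\<lambda>z. cr (\<kappa> z)) (q z) (cnj (q z)) z" if "z \<in> S" for z
  unfolding q_def by (rule has_wirtinger_of_real[OF diff(2)[OF that]])
 have wp: "has_wirtinger p (d_z p z) (cr (laplacian \<phi> z / 4)) z" if "z \<in> S" for z
  unfolding p_def by (rule has_wirtinger_grad_z[OF S(1) phi2 that])
 have wq0: "has_wirtinger q (d_z q z) (cr (laplacian \<kappa> z / 4)) z" if "z \<in> S" for z
  unfolding q_def by (rule has_wirtinger_grad_z[OF S(1) k2 that])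
 \<comment> \<open>The HCMU equation in terms of \<open>p\<close> and \<open>q\<close>, the
   \<open>z\<close>-derivatives of \<open>\<phi>\<close> and \<open>\<kappa>\<close>. Its conjugate
   is exactly what makes \<open>exp (- 2 * \<phi> z) * cnj (q z)\<close> holomorphic.\<close>
 have hc: "d_z q z = 2 * p z * q z" if z: "z \<in> S" for z
 proof -
  have a: "d_z (\<lambda>z. cr (\<kappa> z)) w = q w" if "w \<in> S" for w
   by (rule d_z_wirtinger[OF wk[OF that]])
  have "has_wirtinger (d_z (\<lambda>z. cr (\<kappa> z))) (d_z q z) (cr (laplacian \<kappa> z / 4)) z"
   by (rule has_wirtinger_transform[OF wq0[OF z] S(1) z]) (simp add: a)
  then have "d_z (d_z (\<lambda>z. cr (\<kappa> z))) z = d_z q z" by (rule d_z_wirtinger)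
  then show ?thesis using eq[OF z] a[OF z] d_z_wirtinger[OF wphi[OF z]] by simp
 qed
 have wq: "has_wirtinger q (2 * p z * q z) (cr (laplacian \<kappa> z / 4)) z" if "z \<in> S" for z
  using wq0[OF that] hc[OF that] by simp
 define F where "F = (\<lambda>z. exp (- 2 * cr (\<phi> z)) * cnj (q z))"
 define F' where "F' = (\<lambda>z. exp (- 2 * cr (\<phi> z)) * cr (laplacian \<kappa> z / 4) - 2 * p z * F z)"
 have wF: "has_wirtinger F (F' z) 0 z" if z: "z \<in> S" for z
  unfolding F_def
  by (rule has_wirtinger_cong[OF has_wirtinger_mult[OF has_wirtinger_exp[OF has_wirtinger_cmul[OF wphi[OF z]]] has_wirtinger_cnj[OF wq[OF z]]]])
   (simp_all add: F'_def F_def algebra_simps)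
 then have Fd: "(F has_field_derivative F' z) (at z)" if "z \<in> S" for z
  using that by (simp add: has_wirtinger_holomorphic)
 then have Fh: "F holomorphic_on S"
  using holomorphic_on_open[OF S(1)] by blast
 have "deriv F holomorphic_on S" by (rule holomorphic_deriv[OF Fh S(1)])
 then have F'h: "F' holomorphic_on S"
  by (rule holomorphic_transform) (use Fd DERIV_imp_deriv in blast)
 have wF': "has_wirtinger F' (deriv F' z) 0 z" if "z \<in> S" for z
 proof -
  have "(F' has_field_derivative deriv F' z) (at z)" by (rule holomorphic_derivI[OF F'h S(1) that])
  then show ?thesis by (simp only: has_wirtinger_holomorphic)
 qed
 have ee: "exp (2 * cr (\<phi> z)) * exp (- 2 * cr (\<phi> z)) = 1" for z
  by (simp flip: exp_add)
 have qF: "cnj (q z) = exp (2 * cr (\<phi> z)) * F z" for z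
  using ee[of z] by (simp add: F_def mult.assoc[symmetric])
 have lapphi: "laplacian \<phi> z = - exp (2 * \<phi> z) * \<kappa> z" if "z \<in> S" for z
  using \<kappa>[OF that] by (simp add: exp_minus)
 define M where "M = (\<lambda>z. (F' z + 2 * (p z * F z)) + (1 / 4) * (cr (\<kappa> z) * cr (\<kappa> z)))"
 have wM: "\<exists>A. has_wirtinger M A 0 z" if z: "z \<in> S" for z
 proof -
  \<comment> \<open>The two derivatives by \<open>cnj z\<close> cancel: the definition of curvature
    gives \<open>laplacian \<phi> z = - exp (2 * \<phi> z) * \<kappa> z\<close>, and
    \<open>cnj (q z)\<close> is \<open>exp (2 * \<phi> z) * F z\<close>.\<close>
  have e0: "2 * (cr (laplacian \<phi> z / 4) * F z) + (1 / 4) * (2 * (cr (\<kappa> z) * cnj (q z))) = 0"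
   unfolding qF lapphi[OF z] by (simp add: exp_of_real[symmetric])
  have gen: "0 + 2 * (P * 0 + X * Y) + 1 / 4 * (k * c + c * k) = 2 * (X * Y) + 1 / 4 * (2 * (k * c))"
   for P X Y k c :: complex by (simp add: algebra_simps)
  show ?thesis unfolding M_def
   by (rule exI, rule has_wirtinger_cong[OF has_wirtinger_add[OF has_wirtinger_add[OF wF'[OF z] has_wirtinger_cmul[OF has_wirtinger_mult[OF wp[OF z] wF[OF z]]]]
    has_wirtinger_cmul[OF has_wirtinger_mult[OF wk[OF z] wk[OF z]]]] refl], rule trans[OF gen e0])
 qed
 then obtain A where A: "\<And>z. z \<in> S ==> has_wirtinger M (A z) 0 z" by metis
 have Mr: "Im (M z) = 0" for z
 proof -
  have "M z = exp (- 2 * cr (\<phi> z)) * cr (laplacian \<kappa> z / 4) + (1 / 4) * (cr (\<kappa> z) * cr (\<kappa> z))"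
   by (simp add: M_def F'_def)
  also have "exp (- 2 * cr (\<phi> z)) = cr (exp (- 2 * \<phi> z))" by (simp add: exp_of_real[symmetric])
  finally show ?thesis by simp
 qed
 obtain c0 where c0: "\<And>z. z \<in> S ==> M z = cr c0"
  using has_wirtinger_real_const[OF S A Mr] by blast
 define N where "N = (\<lambda>z. F z * q z + ((- c0) * cr (\<kappa> z) + (1 / 12) * (cr (\<kappa> z) * (cr (\<kappa> z) * cr (\<kappa> z)))))"
 have wN: "\<exists>A. has_wirtinger N A 0 z" if z: "z \<in> S" for z
 proof -
  have "cr (laplacian \<kappa> z / 4) = (exp (2 * cr (\<phi> z)) * exp (- 2 * cr (\<phi> z))) * cr (laplacian \<kappa> z / 4)"
   unfolding ee by simp
  also have "\<dots> = exp (2 * cr (\<phi> z)) * (exp (- 2 * cr (\<phi> z)) * cr (laplacian \<kappa> z / 4))"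
   by (rule mult.assoc)
  also have "exp (- 2 * cr (\<phi> z)) * cr (laplacian \<kappa> z / 4) = F' z + 2 * p z * F z"
   by (simp add: F'_def)
  finally have l: "cr (laplacian \<kappa> z / 4) = exp (2 * cr (\<phi> z)) * (F' z + 2 * p z * F z)" .
  \<comment> \<open>Constancy of \<open>M\<close> makes the Laplacian of \<open>\<kappa>\<close> a
    quadratic polynomial in \<open>\<kappa>\<close> times the area density; integrating it against
    \<open>cnj (q z)\<close> produces the cubic.\<close>
  have "F' z + 2 * p z * F z = c0 - (1 / 4) * (cr (\<kappa> z) * cr (\<kappa> z))"
   using c0[OF z] by (simp add: M_def algebra_simps)
  then have "F z * cr (laplacian \<kappa> z / 4) = cnj (q z) * (c0 - (1 / 4) * (cr (\<kappa> z) * cr (\<kappa> z)))"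
   unfolding l qF by simp
  then have n0: "F z * cr (laplacian \<kappa> z / 4) + 0 * q z + (cr (- c0) * cnj (q z) + (1 / 12) * (cr (\<kappa> z) * (cr (\<kappa> z) * cnj (q z) + cnj (q z) * cr (\<kappa> z)) + cnj (q z) * (cr (\<kappa> z) * cr (\<kappa> z)))) = 0"
   by (simp add: algebra_simps)
  show ?thesis unfolding N_def
   by (rule exI, rule has_wirtinger_cong[OF has_wirtinger_add[OF has_wirtinger_mult[OF wF[OF z] wq[OF z]]
    has_wirtinger_add[OF has_wirtinger_cmul[OF wk[OF z]] has_wirtinger_cmul[OF has_wirtinger_mult[OF wk[OF z] has_wirtinger_mult[OF wk[OF z] wk[OF z]]]]]] refl], rule n0)
 qed
 then obtain A' where A': "\<And>z. z \<in> S ==> has_wirtinger N (A' z) 0 z" by metis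
 have qc: "q z = cr (exp (2 * \<phi> z)) * cnj (F z)" for z
  using arg_cong[OF qF[of z], of cnj] by (simp add: exp_of_real[symmetric] exp_cnj)
 have Fq: "F z * q z = cr (exp (2 * \<phi> z) * (cmod (F z))\<^sup>2)" for z
  unfolding qc of_real_mult complex_norm_square by simp
 have Nr: "Im (N z) = 0" for z unfolding N_def Fq by simp
 obtain c1 where c1: "\<And>z. z \<in> S ==> N z = cr c1"
  using has_wirtinger_real_const[OF S A' Nr] by blast
 show ?thesis
 proof (rule that[OF Fh, of c0 c1])
  fix z assume z: "z \<in> S"
  have e: "2 * q z = 2 * exp (2 * \<phi> z) * cnj (F z)" using qc[of z] by simp
  show "(\<kappa> has_derivative (\<lambda>d. Re (2 * exp (2 * \<phi> z) * cnj (F z) * d))) (at z)"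
   using has_derivative_grad_z[OF diff(2)[OF z]] unfolding e[unfolded q_def] .
  have "cr (exp (2 * \<phi> z) * (cmod (F z))\<^sup>2 - (- ((\<kappa> z) ^ 3) / 12 + c0 * \<kappa> z + c1)) = 0"
   using c1[OF z] unfolding N_def Fq by (simp add: power3_eq_cube algebra_simps)
  then have "exp (2 * \<phi> z) * (cmod (F z))\<^sup>2 - (- ((\<kappa> z) ^ 3) / 12 + c0 * \<kappa> z + c1) = 0" by (simp only: of_real_eq_0_iff)
  then show "exp (2 * \<phi> z) * (cmod (F z))\<^sup>2 = - ((\<kappa> z) ^ 3) / 12 + c0 * \<kappa> z + c1" by simp
 qed
qed

section \<open>The curvature cubic\<close>

text \<open>Evaluated at the curvature it is a quarter of the squared length of the gradient of the
  curvature, so it is positive off the critical points.\<close>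

definition cubic :: "real => real => real => real" where
 "cubic c0 c1 x = - (x ^ 3) / 12 + c0 * x + c1"

lemma cubic_deriv: "(cubic c0 c1 has_real_derivative c0 - x\<^sup>2 / 4) (at x)"
 unfolding cubic_def[abs_def]
 by (auto intro!: derivative_eq_intros)

lemma cubic_continuous: "continuous_on S (cubic c0 c1)"
 by (intro continuous_at_imp_continuous_on ballI DERIV_isCont[OF cubic_deriv])

text \<open>The bound is chosen so that its logarithm is a constant plus
  \<open>2 * ln (1 + x\<^sup>2)\<close>, the quantity that the energy controls on circles.\<close>

lemma cubic_le: "\<exists>C>0. \<forall>x. cubic c0 c1 x \<le> C * (1 + x\<^sup>2)\<^sup>2"
proof (intro exI[of _ "1 + \<bar>c0\<bar> + \<bar>c1\<bar>"] conjI allI)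
 fix x :: real
 let ?q = "(1 + x\<^sup>2)\<^sup>2"
 have q1: "1 \<le> ?q" by (simp add: one_le_power)
 have sq: "1 + x\<^sup>2 \<le> ?q" using self_le_power[of "1 + x\<^sup>2" 2] by simp
 have x1: "\<bar>x\<bar> \<le> 1 + x\<^sup>2"
 proof -
  have "0 \<le> (\<bar>x\<bar> - 1)\<^sup>2" by simp
  then have "2 * \<bar>x\<bar> \<le> 1 + x\<^sup>2" by (simp add: power2_diff)
  then show ?thesis by linarith
 qed
 have "\<bar>x ^ 3\<bar> = \<bar>x\<bar> * x\<^sup>2" by (simp add: power3_eq_cube power2_eq_square abs_mult)
 also have "\<dots> \<le> (1 + x\<^sup>2) * (1 + x\<^sup>2)" using x1 by (intro mult_mono) auto
 finally have 1: "- (x ^ 3) / 12 \<le> ?q" by (simp add: power2_eq_square abs_le_iff)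
 have 2: "c0 * x \<le> \<bar>c0\<bar> * ?q"
 proof -
  have "c0 * x \<le> \<bar>c0\<bar> * \<bar>x\<bar>" by (metis abs_ge_self abs_mult)
  also have "\<dots> \<le> \<bar>c0\<bar> * ?q" using x1 sq by (intro mult_left_mono) auto
  finally show ?thesis .
 qed
 have 3: "c1 \<le> \<bar>c1\<bar> * ?q"
 proof -
  have "\<bar>c1\<bar> * 1 \<le> \<bar>c1\<bar> * ?q" using q1 by (intro mult_left_mono) auto
  then show ?thesis by linarith
 qed
 show "cubic c0 c1 x \<le> (1 + \<bar>c0\<bar> + \<bar>c1\<bar>) * ?q"
  unfolding cubic_def using 1 2 3 by (simp add: distrib_right)
qed auto

text \<open>The lower bound at \<open>- y\<close> makes \<open>1 / G\<close> integrable towards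
  minus infinity; the upper bound at \<open>y\<close> shows that every interval of positivity ends
  on the right.\<close>

lemma cubic_large:
 assumes "12 * (2 + \<bar>c0\<bar> + \<bar>c1\<bar>) \<le> y"
 shows "y\<^sup>2 \<le> cubic c0 c1 (- y)" "cubic c0 c1 y \<le> 0"
proof -
 have y: "1 \<le> y" using assms abs_ge_zero[of c0] abs_ge_zero[of c1] by argo
 have "\<bar>c0\<bar> * y \<le> \<bar>c0\<bar> * y\<^sup>2" using self_le_power[of y 2] y by (intro mult_left_mono) auto
 moreover have "\<bar>c1\<bar> * 1 \<le> \<bar>c1\<bar> * y\<^sup>2" using one_le_power[of y 2] y by (intro mult_left_mono) auto
 moreover have "12 * (2 + \<bar>c0\<bar> + \<bar>c1\<bar>) * y\<^sup>2 \<le> y * y\<^sup>2" using assms by (intro mult_right_mono) auto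
 then have "24 * y\<^sup>2 + 12 * (\<bar>c0\<bar> * y\<^sup>2) + 12 * (\<bar>c1\<bar> * y\<^sup>2) \<le> y ^ 3"
  by (simp add: power3_eq_cube power2_eq_square algebra_simps)
 moreover have "c0 * y \<le> \<bar>c0\<bar> * y" "- (c0 * y) \<le> \<bar>c0\<bar> * y"
  using mult_right_mono[of c0 "\<bar>c0\<bar>" y] mult_right_mono[of "- c0" "\<bar>c0\<bar>" y] y by auto
 moreover have "c1 \<le> \<bar>c1\<bar>" "- c1 \<le> \<bar>c1\<bar>" by auto
 moreover have "0 \<le> y\<^sup>2" by simp
 moreover have "cubic c0 c1 (- y) = y ^ 3 / 12 - c0 * y + c1" "cubic c0 c1 y = - (y ^ 3) / 12 + c0 * y + c1"
  by (simp_all add: cubic_def)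
 ultimately show "y\<^sup>2 \<le> cubic c0 c1 (- y)" "cubic c0 c1 y \<le> 0"
  by linarith+
qed

text \<open>The positivity interval around \<open>X\<close> always has a right end, since the
  leading coefficient is negative, but on the left it may extend to minus infinity; hence the two
  alternatives.\<close>

lemma cubic_component:
 assumes X: "connected X" "X \<noteq> {}" and pos: "\<And>x. x \<in> X ==> 0 < cubic c0 c1 x"
 shows "(\<exists>a b. X \<subseteq> {a<..<b} \<and> a < b \<and> (\<forall>x\<in>{a<..<b}. 0 < cubic c0 c1 x) \<and> cubic c0 c1 a = 0 \<and> cubic c0 c1 b = 0)
  \<or> (\<exists>b. X \<subseteq> {..<b} \<and> (\<forall>x\<in>{..<b}. 0 < cubic c0 c1 x))"
proof -
 let ?G = "cubic c0 c1"
 have isC: "isCont ?G x" for x by (rule DERIV_isCont[OF cubic_deriv])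
 obtain x0 where x0: "x0 \<in> X" using X by blast
 have between: "z \<in> X" if "x \<in> X" "y \<in> X" "x \<le> z" "z \<le> y" for x y z
  using X(1) that unfolding connected_iff_interval by blast
 have clo: "closed {x. ?G x \<le> 0}"
  by (intro closed_Collect_le continuous_on_const cubic_continuous)
 define U where "U = {x. x0 \<le> x \<and> ?G x \<le> 0}"
 define b where "b = Inf U"
 have Une: "U \<noteq> {}"
 proof -
  define y where "y = max x0 (12 * (2 + \<bar>c0\<bar> + \<bar>c1\<bar>))"
  have "y \<in> U" using cubic_large(2)[of c0 c1 y] by (auto simp: U_def y_def)
  then show ?thesis by blast
 qed
 have Ubd: "bdd_below U" by (auto simp: U_def intro: bdd_belowI)
 have "closed U"
 proof -
  have "U = {x0..} \<inter> {x. ?G x \<le> 0}" by (auto simp: U_def)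
  then show ?thesis using clo by (simp add: closed_Int)
 qed
 then have bU: "b \<in> U" unfolding b_def using closed_contains_Inf Une Ubd by blast
 have x0b: "x0 < b" using bU pos[OF x0] by (auto simp: U_def less_le)
 have Gr: "0 < ?G x" if "x0 \<le> x" "x < b" for x
  using that cInf_lower[OF _ Ubd, of x] unfolding b_def U_def by force
 have Gb: "?G b = 0"
 proof -
  have "(?G ---> ?G b) (at_left b)" using isC[of b] by (simp add: isCont_def filterlim_at_split)
  then have "0 \<le> ?G b"
   by (rule tendsto_lowerbound) (use x0b Gr in \<open>auto simp: eventually_at_left_field intro!: exI[of _ x0] less_imp_le\<close>)
  then show ?thesis using bU by (simp add: U_def)
 qed
 have Xb: "x < b" if "x \<in> X" for x
 proof (rule ccontr)
  assume "\<not> x < b"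
  then have "b \<in> X" using between[OF x0 that, of b] x0b by simp
  then show False using pos[of b] Gb by simp
 qed
 show ?thesis
 proof (cases "\<exists>x\<le>x0. ?G x \<le> 0")
  case False
  then have "\<forall>x\<in>{..<b}. 0 < ?G x" using Gr by (metis lessThan_iff linear not_le)
  then show ?thesis using Xb by blast
 next
  case True
  define V where "V = {x. x \<le> x0 \<and> ?G x \<le> 0}"
  define a where "a = Sup V"
  have Vne: "V \<noteq> {}" using True by (auto simp: V_def)
  have Vbd: "bdd_above V" by (auto simp: V_def intro: bdd_aboveI)
  have "closed V"
  proof -
   have "V = {..x0} \<inter> {x. ?G x \<le> 0}" by (auto simp: V_def)
   then show ?thesis using clo by (simp add: closed_Int)
  qed
  then have aV: "a \<in> V" unfolding a_def using closed_contains_Sup Vne Vbd by blast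
  have ax0: "a < x0" using aV pos[OF x0] by (auto simp: V_def less_le)
  have Gl: "0 < ?G x" if "a < x" "x \<le> x0" for x
   using that cSup_upper[OF _ Vbd, of x] unfolding a_def V_def by force
  have Ga: "?G a = 0"
  proof -
   have "(?G ---> ?G a) (at_right a)" using isC[of a] by (simp add: isCont_def filterlim_at_split)
   then have "0 \<le> ?G a"
    by (rule tendsto_lowerbound) (use ax0 Gl in \<open>auto simp: eventually_at_right_field intro!: exI[of _ x0] less_imp_le\<close>)
   then show ?thesis using aV by (simp add: V_def)
  qed
  have "a < x" if "x \<in> X" for x
  proof (rule ccontr)
   assume "\<not> a < x"
   then have "a \<in> X" using between[OF that x0, of a] ax0 by simp
   then show False using pos[of a] Ga by simp
  qed
  moreover have "\<forall>x\<in>{a<..<b}. 0 < ?G x" using Gl Gr by (metis greaterThanLessThan_iff linear)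
  ultimately show ?thesis using Xb Ga Gb ax0 x0b by (intro disjI1 exI[of _ a] exI[of _ b]) auto
 qed
qed

lemma primitive_on_interval:
 fixes f :: "real => real"
 assumes J: "open J" "connected J" and f: "continuous_on J f"
 obtains h where "\<And>x. x \<in> J ==> (h has_real_derivative f x) (at x)"
proof (cases "J = {}")
 case True then show ?thesis using that by blast
next
 case False
 then obtain x0 where x0: "x0 \<in> J" by blast
 define h where "h = (\<lambda>u::real. LBINT y=ereal x0..ereal u. f y)"
 have between: "z \<in> J" if "x \<in> J" "y \<in> J" "x \<le> z" "z \<le> y" for x y z
  using J(2) that unfolding connected_iff_interval by blast
 have "(h has_real_derivative f x) (at x)" if x: "x \<in> J" for x
 proof -
  obtain e where e: "0 < e" "cball x e \<subseteq> J" using J(1) x open_contains_cball by blast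
  then have xe: "x - e \<in> J" "x + e \<in> J" by (auto simp: dist_real_def)
  define a where "a = min x0 (x - e)"
  define b where "b = max x0 (x + e)"
  have ab: "a \<in> J" "b \<in> J" using xe x0 by (auto simp: a_def b_def min_def max_def)
  have sub: "{a..b} \<subseteq> J" using between[OF ab] by auto
  have "((\<lambda>u. LBINT y=ereal x0..ereal u. f y) has_vector_derivative f x) (at x within {a..b})"
   by (rule interval_integral_FTC2) (use e continuous_on_subset[OF f sub] in \<open>auto simp: a_def b_def\<close>)
  moreover have "at x within {a..b} = at x"
   by (rule at_within_interior) (use e in \<open>auto simp: a_def b_def\<close>)
  ultimately show ?thesis by (simp add: h_def has_real_derivative_iff_has_vector_derivative)
 qed
 then show ?thesis using that by blast
qed

text \<open>There is no quadratic term, so the three roots add up to 0 and the third one is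
  \<open>- (a + b)\<close>.\<close>

lemma cubic_two_roots:
 assumes "cubic c0 c1 a = 0" "cubic c0 c1 b = 0" "a < b"
 shows "cubic c0 c1 x = (x - a) * (b - x) * (x + a + b) / 12"
  and "c0 = (a\<^sup>2 + a * b + b\<^sup>2) / 12"
proof -
 have "(b - a) * (c0 - (a\<^sup>2 + a * b + b\<^sup>2) / 12) = cubic c0 c1 b - cubic c0 c1 a"
  by (simp add: cubic_def power2_eq_square power3_eq_cube field_simps)
 then show c0: "c0 = (a\<^sup>2 + a * b + b\<^sup>2) / 12" using assms by simp
 have c1: "c1 = a ^ 3 / 12 - c0 * a" using assms(1) by (simp add: cubic_def)
 show "cubic c0 c1 x = (x - a) * (b - x) * (x + a + b) / 12"
  unfolding cubic_def c1 c0 by (simp add: power2_eq_square power3_eq_cube field_simps)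
qed

text \<open>Positivity between \<open>a\<close> and \<open>b\<close> forces the third root
  \<open>- (a + b)\<close> to lie at or below \<open>a\<close>. Equality,
  \<open>2 * a + b = 0\<close>, is a double root at \<open>a\<close>: the case of cusps.\<close>

lemma cubic_positive_sum:
 assumes "cubic c0 c1 a = 0" "cubic c0 c1 b = 0" "a < b" and pos: "\<And>x. x \<in> {a<..<b} ==> 0 < cubic c0 c1 x"
 shows "0 \<le> 2 * a + b" "0 < a + b" "0 < 2 * b + a"
proof -
 have *: "0 < x + a + b" if "x \<in> {a<..<b}" for x
 proof -
  have "0 < (x - a) * (b - x) * (x + a + b)"
   using pos[OF that] unfolding cubic_two_roots(1)[OF assms(1-3), of x] by simp
  moreover have "0 < (x - a) * (b - x)" using that by simp
  ultimately show ?thesis by (simp only: zero_less_mult_pos)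
 qed
 have "((\<lambda>x. x + a + b) ---> a + a + b) (at_right a)" by (intro tendsto_intros)
 then have "0 \<le> a + a + b"
  by (rule tendsto_lowerbound) (use * \<open>a < b\<close> in \<open>auto simp: eventually_at_right_field intro!: exI[of _ b] less_imp_le\<close>)
 then show "0 \<le> 2 * a + b" by simp
 then show "0 < a + b" "0 < 2 * b + a" using \<open>a < b\<close> by linarith+
qed

text \<open>\<open>b\<close> is a simple root, so \<open>h\<close> grows there at most like a
  logarithm, which yields the bound by \<open>C * (C - ln G)\<close>. At \<open>a\<close>, possibly
  a double root, \<open>h\<close> only has to be bounded above, and this is monotonicity. Linear
  upper bounds on \<open>G\<close> at both ends make \<open>1 / G\<close> non-integrable there, so
  \<open>h\<close> is onto.\<close>

lemma cubic_primitive_bounded: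
 assumes ab: "cubic c0 c1 a = 0" "cubic c0 c1 b = 0" "a < b" and pos: "\<And>x. x \<in> {a<..<b} ==> 0 < cubic c0 c1 x"
 obtains h where "\<And>x. x \<in> {a<..<b} ==> (h has_real_derivative 1 / cubic c0 c1 x) (at x)"
  "\<exists>C\<ge>0. \<forall>x\<in>{a<..<b}. h x \<le> C * (C - ln (cubic c0 c1 x)) \<and> ln (cubic c0 c1 x) \<le> C"
  "\<And>y. \<exists>x\<in>{a<..<b}. h x = y"
proof -
 let ?G = "cubic c0 c1"
 have "continuous_on {a<..<b} (\<lambda>x. 1 / ?G x)"
  by (intro continuous_intros cubic_continuous) (use pos in force)
 then obtain h where h: "\<And>x. x \<in> {a<..<b} ==> (h has_real_derivative 1 / ?G x) (at x)"
  using primitive_on_interval[of "{a<..<b}" "\<lambda>x. 1 / ?G x"] by (metis connected_Ioo open_greaterThanLessThan)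
 note roots = cubic_two_roots(1)[OF ab]
 note sums = cubic_positive_sum[OF ab pos]
 define m where "m = (a + b) / 2"
 have m: "a < m" "m < b" using ab by (auto simp: m_def)
 \<comment> \<open>\<open>M\<close> bounds \<open>G\<close> by a linear function at both ends;
   \<open>D\<close> is the reciprocal of a lower bound of \<open>(x - a) * (x + a + b) / 12\<close>
   on the right half \<open>m \<le> x\<close>.\<close>
 define M where "M = (b - a) * (2 * b + a) / 12"
 have M: "0 < M" using ab sums by (simp add: M_def)
 define D where "D = 12 / ((b - a) / 2 * (3 * (a + b) / 2))"
 have D: "0 < D" using ab sums by (simp add: D_def)
 have GM: "?G x \<le> M * (b - x)" "?G x \<le> M * (x - a)" if "x \<in> {a<..<b}" for x
 proof -
  have "(x - a) * (x + a + b) \<le> (b - a) * (2 * b + a)" using that sums by (intro mult_mono) auto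
  then have "(x - a) * (x + a + b) / 12 * (b - x) \<le> M * (b - x)" unfolding M_def
   using that by (intro mult_right_mono) auto
  then show "?G x \<le> M * (b - x)" unfolding roots by (simp add: mult_ac)
  have "(b - x) * (x + a + b) \<le> (b - a) * (2 * b + a)" using that sums by (intro mult_mono) auto
  then have "(b - x) * (x + a + b) / 12 * (x - a) \<le> M * (x - a)" unfolding M_def
   using that by (intro mult_right_mono) auto
  then show "?G x \<le> M * (x - a)" unfolding roots by (simp add: mult_ac)
 qed
 have GD: "1 / ?G x \<le> D / (b - x)" if "x \<in> {a<..<b}" "m \<le> x" for x
 proof -
  have "(b - a) / 2 * (3 * (a + b) / 2) \<le> (x - a) * (x + a + b)"
   using that sums ab by (intro mult_mono) (auto simp: m_def)
  then have "12 / ((x - a) * (x + a + b)) \<le> D" unfolding D_def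
   using ab sums that by (intro divide_left_mono) auto
  then have "12 / ((x - a) * (x + a + b)) / (b - x) \<le> D / (b - x)"
   using that by (intro divide_right_mono) auto
  then show ?thesis unfolding roots by (simp add: mult_ac)
 qed
 have upper: "h x \<le> h m + D * (ln (b - m) - ln (b - x))" if x: "x \<in> {a<..<b}" "m \<le> x" for x
 proof -
  have "h x + D * ln (b - x) \<le> h m + D * ln (b - m)"
  proof (rule DERIV_nonpos_imp_nonincreasing[OF x(2)])
   fix y assume y: "m \<le> y" "y \<le> x"
   then have yJ: "y \<in> {a<..<b}" using x m by auto
   have "((\<lambda>x. h x + D * ln (b - x)) has_real_derivative 1 / ?G y + D * (- 1 / (b - y))) (at y)"
    by (rule derivative_eq_intros h[OF yJ] refl | use yJ in simp)+
   moreover have "1 / ?G y + D * (- 1 / (b - y)) \<le> 0" using GD[OF yJ y(1)] by simp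
   ultimately show "\<exists>d. ((\<lambda>x. h x + D * ln (b - x)) has_real_derivative d) (at y) \<and> d \<le> 0" by blast
  qed
  then show ?thesis by (simp add: algebra_simps)
 qed
 have lower: "h x \<ge> h m + 1 / M * (ln (b - m) - ln (b - x))" if x: "x \<in> {a<..<b}" "m \<le> x" for x
 proof -
  have "h m + 1 / M * ln (b - m) \<le> h x + 1 / M * ln (b - x)"
  proof (rule DERIV_nonneg_imp_nondecreasing[OF x(2)])
   fix y assume y: "m \<le> y" "y \<le> x"
   then have yJ: "y \<in> {a<..<b}" using x m by auto
   have "((\<lambda>x. h x + 1 / M * ln (b - x)) has_real_derivative 1 / ?G y + 1 / M * (- 1 / (b - y))) (at y)"
    by (rule derivative_eq_intros h[OF yJ] refl | use yJ in simp)+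
   moreover have "1 / (M * (b - y)) \<le> 1 / ?G y" using GM(1)[OF yJ] pos[OF yJ] yJ M by (intro divide_left_mono) auto
   ultimately show "\<exists>d. ((\<lambda>x. h x + 1 / M * ln (b - x)) has_real_derivative d) (at y) \<and> 0 \<le> d"
    by (intro exI conjI) auto
  qed
  then show ?thesis by (simp add: algebra_simps)
 qed
 have left: "h x \<le> h m - 1 / M * (ln (m - a) - ln (x - a))" if x: "x \<in> {a<..<b}" "x \<le> m" for x
 proof -
  have "h x - 1 / M * ln (x - a) \<le> h m - 1 / M * ln (m - a)"
  proof (rule DERIV_nonneg_imp_nondecreasing[OF x(2)])
   fix y assume y: "x \<le> y" "y \<le> m"
   then have yJ: "y \<in> {a<..<b}" using x m by auto
   have "((\<lambda>x. h x - 1 / M * ln (x - a)) has_real_derivative 1 / ?G y - 1 / M * (1 / (y - a))) (at y)"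
    by (rule derivative_eq_intros h[OF yJ] refl | use yJ in simp)+
   moreover have "1 / (M * (y - a)) \<le> 1 / ?G y" using GM(2)[OF yJ] pos[OF yJ] yJ M by (intro divide_left_mono) auto
   ultimately show "\<exists>d. ((\<lambda>x. h x - 1 / M * ln (x - a)) has_real_derivative d) (at y) \<and> 0 \<le> d"
    by (intro exI conjI) auto
  qed
  then show ?thesis by (simp add: algebra_simps)
 qed
 have lnG: "ln (?G x) \<le> ln M + ln (b - x)" if "x \<in> {a<..<b}" for x
 proof -
  have "ln (?G x) \<le> ln (M * (b - x))" using GM(1)[OF that] pos[OF that] by (intro ln_mono) auto
  also have "\<dots> = ln M + ln (b - x)" using M that by (intro ln_mult_pos) auto
  finally show ?thesis .
 qed
 define L where "L = \<bar>ln M\<bar> + \<bar>ln (b - a)\<bar>"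
 define E where "E = \<bar>h m\<bar> + D * \<bar>ln (b - m)\<bar> + D * \<bar>ln M\<bar>"
 have lnL: "ln (?G x) \<le> L" if "x \<in> {a<..<b}" for x
 proof -
  have "ln (b - x) \<le> ln (b - a)" using that by (intro ln_mono) auto
  then show ?thesis using lnG[OF that] unfolding L_def by linarith
 qed
 have hE: "h x \<le> E + D * (L - ln (?G x))" if x: "x \<in> {a<..<b}" for x
 proof (cases "m \<le> x")
  case True
  have "- ln (b - x) \<le> ln M - ln (?G x)" using lnG[OF x] by linarith
  then have "D * (ln (b - m) - ln (b - x)) \<le> D * (\<bar>ln (b - m)\<bar> + (\<bar>ln M\<bar> + (L - ln (?G x))))"
   using D by (intro mult_left_mono) (auto simp: L_def)
  then show ?thesis using upper[OF x True] by (simp add: E_def distrib_left)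
 next
  case False
  have "ln (x - a) \<le> ln (m - a)" using x False by (intro ln_mono) auto
  then have "0 \<le> 1 / M * (ln (m - a) - ln (x - a))" using M by (intro mult_nonneg_nonneg) auto
  then have "h x \<le> h m" using left[OF x] False by linarith
  moreover have "0 \<le> D * (L - ln (?G x))" "0 \<le> D * \<bar>ln (b - m)\<bar>" "0 \<le> D * \<bar>ln M\<bar>" using D lnL[OF x] by auto
  ultimately show ?thesis unfolding E_def by linarith
 qed
 \<comment> \<open>One constant has to serve as factor, as offset and as bound of
   \<open>ln G\<close>; the summand 1 makes the factor at least 1.\<close>
 define C where "C = D + L + E + 1"
 have E0: "0 \<le> E" "0 \<le> L" using D by (auto simp: E_def L_def)
 have bd: "\<exists>C\<ge>0. \<forall>x\<in>{a<..<b}. h x \<le> C * (C - ln (?G x)) \<and> ln (?G x) \<le> C"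
 proof (intro exI[of _ C] conjI ballI)
  show "0 \<le> C" using D E0 by (simp add: C_def)
  fix x assume x: "x \<in> {a<..<b}"
  show "ln (?G x) \<le> C" using lnL[OF x] D E0 by (simp add: C_def)
  have "E \<le> 1 * (C - L)" using D by (simp add: C_def)
  also have "\<dots> \<le> C * (C - L)" using D E0 by (intro mult_right_mono) (auto simp: C_def)
  finally have 1: "E \<le> C * (C - L)" .
  have "D * (L - ln (?G x)) \<le> C * (L - ln (?G x))" using lnL[OF x] E0 by (intro mult_right_mono) (auto simp: C_def)
  then have "h x \<le> C * (C - L) + C * (L - ln (?G x))" using hE[OF x] 1 by linarith
  then show "h x \<le> C * (C - ln (?G x))" by (simp add: algebra_simps)
 qed
 have surj: "\<exists>x\<in>{a<..<b}. h x = y" for y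
 proof -
  \<comment> \<open>The points \<open>x2\<close> and \<open>x1\<close> below are exponentially close
    to the ends, so that the logarithms in \<open>lower\<close> and \<open>left\<close> outweigh
    \<open>\<bar>y - h m\<bar>\<close>.\<close>
  define s where "s = M * \<bar>y - h m\<bar> + \<bar>ln (b - m)\<bar> + \<bar>ln (m - a)\<bar>"
  have sp: "0 \<le> s" using M by (simp add: s_def)
  define x2 where "x2 = b - exp (- s - \<bar>ln (b - m)\<bar>)"
  have x2: "x2 \<in> {a<..<b}" "m \<le> x2"
  proof -
   have "exp (- s - \<bar>ln (b - m)\<bar>) \<le> exp (ln (b - m))"
    unfolding exp_le_cancel_iff using sp by linarith
   then show "m \<le> x2" using m by (simp add: x2_def)
   then show "x2 \<in> {a<..<b}" using m by (auto simp: x2_def)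
  qed
  have "1 / M * (ln (b - m) - ln (b - x2)) \<ge> 1 / M * (M * \<bar>y - h m\<bar>)"
   using M by (intro mult_left_mono) (auto simp: x2_def s_def)
  then have hi: "y \<le> h x2" using lower[OF x2] M by (simp add: abs_if split: if_splits)
  define x1 where "x1 = a + exp (- s - \<bar>ln (m - a)\<bar>)"
  have x1: "x1 \<in> {a<..<b}" "x1 \<le> m"
  proof -
   have "exp (- s - \<bar>ln (m - a)\<bar>) \<le> exp (ln (m - a))"
    unfolding exp_le_cancel_iff using sp by linarith
   then show "x1 \<le> m" using m by (simp add: x1_def)
   then show "x1 \<in> {a<..<b}" using m by (auto simp: x1_def)
  qed
  have "1 / M * (ln (m - a) - ln (x1 - a)) \<ge> 1 / M * (M * \<bar>y - h m\<bar>)"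
   using M by (intro mult_left_mono) (auto simp: x1_def s_def)
  then have lo: "h x1 \<le> y" using left[OF x1] M by (simp add: abs_if split: if_splits)
  have "\<exists>x\<ge>x1. x \<le> x2 \<and> h x = y"
  proof (rule IVT)
   show "h x1 \<le> y" "y \<le> h x2" "x1 \<le> x2" using lo hi x1 x2 by auto
   show "\<forall>x. x1 \<le> x \<and> x \<le> x2 --> isCont h x"
    using x1 x2 by (auto intro!: DERIV_isCont[OF h])
  qed
  then show ?thesis using x1 x2 by force
 qed
 show ?thesis by (rule that[OF h bd surj])
qed

text \<open>Far to the left \<open>G x \<ge> x\<^sup>2\<close>, so there \<open>h\<close> falls
  below its value at \<open>- R\<close> by at most \<open>1 / R\<close>; to the right of
  \<open>- R\<close> it is increasing.\<close>

lemma cubic_primitive_unbounded: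
 assumes pos: "\<And>x. x \<in> {..<b} ==> 0 < cubic c0 c1 x"
 obtains h where "\<And>x. x \<in> {..<b} ==> (h has_real_derivative 1 / cubic c0 c1 x) (at x)"
  "\<exists>C. \<forall>x\<in>{..<b}. - h x \<le> C"
proof -
 let ?G = "cubic c0 c1"
 have "continuous_on {..<b} (\<lambda>x. 1 / ?G x)"
  by (intro continuous_intros cubic_continuous) (use pos in force)
 then obtain h where h: "\<And>x. x \<in> {..<b} ==> (h has_real_derivative 1 / ?G x) (at x)"
  using primitive_on_interval[of "{..<b}" "\<lambda>x. 1 / ?G x"] by (metis connected_Iio open_lessThan)
 define R where "R = max (12 * (2 + \<bar>c0\<bar> + \<bar>c1\<bar>)) (1 - b)"
 have R: "24 \<le> R" "- R < b" "12 * (2 + \<bar>c0\<bar> + \<bar>c1\<bar>) \<le> R" by (auto simp: R_def)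
 have "- h x \<le> \<bar>h (- R)\<bar> + 1" if x: "x < b" for x
 proof (cases "- R \<le> x")
  case True
  have "h (- R) \<le> h x"
  proof (rule DERIV_nonneg_imp_nondecreasing[OF True])
   fix y assume "- R \<le> y" "y \<le> x"
   then have y: "y \<in> {..<b}" using x by auto
   show "\<exists>d. (h has_real_derivative d) (at y) \<and> 0 \<le> d"
    using h[OF y] pos[OF y] by (metis less_imp_le zero_less_divide_1_iff)
  qed
  then show ?thesis by linarith
 next
  case False
  then have xR: "x \<le> - R" by simp
  have "h (- R) + 1 / (- R) \<le> h x + 1 / x"
  proof (rule DERIV_nonpos_imp_nonincreasing[OF xR])
   fix y assume y: "x \<le> y" "y \<le> - R"
   then have yb: "y \<in> {..<b}" "y < 0" using R by auto
   have "((\<lambda>x. h x + 1 / x) has_real_derivative 1 / ?G y + - 1 / y\<^sup>2) (at y)"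
    by (rule derivative_eq_intros h[OF yb(1)] refl | use yb in \<open>simp add: power2_eq_square\<close>)+
   moreover have "y\<^sup>2 \<le> ?G y" using cubic_large(1)[of c0 c1 "- y"] y R by simp
   then have "1 / ?G y + - 1 / y\<^sup>2 \<le> 0" using yb by (simp add: frac_le)
   ultimately show "\<exists>d. ((\<lambda>x. h x + 1 / x) has_real_derivative d) (at y) \<and> d \<le> 0" by blast
  qed
  moreover have "1 / x \<le> 0" using xR R by (simp only: divide_le_0_iff) linarith
  moreover have "1 / R \<le> 1" using R by simp
  moreover have "1 / (- R) = - (1 / R)" by simp
  ultimately show ?thesis by linarith
 qed
 then show ?thesis using that[OF h] by blast
qed

section \<open>Charts of the sphere\<close>

definition plane_dom :: "sphere set => complex set" where
 "plane_dom P = {z. Some z \<notin> P}"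

abbreviation "plane_factor u \<equiv> conf_factor u (Some 0)"

definition plane_curv :: "conf_metric => complex => real" where
 "plane_curv u z = gauss_curvature u (Some z)"

text \<open>\<open>param\<close> with values in the plane. In the chart at infinity the value at 0
  is the default \<open>1 / 0 = 0\<close>, so the function is meant for punctured disks.\<close>

fun chart_pt :: "sphere => complex => complex" where
 "chart_pt (Some a) \<zeta> = a + \<zeta>"
| "chart_pt None \<zeta> = 1 / \<zeta>"

fun chart_der :: "sphere => complex => complex" where
 "chart_der (Some a) \<zeta> = 1"
| "chart_der None \<zeta> = - 1 / \<zeta>\<^sup>2"

lemma param_chart_pt: "\<zeta> \<noteq> 0 ==> param x \<zeta> = Some (chart_pt x \<zeta>)"
 by (cases x) auto

lemma chart_pt_deriv: "\<zeta> \<noteq> 0 ==> (chart_pt x has_field_derivative chart_der x \<zeta>) (at \<zeta>)"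
proof (cases x)
 case None
 assume "\<zeta> \<noteq> 0"
 then have "((\<lambda>\<zeta>. 1 / \<zeta>) has_field_derivative - 1 / \<zeta>\<^sup>2) (at \<zeta>)"
  by (auto intro!: derivative_eq_intros simp: power2_eq_square)
 moreover have "chart_pt None = (\<lambda>\<zeta>. 1 / \<zeta>)" by (rule ext) simp
 ultimately show ?thesis using None by simp
next
 case (Some a)
 have "chart_pt (Some a) = (\<lambda>\<zeta>. a + \<zeta>)" by (rule ext) simp
 then show ?thesis using Some by (auto intro!: derivative_eq_intros)
qed

lemma chart_der_nz: "\<zeta> \<noteq> 0 ==> chart_der x \<zeta> \<noteq> 0"
 by (cases x) auto

lemma chart_pt_inj: "\<zeta> \<noteq> 0 ==> \<xi> \<noteq> 0 ==> chart_pt x \<zeta> = chart_pt x \<xi> \<longleftrightarrow> \<zeta> = \<xi>"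
 by (cases x) auto

lemma conf_factor_shift: "conf_factor u (Some a) = (\<lambda>\<zeta>. plane_factor u (a + \<zeta>))"
 by (rule ext) (simp add: conf_factor_def)

lemma conf_factor_chart:
 assumes "\<zeta> \<noteq> 0"
 shows "conf_factor u x \<zeta> = plane_factor u (chart_pt x \<zeta>) + ln (cmod (chart_der x \<zeta>))"
proof (cases x)
 case None
 have "cmod (- 1 / \<zeta>\<^sup>2) = 1 / (cmod \<zeta>)\<^sup>2" by (simp only: norm_divide norm_power norm_minus_cancel norm_one)
 then show ?thesis unfolding None chart_pt.simps chart_der.simps
  using conf_factor_at_infinity[OF assms, of u] by (simp only:)
next
 case (Some a)
 then show ?thesis by (simp only: conf_factor_shift[of u a] chart_pt.simps chart_der.simps norm_one ln_one add_0_right)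
qed

lemma plane_curv_eq:
 "plane_curv u z = - exp (- 2 * plane_factor u z) * laplacian (plane_factor u) z"
 by (simp add: plane_curv_def gauss_curvature_def conf_factor_shift[of u z] laplacian_shift)

lemma open_plane_dom: "finite P ==> open (plane_dom P)"
 and connected_plane_dom: "finite P ==> connected (plane_dom P)"
 and finite_plane_compl: "finite P ==> finite (- plane_dom P)"
proof -
 assume P: "finite P"
 have "- plane_dom P = Some -` P" by (auto simp: plane_dom_def)
 then show f: "finite (- plane_dom P)" using finite_vimageI[OF P, of Some] by simp
 have e: "plane_dom P = UNIV - (- plane_dom P)" by auto
 show "open (plane_dom P)" using f finite_imp_closed by (metis closed_def double_complement)
 have "connected (UNIV - (- plane_dom P))"
  by (rule connected_open_diff_countable) (use f in \<open>auto intro: countable_finite\<close>)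
 then show "connected (plane_dom P)" using e by simp
qed

lemma Ck_on_plane_factor:
 assumes "conformal_metric u P" shows "Ck_on n (plane_dom P) (plane_factor u)"
proof (rule Ck_on_local)
 show "open (plane_dom P)" using assms open_plane_dom by (simp add: conformal_metric_def)
 fix z assume "z \<in> plane_dom P"
 then obtain e where "e > 0" "smooth_on (ball 0 e) (conf_factor u (Some z))"
  using assms by (auto simp: conformal_metric_def plane_dom_def)
 then have "Ck_on n (ball z e) (plane_factor u)" "z \<in> ball z e"
  using Ck_on_shift[of n e "plane_factor u" z] by (auto simp: smooth_on_def conf_factor_shift[of u z])
 then show "\<exists>T. open T \<and> z \<in> T \<and> Ck_on n T (plane_factor u)" by blast
qed

lemma has_wirtinger_compose:
 assumes "has_wirtinger g A B (h z)" "(h has_field_derivative c) (at z)"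
 shows "has_wirtinger (\<lambda>z. g (h z)) (A * c) (B * cnj c) z"
proof -
 have "((\<lambda>z. g (h z)) has_derivative (\<lambda>d. A * (c * d) + B * cnj (c * d))) (at z)"
  by (rule has_derivative_compose[OF assms(2)[unfolded has_field_derivative_def] assms(1)[unfolded has_wirtinger_def]])
 then show ?thesis unfolding has_wirtinger_def by (rule has_derivative_eq_rhs) (simp add: fun_eq_iff)
qed

lemma has_wirtinger_unique: "has_wirtinger f A B z ==> has_wirtinger f A' B' z ==> A = A' \<and> B = B'"
proof -
 assume a: "has_wirtinger f A B z" "has_wirtinger f A' B' z"
 then have e: "(\<lambda>d. A * d + B * cnj d) = (\<lambda>d. A' * d + B' * cnj d)"
  unfolding has_wirtinger_def by (rule has_derivative_unique)
 have 1: "A + B = A' + B'" using fun_cong[OF e, of 1] by simp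
 have "\<i> * (A - B) = \<i> * (A' - B')" using fun_cong[OF e, of \<i>] by (simp add: algebra_simps)
 then have 2: "A - B = A' - B'" by simp
 have "2 * A = 2 * A'" using arg_cong2[OF 1 2, of "(+)"] by simp
 then show ?thesis using 1 by simp
qed

lemma grad_z_unique:
 assumes "f differentiable (at z)" "(f has_derivative (\<lambda>d. Re (P * d))) (at z)"
 shows "2 * grad_z f z = P"
proof -
 have e: "(\<lambda>d. Re (2 * grad_z f z * d)) = (\<lambda>d. Re (P * d))"
  by (rule has_derivative_unique[OF has_derivative_grad_z[OF assms(1)] assms(2)])
 show ?thesis using fun_cong[OF e, of 1] fun_cong[OF e, of \<i>] by (simp add: complex_eq_iff)
qed

text \<open>The curvature at infinity is computed in the coordinate \<open>1 / z\<close>, so its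
  continuity with the plane has to be proved. The two conformal factors differ by
  \<open>ln (cmod (1 / w\<^sup>2))\<close>, which is harmonic; the Laplacians therefore agree up to
  \<open>1 / (cmod \<zeta>) ^ 4\<close>, and the exponential compensates for that.\<close>

lemma curvature_at_infinity:
 assumes u: "conformal_metric u P" and inf: "None \<notin> P"
 shows "((\<lambda>\<zeta>. plane_curv u (1 / \<zeta>)) ---> gauss_curvature u None) (at 0)"
proof -
 let ?f = "conf_factor u None" and ?g = "plane_factor u"
 obtain e where e: "e > 0" "smooth_on (ball 0 e) ?f"
  using u inf by (auto simp: conformal_metric_def)
 have f2: "Ck_on 2 (ball 0 e) ?f" "Ck_on 4 (ball 0 e) ?f" using e by (auto simp: smooth_on_def)
 have fin: "finite P" using u by (simp add: conformal_metric_def)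
 have g2: "Ck_on 2 (plane_dom P) ?g" by (rule Ck_on_plane_factor[OF u])
 have lapc: "continuous_on (ball 0 e) (laplacian ?f)"
  using f2(1) unfolding laplacian_def[abs_def] by (intro continuous_intros) (auto simp: numeral_2_eq_2)
 have fc: "continuous_on (ball 0 e) ?f"
 proof -
  have "Ck_on (Suc (Suc 0)) (ball 0 e) ?f" using f2(1) by (simp only: numeral_2_eq_2)
  from Ck_on_SucD[OF Ck_on_SucD[OF this]] show ?thesis by simp
 qed
 have "finite (insert 0 ((\<lambda>z. 1 / z) ` (- plane_dom P)))" using finite_plane_compl[OF fin] by simp
 from finite_set_avoid[OF this, of 0] obtain d where d: "0 < d"
  "\<And>x. x \<in> insert 0 ((\<lambda>z. 1 / z) ` (- plane_dom P)) ==> x \<noteq> 0 ==> d \<le> dist 0 x" by blast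
 have key: "plane_curv u (1 / \<zeta>) = - exp (- 2 * ?f \<zeta>) * laplacian ?f \<zeta>" if z: "\<zeta> \<noteq> 0" "cmod \<zeta> < min d e" for \<zeta>
 proof -
  let ?S = "annulus 0 (min d e)"
  have S: "open ?S" "\<zeta> \<in> ?S" by (rule open_annulus) (use z in \<open>simp add: annulus_def\<close>)
  have dom: "1 / w \<in> plane_dom P" "w \<noteq> 0" "w \<in> ball 0 e" if "w \<in> ?S" for w
  proof -
   show w0: "w \<noteq> 0" "w \<in> ball 0 e" using that by (auto simp: annulus_def)
   show "1 / w \<in> plane_dom P"
   proof (rule ccontr)
    assume "1 / w \<notin> plane_dom P"
    then have "w \<in> insert 0 ((\<lambda>z. 1 / z) ` (- plane_dom P))" by (auto intro!: image_eqI[of _ _ "1 / w"])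
    from d(2)[OF this w0(1)] that show False by (simp add: annulus_def)
   qed
  qed
  have inv: "((\<lambda>w. 1 / w) has_field_derivative - 1 / w\<^sup>2) (at w)" if "w \<noteq> 0" for w :: complex
   using that by (auto intro!: derivative_eq_intros simp: power2_eq_square)
  have dg: "?g differentiable (at w)" if "w \<in> plane_dom P" for w using g2 that by (auto simp: numeral_2_eq_2)
  have df: "?f differentiable (at w)" if "w \<in> ball 0 e" for w using f2(1) that by (auto simp: numeral_2_eq_2)
  have grad: "grad_z ?f w = grad_z ?g (1 / w) * (- 1 / w\<^sup>2) + - 1 / w" if w: "w \<in> ?S" for w
  proof -
   have "(?f has_derivative (\<lambda>d. Re (2 * grad_z ?g (1 / w) * ((- 1 / w\<^sup>2) * d)) + Re (- 2 / w * d))) (at w)"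
   proof (rule has_derivative_transform_within_open[OF _ S(1) w])
    have "((\<lambda>w. ln (cmod (1 / w\<^sup>2))) has_derivative (\<lambda>d. Re (- 2 / w * d))) (at w)"
    proof -
     have "((\<lambda>w. 1 / w\<^sup>2) has_field_derivative - 2 / w ^ 3) (at w)"
      using dom(2)[OF w] by (auto intro!: derivative_eq_intros simp: power2_eq_square power3_eq_cube field_simps)
     from ln_norm_has_derivative[OF this] dom(2)[OF w]
     show ?thesis by (simp add: power2_eq_square power3_eq_cube)
    qed
    then show "((\<lambda>w. ?g (1 / w) + ln (cmod (1 / w\<^sup>2))) has_derivative (\<lambda>d. Re (2 * grad_z ?g (1 / w) * ((- 1 / w\<^sup>2) * d)) + Re (- 2 / w * d))) (at w)"
     by (intro has_derivative_add has_derivative_compose[OF inv[OF dom(2)[OF w], unfolded has_field_derivative_def] has_derivative_grad_z[OF dg[OF dom(1)[OF w]]]])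
    fix v assume v: "v \<in> ?S"
    show "?g (1 / v) + ln (cmod (1 / v\<^sup>2)) = ?f v"
     using conf_factor_at_infinity[OF dom(2)[OF v], of u] by (simp add: norm_divide norm_power)
   qed
   then have "(?f has_derivative (\<lambda>d. Re ((2 * grad_z ?g (1 / w) * (- 1 / w\<^sup>2) + - 2 / w) * d))) (at w)"
    by (rule has_derivative_eq_rhs) (simp add: fun_eq_iff algebra_simps)
   from grad_z_unique[OF df[OF dom(3)[OF w]] this] have "2 * grad_z ?f w = 2 * (grad_z ?g (1 / w) * (- 1 / w\<^sup>2) + - 1 / w)"
    by (simp add: algebra_simps)
   then show ?thesis by (simp only: mult_cancel_left) simp
  qed
  note z0 = dom[OF S(2)]
  have hol2: "((\<lambda>w::complex. - 1 / w\<^sup>2) has_field_derivative 2 / \<zeta> ^ 3) (at \<zeta>)" "((\<lambda>w::complex. - 1 / w) has_field_derivative 1 / \<zeta>\<^sup>2) (at \<zeta>)"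
   using z0 by (auto intro!: derivative_eq_intros simp: power2_eq_square power3_eq_cube field_simps)
  have "has_wirtinger (\<lambda>w. grad_z ?g (1 / w) * (- 1 / w\<^sup>2) + - 1 / w)
   ((grad_z ?g (1 / \<zeta>) * (2 / \<zeta> ^ 3) + (d_z (grad_z ?g) (1 / \<zeta>) * (- 1 / \<zeta>\<^sup>2)) * (- 1 / \<zeta>\<^sup>2)) + 1 / \<zeta>\<^sup>2)
   ((grad_z ?g (1 / \<zeta>) * 0 + (cr (laplacian ?g (1 / \<zeta>) / 4) * cnj (- 1 / \<zeta>\<^sup>2)) * (- 1 / \<zeta>\<^sup>2)) + 0) \<zeta>"
   by (intro has_wirtinger_add has_wirtinger_mult has_wirtinger_compose[OF _ inv[OF z0(2)]]
     has_wirtinger_grad_z[OF open_plane_dom[OF fin] g2 z0(1)] hol2[unfolded has_wirtinger_holomorphic])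
  then have "has_wirtinger (grad_z ?f)
   ((grad_z ?g (1 / \<zeta>) * (2 / \<zeta> ^ 3) + (d_z (grad_z ?g) (1 / \<zeta>) * (- 1 / \<zeta>\<^sup>2)) * (- 1 / \<zeta>\<^sup>2)) + 1 / \<zeta>\<^sup>2)
   ((grad_z ?g (1 / \<zeta>) * 0 + (cr (laplacian ?g (1 / \<zeta>) / 4) * cnj (- 1 / \<zeta>\<^sup>2)) * (- 1 / \<zeta>\<^sup>2)) + 0) \<zeta>"
   by (rule has_wirtinger_transform[OF _ S]) (simp only: grad)
  from has_wirtinger_unique[OF this has_wirtinger_grad_z[OF open_ball f2(1) z0(3)]]
  have "cr (laplacian ?f \<zeta> / 4) = cr (laplacian ?g (1 / \<zeta>) / 4) * (cnj (- 1 / \<zeta>\<^sup>2) * (- 1 / \<zeta>\<^sup>2))"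
   by simp
  also have "cnj (- 1 / \<zeta>\<^sup>2) * (- 1 / \<zeta>\<^sup>2) = cr (1 / (cmod \<zeta>) ^ 4)"
  proof -
   have "cnj (- 1 / \<zeta>\<^sup>2) * (- 1 / \<zeta>\<^sup>2) = (- 1 / \<zeta>\<^sup>2) * cnj (- 1 / \<zeta>\<^sup>2)" by (rule mult.commute)
   also have "\<dots> = cr ((cmod (- 1 / \<zeta>\<^sup>2))\<^sup>2)" by (rule complex_norm_square[symmetric])
   also have "(cmod (- 1 / \<zeta>\<^sup>2))\<^sup>2 = 1 / (cmod \<zeta>) ^ 4" by (simp add: norm_divide norm_power power_divide flip: power_mult)
   finally show ?thesis .
  qed
  finally have "cr (laplacian ?f \<zeta>) = cr (laplacian ?g (1 / \<zeta>) * (1 / (cmod \<zeta>) ^ 4))" by simp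
  then have lap: "laplacian ?f \<zeta> = laplacian ?g (1 / \<zeta>) * (1 / (cmod \<zeta>) ^ 4)" by (simp only: of_real_eq_iff)
  have "exp (- 2 * ?f \<zeta>) = exp (- 2 * ?g (1 / \<zeta>)) * exp (- 2 * ln (1 / (cmod \<zeta>)\<^sup>2))"
   unfolding conf_factor_at_infinity[OF z0(2)] exp_add[symmetric] by (simp add: algebra_simps)
  also have "exp (- 2 * ln (1 / (cmod \<zeta>)\<^sup>2)) = (cmod \<zeta>) ^ 4"
  proof -
   have "- 2 * ln (1 / (cmod \<zeta>)\<^sup>2) = ln ((cmod \<zeta>) ^ 4)" using z0(2) by (simp add: ln_div ln_realpow)
   then show ?thesis using z0(2) by simp
  qed
  finally show ?thesis unfolding plane_curv_eq lap using z0(2) by simp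
 qed
 have "((\<lambda>\<zeta>. - exp (- 2 * ?f \<zeta>) * laplacian ?f \<zeta>) ---> - exp (- 2 * ?f 0) * laplacian ?f 0) (at 0)"
 proof -
  have "isCont ?f 0" "isCont (laplacian ?f) 0" using lapc fc e(1) by (auto simp: continuous_on_eq_continuous_at)
  then show ?thesis unfolding isCont_def by (intro tendsto_intros)
 qed
 then have "((\<lambda>\<zeta>. plane_curv u (1 / \<zeta>)) ---> - exp (- 2 * ?f 0) * laplacian ?f 0) (at 0)"
 proof (rule Lim_transform_eventually)
  show "\<forall>\<^sub>F \<zeta> in at 0. - exp (- 2 * ?f \<zeta>) * laplacian ?f \<zeta> = plane_curv u (1 / \<zeta>)"
   unfolding eventually_at using d(1) e(1) key by (intro exI[of _ "min d e"]) (simp add: dist_norm)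
 qed
 then show ?thesis by (simp add: gauss_curvature_def)
qed

section \<open>The surface with two marked points and its local charts\<close>

locale hcmu_surface =
 fixes u :: conf_metric and p q :: sphere and \<alpha> \<beta> :: real
  and F :: "complex => complex" and c0 c1 :: real
 assumes pq: "p \<noteq> q" and hcmu: "nonCSC_HCMU u [p \<mapsto> \<alpha>, q \<mapsto> \<beta>]"
  and F: "F holomorphic_on plane_dom {p, q}"
  and K_der: "\<And>z. z \<in> plane_dom {p, q} ==>
   (plane_curv u has_derivative (\<lambda>d. Re (2 * exp (2 * plane_factor u z) * cnj (F z) * d))) (at z)"
  and metric_F: "\<And>z. z \<in> plane_dom {p, q} ==>
   exp (2 * plane_factor u z) * (cmod (F z))\<^sup>2 = cubic c0 c1 (plane_curv u z)"

text \<open>The equation is imposed at the centre of the chart of each point. Translating charts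
  turns it into an equation on the whole plane domain, which is connected, so that \<open>c0\<close>
  and \<open>c1\<close> are global constants.\<close>

lemma hcmu_surface_exists:
 assumes "p \<noteq> q" and "nonCSC_HCMU u [p \<mapsto> \<alpha>, q \<mapsto> \<beta>]"
 obtains F c0 c1 where "hcmu_surface u p q \<alpha> \<beta> F c0 c1"
proof -
 have dom: "dom [p \<mapsto> \<alpha>, q \<mapsto> \<beta>] = {p, q}" by auto
 have cm: "conformal_metric u {p, q}" and eq: "HCMU_equation u {p, q}"
  using assms(2) unfolding nonCSC_HCMU_def K_surface_metric_def dom by blast+
 let ?S = "plane_dom {p, q}"
 let ?K = "\<lambda>z. cr (plane_curv u z)" and ?f = "\<lambda>z. cr (plane_factor u z)"
 have eq': "d_z (d_z ?K) z
    - 2 * d_z ?f z * d_z ?K z = 0"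
  if "z \<in> ?S" for z
 proof -
  have "Some z \<notin> {p, q}" using that by (simp add: plane_dom_def)
  then have "let K = (\<lambda>\<zeta>. cr (gauss_curvature u (param (Some z) \<zeta>)));
      \<phi> = (\<lambda>\<zeta>. cr (conf_factor u (Some z) \<zeta>))
    in d_z (d_z K) 0 - 2 * d_z \<phi> 0 * d_z K 0 = 0"
   using eq unfolding HCMU_equation_def by blast
  moreover have "(\<lambda>\<zeta>. cr (gauss_curvature u (param (Some z) \<zeta>))) = (\<lambda>\<zeta>. ?K (z + \<zeta>))"
   by (simp add: plane_curv_def)
  moreover have "(\<lambda>\<zeta>. cr (conf_factor u (Some z) \<zeta>)) = (\<lambda>\<zeta>. ?f (z + \<zeta>))"
   by (simp only: conf_factor_shift[of u z])
  ultimately have "d_z (d_z (\<lambda>\<zeta>. ?K (z + \<zeta>))) 0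
    - 2 * d_z (\<lambda>\<zeta>. ?f (z + \<zeta>)) 0 * d_z (\<lambda>\<zeta>. ?K (z + \<zeta>)) 0 = 0"
   unfolding Let_def by (simp only:)
  moreover have "d_z (\<lambda>\<zeta>. ?K (z + \<zeta>)) = (\<lambda>w. d_z ?K (z + w))"
   "d_z (\<lambda>\<zeta>. ?f (z + \<zeta>)) = (\<lambda>w. d_z ?f (z + w))"
   by (rule d_z_shift)+
  moreover have "d_z (\<lambda>w. d_z ?K (z + w)) = (\<lambda>w. d_z (d_z ?K) (z + w))"
   by (rule d_z_shift)
  ultimately show ?thesis by simp
 qed
 obtain F c0 c1 where F: "F holomorphic_on ?S"
  "\<And>z. z \<in> ?S ==> (plane_curv u has_derivative (\<lambda>d. Re (2 * exp (2 * plane_factor u z) * cnj (F z) * d))) (at z)"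
  "\<And>z. z \<in> ?S ==> exp (2 * plane_factor u z) * (cmod (F z))\<^sup>2 = - ((plane_curv u z) ^ 3) / 12 + c0 * plane_curv u z + c1"
  using hcmu_first_integral[OF open_plane_dom connected_plane_dom Ck_on_plane_factor[OF cm] plane_curv_eq eq'] by blast
 have "hcmu_surface u p q \<alpha> \<beta> F c0 c1"
  by unfold_locales (use assms F in \<open>simp_all add: cubic_def\<close>)
 then show ?thesis using that by blast
qed

context hcmu_surface
begin

abbreviation "\<Omega> \<equiv> plane_dom {p, q}"
abbreviation "\<kappa> \<equiv> plane_curv u"
abbreviation "\<phi> \<equiv> plane_factor u"
abbreviation "G \<equiv> cubic c0 c1"

text \<open>Smooth points receive angle 1, that is \<open>2 * pi\<close>, so that one local analysis
  covers all points of the sphere.\<close>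

definition ang :: "sphere => real" where
 "ang x = (if x = p then \<alpha> else if x = q then \<beta> else 1)"

lemma dom_eq: "dom [p \<mapsto> \<alpha>, q \<mapsto> \<beta>] = {p, q}" by auto

lemma conf: "conformal_metric u {p, q}"
 using hcmu unfolding nonCSC_HCMU_def K_surface_metric_def dom_eq by blast

lemma ang_singular: "x \<in> {p, q} ==> singular_angle_factor u x (ang x)"
 using hcmu pq by (auto simp: nonCSC_HCMU_def K_surface_metric_def dom_eq ang_def)

lemma open_\<Omega>: "open \<Omega>" and connected_\<Omega>: "connected \<Omega>" and finite_\<Omega>: "finite (- \<Omega>)"
 by (simp_all add: open_plane_dom connected_plane_dom finite_plane_compl)

lemma phi_diff: "z \<in> \<Omega> ==> \<phi> differentiable (at z)" and grad_phi_cont: "continuous_on \<Omega> (grad_z \<phi>)"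
proof -
 have C: "Ck_on (Suc 0) \<Omega> \<phi>" by (rule Ck_on_plane_factor[OF conf])
 then show "z \<in> \<Omega> ==> \<phi> differentiable (at z)" by simp
 have "grad_z \<phi> = (\<lambda>z. cr (pd_x \<phi> z / 2) + \<i> * cr (- pd_y \<phi> z / 2))"
  by (rule ext) (simp add: grad_z_def Complex_eq)
 then show "continuous_on \<Omega> (grad_z \<phi>)" using C by (auto intro!: continuous_intros)
qed

lemma kappa_cont: "continuous_on \<Omega> \<kappa>"
 by (intro continuous_at_imp_continuous_on ballI has_derivative_continuous[OF K_der])

lemma phi_cont: "continuous_on \<Omega> \<phi>"
 by (intro continuous_at_imp_continuous_on ballI differentiable_imp_continuous_within phi_diff)

lemma near_point: "\<exists>d>0. \<forall>\<zeta>. 0 < cmod \<zeta> \<and> cmod \<zeta> < d --> chart_pt x \<zeta> \<in> \<Omega>"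
proof -
 have "finite {\<zeta>. \<zeta> \<noteq> 0 \<and> chart_pt x \<zeta> \<notin> \<Omega>}"
 proof (rule inj_on_finite[OF _ _ finite_\<Omega>])
  show "inj_on (chart_pt x) {\<zeta>. \<zeta> \<noteq> 0 \<and> chart_pt x \<zeta> \<notin> \<Omega>}" by (rule inj_onI) (simp add: chart_pt_inj)
 qed auto
 from finite_set_avoid[OF this, of 0] obtain d where d: "0 < d" "\<And>\<zeta>. \<zeta> \<noteq> 0 ==> chart_pt x \<zeta> \<notin> \<Omega> ==> d \<le> cmod \<zeta>"
  by auto
 then show ?thesis by (metis not_le zero_less_norm_iff)
qed

text \<open>Twice the \<open>z\<close>-derivative of the conformal factor in the coordinate
  \<open>v\<close>; the second summand comes from \<open>ln (cmod (deriv z v))\<close>.\<close>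

definition chart_grad :: "(complex => complex) => complex => complex" where
 "chart_grad z v = 2 * grad_z \<phi> (z v) * deriv z v + deriv (deriv z) v / deriv z v"

lemma chart_factor_deriv:
 assumes S: "open S" and z: "z holomorphic_on S" and nz: "\<And>v. v \<in> S ==> deriv z v \<noteq> 0" and im: "z ` S \<subseteq> \<Omega>" and v: "v \<in> S"
 shows "((\<lambda>v. \<phi> (z v) + ln (cmod (deriv z v))) has_derivative (\<lambda>d. Re (chart_grad z v * d))) (at v)"
proof -
 have 1: "((\<lambda>v. \<phi> (z v)) has_derivative (\<lambda>d. Re (2 * grad_z \<phi> (z v) * (deriv z v * d)))) (at v)"
  by (rule has_derivative_compose[OF holomorphic_derivI[OF z S v, unfolded has_field_derivative_def] has_derivative_grad_z[OF phi_diff]])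
   (use im v in blast)
 have 2: "((\<lambda>v. ln (cmod (deriv z v))) has_derivative (\<lambda>d. Re (deriv (deriv z) v / deriv z v * d))) (at v)"
  by (rule ln_norm_has_derivative[OF holomorphic_derivI[OF holomorphic_deriv[OF z S] S v] nz[OF v]])
 show ?thesis
  by (rule has_derivative_eq_rhs[OF has_derivative_add[OF 1 2]]) (simp add: fun_eq_iff chart_grad_def algebra_simps)
qed

lemma chart_grad_cont:
 assumes S: "open S" and z: "z holomorphic_on S" and nz: "\<And>v. v \<in> S ==> deriv z v \<noteq> 0" and im: "z ` S \<subseteq> \<Omega>"
 shows "continuous_on S (chart_grad z)"
proof -
 have c: "continuous_on S z" "continuous_on S (deriv z)" "continuous_on S (deriv (deriv z))"
  using hol_cont holomorphic_deriv[OF _ S] z by blast+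
 show ?thesis unfolding chart_grad_def[abs_def]
  by (intro continuous_intros c continuous_on_compose2[OF grad_phi_cont c(1)]) (use nz im in auto)
qed

text \<open>At a marked point the coordinate is the one in which the angle is given. At any other
  point it is the standard one, where the gradient of the factor is bounded and the angle condition
  therefore holds with value 1. The radius is shrunk until the punctured disk avoids the marked
  points.\<close>

lemma chart:
 obtains h b where "0 < b" "h holomorphic_on ball 0 b" "inj_on h (ball 0 b)" "h 0 = 0"
  "\<And>v. v \<in> annulus 0 b ==> h v \<noteq> 0" "\<And>v. v \<in> annulus 0 b ==> chart_pt x (h v) \<in> \<Omega>"
  "((\<lambda>r. cint (\<lambda>v. Re (chart_grad (\<lambda>v. chart_pt x (h v)) v * v) + 1 - ang x) r) ---> 0) (at_right 0)"
proof -
 obtain d where d: "0 < d" "\<And>\<zeta>. 0 < cmod \<zeta> ==> cmod \<zeta> < d ==> chart_pt x \<zeta> \<in> \<Omega>" using near_point by blast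
 have shrink: "\<exists>b. 0 < b \<and> b \<le> e \<and> (\<forall>v\<in>annulus 0 b. h v \<noteq> 0 \<and> chart_pt x (h v) \<in> \<Omega>)"
  if e: "0 < e" and h: "h holomorphic_on ball 0 e" "inj_on h (ball 0 e)" "h 0 = 0" for h e
 proof -
  have "isCont h 0" using hol_cont[OF h(1)] e by (simp add: continuous_on_eq_continuous_at)
  then obtain s where s: "0 < s" "\<And>v. cmod v < s ==> cmod (h v) < d"
   using d(1) h(3) unfolding continuous_at_eps_delta by (force simp: dist_norm)
  have "h v \<noteq> 0 \<and> chart_pt x (h v) \<in> \<Omega>" if v: "v \<in> annulus 0 (min e s)" for v
  proof -
   have v': "v \<in> ball 0 e" "v \<noteq> 0" "cmod v < s" using v by (auto simp: annulus_def)
   have "h v \<noteq> h 0"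
   proof
    assume "h v = h 0"
    then have "v = 0" by (rule inj_onD[OF h(2)]) (use v' e in auto)
    then show False using v' by simp
   qed
   then have "h v \<noteq> 0" using h(3) by simp
   then show ?thesis using d(2)[of "h v"] s(2)[OF v'(3)] by simp
  qed
  then show ?thesis using e s(1) by (intro exI[of _ "min e s"]) auto
 qed
 let ?z = "\<lambda>h v. chart_pt x (h v)"
 have zprops: "?z h holomorphic_on annulus 0 b \<and> (\<forall>v\<in>annulus 0 b. deriv (?z h) v = chart_der x (h v) * deriv h v)"
  if h: "h holomorphic_on ball 0 b" and nz: "\<And>v. v \<in> annulus 0 b ==> h v \<noteq> 0" for h b
 proof -
  have d: "(?z h has_field_derivative chart_der x (h v) * deriv h v) (at v)" if v: "v \<in> annulus 0 b" for v
   by (rule DERIV_chain2[OF chart_pt_deriv[OF nz[OF v]] holomorphic_derivI[OF h open_ball]]) (use v in \<open>auto simp: annulus_def\<close>)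
  have "?z h holomorphic_on annulus 0 b" using d holomorphic_on_open[OF open_annulus] by blast
  then show ?thesis using DERIV_imp_deriv[OF d] by blast
 qed
 show ?thesis
 proof (cases "x \<in> {p, q}")
  case True
  obtain h e where e: "e > 0" and h: "h holomorphic_on ball 0 e" "inj_on h (ball 0 e)" "h 0 = 0"
   and an: "let \<psi> = (\<lambda>w. conf_factor u x (h w) + ln (cmod (deriv h w))) in
     ((\<lambda>r. 1 / (2 * pi) * integral {0..2 * pi}
        (\<lambda>\<theta>. r * deriv (\<lambda>s. \<psi> (cr s * cis \<theta>)) r + 1 - ang x)) ---> 0) (at_right 0)"
   using ang_singular[OF True] unfolding singular_angle_factor_def by blast
  obtain b where b: "0 < b" "b \<le> e" "\<And>v. v \<in> annulus 0 b ==> h v \<noteq> 0" "\<And>v. v \<in> annulus 0 b ==> ?z h v \<in> \<Omega>"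
   using shrink[OF e h] by blast
  have sub: "ball 0 b \<subseteq> ball (0::complex) e" using b by auto
  have hb: "h holomorphic_on ball 0 b" "inj_on h (ball 0 b)"
   using holomorphic_on_subset[OF h(1) sub] inj_on_subset[OF h(2) sub] by auto
  note zp = zprops[OF hb(1) b(3)]
  have dh: "deriv h v \<noteq> 0" if "v \<in> ball 0 b" for v
   by (rule holomorphic_injective_imp_regular[OF hb(1) open_ball hb(2) that])
  have dz: "deriv (?z h) v \<noteq> 0" if "v \<in> annulus 0 b" for v
   using zp that dh[of v] chart_der_nz[OF b(3)[OF that]] by (auto simp: annulus_def)
  let ?\<psi> = "\<lambda>w. conf_factor u x (h w) + ln (cmod (deriv h w))"
  have psi: "?\<psi> v = \<phi> (?z h v) + ln (cmod (deriv (?z h) v))" if v: "v \<in> annulus 0 b" for v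
  proof -
   have "ln (cmod (deriv (?z h) v)) = ln (cmod (chart_der x (h v)) * cmod (deriv h v))"
    using zp v by (simp add: norm_mult)
   also have "\<dots> = ln (cmod (chart_der x (h v))) + ln (cmod (deriv h v))"
    using chart_der_nz[OF b(3)[OF v]] dh[of v] v by (intro ln_mult_pos) (auto simp: annulus_def)
   finally show ?thesis using conf_factor_chart[OF b(3)[OF v], of u x] by simp
  qed
  have im: "?z h ` annulus 0 b \<subseteq> \<Omega>" using b(4) by auto
  have pd: "(?\<psi> has_derivative (\<lambda>d. Re (chart_grad (?z h) v * d))) (at v)" if v: "v \<in> annulus 0 b" for v
   by (rule has_derivative_transform_within_open[OF chart_factor_deriv[OF open_annulus conjunct1[OF zp] dz im v] open_annulus v])
    (simp_all add: psi)
  have rad: "deriv (\<lambda>s. ?\<psi> (cr s * cis \<theta>)) r = Re (chart_grad (?z h) (cr r * cis \<theta>) * cis \<theta>)"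
   if r: "0 < r" "r < b" for r \<theta>
  proof -
   have i: "cr r * cis \<theta> \<in> annulus 0 b" using r by simp
   have l: "((\<lambda>s. cr s * cis \<theta>) has_derivative (\<lambda>d. cr d * cis \<theta>)) (at r)"
    by (auto intro!: derivative_eq_intros)
   have "((\<lambda>s. ?\<psi> (cr s * cis \<theta>)) has_derivative (\<lambda>d. Re (chart_grad (?z h) (cr r * cis \<theta>) * (cr d * cis \<theta>)))) (at r)"
    by (rule has_derivative_compose[OF l pd[OF i]])
   moreover have "(\<lambda>d. Re (chart_grad (?z h) (cr r * cis \<theta>) * (cr d * cis \<theta>)))
    = (\<lambda>d. Re (chart_grad (?z h) (cr r * cis \<theta>) * cis \<theta>) * d)"
    by (rule ext) (simp add: algebra_simps)
   ultimately have "((\<lambda>s. ?\<psi> (cr s * cis \<theta>)) has_real_derivative Re (chart_grad (?z h) (cr r * cis \<theta>) * cis \<theta>)) (at r)"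
    unfolding has_field_derivative_def by (simp only:)
   then show ?thesis by (rule DERIV_imp_deriv)
  qed
  have "((\<lambda>r. 2 * pi * (1 / (2 * pi) * integral {0..2 * pi}
        (\<lambda>\<theta>. r * deriv (\<lambda>s. ?\<psi> (cr s * cis \<theta>)) r + 1 - ang x))) ---> 2 * pi * 0) (at_right 0)"
   by (rule tendsto_mult_left[OF an[unfolded Let_def]])
  then have "((\<lambda>r. cint (\<lambda>v. Re (chart_grad (?z h) v * v) + 1 - ang x) r) ---> 2 * pi * 0) (at_right 0)"
  proof (rule Lim_transform_eventually)
   have "2 * pi * (1 / (2 * pi) * integral {0..2 * pi} (\<lambda>\<theta>. r * deriv (\<lambda>s. ?\<psi> (cr s * cis \<theta>)) r + 1 - ang x))
     = cint (\<lambda>v. Re (chart_grad (?z h) v * v) + 1 - ang x) r" if r: "0 < r" "r < b" for r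
   proof -
    have "(\<lambda>\<theta>. r * deriv (\<lambda>s. ?\<psi> (cr s * cis \<theta>)) r + 1 - ang x)
     = (\<lambda>\<theta>. Re (chart_grad (?z h) (cr r * cis \<theta>) * (cr r * cis \<theta>)) + 1 - ang x)"
     unfolding rad[OF r] by (rule ext) (simp add: algebra_simps)
    then show ?thesis unfolding cint_def by simp
   qed
   then show "\<forall>\<^sub>F r in at_right 0. 2 * pi * (1 / (2 * pi) * integral {0..2 * pi} (\<lambda>\<theta>. r * deriv (\<lambda>s. ?\<psi> (cr s * cis \<theta>)) r + 1 - ang x))
     = cint (\<lambda>v. Re (chart_grad (?z h) v * v) + 1 - ang x) r"
    unfolding eventually_at_right_field using b(1) by blast
  qed
  then show ?thesis using that[OF b(1) hb h(3) b(3,4)] by simp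
 next
  case False
  obtain e where e: "0 < e" "smooth_on (ball 0 e) (conf_factor u x)"
   using conf False by (auto simp: conformal_metric_def)
  have hh: "(\<lambda>v. v) holomorphic_on ball 0 e" "inj_on (\<lambda>v. v) (ball 0 e)" "(\<lambda>v. v) 0 = (0::complex)"
   by (auto intro: holomorphic_intros)
  obtain b where b: "0 < b" "b \<le> e" "\<And>v. v \<in> annulus 0 b ==> v \<noteq> 0" "\<And>v. v \<in> annulus 0 b ==> ?z (\<lambda>v. v) v \<in> \<Omega>"
   using shrink[OF e(1) hh] by blast
  have sub: "ball 0 b \<subseteq> ball (0::complex) e" using b by auto
  have hb: "(\<lambda>v. v) holomorphic_on ball 0 b" by (intro holomorphic_intros)
  have zp: "?z (\<lambda>v. v) holomorphic_on annulus 0 b" "\<And>v. v \<in> annulus 0 b ==> deriv (?z (\<lambda>v. v)) v = chart_der x v"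
   using zprops[OF hb b(3)] by auto
  have dz: "deriv (?z (\<lambda>v. v)) v \<noteq> 0" if "v \<in> annulus 0 b" for v
   using zp(2)[OF that] chart_der_nz[OF b(3)[OF that]] by simp
  have im: "?z (\<lambda>v. v) ` annulus 0 b \<subseteq> \<Omega>" using b(4) by auto
  have C1: "Ck_on (Suc 0) (ball 0 e) (conf_factor u x)" using e(2) by (auto simp: smooth_on_def)
  have gr: "chart_grad (?z (\<lambda>v. v)) v = 2 * grad_z (conf_factor u x) v" if v: "v \<in> annulus 0 b" for v
  proof -
   have "(conf_factor u x has_derivative (\<lambda>d. Re (chart_grad (?z (\<lambda>v. v)) v * d))) (at v)"
   proof (rule has_derivative_transform_within_open[OF chart_factor_deriv[OF open_annulus zp(1) dz im v] open_annulus v])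
    fix w assume w: "w \<in> annulus 0 b"
    show "\<phi> (?z (\<lambda>v. v) w) + ln (cmod (deriv (?z (\<lambda>v. v)) w)) = conf_factor u x w"
     unfolding zp(2)[OF w] using conf_factor_chart[OF b(3)[OF w], of u x] by simp
   qed
   moreover have "conf_factor u x differentiable (at v)" using C1 v b(2) by (auto simp: annulus_def)
   ultimately show ?thesis by (intro grad_z_unique[symmetric])
  qed
  have "isCont (grad_z (conf_factor u x)) 0"
  proof -
   have "grad_z (conf_factor u x) = (\<lambda>z. cr (pd_x (conf_factor u x) z / 2) + \<i> * cr (- pd_y (conf_factor u x) z / 2))"
    by (rule ext) (simp add: grad_z_def Complex_eq)
   moreover have "isCont (pd_x (conf_factor u x)) 0" "isCont (pd_y (conf_factor u x)) 0"
    using C1 e(1) by (simp_all add: continuous_on_eq_continuous_at)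
   ultimately show ?thesis by (auto intro!: continuous_intros)
  qed
  then have g0: "(grad_z (conf_factor u x) ---> grad_z (conf_factor u x) 0) (at 0)" by (simp add: isCont_def)
  have ax: "ang x = 1" using False by (auto simp: ang_def)
  have "((\<lambda>v. Re (2 * grad_z (conf_factor u x) v * v) + 1 - ang x) ---> Re (2 * grad_z (conf_factor u x) 0 * 0) + 1 - ang x) (at 0)"
   by (intro tendsto_intros g0)
  then have "((\<lambda>v. Re (chart_grad (?z (\<lambda>v. v)) v * v) + 1 - ang x) ---> Re (2 * grad_z (conf_factor u x) 0 * 0) + 1 - ang x) (at 0)"
  proof (rule Lim_transform_eventually)
   show "\<forall>\<^sub>F v in at 0. Re (2 * grad_z (conf_factor u x) v * v) + 1 - ang x = Re (chart_grad (?z (\<lambda>v. v)) v * v) + 1 - ang x"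
    unfolding eventually_at using b(1) gr by (intro exI[of _ b]) (auto simp: annulus_def)
  qed
  then have lim: "((\<lambda>v. Re (chart_grad (?z (\<lambda>v. v)) v * v) + 1 - ang x) ---> 0) (at 0)" by (simp add: ax)
  have ct: "continuous_on (annulus 0 b) (\<lambda>v. Re (chart_grad (?z (\<lambda>v. v)) v * v) + 1 - ang x)"
   by (intro continuous_intros chart_grad_cont zp(1) dz im) auto
  have "(cint (\<lambda>v. Re (chart_grad (?z (\<lambda>v. v)) v * v) + 1 - ang x) ---> 2 * pi * 0) (at_right 0)"
   by (rule cint_tendsto[OF ct lim b(1)])
  then show ?thesis using that[OF b(1) hb _ _ b(3,4)] by simp
 qed
qed

text \<open>Otherwise the curvature would be constant on the plane domain and, by continuity, at
  infinity as well.\<close>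

lemma F_not_zero: "\<exists>z\<in>\<Omega>. F z \<noteq> 0"
proof (rule ccontr)
 assume "\<not> ?thesis"
 then have F0: "\<And>z. z \<in> \<Omega> ==> F z = 0" by blast
 have "\<exists>z0. z0 \<in> \<Omega>"
 proof (rule ccontr)
  assume "\<nexists>z0. z0 \<in> \<Omega>"
  then have "finite (UNIV :: complex set)" using finite_\<Omega> by (metis ComplI finite_subset subsetI)
  then show False by (simp add: infinite_UNIV_char_0)
 qed
 then obtain z0 where z0: "z0 \<in> \<Omega>" by blast
 have der: "(\<kappa> has_derivative (\<lambda>_. 0)) (at z)" if "z \<in> \<Omega>" for z
  using K_der[OF that] F0[OF that] by simp
 have c: "\<kappa> z = \<kappa> z0" if "z \<in> \<Omega>" for z
  by (rule has_derivative_zero_unique_connected[OF open_\<Omega> connected_\<Omega> der that z0])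
 have "gauss_curvature u x = \<kappa> z0" if x: "x \<notin> {p, q}" for x
 proof (cases x)
  case (Some z)
  then show ?thesis using c[of z] x by (auto simp: plane_curv_def plane_dom_def)
 next
  case None
  obtain d where d: "0 < d" "\<And>\<zeta>. 0 < cmod \<zeta> ==> cmod \<zeta> < d ==> chart_pt None \<zeta> \<in> \<Omega>" using near_point by blast
  have "((\<lambda>\<zeta>. \<kappa> (1 / \<zeta>)) ---> gauss_curvature u None) (at 0)"
   by (rule curvature_at_infinity[OF conf]) (use None x in simp)
  moreover have "((\<lambda>\<zeta>. \<kappa> (1 / \<zeta>)) ---> \<kappa> z0) (at 0)"
  proof (rule tendsto_eventually)
   show "\<forall>\<^sub>F \<zeta> in at 0. \<kappa> (1 / \<zeta>) = \<kappa> z0"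
    unfolding eventually_at using d c by (intro exI[of _ d]) auto
  qed
  ultimately show ?thesis using None by (meson LIM_unique)
 qed
 then show False using hcmu unfolding nonCSC_HCMU_def dom_eq by blast
qed

lemma F_not_zero_open:
 assumes "open S" "S \<subseteq> \<Omega>" "S \<noteq> {}" shows "\<exists>z\<in>S. F z \<noteq> 0"
proof (rule ccontr)
 assume "\<not> ?thesis"
 then have F0: "\<And>z. z \<in> S ==> F z = 0" by blast
 obtain s where s: "s \<in> S" using assms by blast
 have "F z = 0" if "z \<in> \<Omega>" for z
  by (rule analytic_continuation_open[OF assms(1) open_\<Omega> assms(3) connected_\<Omega> assms(2) F holomorphic_on_const _ that]) (use F0 in auto)
 then show False using F_not_zero by blast
qed

lemma curvature_weight_integrable: "set_integrable lborel \<Omega> (\<lambda>z. (1 + (\<kappa> z)\<^sup>2) * exp (2 * \<phi> z))"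
proof -
 have "set_integrable lborel \<Omega> (area_density u)" "set_integrable lborel \<Omega> (\<lambda>z. (gauss_curvature u (Some z))\<^sup>2 * area_density u z)"
  using hcmu unfolding nonCSC_HCMU_def dom_eq finite_area_def finite_energy_def plane_dom_def by auto
 from set_integral_add(1)[OF this] show ?thesis
  by (simp add: area_density_def plane_curv_def distrib_right)
qed

text \<open>Components of a vector field are divided by the derivative of the coordinate change, so
  \<open>dv / F_local\<close> is the same form as \<open>dz / F\<close>.\<close>

definition F_local :: "(complex => complex) => complex => complex" where
 "F_local z v = F (z v) / deriv z v"

definition phi_local :: "(complex => complex) => complex => real" where
 "phi_local z v = \<phi> (z v) + ln (cmod (deriv z v))"

text \<open>Every point of the sphere, smooth or not, is treated as a puncture with its cone angle.\<close>
lemma punctured_chart: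
 assumes J: "\<And>z. z \<in> \<Omega> ==> F z \<noteq> 0 ==> \<kappa> z \<in> J"
  and h_der: "\<And>t. t \<in> J ==> (hh has_real_derivative 1 / G t) (at t)"
  and h_bd: "(\<exists>C\<ge>0. \<forall>t\<in>J. hh t \<le> C * (C - ln (G t)) \<and> ln (G t) \<le> C) \<or> (\<exists>C. \<forall>t\<in>J. - hh t \<le> C)"
 obtains h b where "0 < b" "h holomorphic_on ball 0 b" "inj_on h (ball 0 b)" "h 0 = 0"
  "\<And>v. v \<in> annulus 0 b ==> h v \<noteq> 0" "\<And>v. v \<in> annulus 0 b ==> chart_pt x (h v) \<in> \<Omega>"
  "\<And>v. v \<in> annulus 0 b ==> deriv (\<lambda>v. chart_pt x (h v)) v = chart_der x (h v) * deriv h v"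
  "punctured_hcmu b (F_local (\<lambda>v. chart_pt x (h v))) (chart_grad (\<lambda>v. chart_pt x (h v))) (\<lambda>v. \<kappa> (chart_pt x (h v))) (phi_local (\<lambda>v. chart_pt x (h v))) G hh J (ang x)"
proof -
 obtain h b where b: "0 < b" and h: "h holomorphic_on ball 0 b" "inj_on h (ball 0 b)" "h 0 = 0"
  and hv: "\<And>v. v \<in> annulus 0 b ==> h v \<noteq> 0" "\<And>v. v \<in> annulus 0 b ==> chart_pt x (h v) \<in> \<Omega>"
  and an: "((\<lambda>r. cint (\<lambda>v. Re (chart_grad (\<lambda>v. chart_pt x (h v)) v * v) + 1 - ang x) r) ---> 0) (at_right 0)"
  by (rule chart[of x]) (rule that)
 define z where "z = (\<lambda>v. chart_pt x (h v))"
 have sub: "annulus 0 b \<subseteq> ball 0 b" by (auto simp: annulus_def)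
 have zd: "(z has_field_derivative chart_der x (h v) * deriv h v) (at v)" if v: "v \<in> annulus 0 b" for v
  unfolding z_def
  by (rule DERIV_chain2[OF chart_pt_deriv[OF hv(1)[OF v]] holomorphic_derivI[OF h(1) open_ball]]) (use v sub in auto)
 have zh: "z holomorphic_on annulus 0 b" using zd holomorphic_on_open[OF open_annulus] by blast
 have zinj: "inj_on z (annulus 0 b)"
 proof (rule inj_onI)
  fix v w assume vw: "v \<in> annulus 0 b" "w \<in> annulus 0 b" "z v = z w"
  then have "h v = h w" using chart_pt_inj[OF hv(1)[OF vw(1)] hv(1)[OF vw(2)]] by (simp add: z_def)
  then show "v = w" by (rule inj_onD[OF h(2)]) (use vw sub in auto)
 qed
 have dz: "deriv z v \<noteq> 0" if "v \<in> annulus 0 b" for v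
  by (rule holomorphic_injective_imp_regular[OF zh open_annulus zinj that])
 have im: "z ` annulus 0 b \<subseteq> \<Omega>" using hv(2) by (auto simp: z_def)
 have zO: "z v \<in> \<Omega>" if "v \<in> annulus 0 b" for v using im that by blast
 define Fv where Fv: "Fv = F_local z"
 define \<psi> where psi: "\<psi> = phi_local z"
 have Fv_def: "Fv = (\<lambda>v. F (z v) / deriv z v)" and \<psi>_def: "\<psi> = (\<lambda>v. \<phi> (z v) + ln (cmod (deriv z v)))"
  by (simp_all add: fun_eq_iff Fv psi F_local_def phi_local_def)
 have e2: "exp (2 * \<psi> v) = exp (2 * \<phi> (z v)) * (cmod (deriv z v))\<^sup>2" if "v \<in> annulus 0 b" for v
 proof -
  have "exp (2 * ln (cmod (deriv z v))) = (cmod (deriv z v))\<^sup>2"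
   unfolding exp_double using dz[OF that] by simp
  then show ?thesis by (simp add: \<psi>_def distrib_left exp_add)
 qed
 have "punctured_hcmu b Fv (chart_grad z) (\<lambda>v. \<kappa> (z v)) \<psi> G hh J (ang x)"
 proof
  show "0 < b" by fact
  have zc: "F \<circ> z holomorphic_on annulus 0 b"
   by (rule holomorphic_on_compose_gen[OF zh F im])
  show "Fv holomorphic_on annulus 0 b" unfolding Fv_def
   using zc dz by (intro holomorphic_intros holomorphic_deriv[OF zh open_annulus]) (auto simp: o_def)
  show "\<exists>v\<in>annulus 0 b. Fv v \<noteq> 0"
  proof -
   have "open (z ` annulus 0 b)" by (rule open_mapping_thm3[OF zh open_annulus zinj])
   moreover have "cr (b / 2) \<in> annulus 0 b" using b by (simp add: annulus_def)
   ultimately obtain y where "y \<in> z ` annulus 0 b" "F y \<noteq> 0" using F_not_zero_open[OF _ im] by blast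
   then show ?thesis using dz by (auto simp: Fv_def)
  qed
  show "((\<lambda>v. \<kappa> (z v)) has_derivative (\<lambda>d. Re (2 * exp (2 * \<psi> v) * cnj (Fv v) * d))) (at v)" if v: "v \<in> annulus 0 b" for v
  proof -
   have "((\<lambda>v. \<kappa> (z v)) has_derivative (\<lambda>d. Re (2 * exp (2 * \<phi> (z v)) * cnj (F (z v)) * (deriv z v * d)))) (at v)"
    by (rule has_derivative_compose[OF holomorphic_derivI[OF zh open_annulus v, unfolded has_field_derivative_def] K_der[OF zO[OF v]]])
   moreover have "cr (2 * exp (2 * \<phi> (z v))) * cnj (F (z v)) * (deriv z v * d) = cr (2 * exp (2 * \<psi> v)) * cnj (Fv v) * d" for d
   proof -
    have "cr ((cmod (deriv z v))\<^sup>2) / cnj (deriv z v) = deriv z v"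
     using dz[OF v] unfolding complex_norm_square by simp
    moreover have "cr (2 * exp (2 * \<psi> v)) * cnj (Fv v) * d = cr (2 * exp (2 * \<phi> (z v))) * cnj (F (z v)) *
      (cr ((cmod (deriv z v))\<^sup>2) / cnj (deriv z v) * d)"
     unfolding e2[OF v] Fv_def complex_cnj_divide of_real_mult by (simp add: mult_ac)
    ultimately show ?thesis by (simp only:)
   qed
   ultimately show ?thesis by (simp only:)
  qed
  show "(\<psi> has_derivative (\<lambda>d. Re (chart_grad z v * d))) (at v)" if "v \<in> annulus 0 b" for v
   unfolding \<psi>_def by (rule chart_factor_deriv[OF open_annulus zh dz im that])
  show "continuous_on (annulus 0 b) (chart_grad z)"
   by (rule chart_grad_cont[OF open_annulus zh dz im])
  show "exp (2 * \<psi> v) * (cmod (Fv v))\<^sup>2 = G (\<kappa> (z v))" if v: "v \<in> annulus 0 b" for v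
   using metric_F[OF zO[OF v]] dz[OF v] unfolding e2[OF v] Fv_def norm_divide power_divide by simp
  show "continuous_on UNIV G" by (rule cubic_continuous)
  show "\<exists>C>0. \<forall>t. G t \<le> C * (1 + t\<^sup>2)\<^sup>2" by (rule cubic_le)
  show "((\<lambda>r. cint (\<lambda>v. Re (chart_grad z v * v) + 1 - ang x) r) ---> 0) (at_right 0)"
   using an unfolding z_def .
  show "\<exists>r. 0 < r \<and> r < \<delta> \<and> r \<notin> N \<and> r\<^sup>2 * cint (\<lambda>v. (1 + (\<kappa> (z v))\<^sup>2) * exp (2 * \<psi> v)) r \<le> 1"
   if "0 < \<delta>" "countable N" for \<delta> :: real and N
  proof -
   let ?f = "\<lambda>z. (1 + (\<kappa> z)\<^sup>2) * exp (2 * \<phi> z)"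
   have fc: "continuous_on (z ` annulus 0 b) ?f"
    by (intro continuous_intros continuous_on_subset[OF kappa_cont im] continuous_on_subset[OF phi_cont im])
   have si: "set_integrable lborel (z ` annulus 0 b) ?f"
    by (rule set_integrable_subset[OF curvature_weight_integrable _ im])
     (use open_mapping_thm3[OF zh open_annulus zinj] in auto)
   have "0 < min \<delta> b" using that b by simp
   from small_circle_energy[OF zh zinj b fc si _ this that(2)]
   obtain r where r: "0 < r" "r < min \<delta> b" "r \<notin> N" "r\<^sup>2 * cint (\<lambda>v. (cmod (deriv z v))\<^sup>2 * ?f (z v)) r \<le> 1"
    by auto
   have "cint (\<lambda>v. (cmod (deriv z v))\<^sup>2 * ?f (z v)) r = cint (\<lambda>v. (1 + (\<kappa> (z v))\<^sup>2) * exp (2 * \<psi> v)) r"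
    by (rule cint_cong) (use r in \<open>simp add: e2\<close>)
   then show ?thesis using r by auto
  qed
  show "\<kappa> (z v) \<in> J" if "v \<in> annulus 0 b" "Fv v \<noteq> 0" for v
   using J[OF zO[OF that(1)]] that(2) by (auto simp: Fv_def)
  show "(hh has_real_derivative 1 / G t) (at t)" if "t \<in> J" for t by (rule h_der[OF that])
  show "(\<exists>C\<ge>0. \<forall>t\<in>J. hh t \<le> C * (C - ln (G t)) \<and> ln (G t) \<le> C) \<or> (\<exists>C. \<forall>t\<in>J. - hh t \<le> C)" by (rule h_bd)
 qed
 then show ?thesis
  using that[OF b h hv] DERIV_imp_deriv[OF zd] unfolding Fv psi z_def by blast
qed

end

section \<open>Simple poles on the sphere\<close>

lemma eventually_at_notin_finite: "finite T ==> \<forall>\<^sub>F z in at s. z \<notin> T" for s :: complex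
 using islimpt_finite by (auto simp: islimpt_iff_eventually)

lemma eventually_ball: "0 < r ==> \<forall>\<^sub>F w in at w0. w \<in> ball w0 r \<and> w \<noteq> w0"
 unfolding eventually_at by (intro exI[of _ r]) (simp add: dist_commute)

lemma entire_extension:
 assumes "finite T" "f holomorphic_on - T" "\<And>t. t \<in> T ==> ((\<lambda>z. (z - t) * f z) ---> 0) (at t)"
 obtains g where "g holomorphic_on UNIV" "\<And>z. z \<notin> T ==> g z = f z"
proof -
 have "\<exists>g. g holomorphic_on UNIV \<and> (\<forall>z. z \<notin> T --> g z = f z)"
  using assms
 proof (induction T arbitrary: f rule: finite_induct)
  case empty then show ?case by auto
 next
  case (insert t T)
  have T: "open (- T)" using insert.hyps by (simp add: finite_imp_closed open_Compl)
  have "f holomorphic_on - T - {t}" using insert.prems(1) by (rule holomorphic_on_subset) auto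
  moreover have "t \<in> interior (- T)" using T insert.hyps by (simp add: interior_open)
  ultimately obtain g where g: "g holomorphic_on - T" "\<And>z. z \<in> - T - {t} ==> g z = f z"
   using holomorphic_on_extend_lim[of f "- T" t] insert.prems(2)[of t] by auto
  have "((\<lambda>z. (z - s) * g z) ---> 0) (at s)" if s: "s \<in> T" for s
  proof (rule Lim_transform_eventually)
   show "((\<lambda>z. (z - s) * f z) ---> 0) (at s)" using insert.prems(2) s by simp
   have "finite (insert t T - {s})" using insert.hyps by simp
   then have "\<forall>\<^sub>F z in at s. z \<notin> insert t T - {s}" by (rule eventually_at_notin_finite)
   moreover have "\<forall>\<^sub>F z in at s. z \<noteq> s" by (simp add: eventually_at_filter)
   ultimately show "\<forall>\<^sub>F z in at s. (z - s) * f z = (z - s) * g z"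
    by eventually_elim (use g(2) in auto)
  qed
  from insert.IH[OF g(1) this] obtain k where "k holomorphic_on UNIV" "\<forall>z. z \<notin> T --> k z = g z" by blast
  then show ?case using g(2) by (intro exI[of _ k]) auto
 qed
 then show ?thesis using that by blast
qed

lemma eventually_inverse_notin_finite:
 assumes "finite T" shows "\<forall>\<^sub>F y in at 0. (1::complex) / y \<notin> T"
proof -
 have "finite ((\<lambda>t. 1 / t) ` T)" using assms by simp
 from eventually_at_notin_finite[OF this, of 0] show ?thesis
  by (rule eventually_mono) (metis divide_divide_eq_right image_eqI mult_1 div_by_1)
qed

text \<open>\<open>n t\<close> is the order of \<open>f dw\<close> at \<open>t\<close> plus one, and
  \<open>m\<close> plays the same role at infinity, where the form is
  \<open>- f (1 / y) / y\<^sup>2 dy\<close>. Removing the principal parts leaves an entire function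
  that tends to 0 at infinity, hence 0; comparing coefficients there gives the residue
  theorem.\<close>

lemma simple_pole_form:
 fixes f :: "complex => complex" and n :: "complex => nat"
 assumes T: "finite T" and f: "f holomorphic_on - T"
  and loc: "\<And>t. t \<in> T ==> ((\<lambda>w. (w - t) * f w / (w - t) ^ n t) ---> L t) (at t)"
  and inf: "((\<lambda>y. - f (1 / y) / y / y ^ m) ---> Li) (at 0)"
 shows "\<And>w. w \<notin> T ==> f w = (\<Sum>s | s \<in> T \<and> n s = 0. L s / (w - s))"
  and "(\<Sum>s | s \<in> T \<and> n s = 0. L s) = - (if m = 0 then Li else 0)"
proof -
 let ?S = "{s. s \<in> T \<and> n s = 0}"
 have S: "finite ?S" using T by simp
 define D where "D = (\<lambda>w. f w - (\<Sum>s\<in>?S. L s / (w - s)))"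
 have Dh: "D holomorphic_on - T" unfolding D_def by (intro holomorphic_intros f) auto
 have lim0: "((\<lambda>w. (w - t) * f w) ---> (if n t = 0 then L t else 0)) (at t)" if "t \<in> T" for t
 proof -
  have "((\<lambda>w. ((w - t) * f w / (w - t) ^ n t) * (w - t) ^ n t) ---> L t * (t - t) ^ n t) (at t)"
   by (intro tendsto_intros loc that)
  then have "((\<lambda>w. (w - t) * f w) ---> L t * (t - t) ^ n t) (at t)"
   by (rule Lim_transform_eventually) (auto simp: eventually_at_filter)
  then show ?thesis by (simp add: power_0_left split: if_split_asm)
 qed
 have Dlim: "((\<lambda>w. (w - t) * D w) ---> 0) (at t)" if t: "t \<in> T" for t
 proof -
  have tm: "((\<lambda>w. (w - t) * (L s / (w - s))) ---> (if s = t then L t else 0)) (at t)" for s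
  proof (cases "s = t")
   case True
   have "((\<lambda>w. L t) ---> L t) (at t)" by simp
   then have "((\<lambda>w. (w - t) * (L t / (w - t))) ---> L t) (at t)"
    by (rule Lim_transform_eventually) (auto simp: eventually_at_filter)
   then show ?thesis using True by simp
  next
   case False
   have "((\<lambda>w. (w - t) * (L s / (w - s))) ---> (t - t) * (L s / (t - s))) (at t)"
    by (intro tendsto_intros) (use False in auto)
   then show ?thesis using False by simp
  qed
  have "((\<lambda>w. (w - t) * f w - (\<Sum>s\<in>?S. (w - t) * (L s / (w - s)))) --->
    (if n t = 0 then L t else 0) - (\<Sum>s\<in>?S. if s = t then L t else 0)) (at t)"
   by (intro tendsto_diff tendsto_sum tm lim0[OF t])
  moreover have "(\<Sum>s\<in>?S. if s = t then L t else 0) = (if n t = 0 then L t else 0)"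
   using t T by (simp add: sum.delta)
  ultimately show ?thesis by (simp add: D_def sum_distrib_left right_diff_distrib)
 qed
 obtain g where g: "g holomorphic_on UNIV" "\<And>z. z \<notin> T ==> g z = D z"
  using entire_extension[OF T Dh Dlim] by blast
 have fy: "((\<lambda>y. f (1 / y) / y) ---> - (if m = 0 then Li else 0)) (at 0)"
 proof -
  have "((\<lambda>y. - ((- f (1 / y) / y / y ^ m) * y ^ m)) ---> - (Li * 0 ^ m)) (at 0)"
   by (intro tendsto_intros inf)
  then have "((\<lambda>y. f (1 / y) / y) ---> - (Li * 0 ^ m)) (at 0)"
   by (rule Lim_transform_eventually) (auto simp: eventually_at_filter)
  then show ?thesis by (simp add: power_0_left split: if_split_asm)
 qed
 have Sy: "((\<lambda>y. \<Sum>s\<in>?S. L s / (1 - s * y)) ---> (\<Sum>s\<in>?S. L s / (1 - s * 0))) (at 0)"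
  by (intro tendsto_intros) auto
 have Deq: "\<forall>\<^sub>F y in at 0. f (1 / y) / y - (\<Sum>s\<in>?S. L s / (1 - s * y)) = D (1 / y) / y"
 proof -
  have "\<forall>\<^sub>F y in at 0. y \<noteq> (0::complex)" by (simp add: eventually_at_filter)
  then show ?thesis
  proof eventually_elim
   case (elim y)
   have "(\<Sum>s\<in>?S. L s / (1 - s * y)) = (\<Sum>s\<in>?S. L s / (1 / y - s)) / y"
    unfolding sum_divide_distrib
   proof (rule sum.cong)
    fix s
    have "1 - s * y = (1 / y - s) * y" using elim by (simp add: left_diff_distrib)
    then show "L s / (1 - s * y) = L s / (1 / y - s) / y" by simp
   qed simp
   then show ?case by (simp add: D_def diff_divide_distrib)
  qed
 qed
 have Dy: "((\<lambda>y. D (1 / y) / y) ---> - (if m = 0 then Li else 0) - (\<Sum>s\<in>?S. L s)) (at 0)"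
  using Lim_transform_eventually[OF tendsto_diff[OF fy Sy] Deq] by simp
 have "((\<lambda>y. D (1 / y) / y * y) ---> (- (if m = 0 then Li else 0) - (\<Sum>s\<in>?S. L s)) * 0) (at 0)"
  by (intro tendsto_mult Dy tendsto_ident_at)
 then have "((\<lambda>y. g (1 / y)) ---> (- (if m = 0 then Li else 0) - (\<Sum>s\<in>?S. L s)) * 0) (at 0)"
 proof (rule Lim_transform_eventually)
  have "\<forall>\<^sub>F y in at 0. y \<noteq> (0::complex)" by (simp add: eventually_at_filter)
  with eventually_inverse_notin_finite[OF T] show "\<forall>\<^sub>F y in at 0. D (1 / y) / y * y = g (1 / y)"
   by eventually_elim (simp add: g(2))
 qed
 then have "(g ---> 0) at_infinity" by (simp add: lim_at_infinity_0 o_def inverse_eq_divide)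
 then have g0: "g z = 0" for z using Liouville_weak_0[OF g(1)] by simp
 then have D0: "D z = 0" if "z \<notin> T" for z using g(2)[OF that] by simp
 show "f w = (\<Sum>s\<in>?S. L s / (w - s))" if "w \<notin> T" for w using D0[OF that] by (simp add: D_def)
 have "\<forall>\<^sub>F y in at 0. D (1 / y) / y = 0"
  using eventually_inverse_notin_finite[OF T] by eventually_elim (simp add: D0)
 then have "((\<lambda>y. D (1 / y) / y) ---> 0) (at 0)" by (rule tendsto_eventually)
 with Dy have "- (if m = 0 then Li else 0) - (\<Sum>s\<in>?S. L s) = 0" by (meson LIM_unique)
 then show "(\<Sum>s\<in>?S. L s) = - (if m = 0 then Li else 0)" by (simp add: algebra_simps)
qed

text \<open>The degree of the canonical divisor is -2. Zeros of the form can occur only at 0 and at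
  infinity, where the orders are \<open>n 0 - 1\<close> and \<open>m - 1\<close>, so the simple
  poles elsewhere number \<open>n 0 + m\<close>. The product \<open>E\<close> of \<open>f\<close>
  with factors that cancel its zeros and poles extends to an entire function without zeros, and its
  growth at infinity must be of degree 0.\<close>

lemma pole_count:
 fixes f :: "complex => complex" and n :: "complex => nat"
 assumes T: "finite T" "0 \<in> T" and f: "f holomorphic_on - T" and nz: "\<And>w. w \<notin> T ==> f w \<noteq> 0"
  and loc: "\<And>t. t \<in> T ==> ((\<lambda>w. (w - t) * f w / (w - t) ^ n t) ---> L t) (at t)"
  and L: "\<And>t. t \<in> T ==> L t \<noteq> 0" and n1: "\<And>t. t \<in> T ==> t \<noteq> 0 ==> n t \<le> 1"
  and inf: "((\<lambda>y. - f (1 / y) / y / y ^ m) ---> Li) (at 0)" and Li: "Li \<noteq> 0"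
 shows "card {s \<in> T. n s = 0 \<and> s \<noteq> 0} = n 0 + m"
  and "\<And>w. w \<notin> T ==> w * f w * (\<Prod>s | s \<in> T \<and> n s = 0 \<and> s \<noteq> 0. w - s) = - Li * w ^ n 0"
proof -
 let ?S = "{s. s \<in> T \<and> n s = 0 \<and> s \<noteq> 0}"
 have S: "finite ?S" using T by simp
 define E where "E = (\<lambda>w. w * f w / w ^ n 0 * (\<Prod>s\<in>?S. w - s))"
 have Eh: "E holomorphic_on - T" unfolding E_def
  by (intro holomorphic_intros f) (use T in auto)
 have Elim: "\<exists>l. l \<noteq> 0 \<and> (E ---> l) (at t)" if t: "t \<in> T" for t
 proof (cases "t = 0")
  case True
  have "(E ---> L 0 * (\<Prod>s\<in>?S. 0 - s)) (at 0)"
   unfolding E_def using loc[OF T(2)] by (intro tendsto_intros) simp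
  moreover have "L 0 * (\<Prod>s\<in>?S. 0 - s) \<noteq> 0" using L[OF T(2)] S by (auto simp: prod_zero_iff)
  ultimately show ?thesis using True by blast
 next
  case False
  show ?thesis
  proof (cases "n t = 0")
   case True
   then have tS: "t \<in> ?S" using t False by simp
   have l: "((\<lambda>w. w / w ^ n 0 * ((w - t) * f w) * (\<Prod>s\<in>?S - {t}. w - s)) ---> t / t ^ n 0 * L t * (\<Prod>s\<in>?S - {t}. t - s)) (at t)"
    using loc[OF t] True False by (intro tendsto_intros) auto
   have e: "(\<lambda>w. w / w ^ n 0 * ((w - t) * f w) * (\<Prod>s\<in>?S - {t}. w - s)) = E"
    unfolding E_def by (rule ext) (simp add: prod.remove[OF S tS] mult_ac)
   have "t / t ^ n 0 * L t * (\<Prod>s\<in>?S - {t}. t - s) \<noteq> 0"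
    using L[OF t] S False by (auto simp: prod_zero_iff)
   with l show ?thesis unfolding e by (intro exI conjI)
  next
   case n0: False
   then have n1: "n t = 1" using n1[OF t False] by simp
   have "((\<lambda>w. w / w ^ n 0 * ((w - t) * f w / (w - t) ^ n t) * (\<Prod>s\<in>?S. w - s)) ---> t / t ^ n 0 * L t * (\<Prod>s\<in>?S. t - s)) (at t)"
    using False by (intro tendsto_intros loc t) auto
   then have l: "(E ---> t / t ^ n 0 * L t * (\<Prod>s\<in>?S. t - s)) (at t)"
    by (rule Lim_transform_eventually) (auto simp: eventually_at_filter E_def n1)
   have "t / t ^ n 0 * L t * (\<Prod>s\<in>?S. t - s) \<noteq> 0"
    using L[OF t] S False n0 by (auto simp: prod_zero_iff)
   with l show ?thesis by (intro exI conjI)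
  qed
 qed
 have "((\<lambda>z. (z - t) * E z) ---> 0) (at t)" if t: "t \<in> T" for t
 proof -
  obtain l where "(E ---> l) (at t)" using Elim[OF t] by blast
  then have "((\<lambda>z. (z - t) * E z) ---> (t - t) * l) (at t)" by (intro tendsto_intros)
  then show ?thesis by simp
 qed
 then obtain g where g: "g holomorphic_on UNIV" "\<And>z. z \<notin> T ==> g z = E z"
  using entire_extension[OF T(1) Eh] by blast
 have gnz: "g z \<noteq> 0" for z
 proof (cases "z \<in> T")
  case True
  obtain l where l: "l \<noteq> 0" "(E ---> l) (at z)" using Elim[OF True] by blast
  have "(g ---> l) (at z)"
   by (rule Lim_transform_eventually[OF l(2)])
    (use eventually_at_notin_finite[OF T(1), of z] in eventually_elim, use g(2) in auto)
  moreover have "(g ---> g z) (at z)"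
   using hol_cont[OF g(1)] by (simp add: continuous_on_eq_continuous_at isCont_def)
  ultimately show ?thesis using l(1) LIM_unique by blast
 next
  case False
  then show ?thesis using g(2)[OF False] nz[OF False] T(2) S by (auto simp: E_def prod_zero_iff)
 qed
 let ?N = "card ?S"
 have Ey: "\<forall>\<^sub>F y in at 0. g (1 / y) * y ^ ?N = - (- f (1 / y) / y / y ^ m) * y ^ (m + n 0) * (\<Prod>s\<in>?S. 1 - s * y)"
 proof -
  have "\<forall>\<^sub>F y in at 0. y \<noteq> (0::complex)" by (simp add: eventually_at_filter)
  with eventually_inverse_notin_finite[OF T(1)] show ?thesis
  proof eventually_elim
   case (elim y)
   have "(\<Prod>s\<in>?S. 1 / y - s) * y ^ ?N = (\<Prod>s\<in>?S. 1 - s * y)"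
    using elim S by (simp add: prod.distrib[symmetric] prod_constant[symmetric] del: prod_constant) (rule prod.cong, auto simp: field_simps)
   moreover have "1 / y * f (1 / y) / (1 / y) ^ n 0 = - (- f (1 / y) / y / y ^ m) * y ^ (m + n 0)"
    using elim by (simp add: power_add power_one_over field_simps)
   moreover have "g (1 / y) = (1 / y * f (1 / y) / (1 / y) ^ n 0) * (\<Prod>s\<in>?S. 1 / y - s)"
    using g(2)[OF elim(1)] by (simp only: E_def)
   ultimately show ?case by (simp only: mult.assoc)
  qed
 qed
 have P1: "((\<lambda>y. \<Prod>s\<in>?S. 1 - s * y) ---> (\<Prod>s\<in>?S. 1 - s * 0)) (at 0)" by (intro tendsto_intros)
 have y0: "\<forall>\<^sub>F y in at 0. y \<noteq> (0::complex)" by (simp add: eventually_at_filter)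
 \<comment> \<open>Either failure contradicts Liouville: too few factors would make \<open>g\<close>
   tend to 0 at infinity, too many would make \<open>1 / g\<close> tend to 0.\<close>
 have ge: "?N \<ge> m + n 0" and C: "?N = m + n 0 ==> g z = - Li" for z
 proof -
  have fin: "g z = - Li * 0 ^ (m + n 0 - ?N)" if le: "?N \<le> m + n 0" for z
  proof -
   have "((\<lambda>y. - (- f (1 / y) / y / y ^ m) * y ^ (m + n 0 - ?N) * (\<Prod>s\<in>?S. 1 - s * y)) ---> - Li * 0 ^ (m + n 0 - ?N) * (\<Prod>s\<in>?S. 1 - s * 0)) (at 0)"
    by (intro tendsto_mult tendsto_minus inf P1 tendsto_power tendsto_ident_at)
   then have "((\<lambda>y. g (1 / y)) ---> - Li * 0 ^ (m + n 0 - ?N) * (\<Prod>s\<in>?S. 1 - s * 0)) (at 0)"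
   proof (rule Lim_transform_eventually)
    show "\<forall>\<^sub>F y in at 0. - (- f (1 / y) / y / y ^ m) * y ^ (m + n 0 - ?N) * (\<Prod>s\<in>?S. 1 - s * y) = g (1 / y)"
     using Ey y0
    proof eventually_elim
     case (elim y)
     have "y ^ (m + n 0) = y ^ (m + n 0 - ?N) * y ^ ?N" using le by (simp add: power_add[symmetric])
     then have "g (1 / y) * y ^ ?N = (- (- f (1 / y) / y / y ^ m) * y ^ (m + n 0 - ?N) * (\<Prod>s\<in>?S. 1 - s * y)) * y ^ ?N"
      using elim(1) by (simp only: mult_ac)
     then show ?case by (rule sym[OF mult_right_cancel[of "y ^ ?N", OF power_not_zero[OF elim(2)], THEN iffD1]])
    qed
   qed
   then have "(g ---> - Li * 0 ^ (m + n 0 - ?N)) at_infinity"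
    by (simp add: lim_at_infinity_0 o_def inverse_eq_divide)
   then show ?thesis by (rule Liouville_weak[OF g(1)])
  qed
  show "?N \<ge> m + n 0"
  proof (rule ccontr)
   assume "\<not> ?N \<ge> m + n 0"
   then have "g 0 = - Li * 0 ^ (m + n 0 - ?N)" "m + n 0 - ?N > 0" using fin[of 0] by auto
   then show False using gnz[of 0] by simp
  qed
  show "?N = m + n 0 ==> g z = - Li" using fin[of z] by simp
 qed
 have le: "?N \<le> m + n 0"
 proof (rule ccontr)
  assume "\<not> ?N \<le> m + n 0"
  then have gt: "0 < ?N - (m + n 0)" by simp
  have "((\<lambda>y. y ^ (?N - (m + n 0)) / (- (- f (1 / y) / y / y ^ m) * (\<Prod>s\<in>?S. 1 - s * y))) ---> 0 ^ (?N - (m + n 0)) / (- Li * (\<Prod>s\<in>?S. 1 - s * 0))) (at 0)"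
   by (intro tendsto_divide tendsto_mult tendsto_minus inf P1 tendsto_power tendsto_ident_at) (use Li in simp)
  then have "((\<lambda>y. 1 / g (1 / y)) ---> 0 ^ (?N - (m + n 0)) / (- Li * (\<Prod>s\<in>?S. 1 - s * 0))) (at 0)"
  proof (rule Lim_transform_eventually)
   show "\<forall>\<^sub>F y in at 0. y ^ (?N - (m + n 0)) / (- (- f (1 / y) / y / y ^ m) * (\<Prod>s\<in>?S. 1 - s * y)) = 1 / g (1 / y)"
    using Ey y0
   proof eventually_elim
    case (elim y)
    define X where "X = - (- f (1 / y) / y / y ^ m) * (\<Prod>s\<in>?S. 1 - s * y)"
    have "y ^ ?N = y ^ (?N - (m + n 0)) * y ^ (m + n 0)" using gt by (simp add: power_add[symmetric])
    then have "g (1 / y) * y ^ (?N - (m + n 0)) * y ^ (m + n 0) = X * y ^ (m + n 0)"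
     using elim(1) by (simp add: X_def mult_ac)
    then have "g (1 / y) * y ^ (?N - (m + n 0)) = X" using elim(2) by simp
    then have "y ^ (?N - (m + n 0)) / X = 1 / g (1 / y)" using gnz[of "1 / y"] elim(2) by (auto simp: field_simps)
    then show ?case by (simp only: X_def)
   qed
  qed
  moreover have "(0::complex) ^ (?N - (m + n 0)) / (- Li * (\<Prod>s\<in>?S. 1 - s * 0)) = 0" using gt by simp
  ultimately have "((\<lambda>w. 1 / g w) ---> 0) at_infinity"
   by (simp only: lim_at_infinity_0 o_def inverse_eq_divide)
  moreover have "(\<lambda>w. 1 / g w) holomorphic_on UNIV" by (intro holomorphic_intros g) (use gnz in auto)
  ultimately have "1 / g 0 = 0" using Liouville_weak_0[of "\<lambda>w. 1 / g w" 0] by simp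
  then show False using gnz[of 0] by simp
 qed
 have eq: "?N = m + n 0" using ge le by simp
 then show "card {s \<in> T. n s = 0 \<and> s \<noteq> 0} = n 0 + m" by simp
 fix w assume w: "w \<notin> T"
 then have "w \<noteq> 0" using T by auto
 have "E w = - Li" using g(2)[OF w] C[OF eq] by simp
 then show "w * f w * (\<Prod>s\<in>?S. w - s) = - Li * w ^ n 0"
  using \<open>w \<noteq> 0\<close> by (simp add: E_def field_simps)
qed

section \<open>Orders of vanishing and the degree of a rational function\<close>

lemma order_unique:
 fixes g :: "complex => complex"
 assumes a: "((\<lambda>w. g w / w ^ a) ---> L) (at 0)" and k: "((\<lambda>w. g w / w ^ k) ---> M) (at 0)"
  and "L \<noteq> 0" "M \<noteq> 0"
 shows "a = k"
proof -
 have *: "\<not> a < k" if "((\<lambda>w. g w / w ^ a) ---> L) (at 0)" "((\<lambda>w. g w / w ^ k) ---> M) (at 0)" "L \<noteq> 0" for a k L M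
 proof
  assume lt: "a < k"
  have "((\<lambda>w. g w / w ^ k * w ^ (k - a)) ---> M * 0 ^ (k - a)) (at 0)"
   by (intro tendsto_intros that(2))
  then have "((\<lambda>w. g w / w ^ a) ---> M * 0 ^ (k - a)) (at 0)"
  proof (rule Lim_transform_eventually)
   have "g w / w ^ k * w ^ (k - a) = g w / w ^ a" if "w \<noteq> 0" for w
   proof -
    have "w ^ k = w ^ (k - a) * w ^ a" using lt by (simp add: power_add[symmetric])
    then show ?thesis using that by simp
   qed
   then show "\<forall>\<^sub>F w in at 0. g w / w ^ k * w ^ (k - a) = g w / w ^ a"
    by (auto simp: eventually_at_filter)
  qed
  then have "M * 0 ^ (k - a) = L" using that(1) by (meson LIM_unique)
  moreover have "(0::complex) ^ (k - a) = 0" using lt by simp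
  ultimately show False using that(3) by simp
 qed
 show ?thesis using *[OF a k assms(3)] *[OF k a assms(4)] by simp
qed

text \<open>With integer residues \<open>e s\<close> the form is \<open>dR / R\<close> for \<open>R = \<Prod>(w - s) ^ e s\<close>, and
 \<open>R - R 0\<close> cannot vanish to an order exceeding the degree of \<open>R\<close>.\<close>
lemma ramification_le_degree:
 fixes e :: "complex => int"
 assumes S: "finite S" "0 \<notin> S" and a: "0 < a" and L: "L \<noteq> 0"
  and lim: "((\<lambda>w. w * (\<Sum>s\<in>S. of_int (e s) / (w - s)) / w ^ a) ---> L) (at 0)"
 shows "int a \<le> max (\<Sum>s | s \<in> S \<and> 0 < e s. e s) (\<Sum>s | s \<in> S \<and> e s < 0. - e s)"
proof -
 define A where "A = (\<Prod>s | s \<in> S \<and> 0 < e s. [:- s, 1:] ^ nat (e s))"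
 define B where "B = (\<Prod>s | s \<in> S \<and> e s < 0. [:- s, 1:] ^ nat (- e s))"
 have pA: "poly A w = (\<Prod>s | s \<in> S \<and> 0 < e s. (w - s) ^ nat (e s))" for w
  by (simp add: A_def poly_prod poly_power)
 have pB: "poly B w = (\<Prod>s | s \<in> S \<and> e s < 0. (w - s) ^ nat (- e s))" for w
  by (simp add: B_def poly_prod poly_power)
 have A0: "poly A w \<noteq> 0" "poly B w \<noteq> 0" if "w \<notin> S" for w
  unfolding pA pB using that S(1) by (auto simp: prod_zero_iff)
 have degA: "int (degree A) = (\<Sum>s | s \<in> S \<and> 0 < e s. e s)"
  unfolding A_def by (subst degree_prod_eq_sum_degree) (auto simp: degree_power_eq)
 have degB: "int (degree B) = (\<Sum>s | s \<in> S \<and> e s < 0. - e s)"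
  unfolding B_def by (subst degree_prod_eq_sum_degree) (auto simp: degree_power_eq)
 let ?f = "\<lambda>w. \<Sum>s\<in>S. of_int (e s) / (w - s)"
 have logd: "(poly (pderiv A) w / poly A w) - (poly (pderiv B) w / poly B w) = ?f w" if w: "w \<notin> S" for w
 proof -
  have ld: "poly (pderiv (\<Prod>s\<in>X. [:- s, 1:] ^ m s)) w / poly (\<Prod>s\<in>X. [:- s, 1:] ^ m s) w = (\<Sum>s\<in>X. of_nat (m s) / (w - s))"
   if X: "finite X" "w \<notin> X" for X and m :: "complex => nat"
   using X
  proof (induction X rule: finite_induct)
   case (insert x X)
   have wx: "w - x \<noteq> 0" "w \<notin> X" using insert by auto
   have P0: "poly (\<Prod>s\<in>X. [:- s, 1:] ^ m s) w \<noteq> 0" using wx insert.hyps by (auto simp: poly_prod poly_power prod_zero_iff)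
   have d1: "poly (pderiv ([:- x, 1:] ^ m x)) w / (w - x) ^ m x = of_nat (m x) / (w - x)"
   proof (cases "m x")
    case (Suc k)
    have "poly (pderiv ([:- x, 1:] ^ Suc k)) w = of_nat (Suc k) * (w - x) ^ k"
     unfolding pderiv_power_Suc by (simp add: pderiv_pCons poly_power del: of_nat_Suc)
    then show ?thesis using wx unfolding Suc by simp
   qed simp
   have "poly (pderiv ([:- x, 1:] ^ m x * (\<Prod>s\<in>X. [:- s, 1:] ^ m s))) w / poly ([:- x, 1:] ^ m x * (\<Prod>s\<in>X. [:- s, 1:] ^ m s)) w
    = poly (pderiv (\<Prod>s\<in>X. [:- s, 1:] ^ m s)) w / poly (\<Prod>s\<in>X. [:- s, 1:] ^ m s) w + poly (pderiv ([:- x, 1:] ^ m x)) w / (w - x) ^ m x"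
    using P0 wx by (simp add: pderiv_mult poly_power add_divide_distrib)
   then show ?case using insert.IH[OF wx(2)] insert.hyps d1 by (simp add: add.commute)
  qed simp
  have "?f w = (\<Sum>s | s \<in> S \<and> 0 < e s. of_int (e s) / (w - s)) + (\<Sum>s | s \<in> S \<and> e s < 0. of_int (e s) / (w - s))"
  proof -
   have "?f w = (\<Sum>s\<in>{s. s \<in> S \<and> 0 < e s} \<union> {s. s \<in> S \<and> e s < 0}. of_int (e s) / (w - s))"
    by (rule sum.mono_neutral_right) (use S in auto)
   also have "\<dots> = (\<Sum>s | s \<in> S \<and> 0 < e s. of_int (e s) / (w - s)) + (\<Sum>s | s \<in> S \<and> e s < 0. of_int (e s) / (w - s))"
    by (rule sum.union_disjoint) (use S in auto)
   finally show ?thesis .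
  qed
  moreover have "poly (pderiv A) w / poly A w = (\<Sum>s | s \<in> S \<and> 0 < e s. of_nat (nat (e s)) / (w - s))"
   unfolding A_def by (rule ld) (use S w in auto)
  moreover have "poly (pderiv B) w / poly B w = (\<Sum>s | s \<in> S \<and> e s < 0. of_nat (nat (- e s)) / (w - s))"
   unfolding B_def by (rule ld) (use S w in auto)
  moreover have "(\<Sum>s | s \<in> S \<and> 0 < e s. of_nat (nat (e s)) / (w - s)) = (\<Sum>s | s \<in> S \<and> 0 < e s. of_int (e s) / (w - s))"
   by (rule sum.cong) auto
  moreover have "(\<Sum>s | s \<in> S \<and> e s < 0. of_nat (nat (- e s)) / (w - s)) = - (\<Sum>s | s \<in> S \<and> e s < 0. of_int (e s) / (w - s))"
   unfolding sum_negf[symmetric] by (rule sum.cong) auto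
  ultimately show ?thesis by simp
 qed
 \<comment> \<open>\<open>r\<close> is the value of \<open>R = A / B\<close> at 0, and
   \<open>D / B\<close> is \<open>R - r\<close>. Its order of vanishing at 0 is one more than that
   of the derivative of \<open>R\<close>, hence equal to \<open>a\<close>.\<close>
 define r where "r = poly A 0 / poly B 0"
 define D where "D = A - smult r B"
 have D0: "poly D 0 = 0" using A0[of 0] S by (simp add: D_def r_def)
 \<comment> \<open>The Wronskian of \<open>D\<close> and \<open>B\<close> is that of
   \<open>A\<close> and \<open>B\<close>, because subtracting a multiple of \<open>B\<close> does
   not change it.\<close>
 have wr: "poly (pderiv D) w * poly B w - poly D w * poly (pderiv B) w = ?f w * (poly A w * poly B w)" if w: "w \<notin> S" for w
 proof -
  have "poly (pderiv D) w * poly B w - poly D w * poly (pderiv B) w = poly (pderiv A) w * poly B w - poly A w * poly (pderiv B) w"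
   by (simp add: D_def pderiv_diff pderiv_smult algebra_simps)
  also have "\<dots> = ((poly (pderiv A) w / poly A w) - (poly (pderiv B) w / poly B w)) * (poly A w * poly B w)"
   using A0[OF w] by (simp add: field_simps)
  finally show ?thesis using logd[OF w] by simp
 qed
 have Dnz: "D \<noteq> 0"
 proof
  assume "D = 0"
  then have f0: "?f w = 0" if "w \<notin> S" for w using wr[OF that] A0[OF that] by simp
  have "\<forall>\<^sub>F w in at 0. w * ?f w / w ^ a = 0"
   using eventually_at_notin_finite[OF S(1), of 0] by eventually_elim (simp add: f0)
  then have "((\<lambda>w. w * ?f w / w ^ a) ---> 0) (at 0)" by (rule tendsto_eventually)
  then show False using lim L LIM_unique by blast
 qed
 define k where "k = order 0 D"
 have "[:- 0, 1:] ^ k dvd D" unfolding k_def by (rule order_1)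
 then obtain D1 where D1: "D = [:0, 1:] ^ k * D1" by (auto simp: dvd_def)
 have D10: "poly D1 0 \<noteq> 0"
 proof
  assume "poly D1 0 = 0"
  then have "[:0, 1:] dvd D1" using poly_eq_0_iff_dvd[of D1 0] by simp
  then have "[:0, 1:] ^ k * [:0, 1:] dvd [:0, 1:] ^ k * D1" by (rule mult_dvd_mono[OF dvd_refl])
  then have "[:- 0, 1:] ^ Suc k dvd D" by (simp only: D1[symmetric] power_Suc2 minus_zero)
  then show False using order_2[OF Dnz, of 0] by (simp add: k_def)
 qed
 have kpos: "0 < k" using D0 Dnz order_root[of D 0] by (simp add: k_def)
 have pd: "w * poly (pderiv D) w = w ^ k * (of_nat k * poly D1 w + w * poly (pderiv D1) w)" for w
 proof -
  obtain j where j: "k = Suc j" using kpos by (cases k) auto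
  have "w * poly (pderiv ([:0, 1:] ^ k)) w = of_nat k * w ^ k"
   unfolding j pderiv_power_Suc by (simp add: pderiv_pCons poly_power del: of_nat_Suc)
  moreover have "w * poly (pderiv D) w = w ^ k * (w * poly (pderiv D1) w) + w * poly (pderiv ([:0, 1:] ^ k)) w * poly D1 w"
   unfolding D1 by (simp add: pderiv_mult poly_power algebra_simps)
  ultimately show ?thesis by (simp add: algebra_simps)
 qed
 have fk: "w * ?f w / w ^ k = ((of_nat k * poly D1 w + w * poly (pderiv D1) w) * poly B w - w * poly D1 w * poly (pderiv B) w) / (poly A w * poly B w)"
  if w: "w \<notin> S" "w \<noteq> 0" for w
 proof -
  have "w * ?f w * (poly A w * poly B w) = (w * poly (pderiv D) w) * poly B w - w * poly D w * poly (pderiv B) w"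
   using wr[OF w(1)] by (simp add: algebra_simps)
  also have "\<dots> = w ^ k * ((of_nat k * poly D1 w + w * poly (pderiv D1) w) * poly B w - w * poly D1 w * poly (pderiv B) w)"
   unfolding pd by (simp add: D1 poly_power algebra_simps)
  finally show ?thesis using A0[OF w(1)] w(2) by (simp add: field_simps)
 qed
 have "((\<lambda>w. ((of_nat k * poly D1 w + w * poly (pderiv D1) w) * poly B w - w * poly D1 w * poly (pderiv B) w) / (poly A w * poly B w)) --->
  ((of_nat k * poly D1 0 + 0 * poly (pderiv D1) 0) * poly B 0 - 0 * poly D1 0 * poly (pderiv B) 0) / (poly A 0 * poly B 0)) (at 0)"
  by (intro tendsto_intros poly_isCont[unfolded isCont_def]) (use A0[of 0] S in auto)
 then have "((\<lambda>w. w * ?f w / w ^ k) ---> ((of_nat k * poly D1 0 + 0 * poly (pderiv D1) 0) * poly B 0 - 0 * poly D1 0 * poly (pderiv B) 0) / (poly A 0 * poly B 0)) (at 0)"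
 proof (rule Lim_transform_eventually)
  show "\<forall>\<^sub>F w in at 0. ((of_nat k * poly D1 w + w * poly (pderiv D1) w) * poly B w - w * poly D1 w * poly (pderiv B) w) / (poly A w * poly B w) = w * ?f w / w ^ k"
   using eventually_at_notin_finite[of "insert 0 S" 0] S(1) by (auto elim!: eventually_mono simp: fk)
 qed
 then have limk: "((\<lambda>w. w * ?f w / w ^ k) ---> of_nat k * poly D1 0 * poly B 0 / (poly A 0 * poly B 0)) (at 0)"
  by (simp only: mult_zero_left add_0_right diff_0_right)
 have "a = k" by (rule order_unique[OF lim limk L]) (use kpos D10 A0[of 0] S in auto)
 moreover have "k \<le> degree D" unfolding k_def by (rule order_degree[OF Dnz])
 moreover have "degree D \<le> max (degree A) (degree B)"
  unfolding D_def by (rule order_trans[OF degree_diff_le_max]) (auto simp: le_max_iff_disj degree_smult_le)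
 ultimately have "int a \<le> max (int (degree A)) (int (degree B))" by linarith
 then show ?thesis unfolding degA degB .
qed

text \<open>A change of coordinate keeps the order and multiplies the leading coefficient by
  \<open>deriv g w0 ^ n\<close>. For \<open>n = 0\<close> this factor is 1: residues are
  invariant.\<close>

lemma transfer_order:
 assumes g: "g holomorphic_on ball w0 r" "0 < r" "g w0 = 0" "deriv g w0 \<noteq> 0"
  and ev: "\<And>w. w \<in> ball w0 r ==> w \<noteq> w0 ==> g w \<noteq> 0 \<and> Fw w = Fv (g w) / deriv g w"
  and lim: "((\<lambda>v. v / Fv v / v ^ n) ---> L) (at 0)"
 shows "((\<lambda>w. (w - w0) / Fw w / (w - w0) ^ n) ---> L * deriv g w0 ^ n) (at w0)"
  and "filterlim g (at 0) (at w0)"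
proof -
 have w0: "w0 \<in> ball w0 r" using g by simp
 have evb: "\<forall>\<^sub>F w in at w0. w \<in> ball w0 r \<and> w \<noteq> w0" by (rule eventually_ball[OF g(2)])
 have gc: "(g ---> 0) (at w0)"
  using hol_cont[OF g(1)] w0 g(3)
  unfolding continuous_on_eq_continuous_at[OF open_ball] isCont_def by fastforce
 show fl: "filterlim g (at 0) (at w0)"
  unfolding filterlim_at using gc evb ev by (auto elim!: eventually_mono)
 have q: "((\<lambda>w. g w / (w - w0)) ---> deriv g w0) (at w0)"
  using holomorphic_derivI[OF g(1) open_ball w0] g(3) by (simp add: has_field_derivative_iff)
 have dc: "(deriv g ---> deriv g w0) (at w0)"
  using hol_cont[OF holomorphic_deriv[OF g(1) open_ball]] w0
  unfolding continuous_on_eq_continuous_at[OF open_ball] isCont_def by blast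
 have "((\<lambda>w. (g w / Fv (g w) / g w ^ n) * (g w / (w - w0)) ^ n * (deriv g w / (g w / (w - w0)))) --->
   L * deriv g w0 ^ n * (deriv g w0 / deriv g w0)) (at w0)"
  by (intro tendsto_intros q dc g(4) filterlim_compose[OF lim fl])
 then have "((\<lambda>w. (w - w0) / Fw w / (w - w0) ^ n) ---> L * deriv g w0 ^ n * (deriv g w0 / deriv g w0)) (at w0)"
 proof (rule Lim_transform_eventually)
  show "\<forall>\<^sub>F w in at w0. (g w / Fv (g w) / g w ^ n) * (g w / (w - w0)) ^ n * (deriv g w / (g w / (w - w0))) = (w - w0) / Fw w / (w - w0) ^ n"
   using evb
  proof eventually_elim
   case (elim w)
   have gw: "g w \<noteq> 0" "Fw w = Fv (g w) / deriv g w" using ev elim by auto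
   define a where "a = g w"
   define c where "c = w - w0"
   have "c \<noteq> 0" "a \<noteq> 0" using elim gw by (auto simp: c_def a_def)
   then have "(a / X / a ^ n) * (a / c) ^ n * (d / (a / c)) = c / (X / d) / c ^ n" for X d
    by (simp add: power_divide)
   then show ?case unfolding gw(2) a_def c_def by blast
  qed
 qed
 then show "((\<lambda>w. (w - w0) / Fw w / (w - w0) ^ n) ---> L * deriv g w0 ^ n) (at w0)" using g(4) by simp
qed

section \<open>Moebius coordinates\<close>

fun mob :: "complex => complex => complex => complex => sphere => sphere" where
 "mob a b c d None = (if c = 0 then None else Some (a / c))"
| "mob a b c d (Some w) = (if c * w + d = 0 then None else Some ((a * w + b) / (c * w + d)))"

text \<open>Exchanging the columns precomposes with \<open>w \<mapsto> 1 / w\<close>; statements at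
  infinity are thereby read off from statements at 0.\<close>

lemma mob_at_infinity: "mob b a d c (Some 0) = mob a b c d None"
 by simp

lemma mob_inverse:
 assumes "a * d - b * c \<noteq> 0" shows "mob d (- b) (- c) a (mob a b c d x) = x"
proof (cases x)
 case None
 have "c = 0 ==> a \<noteq> 0 \<and> d \<noteq> 0" using assms by auto
 moreover have "d * (a / c) + - b \<noteq> 0" if "c \<noteq> 0" using assms that by (simp add: field_simps)
 ultimately show ?thesis using None by (simp add: field_simps)
next
 case (Some w)
 show ?thesis
 proof (cases "c * w + d = 0")
  case True
  then have "c \<noteq> 0" using assms by auto
  moreover have "w = - (d / c)" using True \<open>c \<noteq> 0\<close> by (simp add: field_simps eq_neg_iff_add_eq_0)
  ultimately show ?thesis using True Some by simp
 next
  case False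
  have e: "- c * ((a * w + b) / (c * w + d)) + a = (a * d - b * c) / (c * w + d)"
   using False by (simp add: field_simps)
  moreover have "d * ((a * w + b) / (c * w + d)) + - b = (a * d - b * c) * w / (c * w + d)"
   using False by (simp add: field_simps)
  ultimately show ?thesis using Some False assms by simp
 qed
qed

lemma mob_bij: "a * d - b * c \<noteq> 0 ==> bij (mob a b c d)"
proof (rule bij_betw_byWitness[where f' = "mob d (- b) (- c) a"])
 assume D: "a * d - b * c \<noteq> 0"
 show "\<forall>x\<in>UNIV. mob d (- b) (- c) a (mob a b c d x) = x" using mob_inverse[OF D] by simp
 have "d * a - (- b) * (- c) \<noteq> 0" using D by (simp add: mult.commute)
 from mob_inverse[OF this] show "\<forall>x\<in>UNIV. mob a b c d (mob d (- b) (- c) a x) = x" by simp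
qed auto

lemma mob_exists:
 assumes "p \<noteq> q"
 obtains a b c d where "a * d - b * c \<noteq> 0" "mob a b c d (Some 0) = p" "mob a b c d None = q"
proof (cases p)
 case None
 then obtain y where "q = Some y" using assms by (cases q) auto
 then show ?thesis using that[of y 0 1 1] that[of y 1 1 0] None by simp
next
 case (Some x)
 show ?thesis
 proof (cases q)
  case None
  then show ?thesis using that[of 1 1 x 0] Some by simp
 next
  case s: (Some y)
  then show ?thesis using that[of "- y" 1 x "- 1"] Some assms by simp
 qed
qed

lemma mob_deriv:
 fixes a b c d w :: complex
 assumes "c * w + d \<noteq> 0"
 shows "((\<lambda>w. (a * w + b) / (c * w + d)) has_field_derivative (a * d - b * c) / (c * w + d)\<^sup>2) (at w)"
proof -
 have "((\<lambda>w. (a * w + b) / (c * w + d)) has_field_derivative (a * (c * w + d) - (a * w + b) * c) / ((c * w + d) * (c * w + d))) (at w)"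
  using assms by (auto intro!: derivative_eq_intros)
 moreover have "a * (c * w + d) - (a * w + b) * c = a * d - b * c" by (simp add: algebra_simps)
 ultimately show ?thesis by (simp add: power2_eq_square)
qed

lemma linear_nonzero_ball:
 fixes c d w0 :: complex
 assumes "c * w0 + d \<noteq> 0" obtains r where "0 < r" "\<And>w. w \<in> ball w0 r ==> c * w + d \<noteq> 0"
proof -
 have "open {w. c * w + d \<noteq> 0}" by (intro open_Collect_neq continuous_intros)
 then obtain r where "0 < r" "ball w0 r \<subseteq> {w. c * w + d \<noteq> 0}"
  using assms unfolding open_contains_ball by blast
 then show ?thesis using that by blast
qed

text \<open>\<open>g\<close> is a Moebius map in the standard coordinate at the image of \<open>w0\<close>.\<close>
definition mob_coord :: "complex => complex => complex => complex => complex => (complex => complex) => real => bool" where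
 "mob_coord a b c d w0 g r \<longleftrightarrow> 0 < r \<and> g holomorphic_on ball w0 r \<and> g w0 = 0 \<and> (\<forall>w\<in>ball w0 r. deriv g w \<noteq> 0 \<and>
  mob a b c d (Some w) = param (mob a b c d (Some w0)) (g w) \<and> coord (mob a b c d (Some w0)) (mob a b c d (Some w)) = g w \<and>
  (w \<noteq> w0 --> g w \<noteq> 0 \<and> c * w + d \<noteq> 0 \<and> chart_pt (mob a b c d (Some w0)) (g w) = (a * w + b) / (c * w + d) \<and>
   chart_der (mob a b c d (Some w0)) (g w) * deriv g w = (a * d - b * c) / (c * w + d)\<^sup>2))"

lemma mob_coordD:
 assumes "mob_coord a b c d w0 g r"
 shows "0 < r" "g holomorphic_on ball w0 r" "g w0 = 0" "deriv g w0 \<noteq> 0"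
  "\<And>w. w \<in> ball w0 r ==> mob a b c d (Some w) = param (mob a b c d (Some w0)) (g w)"
  "\<And>w. w \<in> ball w0 r ==> coord (mob a b c d (Some w0)) (mob a b c d (Some w)) = g w"
  "\<And>w. w \<in> ball w0 r ==> w \<noteq> w0 ==> g w \<noteq> 0 \<and> c * w + d \<noteq> 0 \<and>
   chart_pt (mob a b c d (Some w0)) (g w) = (a * w + b) / (c * w + d) \<and>
   chart_der (mob a b c d (Some w0)) (g w) * deriv g w = (a * d - b * c) / (c * w + d)\<^sup>2"
 using assms centre_in_ball[of w0 r] unfolding mob_coord_def by blast+

text \<open>If \<open>w0\<close> is sent to infinity, the coordinate there is \<open>1 / z\<close>,
  and numerator and denominator change roles; hence the two cases.\<close>

lemma mob_local:
 assumes D: "a * d - b * c \<noteq> 0"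
 shows "\<exists>g r. mob_coord a b c d w0 g r"
proof (cases "c * w0 + d = 0")
 case False
 obtain r where r: "0 < r" "\<And>w. w \<in> ball w0 r ==> c * w + d \<noteq> 0"
  using linear_nonzero_ball[OF False] by blast
 define g where "g = (\<lambda>w. (a * w + b) / (c * w + d) - (a * w0 + b) / (c * w0 + d))"
 have gd: "(g has_field_derivative (a * d - b * c) / (c * w + d)\<^sup>2) (at w)" if "w \<in> ball w0 r" for w
  unfolding g_def using DERIV_diff[OF mob_deriv[OF r(2)[OF that], of a b] DERIV_const] by simp
 have dg: "deriv g w = (a * d - b * c) / (c * w + d)\<^sup>2" if "w \<in> ball w0 r" for w
  by (rule DERIV_imp_deriv[OF gd[OF that]])
 have gw: "g w = (a * d - b * c) * (w - w0) / ((c * w + d) * (c * w0 + d))" if "w \<in> ball w0 r" for w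
  unfolding g_def using r(2)[OF that] False by (simp add: diff_frac_eq) (simp add: algebra_simps)
 have m: "mob a b c d (Some w0) = Some ((a * w0 + b) / (c * w0 + d))" using False by simp
 show ?thesis
 proof (intro exI[of _ g] exI[of _ r], unfold mob_coord_def, intro conjI ballI)
  show "g holomorphic_on ball w0 r" using gd holomorphic_on_open[OF open_ball] by blast
  fix w assume w: "w \<in> ball w0 r"
  show "deriv g w \<noteq> 0" using dg[OF w] D r(2)[OF w] by simp
  show "mob a b c d (Some w) = param (mob a b c d (Some w0)) (g w)" unfolding m using r(2)[OF w] by (simp add: g_def)
  show "coord (mob a b c d (Some w0)) (mob a b c d (Some w)) = g w" unfolding m using r(2)[OF w] by (simp add: g_def)
  show "w \<noteq> w0 --> g w \<noteq> 0 \<and> c * w + d \<noteq> 0 \<and> chart_pt (mob a b c d (Some w0)) (g w) = (a * w + b) / (c * w + d) \<and>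
   chart_der (mob a b c d (Some w0)) (g w) * deriv g w = (a * d - b * c) / (c * w + d)\<^sup>2"
  proof (intro impI conjI)
   assume "w \<noteq> w0"
   then show "g w \<noteq> 0" unfolding gw[OF w] using r(2)[OF w] D False by simp
   show "chart_pt (mob a b c d (Some w0)) (g w) = (a * w + b) / (c * w + d)" unfolding m by (simp add: g_def)
   show "chart_der (mob a b c d (Some w0)) (g w) * deriv g w = (a * d - b * c) / (c * w + d)\<^sup>2" unfolding m dg[OF w] by simp
  qed (rule r(2)[OF w])
 qed (use r in \<open>simp_all add: g_def\<close>)
next
 case True
 then have c0: "c \<noteq> 0" using D by auto
 have "a * w0 + b \<noteq> 0"
 proof
  assume "a * w0 + b = 0"
  then have "c * (a * w0 + b) - a * (c * w0 + d) = 0" using True by simp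
  then show False using D by (simp add: algebra_simps)
 qed
 then obtain r where r: "0 < r" "\<And>w. w \<in> ball w0 r ==> a * w + b \<noteq> 0"
  using linear_nonzero_ball by blast
 define g where "g = (\<lambda>w. (c * w + d) / (a * w + b))"
 have gd: "(g has_field_derivative (c * b - d * a) / (a * w + b)\<^sup>2) (at w)" if "w \<in> ball w0 r" for w
  unfolding g_def using mob_deriv[OF r(2)[OF that], of c d] by simp
 have dg: "deriv g w = (c * b - d * a) / (a * w + b)\<^sup>2" if "w \<in> ball w0 r" for w
  by (rule DERIV_imp_deriv[OF gd[OF that]])
 have m: "mob a b c d (Some w0) = None" using True by simp
 have z: "c * w + d = 0 \<longleftrightarrow> w = w0" for w
 proof -
  have "c * w + d = c * (w - w0) + (c * w0 + d)" by (simp add: algebra_simps)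
  then show ?thesis using c0 True by simp
 qed
 show ?thesis
 proof (intro exI[of _ g] exI[of _ r], unfold mob_coord_def, intro conjI ballI)
  show "g holomorphic_on ball w0 r" using gd holomorphic_on_open[OF open_ball] by blast
  fix w assume w: "w \<in> ball w0 r"
  show "deriv g w \<noteq> 0" using dg[OF w] D r(2)[OF w] by (simp add: mult.commute)
  show "mob a b c d (Some w) = param (mob a b c d (Some w0)) (g w)" unfolding m using r(2)[OF w] by (simp add: g_def)
  show "coord (mob a b c d (Some w0)) (mob a b c d (Some w)) = g w" unfolding m using r(2)[OF w] by (simp add: g_def)
  have A: "a * w + b \<noteq> 0" "w \<noteq> w0 ==> c * w + d \<noteq> 0" using r(2)[OF w] z by auto
  have "- 1 / ((c * w + d) / (a * w + b))\<^sup>2 * ((c * b - d * a) / (a * w + b)\<^sup>2) = (a * d - b * c) / (c * w + d)\<^sup>2"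
  proof -
   have "- 1 / (X / Y)\<^sup>2 * (Z / Y\<^sup>2) = (- Z) / X\<^sup>2" if "Y \<noteq> 0" for X Y Z :: complex
    using that by (simp add: power_divide)
   from this[where Y = "a * w + b" and X = "c * w + d" and Z = "c * b - d * a", OF A(1)]
   show ?thesis by (simp add: mult.commute)
  qed
  then show "w \<noteq> w0 --> g w \<noteq> 0 \<and> c * w + d \<noteq> 0 \<and> chart_pt (mob a b c d (Some w0)) (g w) = (a * w + b) / (c * w + d) \<and>
   chart_der (mob a b c d (Some w0)) (g w) * deriv g w = (a * d - b * c) / (c * w + d)\<^sup>2"
   unfolding m chart_pt.simps chart_der.simps dg[OF w] using A by (simp add: g_def)
 qed (use r True in \<open>simp_all add: g_def\<close>)
qed

declare mob.simps [simp del]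

section \<open>Order and leading coefficient of the form at every point\<close>

context hcmu_surface
begin

definition F_chart :: "sphere => complex => complex" where
 "F_chart x \<zeta> = F (chart_pt x \<zeta>) / chart_der x \<zeta>"

text \<open>\<open>n\<close> is the order of \<open>dz / F\<close> at \<open>x\<close> plus one, and
  \<open>L\<close> the leading coefficient in the standard coordinate, which for
  \<open>n = 0\<close> is the residue.\<close>

definition ord_data :: "sphere => nat => complex => bool" where
 "ord_data x n L \<longleftrightarrow> L \<noteq> 0 \<and> ((\<lambda>\<zeta>. \<zeta> / F_chart x \<zeta> / \<zeta> ^ n) ---> L) (at 0) \<and> (\<forall>\<^sub>F \<zeta> in at 0. F (chart_pt x \<zeta>) \<noteq> 0)"

text \<open>The zeros of \<open>F\<close> are countable, so deleting them leaves the domain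
  connected, and its image under the curvature is a connected set on which \<open>G\<close> is
  positive.\<close>

lemma curvature_component:
 "(\<exists>a b. a < b \<and> (\<forall>x\<in>{a<..<b}. 0 < G x) \<and> G a = 0 \<and> G b = 0 \<and> (\<forall>z\<in>\<Omega>. F z \<noteq> 0 --> \<kappa> z \<in> {a<..<b}))
 \<or> (\<exists>b. (\<forall>x\<in>{..<b}. 0 < G x) \<and> (\<forall>z\<in>\<Omega>. F z \<noteq> 0 --> \<kappa> z \<in> {..<b}))"
proof -
 let ?Z = "{z \<in> \<Omega>. F z = 0}"
 have c: "countable ?Z"
 proof (cases "F constant_on \<Omega>")
  case True
  then have "?Z = {}" using F_not_zero unfolding constant_on_def by auto
  then show ?thesis by (simp only: countable_empty)
 next
  case False
  obtain C :: "nat => complex set" where C: "\<And>n. compact (C n)" "\<Union> (range C) = \<Omega>"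
   using open_Union_compact_subsets[OF open_\<Omega>] by metis
  then have "fsigma \<Omega>" unfolding fsigma_Union_compact by (intro exI[of _ C]) auto
  then show ?thesis using holomorphic_countable_zeros[OF F open_\<Omega> connected_\<Omega>] False by blast
 qed
 have conn: "connected (\<Omega> - ?Z)"
  by (rule connected_open_diff_countable[OF _ open_\<Omega> connected_\<Omega> c]) simp
 let ?X = "\<kappa> ` (\<Omega> - ?Z)"
 have "connected ?X"
  by (rule connected_continuous_image[OF continuous_on_subset[OF kappa_cont] conn]) auto
 moreover have "?X \<noteq> {}" using F_not_zero by auto
 moreover have "0 < G x" if x: "x \<in> ?X" for x
 proof -
  obtain z where z: "z \<in> \<Omega>" "F z \<noteq> 0" "x = \<kappa> z" using x by auto
  have "0 < exp (2 * \<phi> z) * (cmod (F z))\<^sup>2" using z(2) by simp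
  then show ?thesis using metric_F[OF z(1)] z(3) by simp
 qed
 ultimately have "(\<exists>a b. ?X \<subseteq> {a<..<b} \<and> a < b \<and> (\<forall>x\<in>{a<..<b}. 0 < G x) \<and> G a = 0 \<and> G b = 0)
  \<or> (\<exists>b. ?X \<subseteq> {..<b} \<and> (\<forall>x\<in>{..<b}. 0 < G x))"
  by (rule cubic_component)
 then show ?thesis
 proof (elim disjE exE conjE)
  fix a b assume *: "?X \<subseteq> {a<..<b}" "a < b" "\<forall>x\<in>{a<..<b}. 0 < G x" "G a = 0" "G b = 0"
  show ?thesis by (rule disjI1, rule exI[of _ a], rule exI[of _ b]) (use * in blast)
 next
  fix b assume *: "?X \<subseteq> {..<b}" "\<forall>x\<in>{..<b}. 0 < G x"
  show ?thesis by (rule disjI2, rule exI[of _ b]) (use * in blast)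
 qed
qed

text \<open>The coordinate supplied with the angle is arbitrary; its inverse carries the local
  result back to the standard coordinate.\<close>

lemma inverse_chart:
 assumes b: "0 < b" and h: "h holomorphic_on ball 0 b" "inj_on h (ball 0 b)" "h 0 = 0"
  and dz: "\<And>v. v \<in> annulus 0 b ==> deriv (\<lambda>v. chart_pt x (h v)) v = chart_der x (h v) * deriv h v"
 obtains g r where "0 < r" "g holomorphic_on ball 0 r" "g 0 = 0" "deriv g 0 \<noteq> 0"
  "\<And>w. w \<in> ball 0 r ==> w \<noteq> 0 ==> g w \<noteq> 0 \<and> F_chart x w = F_local (\<lambda>v. chart_pt x (h v)) (g w) / deriv g w"
  "\<And>w. w \<in> ball 0 r ==> h (g w) = w"
proof -
 obtain g where g: "g holomorphic_on (h ` ball 0 b)" "\<And>z. z \<in> ball 0 b ==> deriv h z * deriv g (h z) = 1"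
  "\<And>z. z \<in> ball 0 b ==> g (h z) = z"
  by (rule holomorphic_has_inverse[OF h(1) open_ball h(2)]) (rule that)
 have "open (h ` ball 0 b)" by (rule open_mapping_thm3[OF h(1) open_ball h(2)])
 moreover have "0 \<in> h ` ball 0 b" using b h(3) by (metis centre_in_ball image_eqI)
 ultimately obtain r where r: "0 < r" "ball 0 r \<subseteq> h ` ball 0 b" unfolding open_contains_ball by blast
 have pre: "\<exists>v\<in>ball 0 b. w = h v \<and> g w = v" if "w \<in> ball 0 r" for w using r(2) that g(3) by auto
 have g0: "g 0 = 0" using g(3)[of 0] h(3) b by simp
 show ?thesis
 proof (rule that[of r g])
  show "g holomorphic_on ball 0 r" using g(1) r(2) by (rule holomorphic_on_subset)
  show "deriv g 0 \<noteq> 0" using g(2)[of 0] h(3) b by auto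
  show "h (g w) = w" if "w \<in> ball 0 r" for w using pre[OF that] by auto
  fix w :: complex assume w: "w \<in> ball 0 r" "w \<noteq> 0"
  obtain v where v: "v \<in> ball 0 b" "w = h v" "g w = v" using pre[OF w(1)] by blast
  have v0: "v \<noteq> 0" using v w h(3) by auto
  then have va: "v \<in> annulus 0 b" using v by (simp add: annulus_def)
  have d1: "deriv h v * deriv g w = 1" using g(2)[OF v(1)] v(2) by simp
  have "F (chart_pt x (h v)) / (chart_der x (h v) * deriv h v) / deriv g w = F (chart_pt x (h v)) / (chart_der x (h v) * (deriv h v * deriv g w))"
   by (simp add: mult_ac)
  also have "\<dots> = F_chart x w" unfolding d1 by (simp add: F_chart_def v(2)[symmetric])
  finally show "g w \<noteq> 0 \<and> F_chart x w = F_local (\<lambda>v. chart_pt x (h v)) (g w) / deriv g w"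
   using v0 unfolding v(3) F_local_def dz[OF va] by simp
 qed (use r g0 in auto)
qed

lemma ord_data_transfer:
 assumes b: "0 < b" and h: "h holomorphic_on ball 0 b" "inj_on h (ball 0 b)" "h 0 = 0"
  and dz: "\<And>v. v \<in> annulus 0 b ==> deriv (\<lambda>v. chart_pt x (h v)) v = chart_der x (h v) * deriv h v"
  and lim: "((\<lambda>v. v / (F_local (\<lambda>v. chart_pt x (h v)) v) / v ^ n) ---> L) (at 0)" and L: "L \<noteq> 0"
  and ev: "\<forall>\<^sub>F v in at 0. F_local (\<lambda>v. chart_pt x (h v)) v \<noteq> 0"
 obtains M where "ord_data x n M" "n = 0 ==> M = L"
  "\<And>k. ((\<lambda>v. \<kappa> (chart_pt x (h v))) ---> k) (at 0) ==> ((\<lambda>\<zeta>. \<kappa> (chart_pt x \<zeta>)) ---> k) (at 0)"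
proof -
 obtain g r where r: "0 < r" and g: "g holomorphic_on ball 0 r" "g 0 = 0" "deriv g 0 \<noteq> 0"
  and gw: "\<And>w. w \<in> ball 0 r ==> w \<noteq> 0 ==> g w \<noteq> 0 \<and> F_chart x w = F_local (\<lambda>v. chart_pt x (h v)) (g w) / deriv g w"
  and hg: "\<And>w. w \<in> ball 0 r ==> h (g w) = w"
  by (rule inverse_chart[OF b h dz]) (assumption | rule that)+
 note tr = transfer_order[OF g(1) r g(2,3) gw lim]
 have evr: "\<forall>\<^sub>F w in at 0. w \<in> ball 0 r"
  unfolding eventually_at using r by (intro exI[of _ r]) (auto simp: dist_commute)
 have "\<forall>\<^sub>F w in at 0. F_local (\<lambda>v. chart_pt x (h v)) (g w) \<noteq> 0"
  using tr(2) ev unfolding filterlim_iff by blast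
 then have e: "\<forall>\<^sub>F w in at 0. F (chart_pt x w) \<noteq> 0"
  using evr by eventually_elim (auto simp: hg F_local_def)
 show ?thesis
 proof (rule that[of "L * deriv g 0 ^ n"])
  show "ord_data x n (L * deriv g 0 ^ n)"
   unfolding ord_data_def using tr(1) e L g(3) by simp
  fix k assume "((\<lambda>v. \<kappa> (chart_pt x (h v))) ---> k) (at 0)"
  from filterlim_compose[OF this tr(2)] have "((\<lambda>w. \<kappa> (chart_pt x (h (g w)))) ---> k) (at 0)" .
  then show "((\<lambda>\<zeta>. \<kappa> (chart_pt x \<zeta>)) ---> k) (at 0)"
   by (rule Lim_transform_eventually) (use evr in eventually_elim, simp add: hg)
 qed simp
qed

lemma ord_data_unbounded:
 assumes pos: "\<And>t. t \<in> {..<b1} ==> 0 < G t" and J: "\<And>z. z \<in> \<Omega> ==> F z \<noteq> 0 ==> \<kappa> z \<in> {..<b1}"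
 shows "\<exists>n L. ord_data x n L \<and> (n = 0 --> Re L < 0)"
proof -
 obtain hh where hh: "\<And>t. t \<in> {..<b1} ==> (hh has_real_derivative 1 / G t) (at t)" "\<exists>C. \<forall>t\<in>{..<b1}. - hh t \<le> C"
  using cubic_primitive_unbounded[OF pos] by metis
 have bd: "(\<exists>C\<ge>0. \<forall>t\<in>{..<b1}. hh t \<le> C * (C - ln (G t)) \<and> ln (G t) \<le> C) \<or> (\<exists>C. \<forall>t\<in>{..<b1}. - hh t \<le> C)"
  using hh(2) by (rule disjI2)
 obtain h b where b: "0 < b" and h: "h holomorphic_on ball 0 b" "inj_on h (ball 0 b)" "h 0 = 0"
  and dz: "\<And>v. v \<in> annulus 0 b ==> deriv (\<lambda>v. chart_pt x (h v)) v = chart_der x (h v) * deriv h v"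
  and P: "punctured_hcmu b (F_local (\<lambda>v. chart_pt x (h v))) (chart_grad (\<lambda>v. chart_pt x (h v))) (\<lambda>v. \<kappa> (chart_pt x (h v))) (phi_local (\<lambda>v. chart_pt x (h v))) G hh {..<b1} (ang x)"
  by (rule punctured_chart[OF J hh(1) bd, of x]) (assumption | rule that)+
 obtain n L where o: "L \<noteq> 0" "((\<lambda>v. v / (F_local (\<lambda>v. chart_pt x (h v)) v) / v ^ n) ---> L) (at 0)"
  "\<forall>\<^sub>F v in at 0. F_local (\<lambda>v. chart_pt x (h v)) v \<noteq> 0"
  "(\<exists>C. \<forall>t\<in>{..<b1}. - hh t \<le> C) ==> n = 0 ==> Re L < 0"
  by (rule punctured_hcmu.order_limit[OF P]) (assumption | rule that)+
 obtain M where "ord_data x n M" "n = 0 ==> M = L"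
  by (rule ord_data_transfer[OF b h dz o(2,1,3)]) (assumption | rule that)+
 then show ?thesis using o(4)[OF hh(2)] by (intro exI[of _ n] exI[of _ M]) auto
qed

lemma ord_data_bounded:
 assumes roots: "G a1 = 0" "G b1 = 0" "a1 < b1"
  and pos: "\<And>t. t \<in> {a1<..<b1} ==> 0 < G t" and J: "\<And>z. z \<in> \<Omega> ==> F z \<noteq> 0 ==> \<kappa> z \<in> {a1<..<b1}"
 shows "\<exists>n L k. ord_data x n L \<and> ((\<lambda>\<zeta>. \<kappa> (chart_pt x \<zeta>)) ---> k) (at 0) \<and>
  (n = 0 --> Im L = 0 \<and> (Re L < 0 --> k = b1) \<and> (0 < Re L --> k = a1)) \<and> (0 < n --> k \<in> {a1<..<b1}) \<and>
  ang x = (c0 - k\<^sup>2 / 4) * (if n = 0 then Re L else 0) + n"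
proof -
 obtain hh where hh: "\<And>t. t \<in> {a1<..<b1} ==> (hh has_real_derivative 1 / G t) (at t)"
  "\<exists>C\<ge>0. \<forall>t\<in>{a1<..<b1}. hh t \<le> C * (C - ln (G t)) \<and> ln (G t) \<le> C" "\<And>y. \<exists>t\<in>{a1<..<b1}. hh t = y"
  by (rule cubic_primitive_bounded[OF roots pos]) (assumption | rule that)+
 have bd: "(\<exists>C\<ge>0. \<forall>t\<in>{a1<..<b1}. hh t \<le> C * (C - ln (G t)) \<and> ln (G t) \<le> C) \<or> (\<exists>C. \<forall>t\<in>{a1<..<b1}. - hh t \<le> C)"
  using hh(2) by (rule disjI1)
 obtain h b where b: "0 < b" and h: "h holomorphic_on ball 0 b" "inj_on h (ball 0 b)" "h 0 = 0"
  and dz: "\<And>v. v \<in> annulus 0 b ==> deriv (\<lambda>v. chart_pt x (h v)) v = chart_der x (h v) * deriv h v"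
  and P: "punctured_hcmu b (F_local (\<lambda>v. chart_pt x (h v))) (chart_grad (\<lambda>v. chart_pt x (h v))) (\<lambda>v. \<kappa> (chart_pt x (h v))) (phi_local (\<lambda>v. chart_pt x (h v))) G hh {a1<..<b1} (ang x)"
  by (rule punctured_chart[OF J hh(1) bd, of x]) (assumption | rule that)+
 have B: "punctured_hcmu_bdd b (F_local (\<lambda>v. chart_pt x (h v))) (chart_grad (\<lambda>v. chart_pt x (h v)))
   (\<lambda>v. \<kappa> (chart_pt x (h v))) (phi_local (\<lambda>v. chart_pt x (h v))) G hh a1 b1 (ang x) (\<lambda>t. c0 - t\<^sup>2 / 4)"
  by (intro punctured_hcmu_bdd.intro punctured_hcmu_bdd_axioms.intro P hh(3) pos cubic_deriv) (auto intro!: continuous_intros)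
 obtain n L k where o: "L \<noteq> 0" "((\<lambda>v. v / (F_local (\<lambda>v. chart_pt x (h v)) v) / v ^ n) ---> L) (at 0)"
  "((\<lambda>v. \<kappa> (chart_pt x (h v))) ---> k) (at 0)"
  "\<forall>\<^sub>F v in at 0. F_local (\<lambda>v. chart_pt x (h v)) v \<noteq> 0"
  "n = 0 ==> Im L = 0" "n = 0 ==> Re L < 0 ==> k = b1" "n = 0 ==> 0 < Re L ==> k = a1"
  "0 < n ==> k \<in> {a1<..<b1}" "ang x = (c0 - k\<^sup>2 / 4) * (if n = 0 then Re L else 0) + n"
  by (rule punctured_hcmu_bdd.local_data[OF B]) (assumption | rule that)+
 obtain M where M: "ord_data x n M" "n = 0 ==> M = L"
  and kl: "\<And>k. ((\<lambda>v. \<kappa> (chart_pt x (h v))) ---> k) (at 0) ==> ((\<lambda>\<zeta>. \<kappa> (chart_pt x \<zeta>)) ---> k) (at 0)"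
  by (rule ord_data_transfer[OF b h dz o(2,1,4)]) (assumption | rule that)+
 show ?thesis
  by (rule exI[of _ n], rule exI[of _ M], rule exI[of _ k], intro conjI M(1) kl o(3) impI)
   (use M(2) o(5-9) in auto)
qed

end

section \<open>The form in a Moebius coordinate that puts the marked points at 0 and
  infinity\<close>

locale hcmu_order = hcmu_surface +
 fixes n :: "sphere => nat" and L :: "sphere => complex" and ma mb mc md :: complex
 assumes ord: "\<And>x. ord_data x (n x) (L x)"
  and det: "ma * md - mb * mc \<noteq> 0"
  and mob_0: "mob ma mb mc md (Some 0) = p" and mob_inf: "mob ma mb mc md None = q"
begin

abbreviation "T \<equiv> mob ma mb mc md"

definition F_mob :: "complex => complex" where
 "F_mob w = F ((ma * w + mb) / (mc * w + md)) / ((ma * md - mb * mc) / (mc * w + md)\<^sup>2)"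

text \<open>Off this set the field is holomorphic and nonzero in the coordinate \<open>w\<close>. It
  includes the point sent to infinity, where the formula for \<open>F_mob\<close> divides by
  0.\<close>

definition zeros :: "complex set" where
 "zeros = {w. w = 0 \<or> mc * w + md = 0 \<or> F_mob w = 0}"

lemma T_inj: "T x = T y \<longleftrightarrow> x = y"
 using mob_bij[OF det] by (meson bij_is_inj injD)

lemma T_dom: "w \<noteq> 0 ==> mc * w + md \<noteq> 0 ==> (ma * w + mb) / (mc * w + md) \<in> \<Omega>"
proof -
 assume w: "w \<noteq> 0" "mc * w + md \<noteq> 0"
 have "T (Some w) \<noteq> p" "T (Some w) \<noteq> q" using T_inj[of "Some w" "Some 0"] T_inj[of "Some w" None] mob_0 mob_inf w by auto
 then show ?thesis using w by (auto simp: plane_dom_def mob.simps)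
qed

lemma order_mob_general:
 assumes D: "a * d - b * c \<noteq> 0"
 obtains M where "M \<noteq> 0" "n (mob a b c d (Some w0)) = 0 ==> M = L (mob a b c d (Some w0))"
  "((\<lambda>w. (w - w0) / (F ((a * w + b) / (c * w + d)) / ((a * d - b * c) / (c * w + d)\<^sup>2)) / (w - w0) ^ n (mob a b c d (Some w0))) ---> M) (at w0)"
  "\<forall>\<^sub>F w in at w0. F ((a * w + b) / (c * w + d)) \<noteq> 0 \<and> c * w + d \<noteq> 0"
proof -
 let ?x = "mob a b c d (Some w0)"
 obtain g r where "mob_coord a b c d w0 g r" using mob_local[OF D] by blast
 note m = mob_coordD[OF this]
 note r = m(1) and g = m(2-4) and gw = m(7)
 let ?FM = "\<lambda>w. F ((a * w + b) / (c * w + d)) / ((a * d - b * c) / (c * w + d)\<^sup>2)"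
 have e: "g w \<noteq> 0 \<and> ?FM w = F_chart ?x (g w) / deriv g w" if "w \<in> ball w0 r" "w \<noteq> w0" for w
  using gw[OF that] unfolding F_chart_def by (metis divide_divide_eq_left)
 have o: "L ?x \<noteq> 0" "((\<lambda>\<zeta>. \<zeta> / F_chart ?x \<zeta> / \<zeta> ^ n ?x) ---> L ?x) (at 0)" "\<forall>\<^sub>F \<zeta> in at 0. F (chart_pt ?x \<zeta>) \<noteq> 0"
  using ord[of ?x] unfolding ord_data_def by auto
 note tr = transfer_order[OF g(1) r g(2,3) e o(2)]
 have evr: "\<forall>\<^sub>F w in at w0. w \<in> ball w0 r \<and> w \<noteq> w0" by (rule eventually_ball[OF r])
 have "\<forall>\<^sub>F w in at w0. F (chart_pt ?x (g w)) \<noteq> 0" using tr(2) o(3) unfolding filterlim_iff by blast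
 then have ev: "\<forall>\<^sub>F w in at w0. F ((a * w + b) / (c * w + d)) \<noteq> 0 \<and> c * w + d \<noteq> 0"
  using evr by eventually_elim (metis gw)
 show ?thesis by (rule that[of "L ?x * deriv g w0 ^ n ?x", OF _ _ tr(1) ev]) (use o(1) g(3) in auto)
qed

lemma order_mob:
 obtains M where "\<And>w. M w \<noteq> 0" "\<And>w. n (T (Some w)) = 0 ==> M w = L (T (Some w))"
  "\<And>w0. ((\<lambda>w. (w - w0) * (1 / F_mob w) / (w - w0) ^ n (T (Some w0))) ---> M w0) (at w0)"
proof -
 have "\<exists>M. M \<noteq> 0 \<and> (n (T (Some w0)) = 0 --> M = L (T (Some w0))) \<and> ((\<lambda>w. (w - w0) * (1 / F_mob w) / (w - w0) ^ n (T (Some w0))) ---> M) (at w0)" for w0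
 proof -
  obtain M where M: "M \<noteq> 0" "n (T (Some w0)) = 0 ==> M = L (T (Some w0))"
  "((\<lambda>w. (w - w0) / (F ((ma * w + mb) / (mc * w + md)) / ((ma * md - mb * mc) / (mc * w + md)\<^sup>2)) / (w - w0) ^ n (T (Some w0))) ---> M) (at w0)"
   by (rule order_mob_general[OF det, of w0]) (assumption | rule that)+
  have e: "(\<lambda>w. (w - w0) * (1 / F_mob w) / (w - w0) ^ n (T (Some w0))) =
   (\<lambda>w. (w - w0) / (F ((ma * w + mb) / (mc * w + md)) / ((ma * md - mb * mc) / (mc * w + md)\<^sup>2)) / (w - w0) ^ n (T (Some w0)))"
   by (rule ext) (simp only: F_mob_def times_divide_eq_right mult_1_right)
  show ?thesis unfolding e by (intro exI[of _ M] conjI impI M)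
 qed
 then have "\<forall>w0. \<exists>M. M \<noteq> 0 \<and> (n (T (Some w0)) = 0 --> M = L (T (Some w0))) \<and> ((\<lambda>w. (w - w0) * (1 / F_mob w) / (w - w0) ^ n (T (Some w0))) ---> M) (at w0)" by blast
 from choice[OF this] obtain M where "\<forall>w0. M w0 \<noteq> 0 \<and> (n (T (Some w0)) = 0 --> M w0 = L (T (Some w0))) \<and> ((\<lambda>w. (w - w0) * (1 / F_mob w) / (w - w0) ^ n (T (Some w0))) ---> M w0) (at w0)" ..
 then show ?thesis by (intro that[of M]) auto
qed

text \<open>The coordinate is \<open>y = 1 / w\<close>, obtained by exchanging the columns of the
  Moebius matrix. The determinant then changes sign, which is the origin of the minus sign in front
  of \<open>1 / F_mob (1 / y)\<close>.\<close>

lemma order_infinity: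
 obtains M where "M \<noteq> 0" "n q = 0 ==> M = L q"
  "((\<lambda>y. - (1 / F_mob (1 / y)) / y / y ^ n q) ---> M) (at 0)"
  "\<forall>\<^sub>F y in at 0. 1 / y \<notin> zeros"
proof -
 have D: "mb * mc - ma * md \<noteq> 0" using det by (simp add: algebra_simps)
 have q: "mob mb ma md mc (Some 0) = q" using mob_at_infinity mob_inf by simp
 obtain M where M: "M \<noteq> 0" "n q = 0 ==> M = L q"
  "((\<lambda>y. (y - 0) / (F ((mb * y + ma) / (md * y + mc)) / ((mb * mc - ma * md) / (md * y + mc)\<^sup>2)) / (y - 0) ^ n q) ---> M) (at 0)"
  "\<forall>\<^sub>F y in at 0. F ((mb * y + ma) / (md * y + mc)) \<noteq> 0 \<and> md * y + mc \<noteq> 0"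
  by (rule order_mob_general[OF D, of 0, unfolded q]) (assumption | rule that)+
 have y0: "\<forall>\<^sub>F y in at 0. y \<noteq> (0::complex)" by (simp add: eventually_at_filter)
 have z: "mc * (1 / y) + md = (md * y + mc) / y" "(ma * (1 / y) + mb) / ((md * y + mc) / y) = (mb * y + ma) / (md * y + mc)" if "y \<noteq> 0" for y
 proof -
  show *: "mc * (1 / y) + md = (md * y + mc) / y" using that by (simp add: field_simps)
  have "ma * (1 / y) + mb = (mb * y + ma) / y" using that by (simp add: field_simps)
  then show "(ma * (1 / y) + mb) / ((md * y + mc) / y) = (mb * y + ma) / (md * y + mc)" using that by simp
 qed
 show ?thesis
 proof (rule that[of M, OF M(1,2)])
  show "\<forall>\<^sub>F y in at 0. 1 / y \<notin> zeros"
   using M(4) y0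
  proof eventually_elim
   case (elim y)
   then show ?case unfolding zeros_def F_mob_def mem_Collect_eq z[OF elim(2)] using det by simp
  qed
  show "((\<lambda>y. - (1 / F_mob (1 / y)) / y / y ^ n q) ---> M) (at 0)"
  proof (rule Lim_transform_eventually[OF M(3)])
   show "\<forall>\<^sub>F y in at 0. (y - 0) / (F ((mb * y + ma) / (md * y + mc)) / ((mb * mc - ma * md) / (md * y + mc)\<^sup>2)) / (y - 0) ^ n q = - (1 / F_mob (1 / y)) / y / y ^ n q"
    using M(4) y0
   proof eventually_elim
    case (elim y)
    define X where "X = F ((mb * y + ma) / (md * y + mc))"
    have "F_mob (1 / y) = X / ((ma * md - mb * mc) / ((md * y + mc) / y)\<^sup>2)"
     unfolding F_mob_def z[OF elim(2)] X_def by simp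
    moreover have "(y - 0) / (X / (E / m\<^sup>2)) = - (1 / (X / (- E / (m / y)\<^sup>2))) / y" if "X \<noteq> 0" "m \<noteq> 0" for E m
     using that elim(2) by (simp add: power2_eq_square field_simps)
    from this[of "md * y + mc" "mb * mc - ma * md"] have "(y - 0) / (X / ((mb * mc - ma * md) / (md * y + mc)\<^sup>2)) = - (1 / (X / ((ma * md - mb * mc) / ((md * y + mc) / y)\<^sup>2))) / y"
     using elim(1) by (simp add: X_def)
    ultimately show ?case unfolding X_def by simp
   qed
  qed
 qed
qed

lemma F_mob_holomorphic: "F_mob holomorphic_on {w. w \<noteq> 0 \<and> mc * w + md \<noteq> 0}"
proof -
 let ?S = "{w. w \<noteq> 0 \<and> mc * w + md \<noteq> 0}"
 have z: "(\<lambda>w. (ma * w + mb) / (mc * w + md)) holomorphic_on ?S" by (intro holomorphic_intros) auto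
 have "(F \<circ> (\<lambda>w. (ma * w + mb) / (mc * w + md))) holomorphic_on ?S"
  by (rule holomorphic_on_compose_gen[OF z F]) (use T_dom in auto)
 then show ?thesis unfolding F_mob_def[abs_def] using det by (intro holomorphic_intros) (auto simp: o_def)
qed

text \<open>The order data at every point, infinity included, show that the set accumulates nowhere
  on the sphere; compactness does the rest.\<close>

lemma finite_zeros: "finite zeros"
proof (rule ccontr)
 assume inf: "infinite zeros"
 have ni: "\<not> w0 islimpt zeros" for w0
 proof -
  obtain M where "\<forall>\<^sub>F w in at w0. F ((ma * w + mb) / (mc * w + md)) \<noteq> 0 \<and> mc * w + md \<noteq> 0"
   by (rule order_mob_general[OF det, of w0]) blast
  moreover have "\<forall>\<^sub>F w in at w0. w \<noteq> 0" using eventually_at_notin_finite[of "{0}" w0] by simp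
  ultimately have "\<forall>\<^sub>F w in at w0. w \<notin> zeros"
   by eventually_elim (use det in \<open>simp add: zeros_def F_mob_def\<close>)
  then show ?thesis by (simp add: islimpt_iff_eventually)
 qed
 obtain M where "\<forall>\<^sub>F y in at 0. 1 / y \<notin> zeros" by (rule order_infinity) blast
 then obtain e where e: "0 < e" "\<And>y. y \<noteq> 0 ==> cmod y < e ==> 1 / y \<notin> zeros"
  unfolding eventually_at by auto
 have "zeros \<subseteq> cball 0 (1 / e)"
 proof
  fix w assume w: "w \<in> zeros"
  show "w \<in> cball 0 (1 / e)"
  proof (rule ccontr)
   assume "w \<notin> cball 0 (1 / e)"
   then have gt: "1 / e < cmod w" by simp
   then have "w \<noteq> 0" using e(1) by (auto simp: not_less[symmetric])
   moreover have "cmod (1 / w) < e" using gt e(1) \<open>w \<noteq> 0\<close> by (simp add: norm_divide field_simps)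
   ultimately show False using e(2)[of "1 / w"] w by simp
  qed
 qed
 then have "\<exists>x. x islimpt zeros"
  using compact_cball[of 0 "1 / e"] inf unfolding compact_eq_Bolzano_Weierstrass by blast
 then show False using ni by blast
qed

lemma zero_set_closed_form: "- zeros \<subseteq> {w. w \<noteq> 0 \<and> mc * w + md \<noteq> 0}" "w \<notin> zeros ==> F_mob w \<noteq> 0" "0 \<in> zeros"
 by (auto simp: zeros_def)

lemma inv_F_holomorphic: "(\<lambda>w. 1 / F_mob w) holomorphic_on - zeros"
 by (intro holomorphic_intros holomorphic_on_subset[OF F_mob_holomorphic] zero_set_closed_form) (auto simp: zeros_def)

lemma pole_in_zeros: "n (T (Some s)) = 0 ==> s \<in> zeros"
proof (rule ccontr)
 assume s: "n (T (Some s)) = 0" "s \<notin> zeros"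
 obtain M where M: "\<And>w. M w \<noteq> 0" "\<And>w0. ((\<lambda>w. (w - w0) * (1 / F_mob w) / (w - w0) ^ n (T (Some w0))) ---> M w0) (at w0)"
  by (rule order_mob) (assumption | rule that)+
 have op: "open (- zeros)" using finite_zeros by (simp add: finite_imp_closed open_Compl)
 have "isCont (\<lambda>w. 1 / F_mob w) s"
  using hol_cont[OF inv_F_holomorphic] s(2) op by (simp add: continuous_on_eq_continuous_at)
 then have lim: "((\<lambda>w. 1 / F_mob w) ---> 1 / F_mob s) (at s)" by (simp add: isCont_def)
 have "((\<lambda>w. (w - s) * (1 / F_mob w)) ---> (s - s) * (1 / F_mob s)) (at s)"
  by (rule tendsto_mult[OF _ lim]) (intro tendsto_intros)
 moreover have "((\<lambda>w. (w - s) * (1 / F_mob w)) ---> M s) (at s)" using M(2)[of s] s(1) by simp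
 ultimately have "M s = (s - s) * (1 / F_mob s)" by (meson LIM_unique)
 then show False using M(1)[of s] by simp
qed

definition poles :: "complex set" where
 "poles = {s. n (T (Some s)) = 0}"

lemma poles_eq: "poles = {s. s \<in> zeros \<and> n (T (Some s)) = 0}"
 using pole_in_zeros by (auto simp: poles_def)

lemma finite_poles: "finite poles"
 unfolding poles_eq using finite_zeros by simp

lemma partial_fractions: "w \<notin> zeros ==> 1 / F_mob w = (\<Sum>s\<in>poles. L (T (Some s)) / (w - s))"
 and residue_sum: "(\<Sum>s\<in>poles. L (T (Some s))) = - (if n q = 0 then L q else 0)"
proof -
 obtain M where M: "\<And>w. M w \<noteq> 0" "\<And>w. n (T (Some w)) = 0 ==> M w = L (T (Some w))"
  "\<And>w0. ((\<lambda>w. (w - w0) * (1 / F_mob w) / (w - w0) ^ n (T (Some w0))) ---> M w0) (at w0)"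
  by (rule order_mob) (rule that)
 obtain Mi where Mi: "Mi \<noteq> 0" "n q = 0 ==> Mi = L q" "((\<lambda>y. - (1 / F_mob (1 / y)) / y / y ^ n q) ---> Mi) (at 0)"
  by (rule order_infinity) (rule that)
 note sp = simple_pole_form[OF finite_zeros inv_F_holomorphic M(3) Mi(3), folded poles_eq]
 have "(\<Sum>s\<in>poles. M s / (w - s)) = (\<Sum>s\<in>poles. L (T (Some s)) / (w - s))"
  by (rule sum.cong) (simp_all add: poles_def M(2))
 then show "w \<notin> zeros ==> 1 / F_mob w = (\<Sum>s\<in>poles. L (T (Some s)) / (w - s))"
  using sp(1)[of w] by simp
 have "(\<Sum>s\<in>poles. M s) = (\<Sum>s\<in>poles. L (T (Some s)))"
  by (rule sum.cong) (simp_all add: poles_def M(2))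
 then show "(\<Sum>s\<in>poles. L (T (Some s))) = - (if n q = 0 then L q else 0)"
  using sp(2) Mi(2) by (cases "n q = 0") simp_all
qed

lemma exists_not_zero: "\<exists>w. w \<notin> zeros"
 using finite_zeros ex_new_if_finite infinite_UNIV_char_0 by blast

lemma poles_nonempty: "poles \<noteq> {}"
proof
 assume e: "poles = {}"
 obtain w where w: "w \<notin> zeros" using exists_not_zero by blast
 then show False using partial_fractions[OF w] zero_set_closed_form(2)[OF w] by (simp add: e)
qed

text \<open>The hypothesis says that zeros of the form can sit only at \<open>p\<close> and
  \<open>q\<close>, which are 0 and infinity in the coordinate \<open>w\<close>, as
  \<open>pole_count\<close> wants.\<close>

lemma pole_number:
 assumes "\<And>x. x \<noteq> p ==> x \<noteq> q ==> n x \<le> 1"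
 shows "card (poles - {0}) = n p + n q"
  and "\<exists>M. M \<noteq> 0 \<and> ((\<lambda>w. w * (\<Sum>s\<in>poles. L (T (Some s)) / (w - s)) / w ^ n p) ---> M) (at 0)"
proof -
 obtain M where M: "\<And>w. M w \<noteq> 0" "\<And>w. n (T (Some w)) = 0 ==> M w = L (T (Some w))"
  "\<And>w0. ((\<lambda>w. (w - w0) * (1 / F_mob w) / (w - w0) ^ n (T (Some w0))) ---> M w0) (at w0)"
  by (rule order_mob) (rule that)
 obtain Mi where Mi: "Mi \<noteq> 0" "((\<lambda>y. - (1 / F_mob (1 / y)) / y / y ^ n q) ---> Mi) (at 0)"
  by (rule order_infinity) (rule that)
 have n1: "n (T (Some t)) \<le> 1" if "t \<in> zeros" "t \<noteq> 0" for t
 proof (rule assms)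
  show "T (Some t) \<noteq> p" "T (Some t) \<noteq> q" using T_inj[of "Some t" "Some 0"] T_inj[of "Some t" None] mob_0 mob_inf that by auto
 qed
 have nz: "1 / F_mob w \<noteq> 0" if "w \<notin> zeros" for w using zero_set_closed_form(2)[OF that] by simp
 have "{s \<in> zeros. n (T (Some s)) = 0 \<and> s \<noteq> 0} = poles - {0}" using pole_in_zeros by (auto simp: poles_def)
 then show "card (poles - {0}) = n p + n q"
  using pole_count(1)[OF finite_zeros zero_set_closed_form(3) inv_F_holomorphic nz M(3) M(1) n1 Mi(2,1)] mob_0 by simp
 have "((\<lambda>w. w * (\<Sum>s\<in>poles. L (T (Some s)) / (w - s)) / w ^ n p) ---> M 0) (at 0)"
 proof (rule Lim_transform_eventually)
  show "((\<lambda>w. (w - 0) * (1 / F_mob w) / (w - 0) ^ n p) ---> M 0) (at 0)" using M(3)[of 0] mob_0 by simp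
  show "\<forall>\<^sub>F w in at 0. (w - 0) * (1 / F_mob w) / (w - 0) ^ n p = w * (\<Sum>s\<in>poles. L (T (Some s)) / (w - s)) / w ^ n p"
   using eventually_at_notin_finite[OF finite_zeros, of 0] by eventually_elim (simp add: partial_fractions)
 qed
 then show "\<exists>M. M \<noteq> 0 \<and> ((\<lambda>w. w * (\<Sum>s\<in>poles. L (T (Some s)) / (w - s)) / w ^ n p) ---> M) (at 0)" using M(1) by blast
qed

end

section \<open>Extremal points and saddles\<close>

lemma openin_riemann_sphere:
 "openin riemann_sphere V \<longleftrightarrow> open {z. Some z \<in> V} \<and> (None \<in> V --> bounded {z. Some z \<notin> V})"
proof
 assume "openin riemann_sphere V"
 then consider U where "open U" "V = Some ` U" | C where "compact C" "V = insert None (Some ` (- C))"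
  unfolding riemann_sphere_def openin_Alexandroff_compactification by (auto simp: Compl_eq_Diff_UNIV)
 then show "open {z. Some z \<in> V} \<and> (None \<in> V --> bounded {z. Some z \<notin> V})"
 proof cases
  case 1
  then have "{z. Some z \<in> V} = U" "None \<notin> V" by auto
  then show ?thesis using 1 by simp
 next
  case 2
  then have "{z. Some z \<in> V} = - C" "{z. Some z \<notin> V} = C" by auto
  then show ?thesis using 2 by (simp add: compact_imp_bounded compact_imp_closed open_Compl)
 qed
next
 assume r: "open {z. Some z \<in> V} \<and> (None \<in> V --> bounded {z. Some z \<notin> V})"
 show "openin riemann_sphere V"
 proof (cases "None \<in> V")
  case False
  have V: "V = Some ` {z. Some z \<in> V}"
  proof (rule set_eqI)
   fix x show "x \<in> V \<longleftrightarrow> x \<in> Some ` {z. Some z \<in> V}" using False by (cases x) auto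
  qed
  have o: "openin euclidean {z. Some z \<in> V}" using r by (simp add: open_openin[symmetric])
  show ?thesis unfolding riemann_sphere_def openin_Alexandroff_compactification
   by (rule disjI1, rule exI[of _ "{z. Some z \<in> V}"], rule conjI[OF o V])
 next
  case True
  let ?C = "{z. Some z \<notin> V}"
  have "- ?C = {z. Some z \<in> V}" by auto
  then have cl: "closed ?C" using r by (simp add: closed_def)
  have "V = insert None (Some ` (- ?C))"
  proof (rule set_eqI)
   fix x show "x \<in> V \<longleftrightarrow> x \<in> insert None (Some ` (- ?C))" using True by (cases x) auto
  qed
  moreover have "compact ?C" using cl r True by (simp add: compact_eq_bounded_closed)
  ultimately show ?thesis
   unfolding riemann_sphere_def openin_Alexandroff_compactification using cl
   by (intro disjI2 exI[of _ ?C]) (simp add: Compl_eq_Diff_UNIV)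
 qed
qed

lemma topspace_riemann_sphere: "topspace riemann_sphere = UNIV"
proof (rule set_eqI)
 fix x show "x \<in> topspace riemann_sphere \<longleftrightarrow> x \<in> UNIV" by (cases x) (simp_all add: riemann_sphere_def)
qed

text \<open>Continuity becomes a limit in the punctured standard coordinate at each point, the form
  in which limits of the curvature are known.\<close>

lemma continuous_map_riemann_sphere:
 "continuous_map riemann_sphere euclideanreal k \<longleftrightarrow> (\<forall>x. ((\<lambda>\<zeta>. k (Some (chart_pt x \<zeta>))) ---> k x) (at 0))"
proof
 assume c: "continuous_map riemann_sphere euclideanreal k"
 show "\<forall>x. ((\<lambda>\<zeta>. k (Some (chart_pt x \<zeta>))) ---> k x) (at 0)"
 proof (rule allI, rule topological_tendstoI)
  fix x S assume S: "open S" "k x \<in> S"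
  have "openin riemann_sphere {y \<in> topspace riemann_sphere. k y \<in> S}"
   by (rule openin_continuous_map_preimage[OF c]) (use S in simp)
  moreover have "{y \<in> topspace riemann_sphere. k y \<in> S} = {y. k y \<in> S}"
   by (simp add: topspace_riemann_sphere)
  ultimately have o: "open {z. k (Some z) \<in> S}" "k None \<in> S ==> bounded {z. k (Some z) \<notin> S}"
   unfolding openin_riemann_sphere by auto
  show "\<forall>\<^sub>F \<zeta> in at 0. k (Some (chart_pt x \<zeta>)) \<in> S"
  proof (cases x)
   case (Some a)
   then have "a \<in> {z. k (Some z) \<in> S}" using S by simp
   then obtain e where e: "0 < e" "ball a e \<subseteq> {z. k (Some z) \<in> S}" using o(1) open_contains_ball by blast
   then show ?thesis unfolding eventually_at Some
    by (intro exI[of _ e]) (auto simp: dist_norm subset_iff)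
  next
   case None
   then obtain B where B: "0 < B" "\<And>z. k (Some z) \<notin> S ==> cmod z \<le> B" using o(2) S bounded_pos by (metis mem_Collect_eq)
   have "k (Some (1 / \<zeta>)) \<in> S" if z: "\<zeta> \<noteq> 0" "cmod \<zeta> < 1 / B" for \<zeta>
   proof (rule ccontr)
    assume "k (Some (1 / \<zeta>)) \<notin> S"
    then have "1 / cmod \<zeta> \<le> B" using B(2)[of "1 / \<zeta>"] by (simp add: norm_divide)
    then show False using z B(1) by (simp add: field_simps)
   qed
   then show ?thesis unfolding eventually_at None using B(1) by (intro exI[of _ "1 / B"]) simp
  qed
 qed
next
 assume lim: "\<forall>x. ((\<lambda>\<zeta>. k (Some (chart_pt x \<zeta>))) ---> k x) (at 0)"
 have "isCont (\<lambda>z. k (Some z)) a" for a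
  using lim[rule_format, of "Some a"] unfolding isCont_iff by simp
 then have co: "continuous_on UNIV (\<lambda>z. k (Some z))" by (simp add: continuous_at_imp_continuous_on)
 have "openin riemann_sphere {y \<in> topspace riemann_sphere. k y \<in> S}" if S: "open S" for S
 proof -
  have "open {z. k (Some z) \<in> S}" using open_vimage[OF S co] by (simp add: vimage_def)
  moreover have "bounded {z. k (Some z) \<notin> S}" if "k None \<in> S"
  proof -
   have "\<forall>\<^sub>F \<zeta> in at 0. k (Some (1 / \<zeta>)) \<in> S"
    using topological_tendstoD[OF lim[rule_format, of None] S that] by simp
   then obtain e where e: "0 < e" "\<And>\<zeta>. \<zeta> \<noteq> 0 ==> cmod \<zeta> < e ==> k (Some (1 / \<zeta>)) \<in> S"
    unfolding eventually_at by auto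
   have "cmod z \<le> 1 / e" if z: "k (Some z) \<notin> S" for z
   proof (rule ccontr)
    assume "\<not> cmod z \<le> 1 / e"
    then have gt: "1 / e < cmod z" by simp
    then have z0: "z \<noteq> 0" using e(1) by (auto simp: not_less[symmetric])
    then have "cmod (1 / z) < e" using gt e(1) by (simp add: norm_divide field_simps)
    then show False using e(2)[of "1 / z"] z0 z by simp
   qed
   then show ?thesis unfolding bounded_iff by blast
  qed
  moreover have "{y \<in> topspace riemann_sphere. k y \<in> S} = {y. k y \<in> S}"
   by (simp add: topspace_riemann_sphere)
  ultimately show ?thesis unfolding openin_riemann_sphere by simp
 qed
 then show "continuous_map riemann_sphere euclideanreal k" unfolding continuous_map_def by simp
qed

section \<open>The curvature on the closed sphere: extrema, residues and angles\<close>

locale hcmu_sphere = hcmu_order +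
 fixes a1 b1 :: real and kx :: "sphere => real"
 assumes roots: "G a1 = 0" "G b1 = 0" "a1 < b1"
  and G_pos: "\<And>t. t \<in> {a1<..<b1} ==> 0 < G t"
  and K_range: "\<And>z. z \<in> \<Omega> ==> F z \<noteq> 0 ==> \<kappa> z \<in> {a1<..<b1}"
  and kx_lim: "\<And>x. ((\<lambda>\<zeta>. \<kappa> (chart_pt x \<zeta>)) ---> kx x) (at 0)"
  and Im_L: "\<And>x. n x = 0 ==> Im (L x) = 0"
  and kx_max: "\<And>x. n x = 0 ==> Re (L x) < 0 ==> kx x = b1"
  and kx_min: "\<And>x. n x = 0 ==> 0 < Re (L x) ==> kx x = a1"
  and kx_saddle: "\<And>x. 0 < n x ==> kx x \<in> {a1<..<b1}"
  and ang_eq: "\<And>x. ang x = (c0 - (kx x)\<^sup>2 / 4) * (if n x = 0 then Re (L x) else 0) + n x"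

text \<open>An interval of curvature values unbounded below is excluded here. In that case every
  pole, infinity included, would have a negative residue, whereas the residues add up to 0 and there
  is at least one finite pole.\<close>

lemma hcmu_sphere_exists:
 assumes H: "hcmu_surface u p q \<alpha> \<beta> F c0 c1"
 obtains n L ma mb mc md a1 b1 kx where "hcmu_sphere u p q \<alpha> \<beta> F c0 c1 n L ma mb mc md a1 b1 kx"
proof -
 interpret hcmu_surface u p q \<alpha> \<beta> F c0 c1 by (rule H)
 obtain ma mb mc md where m: "ma * md - mb * mc \<noteq> 0" "mob ma mb mc md (Some 0) = p" "mob ma mb mc md None = q"
  by (rule mob_exists[OF pq]) (rule that)
 consider (bdd) a1 b1 where "a1 < b1" "\<And>t. t \<in> {a1<..<b1} ==> 0 < G t" "G a1 = 0" "G b1 = 0"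
   "\<And>z. z \<in> \<Omega> ==> F z \<noteq> 0 ==> \<kappa> z \<in> {a1<..<b1}"
  | (unb) b1 where "\<And>t. t \<in> {..<b1} ==> 0 < G t" "\<And>z. z \<in> \<Omega> ==> F z \<noteq> 0 ==> \<kappa> z \<in> {..<b1}"
  using curvature_component by blast
 then show ?thesis
 proof cases
  case unb
  have "\<forall>x. \<exists>nL. ord_data x (fst nL) (snd nL) \<and> (fst nL = 0 --> Re (snd nL) < 0)"
   using ord_data_unbounded[OF unb(1,2)] by (metis fst_conv snd_conv)
  from choice[OF this] obtain nL where nL: "\<And>x. ord_data x (fst (nL x)) (snd (nL x))" "\<And>x. fst (nL x) = 0 ==> Re (snd (nL x)) < 0"
   by blast
  interpret hcmu_order u p q \<alpha> \<beta> F c0 c1 "\<lambda>x. fst (nL x)" "\<lambda>x. snd (nL x)" ma mb mc md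
   by unfold_locales (rule nL(1) m)+
  have "(\<Sum>s\<in>poles. Re (snd (nL (T (Some s))))) < (\<Sum>s\<in>poles. 0)"
   by (rule sum_strict_mono[OF finite_poles poles_nonempty]) (simp add: poles_def nL(2))
  moreover have "Re (\<Sum>s\<in>poles. snd (nL (T (Some s)))) \<ge> 0"
   unfolding residue_sum using nL(2)[of q] by (cases "fst (nL q) = 0") (simp_all add: less_imp_le)
  ultimately have False by simp
  then show ?thesis ..
 next
  case bdd
  let ?P = "\<lambda>x n L k. ord_data x n L \<and> ((\<lambda>\<zeta>. \<kappa> (chart_pt x \<zeta>)) ---> k) (at 0) \<and>
  (n = 0 --> Im L = 0 \<and> (Re L < 0 --> k = b1) \<and> (0 < Re L --> k = a1)) \<and> (0 < n --> k \<in> {a1<..<b1}) \<and>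
  ang x = (c0 - k\<^sup>2 / 4) * (if n = 0 then Re L else 0) + real n"
  have "\<forall>x. \<exists>t. ?P x (fst t) (fst (snd t)) (snd (snd t))"
  proof
   fix x
   obtain n L k where "?P x n L k" using ord_data_bounded[OF bdd(3,4,1,2,5), of x] by blast
   then show "\<exists>t. ?P x (fst t) (fst (snd t)) (snd (snd t))" by - (rule exI[of _ "(n, L, k)"], unfold fst_conv snd_conv, assumption)
  qed
  from choice[OF this] obtain t where t: "\<And>x. ?P x (fst (t x)) (fst (snd (t x))) (snd (snd (t x)))" by blast
  have "hcmu_sphere u p q \<alpha> \<beta> F c0 c1 (\<lambda>x. fst (t x)) (\<lambda>x. fst (snd (t x))) ma mb mc md a1 b1 (\<lambda>x. snd (snd (t x)))"
   by unfold_locales (use t m bdd in \<open>simp_all only: simp_thms\<close>)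
  then show ?thesis by (rule that)
 qed
qed

context hcmu_sphere
begin

lemma chart_eventually: "\<forall>\<^sub>F \<zeta> in at 0. chart_pt x \<zeta> \<in> \<Omega>"
 using near_point[of x] unfolding eventually_at by (auto simp: dist_norm)

lemma kx_plane: "z \<in> \<Omega> ==> kx (Some z) = \<kappa> z"
proof -
 assume z: "z \<in> \<Omega>"
 have "isCont \<kappa> z" using kappa_cont open_\<Omega> z by (simp add: continuous_on_eq_continuous_at)
 then have "((\<lambda>\<zeta>. \<kappa> (chart_pt (Some z) \<zeta>)) ---> \<kappa> z) (at 0)" by (simp add: isCont_iff)
 with kx_lim[of "Some z"] show ?thesis by (meson LIM_unique)
qed

lemma kx_chart_lim: "((\<lambda>\<zeta>. kx (Some (chart_pt x \<zeta>))) ---> kx x) (at 0)"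
 by (rule Lim_transform_eventually[OF kx_lim]) (use chart_eventually[of x] in eventually_elim, simp add: kx_plane)

lemma kx_eq: "x \<notin> {p, q} ==> kx x = gauss_curvature u x"
proof (cases x)
 case (Some z)
 assume "x \<notin> {p, q}"
 then show ?thesis using kx_plane[of z] Some by (simp add: plane_dom_def plane_curv_def)
next
 case None
 assume "x \<notin> {p, q}"
 then have "((\<lambda>\<zeta>. \<kappa> (1 / \<zeta>)) ---> gauss_curvature u None) (at 0)"
  using curvature_at_infinity[OF conf] None by simp
 with kx_lim[of None] show ?thesis unfolding None by (simp add: LIM_unique)
qed

text \<open>\<open>curvature_ext\<close> is a definite description; it is well defined because a
  continuous function on the sphere is determined by its values off two points.\<close>

lemma curvature_ext_eq: "curvature_ext u {p, q} = kx"
 unfolding curvature_ext_def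
proof (rule the_equality)
 show "continuous_map riemann_sphere euclideanreal kx \<and> (\<forall>x. x \<notin> {p, q} --> kx x = gauss_curvature u x)"
  using kx_chart_lim kx_eq unfolding continuous_map_riemann_sphere by blast
 fix k assume k: "continuous_map riemann_sphere euclideanreal k \<and> (\<forall>x. x \<notin> {p, q} --> k x = gauss_curvature u x)"
 show "k = kx"
 proof
  fix x
  have "((\<lambda>\<zeta>. k (Some (chart_pt x \<zeta>))) ---> k x) (at 0)" using k unfolding continuous_map_riemann_sphere by blast
  moreover have "((\<lambda>\<zeta>. k (Some (chart_pt x \<zeta>))) ---> kx x) (at 0)"
  proof (rule Lim_transform_eventually[OF kx_chart_lim])
   show "\<forall>\<^sub>F \<zeta> in at 0. kx (Some (chart_pt x \<zeta>)) = k (Some (chart_pt x \<zeta>))"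
    using chart_eventually[of x]
   proof eventually_elim
    case (elim \<zeta>)
    then have "Some (chart_pt x \<zeta>) \<notin> {p, q}" by (simp add: plane_dom_def)
    then show ?case using k kx_eq by simp
   qed
  qed
  ultimately show "k x = kx x" by (rule LIM_unique)
 qed
qed

lemma L_nz: "L x \<noteq> 0" and order_chart: "((\<lambda>\<zeta>. \<zeta> / F_chart x \<zeta> / \<zeta> ^ n x) ---> L x) (at 0)"
 and F_chart_eventually: "\<forall>\<^sub>F \<zeta> in at 0. F (chart_pt x \<zeta>) \<noteq> 0"
 using ord[of x] unfolding ord_data_def by auto

lemma Re_L_nz: "n x = 0 ==> Re (L x) \<noteq> 0"
 using L_nz[of x] Im_L[of x] by (auto simp: complex_eq_iff)

lemma L_real: "n x = 0 ==> L x = cr (Re (L x))"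
 using Im_L[of x] by (simp add: complex_eq_iff)

lemma kx_max_iff: "kx x = b1 \<longleftrightarrow> n x = 0 \<and> Re (L x) < 0"
 and kx_min_iff: "kx x = a1 \<longleftrightarrow> n x = 0 \<and> 0 < Re (L x)"
 and kx_range: "a1 \<le> kx x" "kx x \<le> b1"
proof -
 consider "0 < n x" | "n x = 0" "Re (L x) < 0" | "n x = 0" "0 < Re (L x)" using Re_L_nz[of x] by linarith
 then have "(kx x = b1 \<longleftrightarrow> n x = 0 \<and> Re (L x) < 0) \<and> (kx x = a1 \<longleftrightarrow> n x = 0 \<and> 0 < Re (L x)) \<and> a1 \<le> kx x \<and> kx x \<le> b1"
  by cases (use kx_saddle[of x] kx_max[of x] kx_min[of x] roots(3) in auto)
 then show "kx x = b1 \<longleftrightarrow> n x = 0 \<and> Re (L x) < 0" "kx x = a1 \<longleftrightarrow> n x = 0 \<and> 0 < Re (L x)" "a1 \<le> kx x" "kx x \<le> b1"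
  by auto
qed

definition extr :: "sphere set" where
 "extr = {x. n x = 0}"

lemma extr_poles: "extr = (\<lambda>s. T (Some s)) ` poles \<union> (if n q = 0 then {q} else {})"
 and q_not_pole: "q \<notin> (\<lambda>s. T (Some s)) ` poles"
 and inj_poles: "inj_on (\<lambda>s. T (Some s)) poles"
proof -
 show nq: "q \<notin> (\<lambda>s. T (Some s)) ` poles" using T_inj[of _ None] mob_inf by auto
 show "inj_on (\<lambda>s. T (Some s)) poles" using T_inj by (auto intro!: inj_onI)
 show "extr = (\<lambda>s. T (Some s)) ` poles \<union> (if n q = 0 then {q} else {})"
 proof (intro equalityI subsetI)
  fix x assume x: "x \<in> extr"
  have "x \<in> range T" using bij_is_surj[OF mob_bij[OF det]] by simp
  then obtain y where y: "x = T y" by blast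
  show "x \<in> (\<lambda>s. T (Some s)) ` poles \<union> (if n q = 0 then {q} else {})"
   using x y mob_inf by (cases y) (auto simp: extr_def poles_def)
 qed (auto simp: extr_def poles_def split: if_splits)
qed

lemma finite_extr: "finite extr"
 unfolding extr_poles using finite_poles by simp

lemma sum_extr: "(\<Sum>x\<in>extr. Re (L x)) = 0"
proof -
 have "(\<Sum>x\<in>extr. Re (L x)) = (\<Sum>x\<in>(\<lambda>s. T (Some s)) ` poles. Re (L x)) + (if n q = 0 then Re (L q) else 0)"
  unfolding extr_poles using q_not_pole finite_poles by (subst sum.union_disjoint) auto
 also have "(\<Sum>x\<in>(\<lambda>s. T (Some s)) ` poles. Re (L x)) = Re (\<Sum>s\<in>poles. L (T (Some s)))"
  by (simp add: sum.reindex[OF inj_poles])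
 finally show ?thesis unfolding residue_sum by simp
qed

lemma extr_ne: "extr \<noteq> {}"
 using poles_nonempty unfolding extr_poles by auto

text \<open>The residues add up to 0 and none of them is 0, so both signs occur; this is why both
  ends of the interval are attained.\<close>

lemma exists_max: "\<exists>x. n x = 0 \<and> Re (L x) < 0" and exists_min: "\<exists>x. n x = 0 \<and> 0 < Re (L x)"
proof -
 show "\<exists>x. n x = 0 \<and> Re (L x) < 0"
 proof (rule ccontr)
  assume no: "\<nexists>x. n x = 0 \<and> Re (L x) < 0"
  have "0 < Re (L x)" if "x \<in> extr" for x
  proof -
   have "n x = 0" using that by (simp add: extr_def)
   then have "\<not> Re (L x) < 0" "Re (L x) \<noteq> 0" using no Re_L_nz by blast+
   then show ?thesis by linarith
  qed
  then have "0 < (\<Sum>x\<in>extr. Re (L x))" by (rule sum_pos[OF finite_extr extr_ne])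
  then show False by (simp add: sum_extr)
 qed
 show "\<exists>x. n x = 0 \<and> 0 < Re (L x)"
 proof (rule ccontr)
  assume no: "\<nexists>x. n x = 0 \<and> 0 < Re (L x)"
  have "0 < - Re (L x)" if "x \<in> extr" for x
  proof -
   have "n x = 0" using that by (simp add: extr_def)
   then have "\<not> 0 < Re (L x)" "Re (L x) \<noteq> 0" using no Re_L_nz by blast+
   then show ?thesis by linarith
  qed
  then have "0 < (\<Sum>x\<in>extr. - Re (L x))" by (rule sum_pos[OF finite_extr extr_ne])
  then show False by (simp add: sum_extr sum_negf)
 qed
qed

lemma max_points_eq: "max_points kx = {x. n x = 0 \<and> Re (L x) < 0}"
proof -
 obtain y where y: "kx y = b1" using exists_max kx_max_iff by blast
 have "x \<in> max_points kx \<longleftrightarrow> kx x = b1" for x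
  unfolding max_points_def mem_Collect_eq
 proof
  assume "\<forall>z. kx z \<le> kx x"
  then have "b1 \<le> kx x" using y by auto
  then show "kx x = b1" using kx_range(2)[of x] by simp
 qed (simp add: kx_range(2))
 then show ?thesis using kx_max_iff by auto
qed

lemma min_points_eq: "min_points kx = {x. n x = 0 \<and> 0 < Re (L x)}"
proof -
 obtain y where y: "kx y = a1" using exists_min kx_min_iff by blast
 have "x \<in> min_points kx \<longleftrightarrow> kx x = a1" for x
  unfolding min_points_def mem_Collect_eq
 proof
  assume "\<forall>z. kx x \<le> kx z"
  then have "kx x \<le> a1" using y by auto
  then show "kx x = a1" using kx_range(1)[of x] by simp
 qed (simp add: kx_range(1))
 then show ?thesis using kx_min_iff by auto
qed

abbreviation "maxs \<equiv> max_points kx"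
abbreviation "mins \<equiv> min_points kx"

lemma extremal_points_eq: "extremal_points kx = extr"
 unfolding extremal_points_def max_points_eq min_points_eq extr_def using Re_L_nz by (auto simp: neq_iff)

lemma max_min_disjoint: "maxs \<inter> mins = {}" and finite_max: "finite (maxs)" and finite_min: "finite (mins)"
proof -
 show "maxs \<inter> mins = {}" unfolding max_points_eq min_points_eq by auto
 show "finite (maxs)" "finite (mins)"
  using finite_extr unfolding extremal_points_eq[symmetric] extremal_points_def by auto
qed

lemma ang_smooth: "x \<notin> {p, q} ==> ang x = 1"
 by (simp add: ang_def)

text \<open>At a smooth point with \<open>n x \<ge> 1\<close> the angle formula reads
  \<open>1 = n x\<close>, so the form has no zeros off the marked points.\<close>

lemma order_smooth: "x \<noteq> p ==> x \<noteq> q ==> n x \<le> 1"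
 using ang_eq[of x] ang_smooth[of x] by (cases "n x = 0") auto

lemma card_smooth_extr: "card (extr - {p, q}) = n p + n q"
proof -
 have "extr - {p, q} = (\<lambda>s. T (Some s)) ` (poles - {0})"
 proof (intro equalityI subsetI)
  fix x assume x: "x \<in> extr - {p, q}"
  then obtain s where "s \<in> poles" "x = T (Some s)" unfolding extr_poles by (auto split: if_splits)
  then show "x \<in> (\<lambda>s. T (Some s)) ` (poles - {0})" using x mob_0 by auto
 next
  fix x assume "x \<in> (\<lambda>s. T (Some s)) ` (poles - {0})"
  then obtain s where s: "s \<in> poles" "s \<noteq> 0" "x = T (Some s)" by auto
  then have "x \<noteq> p" "x \<noteq> q" using T_inj[of "Some s" "Some 0"] T_inj[of "Some s" None] mob_0 mob_inf by auto
  then show "x \<in> extr - {p, q}" using s unfolding extr_poles by auto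
 qed
 then have "card (extr - {p, q}) = card (poles - {0})"
  using card_image[OF inj_on_subset[OF inj_poles, of "poles - {0}"]] by simp
 then show ?thesis using pole_number(1)[OF order_smooth] by simp
qed

text \<open>\<open>ga\<close> and \<open>gb\<close> are the absolute slopes of \<open>G\<close> at
  its two ends. The slope \<open>ga\<close> at the minimum may be 0, and then every minimum has
  angle 0.\<close>

definition ga :: real where "ga = c0 - a1\<^sup>2 / 4"
definition gb :: real where "gb = b1\<^sup>2 / 4 - c0"

text \<open>The slopes differ by \<open>(b1 - a1)\<^sup>2 / 12\<close>. This positive difference is
  the source of the strict inequalities between weighted numbers of maxima and minima.\<close>

lemma slopes: "0 \<le> ga" "ga < gb" "gb = (b1 - a1) * (a1 + 2 * b1) / 12" "ga = (b1 - a1) * (b1 + 2 * a1) / 12"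
proof -
 note c = cubic_two_roots(2)[OF roots]
 note s = cubic_positive_sum[OF roots G_pos]
 show b: "gb = (b1 - a1) * (a1 + 2 * b1) / 12" by (subst gb_def, subst c) (simp add: power2_eq_square field_simps)
 show a: "ga = (b1 - a1) * (b1 + 2 * a1) / 12" by (subst ga_def, subst c) (simp add: power2_eq_square field_simps)
 have s1: "0 \<le> b1 + 2 * a1" using s by linarith
 show "0 \<le> ga" unfolding a using s1 roots(3) by simp
 have "0 < (b1 - a1) * (b1 - a1)" using roots(3) by simp
 moreover have "gb - ga = (b1 - a1) * (b1 - a1) / 12" unfolding a b by (simp add: field_simps)
 ultimately show "ga < gb" by simp
qed

lemma ang_max: "x \<in> maxs ==> ang x = - gb * Re (L x)"
 and ang_min: "x \<in> mins ==> ang x = ga * Re (L x)"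
 using ang_eq[of x] kx_max[of x] kx_min[of x] unfolding max_points_eq min_points_eq ga_def gb_def
 by (simp_all add: algebra_simps)

text \<open>The residue theorem with residues rewritten as angles over slopes. Cross-multiplying
  keeps it true for \<open>ga = 0\<close>, when the angles at the minima are 0.\<close>

lemma angle_balance: "ga * (\<Sum>x\<in>maxs. ang x) = gb * (\<Sum>x\<in>mins. ang x)"
proof -
 have "(\<Sum>x\<in>maxs. Re (L x)) + (\<Sum>x\<in>mins. Re (L x)) = (\<Sum>x\<in>extr. Re (L x))"
  unfolding extremal_points_eq[symmetric] extremal_points_def
  by (rule sum.union_disjoint[symmetric, OF finite_max finite_min max_min_disjoint])
 then have "(\<Sum>x\<in>mins. Re (L x)) = - (\<Sum>x\<in>maxs. Re (L x))" using sum_extr by simp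
 moreover have "(\<Sum>x\<in>maxs. ang x) = - gb * (\<Sum>x\<in>maxs. Re (L x))"
  by (simp only: ang_max sum_distrib_left cong: sum.cong)
 moreover have "(\<Sum>x\<in>mins. ang x) = ga * (\<Sum>x\<in>mins. Re (L x))"
  by (simp only: ang_min sum_distrib_left cong: sum.cong)
 ultimately show ?thesis by simp
qed

lemma min_smooth_ga: "x \<in> mins ==> x \<notin> {p, q} ==> 0 < ga"
 using ang_min[of x] ang_smooth[of x] slopes(1) by (cases "ga = 0") auto

text \<open>After multiplication by \<open>ga * P\<close> the residues at smooth extremal points
  become the integers \<open>P\<close> at minima and \<open>- Q\<close> at maxima. The saddle
  \<open>p\<close> sits at 0 and \<open>q\<close> at infinity, so the extremal points other than
  \<open>q\<close> are exactly the finite zeros and poles of the rational function.\<close>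

lemma branched_degree:
 assumes np: "0 < n p" and ga: "0 < ga" and PQ: "0 < P" "0 < Q" and bal: "ga * real P = gb * real Q"
 shows "n p \<le> max (P * card (mins - {q})) (Q * card (maxs - {q}))"
proof -
 define e where "e s = (if T (Some s) \<in> mins then int P else - int Q)" for s
 have p_no: "T (Some s) \<noteq> p" "T (Some s) \<noteq> q" if "s \<in> poles" for s
  using that np q_not_pole by (auto simp: poles_def)
 have s0: "0 \<notin> poles" using np mob_0 by (simp add: poles_def)
 have mm: "T (Some s) \<in> maxs" if "s \<in> poles" "T (Some s) \<notin> mins" for s
  using that Re_L_nz[of "T (Some s)"] unfolding max_points_eq min_points_eq poles_def by auto
 let ?c = "cr (ga * real P)"
 have c0: "?c \<noteq> 0" using ga PQ by simp
 have Le: "L (T (Some s)) = of_int (e s) / ?c" if s: "s \<in> poles" for s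
 proof -
  let ?x = "T (Some s)"
  have sm: "ang ?x = 1" using p_no[OF s] by (simp add: ang_smooth)
  have nx: "n ?x = 0" using s by (simp add: poles_def)
  have "Re (L ?x) = of_int (e s) / (ga * real P)"
  proof (cases "?x \<in> mins")
   case True
   then have "ga * Re (L ?x) = 1" using ang_min sm by simp
   then show ?thesis using True ga PQ by (simp add: e_def field_simps)
  next
   case False
   then have "gb * Re (L ?x) = - 1" using ang_max[OF mm[OF s False]] sm by simp
   then have "ga * real P * Re (L ?x) = - real Q" unfolding bal by (simp add: algebra_simps)
   then show ?thesis using False ga PQ by (simp add: e_def field_simps)
  qed
  then show ?thesis using L_real[OF nx] by simp
 qed
 obtain M where M: "M \<noteq> 0" "((\<lambda>w. w * (\<Sum>s\<in>poles. L (T (Some s)) / (w - s)) / w ^ n p) ---> M) (at 0)"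
  using pole_number(2)[OF order_smooth] by blast
 have "((\<lambda>w. ?c * (w * (\<Sum>s\<in>poles. L (T (Some s)) / (w - s)) / w ^ n p)) ---> ?c * M) (at 0)"
  by (intro tendsto_mult tendsto_const M(2))
 moreover have "?c * (w * (\<Sum>s\<in>poles. L (T (Some s)) / (w - s)) / w ^ n p) = w * (\<Sum>s\<in>poles. of_int (e s) / (w - s)) / w ^ n p" for w
 proof -
  have "(\<Sum>s\<in>poles. of_int (e s) / (w - s)) = (\<Sum>s\<in>poles. ?c * (L (T (Some s)) / (w - s)))"
   by (rule sum.cong) (use Le c0 in simp_all)
  also have "\<dots> = ?c * (\<Sum>s\<in>poles. L (T (Some s)) / (w - s))" by (rule sum_distrib_left[symmetric])
  finally show ?thesis by simp
 qed
 ultimately have lim: "((\<lambda>w. w * (\<Sum>s\<in>poles. of_int (e s) / (w - s)) / w ^ n p) ---> ?c * M) (at 0)" by (simp only:)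
 have cM: "?c * M \<noteq> 0" using c0 M(1) by simp
 have cd: "card {s \<in> poles. T (Some s) \<in> X} = card (X - {q})" if X: "X \<subseteq> extr" for X
 proof -
  have im: "(\<lambda>s. T (Some s)) ` {s \<in> poles. T (Some s) \<in> X} = X - {q}"
  proof (intro equalityI subsetI)
   fix x assume x: "x \<in> X - {q}"
   then obtain s where "s \<in> poles" "x = T (Some s)" using X unfolding extr_poles by (auto split: if_splits)
   then show "x \<in> (\<lambda>s. T (Some s)) ` {s \<in> poles. T (Some s) \<in> X}" using x by auto
  qed (use p_no in auto)
  have "inj_on (\<lambda>s. T (Some s)) {s \<in> poles. T (Some s) \<in> X}" by (rule inj_on_subset[OF inj_poles]) auto
  from card_image[OF this] show ?thesis unfolding im by simp
 qed
 have ext: "mins \<subseteq> extr" "maxs \<subseteq> extr" unfolding max_points_eq min_points_eq extr_def by auto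
 have "int (n p) \<le> max (\<Sum>s | s \<in> poles \<and> 0 < e s. e s) (\<Sum>s | s \<in> poles \<and> e s < 0. - e s)"
  by (rule ramification_le_degree[OF finite_poles s0 np cM lim])
 also have "(\<Sum>s | s \<in> poles \<and> 0 < e s. e s) = (\<Sum>s\<in>{s \<in> poles. T (Some s) \<in> mins}. int P)"
  by (rule sum.cong) (use PQ in \<open>auto simp: e_def split: if_splits\<close>)
 also have "\<dots> = int (P * card (mins - {q}))" by (simp add: cd[OF ext(1)])
 also have "(\<Sum>s | s \<in> poles \<and> e s < 0. - e s) = (\<Sum>s\<in>{s \<in> poles. T (Some s) \<in> maxs}. int Q)"
  by (rule sum.cong) (use PQ mm max_min_disjoint in \<open>auto simp: e_def split: if_splits\<close>)
 also have "\<dots> = int (Q * card (maxs - {q}))" by (simp add: cd[OF ext(2)])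
 finally show ?thesis by linarith
qed

text \<open>At a saddle of order one \<open>dK\<close> would have the nonzero limit \<open>2 G(K) L\<close>.\<close>
lemma singular_saddle:
 assumes x: "x \<in> {p, q}" and s: "x \<in> saddle_points {p, q} kx"
 shows "2 \<le> n x" "ang x = real (n x)"
proof -
 have n0: "0 < n x" using s unfolding saddle_points_def extremal_points_eq extr_def by simp
 show "ang x = real (n x)" using ang_eq[of x] n0 by simp
 have cr: "((pd_x (kx \<circ> param x)) ---> 0) (at 0)" "((pd_y (kx \<circ> param x)) ---> 0) (at 0)"
  using s x unfolding saddle_points_def critical_point_def by auto
 have "n x \<noteq> 1"
 proof
  assume n1: "n x = 1"
  \<comment> \<open>For order 1 this is \<open>2 * G / F_chart\<close>, twice the
    \<open>z\<close>-derivative of the curvature in the coordinate \<open>\<zeta>\<close>.\<close>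
  define A where "A \<zeta> = cr (2 * G (\<kappa> (chart_pt x \<zeta>))) * (\<zeta> / F_chart x \<zeta> / \<zeta> ^ n x)" for \<zeta>
  obtain d where d: "0 < d" "\<And>\<zeta>. 0 < cmod \<zeta> ==> cmod \<zeta> < d ==> chart_pt x \<zeta> \<in> \<Omega>" using near_point[of x] by blast
  have pd: "cr (pd_x (kx \<circ> param x) \<zeta>) - \<i> * cr (pd_y (kx \<circ> param x) \<zeta>) = A \<zeta>"
   if z: "\<zeta> \<in> annulus 0 d" "F (chart_pt x \<zeta>) \<noteq> 0" for \<zeta>
  proof -
   have z0: "\<zeta> \<noteq> 0" "chart_pt x \<zeta> \<in> \<Omega>" using z d(2) by (auto simp: annulus_def)
   let ?B = "cr (2 * exp (2 * \<phi> (chart_pt x \<zeta>))) * cnj (F (chart_pt x \<zeta>)) * chart_der x \<zeta>"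
   have "((\<lambda>\<zeta>. \<kappa> (chart_pt x \<zeta>)) has_derivative (\<lambda>d. Re (2 * exp (2 * \<phi> (chart_pt x \<zeta>)) * cnj (F (chart_pt x \<zeta>)) * (chart_der x \<zeta> * d)))) (at \<zeta>)"
    by (rule has_derivative_compose[OF chart_pt_deriv[OF z0(1), unfolded has_field_derivative_def] K_der[OF z0(2)]])
   then have "((\<lambda>\<zeta>. \<kappa> (chart_pt x \<zeta>)) has_derivative (\<lambda>d. Re (?B * d))) (at \<zeta>)"
    by (rule has_derivative_eq_rhs) (simp add: fun_eq_iff mult.assoc)
   then have "((kx \<circ> param x) has_derivative (\<lambda>d. Re (?B * d))) (at \<zeta>)"
   proof (rule has_derivative_transform_within_open[OF _ open_annulus z(1)])
    fix v assume v: "v \<in> annulus 0 d"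
    then have "v \<noteq> 0" "chart_pt x v \<in> \<Omega>" using d(2) by (auto simp: annulus_def)
    then show "\<kappa> (chart_pt x v) = (kx \<circ> param x) v" by (simp add: param_chart_pt kx_plane)
   qed
   then have "frechet_derivative (kx \<circ> param x) (at \<zeta>) = (\<lambda>d. Re (?B * d))" by (rule frechet_derivative_at[symmetric])
   then have "cr (pd_x (kx \<circ> param x) \<zeta>) - \<i> * cr (pd_y (kx \<circ> param x) \<zeta>) = ?B"
    unfolding pd_x_def pd_y_def by (simp add: complex_eq_iff)
   moreover have "?B = A \<zeta>"
   proof -
    have "F_chart x \<zeta> \<noteq> 0" using z(2) chart_der_nz[OF z0(1)] by (simp add: F_chart_def)
    have "cr (G (\<kappa> (chart_pt x \<zeta>))) = cr (exp (2 * \<phi> (chart_pt x \<zeta>))) * (F (chart_pt x \<zeta>) * cnj (F (chart_pt x \<zeta>)))"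
     unfolding metric_F[OF z0(2), symmetric] by (simp add: complex_norm_square[symmetric])
    then have "A \<zeta> = cr (2 * exp (2 * \<phi> (chart_pt x \<zeta>))) * (F (chart_pt x \<zeta>) * cnj (F (chart_pt x \<zeta>))) * (1 / F_chart x \<zeta>)"
     unfolding A_def n1 using z0(1) by simp
    then show ?thesis using z(2) by (simp add: F_chart_def)
   qed
   ultimately show ?thesis by simp
  qed
  have "(A ---> cr (2 * G (kx x)) * L x) (at 0)"
  proof -
   have "isCont G (kx x)" by (rule DERIV_isCont[OF cubic_deriv])
   from isCont_tendsto_compose[OF this kx_lim] show ?thesis
    unfolding A_def by (intro tendsto_intros order_chart)
  qed
  moreover have "(A ---> cr 0 - \<i> * cr 0) (at 0)"
  proof (rule Lim_transform_eventually)
   show "((\<lambda>\<zeta>. cr (pd_x (kx \<circ> param x) \<zeta>) - \<i> * cr (pd_y (kx \<circ> param x) \<zeta>)) ---> cr 0 - \<i> * cr 0) (at 0)"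
    by (intro tendsto_intros cr)
   have "\<forall>\<^sub>F \<zeta> in at 0. \<zeta> \<in> annulus 0 d" unfolding eventually_at using d(1) by (intro exI[of _ d]) (simp add: annulus_def)
   with F_chart_eventually[of x]
   show "\<forall>\<^sub>F \<zeta> in at 0. cr (pd_x (kx \<circ> param x) \<zeta>) - \<i> * cr (pd_y (kx \<circ> param x) \<zeta>) = A \<zeta>"
    by eventually_elim (rule pd)
  qed
  ultimately have "cr (2 * G (kx x)) * L x = cr 0 - \<i> * cr 0" by (rule LIM_unique)
  then show False using G_pos[OF kx_saddle[OF n0]] L_nz[of x] by simp
 qed
 then show "2 \<le> n x" using n0 by linarith
qed

section \<open>Counting extremal points when \<open>p\<close> is a saddle\<close>

lemma angles_nonneg: "0 \<le> \<alpha>" "0 \<le> \<beta>"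
 using hcmu pq unfolding nonCSC_HCMU_def K_surface_metric_def by (auto split: if_splits)

lemma ang_sum:
 assumes "finite S" "p \<notin> S"
 shows "(\<Sum>x\<in>S. ang x) = (if q \<in> S then \<beta> else 0) + real (card (S - {q}))"
proof -
 have "(\<Sum>x\<in>S - {q}. ang x) = (\<Sum>x\<in>S - {q}. 1)"
  by (rule sum.cong) (use assms in \<open>auto intro: ang_smooth\<close>)
 moreover have "ang q = \<beta>" using pq by (simp add: ang_def)
 ultimately show ?thesis using assms by (cases "q \<in> S") (simp_all add: sum.remove)
qed

lemma extr_split: "extr = maxs \<union> mins"
 using extremal_points_eq by (simp add: extremal_points_def)

lemma points_nonempty: "maxs \<noteq> {}" "mins \<noteq> {}"
 using exists_max exists_min unfolding max_points_eq min_points_eq by auto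

lemma saddle_not_extr: "0 < n p ==> p \<notin> maxs" "0 < n p ==> p \<notin> mins"
 unfolding max_points_eq min_points_eq by auto

text \<open>\<open>i\<close> and \<open>j\<close> count the smooth maxima and minima. The marked
  point \<open>q\<close>, when extremal, enters the balance with weight \<open>\<beta>\<close>
  instead of 1.\<close>

lemma point_counts:
 assumes np: "0 < n p"
 defines "i \<equiv> card (maxs - {q})" and "j \<equiv> card (mins - {q})"
 shows "i + j = n p + n q" "mins - {q} \<noteq> {} ==> 0 < ga"
  "ga * (real i + (if q \<in> maxs then \<beta> else 0)) = gb * (real j + (if q \<in> mins then \<beta> else 0))"
  "\<And>P Q. 0 < ga ==> 0 < P ==> 0 < Q ==> ga * real P = gb * real Q ==> n p \<le> max (P * j) (Q * i)"
proof -
 have "extr - {p, q} = (maxs - {q}) \<union> (mins - {q})"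
  unfolding extr_split using saddle_not_extr[OF np] by auto
 moreover have "(maxs - {q}) \<inter> (mins - {q}) = {}" using max_min_disjoint by auto
 ultimately have "card (extr - {p, q}) = i + j"
  unfolding i_def j_def using finite_max finite_min by (simp add: card_Un_disjoint)
 then show "i + j = n p + n q" using card_smooth_extr by simp
 show "0 < ga" if "mins - {q} \<noteq> {}"
  using that min_smooth_ga saddle_not_extr[OF np] by blast
 show "ga * (real i + (if q \<in> maxs then \<beta> else 0)) = gb * (real j + (if q \<in> mins then \<beta> else 0))"
  using angle_balance unfolding ang_sum[OF finite_max saddle_not_extr(1)[OF np]] ang_sum[OF finite_min saddle_not_extr(2)[OF np]]
  by (simp only: i_def j_def add.commute)
 show "n p \<le> max (P * j) (Q * i)" if "0 < ga" "0 < P" "0 < Q" "ga * real P = gb * real Q" for P Q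
  using branched_degree[OF np that] by (simp only: i_def j_def)
qed

lemma card_pos: "1 \<le> card (maxs)" "1 \<le> card (mins)"
 using points_nonempty finite_max finite_min by (simp_all add: Suc_le_eq card_gt_0_iff)

text \<open>\<open>I1 = i\<close> is the number of smooth maxima and \<open>I2 = j\<close>. The
  balance \<open>ga * (i + \<beta>) = gb * j\<close> with \<open>ga < gb\<close> gives
  \<open>i + \<beta> > j\<close>. If \<open>j\<close> divides \<open>i + b\<close>, the slope ratio
  \<open>gb / ga\<close> is the integer \<open>P = (i + b) / j\<close>, and
  \<open>branched_degree\<close> with \<open>Q = 1\<close> bounds the order of the saddle by
  \<open>i + b\<close>.\<close>

lemma saddle_max_case:
 assumes np: "0 < n p" and q: "q \<in> maxs"
 shows "\<exists>I1 I2 :: int. has_points (maxs) (I1 + 1) \<and> I1 + 1 \<ge> 1 \<and>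
  has_points (mins) I2 \<and> I2 \<ge> 1 \<and> I1 + I2 = int (n p) \<and> of_int I1 + \<beta> > of_int I2 \<and>
  (\<forall>b::int. \<beta> = of_int b \<and> 2 \<le> b --> I2 = 1 \<or> (I2 \<ge> 2 \<and> I2 dvd (I1 + b) \<and> I1 + b > int (n p) - 1) \<or>
   (I2 \<ge> 2 \<and> \<not> I2 dvd (I1 + b)))"
proof -
 define i where "i = card (maxs - {q})"
 define j where "j = card (mins)"
 have qm: "q \<notin> mins" "n q = 0" using q unfolding max_points_eq min_points_eq by auto
 have mn: "mins - {q} = mins" using qm by auto
 note m = point_counts[OF np, unfolded mn, folded i_def j_def]
 have c: "card (maxs) = i + 1" unfolding i_def using card_Suc_Diff1[OF finite_max q] by linarith
 have j1: "1 \<le> j" using card_pos by (simp add: j_def)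
 have ga: "0 < ga" by (rule m(2)[OF points_nonempty(2)])
 have bal: "ga * (real i + \<beta>) = gb * real j" using m(3) q qm by simp
 have "ga * real j < gb * real j" using slopes(2) j1 by simp
 then have "ga * real j < ga * (real i + \<beta>)" unfolding bal .
 then have gt: "real i + \<beta> > real j" using ga by simp
 have deg: "int i + b > int (n p) - 1" if b: "\<beta> = of_int b" "2 \<le> b" "int j dvd (int i + b)" for b
 proof -
  define B where "B = nat b"
  have B: "b = int B" using b(2) by (simp add: B_def)
  have "j dvd i + B" using b(3) unfolding B by (metis int_dvd_int_iff of_nat_add)
  then obtain P where P: "i + B = P * j" by (metis dvdE mult.commute)
  have "0 < P" using P b(2) B by (cases P) auto
  have "ga * (real i + real B) = gb * real j" using bal b(1) unfolding B by simp
  moreover have "real i + real B = real P * real j" using P by (metis of_nat_add of_nat_mult)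
  ultimately have "ga * real P * real j = gb * real 1 * real j" by simp
  then have "ga * real P = gb * real 1" using j1 by simp
  from m(4)[OF ga \<open>0 < P\<close> _ this] have "n p \<le> max (i + B) i" by (simp add: P)
  then show ?thesis unfolding B by simp
 qed
 have "int j = 1 \<or> (int j \<ge> 2 \<and> int j dvd (int i + b) \<and> int i + b > int (n p) - 1) \<or> (int j \<ge> 2 \<and> \<not> int j dvd (int i + b))"
  if "\<beta> = of_int b \<and> 2 \<le> b" for b using deg[of b] that j1 by linarith
 then show ?thesis
  by (intro exI[of _ "int i"] exI[of _ "int j"])
   (use m(1) c j1 qm gt finite_max finite_min in \<open>auto simp: has_points_def j_def\<close>)
qed

text \<open>\<open>I2 = j\<close> counts the smooth minima, and the balance is
  \<open>ga * i = gb * (j + \<beta>)\<close>. In lowest terms the slope ratio is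
  \<open>P / Q\<close> with \<open>i = d * P\<close> and \<open>j + b = d * Q\<close>, which gives
  \<open>n p \<le> Q * i\<close>. If \<open>j + b\<close> divided \<open>i\<close>, then
  \<open>Q = 1\<close> and \<open>n p \<le> i\<close>, against \<open>i + j = n p\<close> with
  \<open>j \<ge> 1\<close>.\<close>

lemma saddle_min_case:
 assumes np: "0 < n p" and q: "q \<in> mins"
 shows "\<exists>I1 I2 :: int. has_points (maxs) I1 \<and> I1 \<ge> 1 \<and>
  has_points (mins) (I2 + 1) \<and> I2 + 1 \<ge> 1 \<and> I1 + I2 = int (n p) \<and>
  (\<beta> \<noteq> 0 --> of_int I1 > of_int I2 + \<beta>) \<and>
  (\<forall>b::int. \<beta> = of_int b \<and> 2 \<le> b --> I2 = 0 \<or> (I2 \<ge> 1 \<and> \<not> (I2 + b) dvd I1 \<and>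
         I1 * (I2 + b) \<ge> (int (n p) - 1) * gcd (I2 + b) I1))"
proof -
 define i where "i = card (maxs)"
 define j where "j = card (mins - {q})"
 have qm: "q \<notin> maxs" "n q = 0" using q unfolding max_points_eq min_points_eq by auto
 have mx: "maxs - {q} = maxs" using qm by auto
 note m = point_counts[OF np, unfolded mx, folded i_def j_def]
 have c: "card (mins) = j + 1" unfolding j_def using card_Suc_Diff1[OF finite_min q] by linarith
 have i1: "1 \<le> i" using card_pos by (simp add: i_def)
 have bal: "ga * real i = gb * (real j + \<beta>)" using m(3) q qm by simp
 have gt: "real i > real j + \<beta>" if "\<beta> \<noteq> 0"
 proof -
  have pos: "0 < real j + \<beta>" using that angles_nonneg(2) by (simp add: add_nonneg_pos)
  then have lt: "ga * (real j + \<beta>) < gb * (real j + \<beta>)" using slopes(2) by (intro mult_strict_right_mono)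
  then have "ga * (real j + \<beta>) < ga * real i" unfolding bal .
  then show ?thesis using slopes(1) by (simp add: mult_less_cancel_left)
 qed
 have deg: "j = 0 \<or> (1 \<le> j \<and> \<not> (int j + b) dvd int i \<and> int i * (int j + b) \<ge> (int (n p) - 1) * gcd (int j + b) (int i))"
  if b: "\<beta> = of_int b" "2 \<le> b" for b
 proof (cases "j = 0")
  case False
  then have j1: "1 \<le> j" by simp
  have ga: "0 < ga" 
  proof (rule m(2), rule notI)
   assume "mins - {q} = {}"
   then have "j = 0" unfolding j_def by (simp only: card.empty)
   then show False using j1 by simp
  qed
  define B where "B = nat b"
  have B: "b = int B" using b(2) by (simp add: B_def)
  define d where "d = gcd (j + B) i"
  have d0: "0 < d" using j1 by (simp add: d_def)
  obtain P where P: "i = d * P" unfolding d_def by (meson dvdE gcd_dvd2)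
  obtain Q where Q: "j + B = d * Q" unfolding d_def by (meson dvdE gcd_dvd1)
  have PQ: "0 < P" "0 < Q" using P Q i1 j1 by (auto intro!: Nat.gr0I)
  have e1: "ga * real i = gb * (real j + real B)" using bal b(1) unfolding B by simp
  have e2: "real j + real B = real d * real Q" using Q by (metis of_nat_add of_nat_mult)
  have "real d * (ga * real P) = real d * (gb * real Q)" using e1 unfolding e2 P by (simp add: mult_ac)
  then have "ga * real P = gb * real Q" using d0 by simp
  from m(4)[OF ga PQ this] have le: "n p \<le> max (P * j) (Q * i)" .
  \<comment> \<open>The term \<open>P * B\<close> belongs to the minimum \<open>q\<close> at
    infinity; it makes up the difference between \<open>P * j\<close> and \<open>Q * i\<close>, so
    the maximum of the two is \<open>Q * i\<close>.\<close>
  have "P * j \<le> P * (j + B)" by simp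
  also have "\<dots> = Q * i" unfolding P Q by simp
  finally have le: "n p \<le> Q * i" using le by simp
  then have "n p * d \<le> Q * i * d" by simp
  also have "\<dots> = i * (j + B)" unfolding Q by simp
  finally have "(n p - 1) * d \<le> i * (j + B)" by (meson diff_le_self le_trans mult_le_mono1)
  then have "int ((n p - 1) * d) \<le> int (i * (j + B))" by (simp only: of_nat_le_iff)
  moreover have "int (n p - 1) = int (n p) - 1" using np by (simp add: of_nat_diff)
  moreover have "gcd (int j + int B) (int i) = int d" by (metis d_def gcd_int_int_eq of_nat_add)
  ultimately have g: "(int (n p) - 1) * gcd (int j + b) (int i) \<le> int i * (int j + b)"
   unfolding B by (simp only: of_nat_mult of_nat_add)
  have "\<not> (int j + b) dvd int i"
  proof
   assume "(int j + b) dvd int i"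
   then have "j + B dvd i" unfolding B by (metis int_dvd_int_iff of_nat_add)
   then have "d = j + B" unfolding d_def by (simp add: gcd_proj1_iff)
   then have "Q = 1" using Q d0 by simp
   then show False using le m(1) qm j1 by simp
  qed
  then show ?thesis using g j1 by simp
 qed simp
 have "\<beta> = of_int b \<and> 2 \<le> b --> int j = 0 \<or> (int j \<ge> 1 \<and> \<not> (int j + b) dvd int i \<and> int i * (int j + b) \<ge> (int (n p) - 1) * gcd (int j + b) (int i))" for b
  using deg[of b] by auto
 then show ?thesis
  by (intro exI[of _ "int i"] exI[of _ "int j"])
   (use m(1) c i1 qm gt finite_max finite_min in \<open>auto simp: has_points_def i_def\<close>)
qed

text \<open>The divisibility clause bounds only the saddle at the origin of the Moebius coordinate;
  the bound for the other one comes from exchanging the marked points.\<close>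

lemma two_saddles_case:
 assumes np: "0 < n p" and nq: "0 < n q"
 shows "card (maxs) \<ge> 1" "card (mins) \<ge> 1" "card (maxs) > card (mins)"
  "card (maxs) + card (mins) = n p + n q"
  "card (mins) dvd card (maxs) ==> n p \<le> card (maxs)"
proof -
 define i where "i = card (maxs)"
 define j where "j = card (mins)"
 have qm: "q \<notin> maxs" "q \<notin> mins" using nq unfolding max_points_eq min_points_eq by auto
 have mm: "maxs - {q} = maxs" "mins - {q} = mins" using qm by auto
 note m = point_counts[OF np, unfolded mm, folded i_def j_def]
 show ij: "1 \<le> card (maxs)" "1 \<le> card (mins)" by (rule card_pos)+
 show "card (maxs) + card (mins) = n p + n q" using m(1) by (simp add: i_def j_def)
 have ga: "0 < ga" by (rule m(2)[OF points_nonempty(2)])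
 have bal: "ga * real i = gb * real j" using m(3) qm by simp
 have "ga * real j < gb * real j" using slopes(2) ij by (simp add: j_def)
 then have "ga * real j < ga * real i" unfolding bal .
 then show "card (maxs) > card (mins)" using ga by (simp add: i_def j_def)
 assume "card (mins) dvd card (maxs)"
 then obtain P where P: "i = P * j" unfolding i_def j_def by (metis dvdE mult.commute)
 have "0 < P" using P ij by (cases P) (auto simp: i_def)
 have "ga * real P * real j = gb * real 1 * real j" using bal P by simp
 then have "ga * real P = gb * real 1" using ij by (simp add: j_def)
 from m(4)[OF ga \<open>0 < P\<close> _ this] show "n p \<le> card (maxs)" using P by (simp add: i_def)
qed

end

section \<open>Footballs\<close>

text \<open>Matrix multiplication. The auxiliary \<open>key\<close> works in homogeneous coordinates
  \<open>A'\<close>, \<open>C'\<close>, which treat finite points and infinity alike.\<close>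

lemma mob_comp:
 assumes D: "a * d - b * c \<noteq> 0" and D': "a' * d' - b' * c' \<noteq> 0"
 obtains e f g h where "e * h - f * g \<noteq> 0" "\<And>x. mob e f g h x = mob a b c d (mob a' b' c' d' x)"
proof (rule that)
 have "(a * a' + b * c') * (c * b' + d * d') - (a * b' + b * d') * (c * a' + d * c') = (a * d - b * c) * (a' * d' - b' * c')"
  by (simp add: algebra_simps)
 then show "(a * a' + b * c') * (c * b' + d * d') - (a * b' + b * d') * (c * a' + d * c') \<noteq> 0"
  using D D' by simp
 fix x
 have key: "(if C = 0 then None else Some (A / C)) =
   (if C' = 0 then mob a b c d None else mob a b c d (Some (A' / C')))"
  if A: "A = a * A' + b * C'" and C: "C = c * A' + d * C'" and ne: "A' \<noteq> 0 \<or> C' \<noteq> 0" for A C A' C' :: complex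
 proof (cases "C' = 0")
  case True
  then have "A' \<noteq> 0" using ne by simp
  then show ?thesis using True A C by (simp add: mob.simps)
 next
  case False
  have 1: "c * (A' / C') + d = C / C'" "a * (A' / C') + b = A / C'" using False A C by (simp_all add: field_simps)
  show ?thesis unfolding mob.simps 1 using False by simp
 qed
 show "mob (a * a' + b * c') (a * b' + b * d') (c * a' + d * c') (c * b' + d * d') x = mob a b c d (mob a' b' c' d' x)"
 proof (cases x)
  case None
  have "a' \<noteq> 0 \<or> c' \<noteq> 0" using D' by auto
  from key[OF refl refl this] show ?thesis unfolding None mob.simps(1)[of "a * a' + b * c'"] mob.simps(1)[of a'] by simp
 next
  case (Some w)
  have "a' * w + b' \<noteq> 0 \<or> c' * w + d' \<noteq> 0"
  proof (rule ccontr)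
   assume "\<not> ?thesis"
   then have "c' * (a' * w + b') - a' * (c' * w + d') = 0" by simp
   then show False using D' by (simp add: algebra_simps)
  qed
  from key[OF refl refl this]
  have "(if c * (a' * w + b') + d * (c' * w + d') = 0 then None else Some ((a * (a' * w + b') + b * (c' * w + d')) / (c * (a' * w + b') + d * (c' * w + d')))) =
   mob a b c d (mob a' b' c' d' (Some w))" by (simp add: mob.simps(2)[of a'])
  moreover have "c * (a' * w + b') + d * (c' * w + d') = (c * a' + d * c') * w + (c * b' + d * d')"
   "a * (a' * w + b') + b * (c' * w + d') = (a * a' + b * c') * w + (a * b' + b * d')"
   by (simp_all add: algebra_simps)
  ultimately show ?thesis unfolding Some mob.simps(2)[of "a * a' + b * c'"] by (simp only:)
 qed
qed

lemma param_mob: obtains a b c d where "a * d - b * c \<noteq> 0" "\<And>\<zeta>. param x \<zeta> = mob a b c d (Some \<zeta>)"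
proof (cases x)
 case None
 then show ?thesis using that[of 0 0 1 1] by (simp add: mob.simps)
next
 case (Some a)
 then show ?thesis using that[of 1 1 a 0] by (simp add: mob.simps add.commute)
qed

lemma param_0: "param x 0 = x"
 by (cases x) auto

text \<open>Standard charts are themselves restrictions of Moebius maps, so a Moebius map read in
  charts reduces to \<open>mob_local\<close> at 0.\<close>

lemma mob_chart:
 assumes D: "a * d - b * c \<noteq> 0"
 obtains h r where "0 < r" "h holomorphic_on ball 0 r" "h 0 = 0" "deriv h 0 \<noteq> 0"
  "\<And>\<zeta>. \<zeta> \<in> ball 0 r ==> coord (mob a b c d x) (mob a b c d (param x \<zeta>)) = h \<zeta>"
proof -
 obtain a' b' c' d' where D': "a' * d' - b' * c' \<noteq> 0" and p: "\<And>\<zeta>. param x \<zeta> = mob a' b' c' d' (Some \<zeta>)"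
  by (rule param_mob) (rule that)
 obtain e f g h where D2: "e * h - f * g \<noteq> 0" and m: "\<And>x. mob e f g h x = mob a b c d (mob a' b' c' d' x)"
  by (rule mob_comp[OF D D']) (rule that)
 have x: "mob e f g h (Some 0) = mob a b c d x" using m[of "Some 0"] p[of 0] param_0[of x] by simp
 obtain k r where "mob_coord e f g h 0 k r" using mob_local[OF D2] by blast
 note k = mob_coordD[OF this]
 show ?thesis by (rule that[OF k(1-4)]) (use k(6)[unfolded x] in \<open>simp only: m p\<close>)
qed

lemma mob_automorphism:
 assumes D: "a * d - b * c \<noteq> 0" shows "conformal_automorphism (mob a b c d)"
 unfolding conformal_automorphism_def
proof (intro conjI allI)
 show "bij (mob a b c d)" by (rule mob_bij[OF D])
 fix x
 obtain h r where h: "0 < r" "h holomorphic_on ball 0 r"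
  "\<And>\<zeta>. \<zeta> \<in> ball 0 r ==> coord (mob a b c d x) (mob a b c d (param x \<zeta>)) = h \<zeta>"
  by (rule mob_chart[OF D, of x]) (rule that)
 have "(\<lambda>\<zeta>. coord (mob a b c d x) (mob a b c d (param x \<zeta>))) holomorphic_on ball 0 r"
  using h(2) by (rule holomorphic_transform) (simp add: h(3))
 then show "(\<lambda>\<zeta>. coord (mob a b c d x) (mob a b c d (param x \<zeta>))) analytic_on {0}"
  using h(1) by (auto simp: analytic_on_def)
qed

text \<open>The pull-back of the metric \<open>u'\<close> along the holomorphic map \<open>f\<close>
  is \<open>s\<close> times the metric \<open>u\<close>; here \<open>s\<close> scales squared
  lengths, hence also areas.\<close>

definition homothety :: "conf_metric => sphere set => conf_metric => (sphere => sphere) => real => bool" where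
 "homothety u P u' f s \<longleftrightarrow> (\<forall>x. x \<notin> P --> (\<exists>D. ((\<lambda>\<zeta>. coord (f x) (f (param x \<zeta>))) has_field_derivative D) (at 0) \<and>
   exp (2 * conf_factor u' (f x) 0) * (cmod D)\<^sup>2 = s * exp (2 * conf_factor u x 0)))"

lemma mob_isometry:
 assumes D: "a * d - b * c \<noteq> 0" and P: "mob a b c d ` P = P'" and iso: "homothety u P u' (mob a b c d) 1"
 shows "is_isometry u P u' P' (mob a b c d)"
 unfolding is_isometry_def
proof (intro conjI allI impI)
 have b: "bij (mob a b c d)" by (rule mob_bij[OF D])
 have "bij_betw (mob a b c d) (- P) (mob a b c d ` (- P))" by (rule bij_betw_subset[OF b]) auto
 then show "bij_betw (mob a b c d) (- P) (- P')" unfolding bij_image_Compl_eq[OF b] P .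
 fix x assume x: "x \<notin> P"
 let ?h = "\<lambda>\<zeta>. coord (mob a b c d x) (mob a b c d (param x \<zeta>))"
 obtain h r where h: "0 < r" "h holomorphic_on ball 0 r" "\<And>\<zeta>. \<zeta> \<in> ball 0 r ==> ?h \<zeta> = h \<zeta>"
  by (rule mob_chart[OF D, of x]) (rule that)
 have hh: "?h holomorphic_on ball 0 r" using h(2) by (rule holomorphic_transform) (simp add: h(3))
 obtain D where D: "(?h has_field_derivative D) (at 0)" "exp (2 * conf_factor u' (mob a b c d x) 0) * (cmod D)\<^sup>2 = 1 * exp (2 * conf_factor u x 0)"
  using iso x unfolding homothety_def by blast
 have "(exp (conf_factor u' (mob a b c d x) 0) * cmod D)\<^sup>2 = (exp (conf_factor u x 0))\<^sup>2"
  using D(2) by (simp add: power_mult_distrib exp_double[symmetric])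
 then have e: "exp (conf_factor u' (mob a b c d x) 0) * cmod D = exp (conf_factor u x 0)"
  by (rule power2_eq_imp_eq) auto
 have "frechet_derivative ?h (at 0) = (\<lambda>v. D * v)"
  using D(1) unfolding has_field_derivative_def by (rule frechet_derivative_at[symmetric])
 then have "exp (conf_factor u' (mob a b c d x) 0) * cmod (frechet_derivative ?h (at 0) v) = exp (conf_factor u x 0) * cmod v" for v
  using e by (simp add: norm_mult)
 moreover have "\<exists>e>0. smooth_on (ball 0 e) ?h" using smooth_on_holomorphic[OF open_ball hh] h(1) by blast
 ultimately show "let h = ?h in (\<exists>e>0. smooth_on (ball 0 e) h) \<and>
   (\<forall>v. exp (conf_factor u' (mob a b c d x) 0) * cmod (frechet_derivative h (at 0) v) = exp (conf_factor u x 0) * cmod v)"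
  unfolding Let_def by blast
qed

section \<open>The metric without saddles in its Moebius coordinate\<close>

locale hcmu_football = hcmu_sphere +
 assumes order_p: "n p = 0" and order_q: "n q = 0"
begin

lemma extr_eq: "extr = {p, q}"
proof -
 have "card (extr - {p, q}) = 0" using card_smooth_extr order_p order_q by simp
 then have "extr - {p, q} = {}" using finite_extr by simp
 then show ?thesis using order_p order_q by (auto simp: extr_def)
qed

lemma poles_p: "poles = {0}"
proof -
 have "card (poles - {0}) = 0" using pole_number(1)[OF order_smooth] order_p order_q by simp
 then have "poles - {0} = {}" using finite_poles by simp
 moreover have "0 \<in> poles" using mob_0 order_p by (simp add: poles_def)
 ultimately show ?thesis by auto
qed

definition c :: real where "c = Re (L p)"

lemma c_nz: "c \<noteq> 0" and L_c: "L p = cr c"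
 unfolding c_def using Re_L_nz[OF order_p] L_real[OF order_p] by auto

text \<open>The only finite pole is 0, so the partial fractions reduce to \<open>c / w\<close>;
  continuity carries the formula over to the other points of \<open>zeros\<close> at which it is
  claimed.\<close>

lemma F_mob_eq:
 assumes "w \<noteq> 0" "mc * w + md \<noteq> 0" shows "F_mob w = w / c"
proof -
 let ?S = "{w. w \<noteq> 0 \<and> mc * w + md \<noteq> 0}"
 have eq: "F_mob w = w / c" if w: "w \<notin> zeros" for w
 proof -
  have "1 / F_mob w = c / w" using partial_fractions[OF w] mob_0 by (simp add: poles_p L_c)
  then have "1 / (1 / F_mob w) = 1 / (c / w)" by simp
  then show ?thesis by simp
 qed
 have "open ?S" by (intro open_Collect_conj open_Collect_neq continuous_intros)
 then have "isCont F_mob w" using hol_cont[OF F_mob_holomorphic] assms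
  by (simp add: continuous_on_eq_continuous_at)
 then have "(F_mob ---> F_mob w) (at w)" by (simp add: isCont_def)
 moreover have "(F_mob ---> w / c) (at w)"
 proof (rule Lim_transform_eventually)
  show "((\<lambda>w. w / c) ---> w / c) (at w)" using c_nz by (intro tendsto_intros) simp
  show "\<forall>\<^sub>F w in at w. w / c = F_mob w"
   using eventually_at_notin_finite[OF finite_zeros, of w] by eventually_elim (simp add: eq)
 qed
 ultimately show ?thesis by (rule LIM_unique)
qed

lemma regular_image: "w \<noteq> 0 ==> T (Some w) \<notin> {p, q}" and regular_preimage: "x \<notin> {p, q} ==> \<exists>w. w \<noteq> 0 \<and> x = T (Some w)"
proof -
 show "w \<noteq> 0 ==> T (Some w) \<notin> {p, q}"
  using T_inj[of "Some w" "Some 0"] T_inj[of "Some w" None] mob_0 mob_inf by auto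
 assume x: "x \<notin> {p, q}"
 have "x \<in> range T" using bij_is_surj[OF mob_bij[OF det]] by simp
 then obtain y where y: "x = T y" by blast
 show "\<exists>w. w \<noteq> 0 \<and> x = T (Some w)"
 proof (cases y)
  case (Some w)
  then have "w \<noteq> 0" using x y mob_0 by auto
  then show ?thesis using y Some by blast
 qed (use x y mob_inf in simp)
qed

lemma kx_regular: "w \<noteq> 0 ==> kx (T (Some w)) \<in> {a1<..<b1}"
proof (rule kx_saddle)
 assume "w \<noteq> 0"
 then have "T (Some w) \<notin> extr" using regular_image[of w] extr_eq by simp
 then show "0 < n (T (Some w))" by (simp add: extr_def)
qed

lemma T_finite: "w \<noteq> 0 ==> mc * w + md \<noteq> 0 ==> kx (T (Some w)) = \<kappa> ((ma * w + mb) / (mc * w + md))"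
 using T_dom[of w] kx_plane by (simp add: mob.simps)

lemma metric_T: "w \<noteq> 0 ==> mc * w + md \<noteq> 0 ==>
 exp (2 * \<phi> ((ma * w + mb) / (mc * w + md))) * (cmod ((ma * md - mb * mc) / (mc * w + md)\<^sup>2))\<^sup>2 = G (kx (T (Some w))) * (c / cmod w)\<^sup>2"
proof -
 assume w: "w \<noteq> 0" "mc * w + md \<noteq> 0"
 define m where "m = (ma * md - mb * mc) / (mc * w + md)\<^sup>2"
 have m0: "m \<noteq> 0" using det w by (simp add: m_def)
 let ?z = "(ma * w + mb) / (mc * w + md)"
 have "F ?z = m * w / c" using F_mob_eq[OF w] m0 unfolding F_mob_def m_def[symmetric] by (simp add: field_simps)
 then have "(cmod (F ?z))\<^sup>2 = (cmod m)\<^sup>2 * (cmod w / c)\<^sup>2" by (simp add: norm_mult norm_divide power_mult_distrib power_divide)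
 then have "exp (2 * \<phi> ?z) * ((cmod m)\<^sup>2 * (cmod w / c)\<^sup>2) = G (kx (T (Some w)))"
  using metric_F[OF T_dom[OF w]] T_finite[OF w] by simp
 then show ?thesis unfolding m_def[symmetric] using w c_nz by (simp add: field_simps)
qed

lemma kappa_T_cont: "w \<noteq> 0 ==> isCont (\<lambda>w. kx (T (Some w))) w"
proof -
 assume w: "w \<noteq> 0"
 let ?x = "T (Some w)"
 obtain g r where "mob_coord ma mb mc md w g r" using mob_local[OF det] by blast
 note m = mob_coordD[OF this]
 note r = m(1) and g = m(2,3) and gw = m(7)
 have evr: "\<forall>\<^sub>F v in at w. v \<in> ball w r \<and> v \<noteq> w" by (rule eventually_ball[OF r])
 have ev0: "\<forall>\<^sub>F v in at w. v \<noteq> 0" using eventually_at_notin_finite[of "{0}" w] by simp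
 have "isCont g w" using hol_cont[OF g(1)] r by (simp add: continuous_on_eq_continuous_at)
 then have "(g ---> 0) (at w)" using g(2) by (simp add: isCont_def)
 then have "filterlim g (at 0) (at w)"
  unfolding filterlim_at using evr gw by (auto elim!: eventually_mono)
 from filterlim_compose[OF kx_lim[of ?x] this] have "((\<lambda>v. \<kappa> (chart_pt ?x (g v))) ---> kx ?x) (at w)" .
 then have "((\<lambda>v. kx (T (Some v))) ---> kx ?x) (at w)"
  by (rule Lim_transform_eventually) (use evr ev0 in eventually_elim, use gw T_finite in auto)
 then show ?thesis by (simp add: isCont_def)
qed

text \<open>\<open>metric_T\<close> says nothing about a point that \<open>T\<close> sends to
  infinity. The formula in the standard chart is therefore obtained as a limit from neighbouring
  points, uniformly for all \<open>w\<close>.\<close>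

lemma metric_chart:
 assumes w: "w \<noteq> 0" and mc: "mob_coord ma mb mc md w g r"
 shows "exp (2 * conf_factor u (T (Some w)) 0) * (cmod (deriv g w))\<^sup>2 = G (kx (T (Some w))) * (c / cmod w)\<^sup>2"
proof -
 note m = mob_coordD[OF mc]
 note r = m(1) and g = m(2,3) and gw = m(7)
 let ?x = "T (Some w)"
 have wr: "w \<in> ball w r" using r by simp
 have evr: "\<forall>\<^sub>F v in at w. v \<in> ball w r \<and> v \<noteq> w" by (rule eventually_ball[OF r])
 have ev0: "\<forall>\<^sub>F v in at w. v \<noteq> 0" using eventually_at_notin_finite[of "{0}" w] by simp
 have gc: "(g ---> 0) (at w)" "(deriv g ---> deriv g w) (at w)"
  using hol_cont[OF g(1)] hol_cont[OF holomorphic_deriv[OF g(1) open_ball]] wr g(2)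
  unfolding continuous_on_eq_continuous_at[OF open_ball] isCont_def by fastforce+
 obtain e where e: "0 < e" "smooth_on (ball 0 e) (conf_factor u ?x)"
  using conf regular_image[OF w] unfolding conformal_metric_def by blast
 have "continuous_on (ball 0 e) (conf_factor u ?x)" using e(2) unfolding smooth_on_def by (metis Ck_on.simps(1))
 then have "isCont (conf_factor u ?x) 0" using e(1) by (simp add: continuous_on_eq_continuous_at)
 from isCont_tendsto_compose[OF this gc(1)] have cf: "((\<lambda>v. conf_factor u ?x (g v)) ---> conf_factor u ?x 0) (at w)" .
 have 1: "((\<lambda>v. exp (2 * conf_factor u ?x (g v)) * (cmod (deriv g v))\<^sup>2) ---> exp (2 * conf_factor u ?x 0) * (cmod (deriv g w))\<^sup>2) (at w)"
  by (intro tendsto_intros cf gc(2))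
 have "isCont G (kx ?x)" by (rule DERIV_isCont[OF cubic_deriv])
 moreover have "((\<lambda>v. kx (T (Some v))) ---> kx ?x) (at w)" using kappa_T_cont[OF w] by (simp add: isCont_def)
 ultimately have "((\<lambda>v. G (kx (T (Some v)))) ---> G (kx ?x)) (at w)" by (rule isCont_tendsto_compose)
 then have 2: "((\<lambda>v. G (kx (T (Some v))) * (c / cmod v)\<^sup>2) ---> G (kx ?x) * (c / cmod w)\<^sup>2) (at w)"
  by (intro tendsto_intros) (use w in auto)
 have "\<forall>\<^sub>F v in at w. exp (2 * conf_factor u ?x (g v)) * (cmod (deriv g v))\<^sup>2 = G (kx (T (Some v))) * (c / cmod v)\<^sup>2"
  using evr ev0
 proof eventually_elim
  case (elim v)
  have v: "g v \<noteq> 0" "mc * v + md \<noteq> 0" "chart_pt ?x (g v) = (ma * v + mb) / (mc * v + md)"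
   "chart_der ?x (g v) * deriv g v = (ma * md - mb * mc) / (mc * v + md)\<^sup>2" using gw elim by auto
  have "exp (2 * conf_factor u ?x (g v)) = exp (2 * \<phi> ((ma * v + mb) / (mc * v + md))) * (exp (ln (cmod (chart_der ?x (g v)))))\<^sup>2"
   unfolding conf_factor_chart[OF v(1)] v(3) by (simp add: distrib_left exp_add exp_double)
  also have "exp (ln (cmod (chart_der ?x (g v)))) = cmod (chart_der ?x (g v))" using chart_der_nz[OF v(1)] by simp
  finally have "exp (2 * conf_factor u ?x (g v)) * (cmod (deriv g v))\<^sup>2
   = exp (2 * \<phi> ((ma * v + mb) / (mc * v + md))) * (cmod (chart_der ?x (g v) * deriv g v))\<^sup>2"
   by (simp add: norm_mult power_mult_distrib)
  then show ?case unfolding v(4) using metric_T[OF elim(2) v(2)] by simp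
 qed
 from Lim_transform_eventually[OF 1 this] 2 show ?thesis by (rule LIM_unique)
qed

text \<open>The vector field is \<open>w / c\<close>, so the primitive of \<open>1 / G\<close> along \<open>K\<close> is harmonic with a logarithmic pole.\<close>
lemma level_sets:
 assumes hh: "\<And>t. t \<in> {a1<..<b1} ==> (hh has_real_derivative 1 / G t) (at t)"
 obtains s0 where "\<And>w. w \<noteq> 0 ==> hh (kx (T (Some w))) = 2 * c * ln (cmod w) + s0"
proof -
 let ?S = "{w. w \<noteq> 0 \<and> mc * w + md \<noteq> 0}"
 define f where "f w = hh (kx (T (Some w))) - 2 * c * ln (cmod w)" for w
 have op: "open ?S" by (intro open_Collect_conj open_Collect_neq continuous_intros)
 have fin: "finite (- ?S)"
 proof (rule finite_subset[OF _ finite_zeros])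
  show "- ?S \<subseteq> zeros" using zero_set_closed_form(1) by blast
 qed
 have conn: "connected ?S"
 proof -
  have "connected (UNIV - (- ?S))" by (rule connected_open_diff_countable) (use fin in \<open>auto intro: countable_finite\<close>)
  then show ?thesis by (simp only: Diff_eq double_complement Int_UNIV_left)
 qed
 let ?z = "\<lambda>w. (ma * w + mb) / (mc * w + md)"
 have fd: "(f has_derivative (\<lambda>_. 0)) (at w)" if w: "w \<in> ?S" for w
 proof -
  have w': "w \<noteq> 0" "mc * w + md \<noteq> 0" using w by auto
  define m where "m = (ma * md - mb * mc) / (mc * w + md)\<^sup>2"
  have m0: "m \<noteq> 0" using det w' by (simp add: m_def)
  note zO = T_dom[OF w']
  have zd: "(?z has_derivative (\<lambda>d. m * d)) (at w)" using mob_deriv[OF w'(2), of ma mb] unfolding has_field_derivative_def m_def .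
  have kd: "((\<lambda>w. \<kappa> (?z w)) has_derivative (\<lambda>d. Re (2 * exp (2 * \<phi> (?z w)) * cnj (F (?z w)) * (m * d)))) (at w)"
   by (rule has_derivative_compose[OF zd K_der[OF zO]])
  have Fz: "F (?z w) = m * w / c" using F_mob_eq[OF w'] m0 unfolding F_mob_def m_def[symmetric] by (simp add: field_simps)
  have F0: "F (?z w) \<noteq> 0" unfolding Fz using m0 w' c_nz by simp
  have kin: "\<kappa> (?z w) \<in> {a1<..<b1}" by (rule K_range[OF zO F0])
  have hd: "(hh has_derivative (\<lambda>d. 1 / G (\<kappa> (?z w)) * d)) (at (\<kappa> (?z w)))"
   using hh[OF kin] unfolding has_field_derivative_def .
  have comp: "((\<lambda>w. hh (\<kappa> (?z w))) has_derivative (\<lambda>d. 1 / G (\<kappa> (?z w)) * Re (2 * exp (2 * \<phi> (?z w)) * cnj (F (?z w)) * (m * d)))) (at w)"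
   by (rule has_derivative_compose[OF kd hd])
  have "1 / G (\<kappa> (?z w)) * Re (2 * exp (2 * \<phi> (?z w)) * cnj (F (?z w)) * (m * d)) = Re (2 * c / w * d)" for d
  proof -
   have "cr (G (\<kappa> (?z w))) = cr (exp (2 * \<phi> (?z w))) * (F (?z w) * cnj (F (?z w)))"
    unfolding metric_F[OF zO, symmetric] by (simp add: complex_norm_square[symmetric])
   then have "2 * exp (2 * \<phi> (?z w)) * cnj (F (?z w)) * (m * d) = cr (G (\<kappa> (?z w))) * (2 / F (?z w) * m * d)"
    using F0 by simp
   also have "2 / F (?z w) * m * d = 2 * c / w * d" unfolding Fz using m0 w' c_nz by simp
   finally have e: "2 * exp (2 * \<phi> (?z w)) * cnj (F (?z w)) * (m * d) = cr (G (\<kappa> (?z w))) * (2 * c / w * d)" .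
   have "Re (2 * exp (2 * \<phi> (?z w)) * cnj (F (?z w)) * (m * d)) = G (\<kappa> (?z w)) * Re (2 * c / w * d)"
    unfolding e by (simp only: times_complex.sel(1)[of "cr _"] Re_complex_of_real Im_complex_of_real mult_zero_left diff_0_right)
   then show ?thesis using G_pos[OF kin] by simp
  qed
  then have comp: "((\<lambda>w. hh (\<kappa> (?z w))) has_derivative (\<lambda>d. Re (2 * c / w * d))) (at w)" using comp by (simp only:)
  have l: "((\<lambda>w. 2 * c * ln (cmod w)) has_derivative (\<lambda>d. 2 * c * Re (1 / w * d))) (at w)"
   by (rule has_derivative_mult_right[OF ln_norm_has_derivative[OF DERIV_ident w'(1)]])
  have Rc: "Re (2 * c / w * d) = 2 * c * Re (1 / w * d)" for d
  proof -
   have e: "cr (2 * c) / w * d = cr (2 * c) * (1 / w * d)" by simp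
   show ?thesis unfolding e by (simp only: times_complex.sel(1)[of "cr _"] Re_complex_of_real Im_complex_of_real mult_zero_left diff_0_right)
  qed
  have "((\<lambda>w. hh (\<kappa> (?z w)) - 2 * c * ln (cmod w)) has_derivative (\<lambda>d. 0)) (at w)"
   by (rule has_derivative_eq_rhs[OF has_derivative_diff[OF comp l]]) (simp only: Rc diff_self)
  then show ?thesis
   by (rule has_derivative_transform_within_open[OF _ op w]) (simp add: f_def T_finite)
 qed
 obtain w1 where w1: "w1 \<in> ?S"
  using ex_new_if_finite[OF infinite_UNIV_char_0 fin] by blast
 have const: "f w = f w1" if "w \<in> ?S" for w
  by (rule has_derivative_zero_unique_connected[OF op conn fd that w1])
 \<comment> \<open>The point sent to infinity was excluded so far and is reached by
   continuity.\<close>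
 have "f w = f w1" if w: "w \<noteq> 0" for w
 proof -
  have "isCont hh (kx (T (Some w)))" by (rule DERIV_isCont[OF hh[OF kx_regular[OF w]]])
  moreover have "((\<lambda>v. kx (T (Some v))) ---> kx (T (Some w))) (at w)" using kappa_T_cont[OF w] by (simp add: isCont_def)
  ultimately have "((\<lambda>v. hh (kx (T (Some v)))) ---> hh (kx (T (Some w)))) (at w)" by (rule isCont_tendsto_compose)
  then have "(f ---> f w) (at w)" unfolding f_def[abs_def] by (intro tendsto_intros) (use w in auto)
  moreover have "(f ---> f w1) (at w)"
   by (rule tendsto_eventually) (use eventually_at_notin_finite[OF fin, of w] in eventually_elim, use const in auto)
  ultimately show ?thesis by (rule LIM_unique)
 qed
 then show ?thesis using that[of "f w1"] by (simp add: f_def algebra_simps)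
qed

lemma primitive:
 obtains hh where "\<And>t. t \<in> {a1<..<b1} ==> (hh has_real_derivative 1 / G t) (at t)"
  "\<And>s t. s \<in> {a1<..<b1} ==> t \<in> {a1<..<b1} ==> hh s = hh t ==> s = t"
proof -
 obtain hh where hh: "\<And>t. t \<in> {a1<..<b1} ==> (hh has_real_derivative 1 / G t) (at t)"
  by (rule cubic_primitive_bounded[OF roots G_pos]) (assumption | rule that)+
 have lt: "hh s < hh t" if st: "s \<in> {a1<..<b1}" "t \<in> {a1<..<b1}" "s < t" for s t
 proof (rule DERIV_pos_imp_increasing[OF st(3)])
  fix x assume "s \<le> x" "x \<le> t"
  then have "x \<in> {a1<..<b1}" using st by auto
  then show "\<exists>y. (hh has_real_derivative y) (at x) \<and> 0 < y" using hh[of x] G_pos[of x] by (intro exI[of _ "1 / G x"]) simp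
 qed
 show ?thesis
 proof (rule that[OF hh])
  fix s t assume st: "s \<in> {a1<..<b1}" "t \<in> {a1<..<b1}" "hh s = hh t"
  show "s = t" using lt[of s t] lt[of t s] st by (metis less_irrefl linorder_neqE_linordered_idom)
 qed
qed

text \<open>A critical point of the curvature would be one of \<open>2 * c * ln (cmod w)\<close>,
  whose derivative in the direction \<open>w\<close> is \<open>2 * c\<close>.\<close>

lemma no_saddles: "saddle_points {p, q} kx = {}"
proof (rule ccontr)
 assume "saddle_points {p, q} kx \<noteq> {}"
 then obtain x where x: "x \<in> saddle_points {p, q} kx" by blast
 then have xn: "x \<notin> {p, q}" unfolding saddle_points_def extremal_points_eq extr_eq by simp
 then obtain w where w: "w \<noteq> 0" "x = T (Some w)" using regular_preimage by blast
 have cr: "((kx \<circ> param x) has_derivative (\<lambda>_. 0)) (at 0)"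
  using x xn unfolding saddle_points_def critical_point_def by simp
 obtain hh where hh: "\<And>t. t \<in> {a1<..<b1} ==> (hh has_real_derivative 1 / G t) (at t)" by (rule primitive) (rule that)
 obtain s0 where s0: "\<And>w. w \<noteq> 0 ==> hh (kx (T (Some w))) = 2 * c * ln (cmod w) + s0" by (rule level_sets[OF hh]) (assumption | rule that)+
 obtain g r where "mob_coord ma mb mc md w g r" using mob_local[OF det] by blast
 note m = mob_coordD[OF this]
 note r = m(1) and g = m(2,3) and gw = m(5)
 have wr: "w \<in> ball w r" using r by simp
 have gd: "(g has_derivative (\<lambda>d. deriv g w * d)) (at w)"
  using holomorphic_derivI[OF g(1) open_ball wr] unfolding has_field_derivative_def .
 have 1: "((\<lambda>v. (kx \<circ> param x) (g v)) has_derivative (\<lambda>_. 0)) (at w)"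
  by (rule has_derivative_compose[OF gd]) (unfold g(2), rule cr)
 have kw: "(kx \<circ> param x) (g w) = kx (T (Some w))" using gw[OF wr] w(2) by simp
 have "(hh has_derivative (\<lambda>d. 1 / G (kx (T (Some w))) * d)) (at ((kx \<circ> param x) (g w)))"
  using hh[OF kx_regular[OF w(1)]] unfolding has_field_derivative_def kw .
 from has_derivative_compose[OF 1 this] have 2: "((\<lambda>v. hh ((kx \<circ> param x) (g v))) has_derivative (\<lambda>_. 0)) (at w)" by simp
 let ?A = "annulus 0 (cmod w + 1) \<inter> ball w r"
 have "((\<lambda>v. 2 * c * ln (cmod v) + s0) has_derivative (\<lambda>_. 0)) (at w)"
 proof (rule has_derivative_transform_within_open[OF 2])
  show "open ?A" by (intro open_Int open_annulus open_ball)
  show "w \<in> ?A" using w(1) wr by (simp add: annulus_def)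
  fix v assume v: "v \<in> ?A"
  then have "v \<noteq> 0" "v \<in> ball w r" by (auto simp: annulus_def)
  then show "hh ((kx \<circ> param x) (g v)) = 2 * c * ln (cmod v) + s0" using s0[of v] gw[of v] w(2) by simp
 qed
 moreover have "((\<lambda>v. 2 * c * ln (cmod v) + s0) has_derivative (\<lambda>d. 2 * c * Re (1 / w * d) + 0)) (at w)"
  by (intro has_derivative_add has_derivative_const has_derivative_mult_right[OF ln_norm_has_derivative[OF DERIV_ident w(1)]])
 ultimately have "(\<lambda>_. 0) = (\<lambda>d. 2 * c * Re (1 / w * d) + 0)" by (rule has_derivative_unique)
 from fun_cong[OF this, of w] show False using c_nz w(1) by simp
qed

end

text \<open>In the coordinate \<open>w\<close> the metric is \<open>G (K) (c / |w|)\<^sup>2 |dw|\<^sup>2\<close>, and both maps are dilations there.\<close>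
lemma football_homothety:
 assumes H: "hcmu_football u p q \<alpha> \<beta> F c0 c1 n L ma mb mc md a1 b1 kx"
  and H': "hcmu_football u' p' q' \<alpha>' \<beta>' F' c0' c1' n' L' ma' mb' mc' md' a1' b1' kx'"
  and mu: "\<mu> \<noteq> 0"
  and rel: "\<And>w. w \<noteq> 0 ==> cubic c0' c1' (kx' (mob ma' mb' mc' md' (Some (\<mu> * w)))) * (Re (L' p'))\<^sup>2
   = s * (cubic c0 c1 (kx (mob ma mb mc md (Some w))) * (Re (L p))\<^sup>2)"
  and D: "a * d - b * c \<noteq> 0" and f: "\<And>w. mob a b c d (mob ma mb mc md (Some w)) = mob ma' mb' mc' md' (Some (\<mu> * w))"
 shows "homothety u {p, q} u' (mob a b c d) s"
 unfolding homothety_def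
proof (intro allI impI)
 interpret A: hcmu_football u p q \<alpha> \<beta> F c0 c1 n L ma mb mc md a1 b1 kx by (rule H)
 interpret B: hcmu_football u' p' q' \<alpha>' \<beta>' F' c0' c1' n' L' ma' mb' mc' md' a1' b1' kx' by (rule H')
 fix x assume "x \<notin> {p, q}"
 then obtain w where w: "w \<noteq> 0" and x: "x = A.T (Some w)" using A.regular_preimage by blast
 have mw: "\<mu> * w \<noteq> 0" using mu w by simp
 have fx: "mob a b c d x = B.T (Some (\<mu> * w))" unfolding x f ..
 let ?f = "mob a b c d"
 obtain h r where h: "0 < r" "h holomorphic_on ball 0 r" "h 0 = 0"
  and hf: "\<And>\<zeta>. \<zeta> \<in> ball 0 r ==> coord (?f x) (?f (param x \<zeta>)) = h \<zeta>"
  by (rule mob_chart[OF D, of x]) (rule that)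
 obtain g1 r1 where c1: "mob_coord ma mb mc md w g1 r1" using mob_local[OF A.det] by blast
 note g1 = mob_coordD(1-4)[OF c1] and p1 = mob_coordD(5)[OF c1]
 obtain g2 r2 where c2: "mob_coord ma' mb' mc' md' (\<mu> * w) g2 r2" using mob_local[OF B.det] by blast
 note g2 = mob_coordD(1-4)[OF c2] and p2 = mob_coordD(6)[OF c2]
 have m1: "exp (2 * conf_factor u x 0) * (cmod (deriv g1 w))\<^sup>2 = cubic c0 c1 (kx x) * (A.c / cmod w)\<^sup>2"
  unfolding x by (rule A.metric_chart[OF w c1])
 have m2: "exp (2 * conf_factor u' (?f x) 0) * (cmod (deriv g2 (\<mu> * w)))\<^sup>2 = cubic c0' c1' (kx' (?f x)) * (B.c / cmod (\<mu> * w))\<^sup>2"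
  unfolding fx by (rule B.metric_chart[OF mw c2])
 have d1: "(g1 has_field_derivative deriv g1 w) (at w)" by (rule holomorphic_derivI[OF g1(2) open_ball]) (use g1(1) in simp)
 have d2: "(g2 has_field_derivative deriv g2 (\<mu> * w)) (at (\<mu> * w))" by (rule holomorphic_derivI[OF g2(2) open_ball]) (use g2(1) in simp)
 have d3: "(h has_field_derivative deriv h 0) (at 0)" by (rule holomorphic_derivI[OF h(2) open_ball]) (use h(1) in simp)
 have e1: "((\<lambda>v. h (g1 v)) has_field_derivative deriv h 0 * deriv g1 w) (at w)"
  by (rule DERIV_chain2[OF _ d1]) (use d3 g1(3) in simp)
 have e2: "((\<lambda>v. g2 (\<mu> * v)) has_field_derivative deriv g2 (\<mu> * w) * \<mu>) (at w)"
  by (rule DERIV_chain2[where g = "\<lambda>v. \<mu> * v" and x = w, OF d2]) (auto intro!: derivative_eq_intros)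
 \<comment> \<open>Both sides are the map \<open>mob a b c d\<close> in standard charts, once read
   through the chart at \<open>x\<close> and once as a dilation of the \<open>w\<close> plane;
   comparing derivatives at \<open>w\<close> gives \<open>dd\<close>.\<close>
 have "\<forall>\<^sub>F v in nhds w. h (g1 v) = g2 (\<mu> * v)"
 proof -
  have "open (ball w r1 \<inter> g1 -` ball 0 r)"
   by (rule continuous_open_preimage[OF hol_cont[OF g1(2)] open_ball open_ball])
  moreover have "w \<in> ball w r1 \<inter> g1 -` ball 0 r" using g1(1,3) h(1) by simp
  ultimately have "\<forall>\<^sub>F v in nhds w. v \<in> ball w r1 \<inter> g1 -` ball 0 r" by (rule eventually_nhds_in_open)
  then have t1: "\<forall>\<^sub>F v in nhds w. g1 v \<in> ball 0 r" by (rule eventually_mono) simp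
  have "open ((\<lambda>v. \<mu> * v) -` ball (\<mu> * w) r2)" by (intro open_vimage open_ball continuous_intros)
  then have "\<forall>\<^sub>F v in nhds w. v \<in> (\<lambda>v. \<mu> * v) -` ball (\<mu> * w) r2" by (rule eventually_nhds_in_open) (use g2(1) in simp)
  then have t2: "\<forall>\<^sub>F v in nhds w. \<mu> * v \<in> ball (\<mu> * w) r2" by (rule eventually_mono) simp
  have t3: "\<forall>\<^sub>F v in nhds w. v \<in> ball w r1" by (rule eventually_nhds_in_open) (use g1(1) in auto)
  show ?thesis using t1 t2 t3
  proof eventually_elim
   case (elim v)
   have "h (g1 v) = coord (?f x) (?f (param x (g1 v)))" using hf[OF elim(1)] by simp
   also have "param x (g1 v) = A.T (Some v)" using p1[OF elim(3)] x by simp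
   also have "coord (?f x) (?f (A.T (Some v))) = g2 (\<mu> * v)" unfolding f fx by (rule p2[OF elim(2)])
   finally show ?case .
  qed
 qed
 then have "((\<lambda>v. h (g1 v)) has_field_derivative deriv g2 (\<mu> * w) * \<mu>) (at w)"
  using e2 by (simp add: DERIV_cong_ev)
 then have dd: "deriv h 0 * deriv g1 w = deriv g2 (\<mu> * w) * \<mu>" by (rule DERIV_unique[OF e1])
 have hd: "((\<lambda>\<zeta>. coord (?f x) (?f (param x \<zeta>))) has_field_derivative deriv h 0) (at 0)"
  by (rule has_field_derivative_transform_within_open[OF d3 open_ball[of 0 r]]) (use h(1) hf in auto)
 let ?E' = "exp (2 * conf_factor u' (?f x) 0)" and ?E = "exp (2 * conf_factor u x 0)"
 have "?E' * (cmod (deriv h 0))\<^sup>2 * (cmod (deriv g1 w))\<^sup>2 = ?E' * (cmod (deriv h 0 * deriv g1 w))\<^sup>2"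
  by (simp add: norm_mult power_mult_distrib)
 also have "\<dots> = (?E' * (cmod (deriv g2 (\<mu> * w)))\<^sup>2) * (cmod \<mu>)\<^sup>2" unfolding dd by (simp add: norm_mult power_mult_distrib)
 also have "\<dots> = cubic c0' c1' (kx' (?f x)) * (B.c)\<^sup>2 / (cmod w)\<^sup>2"
  unfolding m2 using mu w by (simp add: norm_mult power_mult_distrib power_divide)
 also have "\<dots> = s * (cubic c0 c1 (kx x) * (A.c)\<^sup>2) / (cmod w)\<^sup>2"
  using rel[OF w] by (simp add: fx x[symmetric] A.c_def B.c_def)
 also have "\<dots> = s * (?E * (cmod (deriv g1 w))\<^sup>2)" unfolding m1 by (simp add: power_divide)
 finally have "?E' * (cmod (deriv h 0))\<^sup>2 = s * ?E" using g1(4) by simp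
 then show "\<exists>D. ((\<lambda>\<zeta>. coord (?f x) (?f (param x \<zeta>))) has_field_derivative D) (at 0) \<and> ?E' * (cmod D)\<^sup>2 = s * ?E"
  using hd by blast
qed

context hcmu_football
begin

lemma rotation_mob: "rotation \<theta> = mob (cis \<theta>) 0 0 1"
proof
 fix x show "rotation \<theta> x = mob (cis \<theta>) 0 0 1 x" by (cases x) (simp_all add: rotation_def mob.simps)
qed

text \<open>A rotation of the \<open>w\<close> plane keeps \<open>cmod w\<close>, hence the
  primitive of \<open>1 / G\<close> at the curvature by \<open>level_sets\<close>, hence the
  curvature, because the primitive is injective; the metric depends on nothing else.\<close>

lemma rotationally_symmetric: "rotationally_symmetric u {p, q}"
proof -
 let ?f = "mob md (- mb) (- mc) ma"
 have det': "md * ma - (- mb) * (- mc) \<noteq> 0" using det by (simp add: mult.commute)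
 have inv: "inv ?f = T"
 proof (rule inv_equality)
  show "T (?f x) = x" for x using mob_inverse[OF det', of x] by simp
  show "?f (T x) = x" for x by (rule mob_inverse[OF det])
 qed
 have "is_isometry u {p, q} u {p, q} (inv ?f \<circ> rotation \<theta> \<circ> ?f)" for \<theta>
 proof -
  have dr: "cis \<theta> * 1 - 0 * 0 \<noteq> 0" by simp
  obtain e f g h where D1: "e * h - f * g \<noteq> 0" and m1: "\<And>x. mob e f g h x = T (mob (cis \<theta>) 0 0 1 x)"
   by (rule mob_comp[OF det dr]) (rule that)
  obtain a b c d where D: "a * d - b * c \<noteq> 0" and m: "\<And>x. mob a b c d x = mob e f g h (?f x)"
   by (rule mob_comp[OF D1 det']) (rule that)
  have eq: "inv ?f \<circ> rotation \<theta> \<circ> ?f = mob a b c d"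
   unfolding inv rotation_mob by (rule ext) (simp add: m m1)
  have on: "mob a b c d (T x) = T (mob (cis \<theta>) 0 0 1 x)" for x unfolding m mob_inverse[OF det] m1 ..
  have onw: "mob a b c d (T (Some w)) = T (Some (cis \<theta> * w))" for w unfolding on by (simp add: mob.simps)
  have im: "mob a b c d ` {p, q} = {p, q}"
   using onw[of 0] on[of None] mob_0 mob_inf by (simp add: mob.simps)
  obtain hh where hh: "\<And>t. t \<in> {a1<..<b1} ==> (hh has_real_derivative 1 / G t) (at t)"
   "\<And>s t. s \<in> {a1<..<b1} ==> t \<in> {a1<..<b1} ==> hh s = hh t ==> s = t" by (rule primitive) (rule that)
  obtain s0 where s0: "\<And>w. w \<noteq> 0 ==> hh (kx (T (Some w))) = 2 * hcmu_football.c p L * ln (cmod w) + s0"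
   by (rule level_sets[OF hh(1)]) (assumption | rule that)+
  have k: "kx (T (Some (cis \<theta> * w))) = kx (T (Some w))" if w: "w \<noteq> 0" for w
   by (rule hh(2)) (use w s0[of w] s0[of "cis \<theta> * w"] kx_regular[of w] kx_regular[of "cis \<theta> * w"] in \<open>simp_all add: norm_mult\<close>)
  have "homothety u {p, q} u (mob a b c d) 1"
   by (rule football_homothety[OF hcmu_football_axioms hcmu_football_axioms cis_neq_zero _ D onw]) (simp add: k)
  then show ?thesis unfolding eq by (rule mob_isometry[OF D im])
 qed
 then show ?thesis unfolding rotationally_symmetric_def using mob_automorphism[OF det'] by blast
qed

lemma football: "football u [p \<mapsto> \<alpha>, q \<mapsto> \<beta>]"
 unfolding football_def dom_eq curvature_ext_eq no_saddles extremal_points_eq extr_eq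
 using hcmu rotationally_symmetric pq by simp

end

section \<open>Area under homotheties, and uniqueness\<close>

lemma area_set:
 assumes u: "conformal_metric u P" and S: "open S" "S \<subseteq> plane_dom P" "finite (plane_dom P - S)"
 shows "area u P = set_lebesgue_integral lborel S (area_density u)"
proof -
 have P: "finite P" using u by (simp add: conformal_metric_def)
 have e: "{z. Some z \<notin> P} = plane_dom P" by (simp add: plane_dom_def)
 have "Ck_on 0 (plane_dom P) (plane_factor u)" by (rule Ck_on_plane_factor[OF u])
 then have "continuous_on (plane_dom P) (area_density u)" unfolding area_density_def[abs_def] by (auto intro!: continuous_intros)
 then have m: "set_borel_measurable lborel X (area_density u)" if "open X" "X \<subseteq> plane_dom P" for X
  using borel_measurable_continuous_on_indicator[of X "area_density u"] that continuous_on_subset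
  by (auto simp: set_borel_measurable_def)
 have "AE x in lborel. x \<notin> plane_dom P - S"
  by (rule AE_not_in[OF finite_imp_null_set_lborel[OF S(3)]])
 then have "AE x in lborel. x \<in> S \<longleftrightarrow> x \<in> plane_dom P" by eventually_elim (use S(2) in auto)
 from set_integral_cong_set[OF m[OF S(1,2)] m[OF open_plane_dom[OF P] order_refl] this]
 show ?thesis by (simp add: area_def e)
qed

text \<open>The area is an integral over the plane, so the points sent to infinity or coming from it
  are removed on both sides; these are finitely many. On the rest the holomorphic change of
  variables applies.\<close>

lemma area_homothety:
 assumes u: "conformal_metric u P" and u': "conformal_metric u' P'" "finite_area u' P'"
  and D: "a * d - b * c \<noteq> 0" and P: "mob a b c d ` P = P'" and hom: "homothety u P u' (mob a b c d) s"
 shows "area u' P' = s * area u P"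
proof -
 have fP: "finite P" "finite P'" using u u' by (simp_all add: conformal_metric_def)
 define N where "N z = (a * z + b) / (c * z + d)" for z
 define S where "S = plane_dom P \<inter> {z. c * z + d \<noteq> 0}"
 have inj: "mob a b c d x = mob a b c d y \<longleftrightarrow> x = y" for x y using mob_bij[OF D] by (meson bij_is_inj injD)
 have m: "mob a b c d (Some z) = Some (N z)" if "c * z + d \<noteq> 0" for z using that by (simp add: mob.simps N_def)
 have oS: "open S" unfolding S_def by (intro open_Int open_plane_dom fP open_Collect_neq continuous_intros)
 have Nd: "(N has_field_derivative (a * d - b * c) / (c * z + d)\<^sup>2) (at z)" if "c * z + d \<noteq> 0" for z
  unfolding N_def[abs_def] by (rule mob_deriv[OF that])
 have Nh: "N holomorphic_on S" using Nd oS unfolding S_def by (auto simp: holomorphic_on_open)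
 have Ninj: "inj_on N S"
 proof (rule inj_onI)
  fix z w assume zw: "z \<in> S" "w \<in> S" "N z = N w"
  then have "mob a b c d (Some z) = mob a b c d (Some w)" using m by (simp add: S_def)
  then show "z = w" using inj by simp
 qed
 have im: "N ` S \<subseteq> plane_dom P'"
 proof
  fix y assume "y \<in> N ` S"
  then obtain z where z: "z \<in> S" "y = N z" by blast
  have "Some y \<notin> P'"
  proof
   assume "Some y \<in> P'"
   then obtain x where "x \<in> P" "mob a b c d x = mob a b c d (Some z)" using P m z by (auto simp: S_def)
   then show False using inj z by (auto simp: S_def plane_dom_def)
  qed
  then show "y \<in> plane_dom P'" by (simp add: plane_dom_def)
 qed
 have oN: "open (N ` S)" by (rule open_mapping_thm3[OF Nh oS Ninj])
 have fin1: "finite (plane_dom P - S)"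
 proof (rule finite_subset)
  show "plane_dom P - S \<subseteq> {- d / c}"
  proof
   fix z assume "z \<in> plane_dom P - S"
   then have z: "c * z + d = 0" by (simp add: S_def)
   then have "c \<noteq> 0" using D by auto
   then show "z \<in> {- d / c}" using z by (simp add: field_simps eq_neg_iff_add_eq_0)
  qed
 qed simp
 have fin2: "finite (plane_dom P' - N ` S)"
 proof (rule finite_subset)
  show "plane_dom P' - N ` S \<subseteq> {a / c}"
  proof
   fix y assume y: "y \<in> plane_dom P' - N ` S"
   have "Some y \<in> range (mob a b c d)" using bij_is_surj[OF mob_bij[OF D]] by simp
   then obtain x where x: "Some y = mob a b c d x" by blast
   have xP: "x \<notin> P" using y P x by (auto simp: plane_dom_def)
   show "y \<in> {a / c}"
   proof (cases x)
    case None
    then show ?thesis using x by (simp add: mob.simps split: if_splits)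
   next
    case (Some z)
    then have cz: "c * z + d \<noteq> 0" using x by (auto simp: mob.simps)
    then have "z \<in> S" using xP Some by (simp add: S_def plane_dom_def)
    moreover have "y = N z" using x Some m[OF cz] by simp
    ultimately show ?thesis using y by auto
   qed
  qed
 qed simp
 have dens: "(cmod (deriv N z))\<^sup>2 * area_density u' (N z) = s * area_density u z" if z: "z \<in> S" for z
 proof -
  have cz: "c * z + d \<noteq> 0" and zP: "Some z \<notin> P" using z by (auto simp: S_def plane_dom_def)
  obtain E where E: "((\<lambda>\<zeta>. coord (mob a b c d (Some z)) (mob a b c d (param (Some z) \<zeta>))) has_field_derivative E) (at 0)"
   "exp (2 * conf_factor u' (mob a b c d (Some z)) 0) * (cmod E)\<^sup>2 = s * exp (2 * conf_factor u (Some z) 0)"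
   using hom zP unfolding homothety_def by blast
  have "((\<lambda>\<zeta>. N (z + \<zeta>) - N z) has_field_derivative E) (at 0)"
  proof (rule has_field_derivative_transform_within_open[OF E(1)])
   show "open {\<zeta>. c * (z + \<zeta>) + d \<noteq> 0}" by (intro open_Collect_neq continuous_intros)
   show "0 \<in> {\<zeta>. c * (z + \<zeta>) + d \<noteq> 0}" using cz by simp
   fix \<zeta> assume "\<zeta> \<in> {\<zeta>. c * (z + \<zeta>) + d \<noteq> 0}"
   then have "c * (z + \<zeta>) + d \<noteq> 0" by simp
   from m[OF this] show "coord (mob a b c d (Some z)) (mob a b c d (param (Some z) \<zeta>)) = N (z + \<zeta>) - N z"
    using m[OF cz] by simp
  qed
  moreover have "((\<lambda>\<zeta>. N (z + \<zeta>) - N z) has_field_derivative deriv N z) (at 0)"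
  proof -
   have N0: "(N has_field_derivative deriv N z) (at (z + 0))" using DERIV_imp_deriv[OF Nd[OF cz]] Nd[OF cz] by simp
   have "((\<lambda>\<zeta>. z + \<zeta>) has_field_derivative 1) (at 0)" by (auto intro!: derivative_eq_intros)
   from DERIV_diff[OF DERIV_chain2[where g = "\<lambda>\<zeta>. z + \<zeta>" and x = 0, OF N0 this] DERIV_const[of "N z"]]
   show ?thesis by simp
  qed
  ultimately have "E = deriv N z" by (rule DERIV_unique)
  then show ?thesis
   using E(2) unfolding m[OF cz] area_density_def by (simp add: conf_factor_shift[of u z] conf_factor_shift[of u' "N z"] mult.commute)
 qed
 have "Ck_on 0 (plane_dom P') (plane_factor u')" by (rule Ck_on_plane_factor[OF u'(1)])
 then have cd: "continuous_on (N ` S) (area_density u')"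
  unfolding area_density_def[abs_def] by (auto intro!: continuous_intros continuous_on_subset[OF _ im])
 have "set_integrable lborel (plane_dom P') (area_density u')" using u'(2) unfolding finite_area_def plane_dom_def .
 then have si: "set_integrable lborel (N ` S) (area_density u')"
  by (rule set_integrable_subset) (use oN im in auto)
 have "area u' P' = set_lebesgue_integral lborel S (\<lambda>z. (cmod (deriv N z))\<^sup>2 * area_density u' (N z))"
  using holomorphic_change_of_variables(2)[OF oS Nh Ninj cd si] area_set[OF u'(1) oN im fin2] by simp
 also have "\<dots> = set_lebesgue_integral lborel S (\<lambda>z. s * area_density u z)"
  by (rule set_lebesgue_integral_cong) (use dens oS in auto)
 also have "\<dots> = s * area u P" using area_set[OF u oS _ fin1] by (simp add: S_def)
 finally show ?thesis .
qed

lemma area_nonzero: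
 assumes u: "conformal_metric u P" "finite_area u P" shows "area u P \<noteq> 0"
proof
 assume a: "area u P = 0"
 let ?f = "\<lambda>z. indicator (plane_dom P) z *\<^sub>R area_density u z"
 have fP: "finite P" using u by (simp add: conformal_metric_def)
 have i: "integrable lborel ?f" using u(2) unfolding finite_area_def set_integrable_def plane_dom_def .
 have "integral\<^sup>L lborel ?f = 0" using a unfolding area_def set_lebesgue_integral_def plane_dom_def .
 then have "AE z in lborel. ?f z = 0"
  using integral_nonneg_eq_0_iff_AE[OF i] by (simp add: area_density_def)
 moreover have "AE z in lborel. z \<notin> - plane_dom P"
  by (rule AE_not_in[OF finite_imp_null_set_lborel[OF finite_plane_compl[OF fP]]])
 ultimately have "AE z::complex in lborel. False"
  by eventually_elim (simp add: area_density_def indicator_def split: if_splits)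
 then show False by (simp add: AE_iff_null emeasure_lborel_UNIV null_sets_def)
qed

text \<open>With one maximum and one minimum the balance reads \<open>ga * x = gb * y\<close> for
  their angles \<open>x\<close> and \<open>y\<close>, so \<open>ga < gb\<close> puts the larger
  angle at the maximum. The angles thus decide which marked point is the maximum.\<close>

lemma (in hcmu_football) max_p: "p \<in> maxs ==> maxs = {p} \<and> mins = {q} \<and> \<beta> < \<alpha>"
 and max_q: "q \<in> maxs ==> \<alpha> < \<beta>"
proof -
 have sp: "maxs \<union> mins = {p, q}" using extr_split extr_eq by simp
 have angs: "ang p = \<alpha>" "ang q = \<beta>" using pq by (simp_all add: ang_def)
 have pos: "0 < ang x" if "x \<in> maxs" for x
 proof -
  have "Re (L x) < 0" using that unfolding max_points_eq by simp
  then have "0 < gb * - Re (L x)" using slopes(1,2) by (intro mult_pos_pos) auto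
  then show ?thesis using ang_max[OF that] by simp
 qed
 have lt: "y < x" if "ga * x = gb * y" "0 < x" for x y :: real
 proof -
  have "gb * y < gb * x" using that slopes(1,2) by (metis mult_strict_right_mono)
  then show ?thesis using slopes(1,2) by (simp add: mult_less_cancel_left)
 qed
 show "maxs = {p} \<and> mins = {q} \<and> \<beta> < \<alpha>" if p: "p \<in> maxs"
 proof -
  have "p \<notin> mins" using p max_min_disjoint by auto
  then have mn: "mins = {q}" using sp points_nonempty(2) by auto
  then have mx: "maxs = {p}" using sp p max_min_disjoint by auto
  show ?thesis using lt[of \<alpha> \<beta>] angle_balance pos[OF p] by (simp add: mn mx angs)
 qed
 show "\<alpha> < \<beta>" if q: "q \<in> maxs"
 proof -
  have "q \<notin> mins" using q max_min_disjoint by auto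
  then have mn: "mins = {p}" using sp points_nonempty(2) by auto
  then have mx: "maxs = {q}" using sp q max_min_disjoint by auto
  show ?thesis using lt[of \<beta> \<alpha>] angle_balance pos[OF q] by (simp add: mn mx angs)
 qed
qed

text \<open>The angles give the ratio of the slopes, and this fixes \<open>a1 / b1\<close>; so the
  two cubics agree up to the scaling \<open>x \<mapsto> m * x\<close>. Under it the cubic scales by
  \<open>m ^ 3\<close>, the slopes by \<open>m\<^sup>2\<close>, the residue by
  \<open>1 / m\<^sup>2\<close>, and hence the metric by \<open>m ^ 3 / m ^ 4 = 1 / m\<close>. Equal
  areas leave \<open>m = 1\<close>.\<close>

lemma football_unique:
 assumes H: "hcmu_football u p q \<alpha> \<beta> F c0 c1 n L ma mb mc md a1 b1 kx"
  and H': "hcmu_football u' p' q' \<alpha> \<beta> F' c0' c1' n' L' ma' mb' mc' md' a1' b1' kx'"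
  and p: "p \<in> max_points kx" "p' \<in> max_points kx'" and ar: "area u' {p', q'} = area u {p, q}"
 shows "isometric u {p, q} u' {p', q'}"
proof -
 interpret A: hcmu_football u p q \<alpha> \<beta> F c0 c1 n L ma mb mc md a1 b1 kx by (rule H)
 interpret B: hcmu_football u' p' q' \<alpha> \<beta> F' c0' c1' n' L' ma' mb' mc' md' a1' b1' kx' by (rule H')
 have bal: "A.ga * \<alpha> = A.gb * \<beta>" using A.angle_balance A.max_p[OF p(1)] A.pq by (simp add: A.ang_def)
 have bal': "B.ga * \<alpha> = B.gb * \<beta>" using B.angle_balance B.max_p[OF p(2)] B.pq by (simp add: B.ang_def)
 have alpha: "0 < \<alpha>" using A.max_p[OF p(1)] A.angles_nonneg by simp
 have "A.ga * B.gb * \<alpha> = B.gb * (A.ga * \<alpha>)" by simp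
 also have "\<dots> = A.gb * (B.gb * \<beta>)" unfolding bal by simp
 also have "\<dots> = B.ga * A.gb * \<alpha>" unfolding bal'[symmetric] by simp
 finally have "A.ga * B.gb = B.ga * A.gb" using alpha by simp
 then have "((b1 - a1) * (b1' - a1')) * ((b1 + 2 * a1) * (a1' + 2 * b1')) = ((b1 - a1) * (b1' - a1')) * ((b1' + 2 * a1') * (a1 + 2 * b1))"
 proof -
  assume eq: "A.ga * B.gb = B.ga * A.gb"
  have "((b1 - a1) * (b1' - a1')) * ((b1 + 2 * a1) * (a1' + 2 * b1')) = 144 * (A.ga * B.gb)"
   unfolding A.slopes(4) B.slopes(3) by simp
  moreover have "((b1 - a1) * (b1' - a1')) * ((b1' + 2 * a1') * (a1 + 2 * b1)) = 144 * (B.ga * A.gb)"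
   unfolding A.slopes(3) B.slopes(4) by simp
  ultimately show ?thesis unfolding eq by simp
 qed
 then have "(b1 + 2 * a1) * (a1' + 2 * b1') = (b1' + 2 * a1') * (a1 + 2 * b1)" using A.roots(3) B.roots(3) by simp
 then have cross: "a1 * b1' = a1' * b1" by (simp add: algebra_simps)
 have b_pos: "0 < b1" using cubic_positive_sum(3)[OF A.roots A.G_pos] A.roots(3) by linarith
 have b_pos': "0 < b1'" using cubic_positive_sum(3)[OF B.roots B.G_pos] B.roots(3) by linarith
 define m where "m = b1' / b1"
 have m: "0 < m" "b1' = m * b1" "a1' = m * a1"
  using b_pos b_pos' cross by (simp_all add: m_def field_simps)
 have scal: "cubic c0' c1' (m * x) = m ^ 3 * cubic c0 c1 x" for x
  unfolding cubic_two_roots(1)[OF A.roots] cubic_two_roots(1)[OF B.roots] m(2,3)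
  by (simp add: power3_eq_cube algebra_simps)
 have "(b1' - a1') * (a1' + 2 * b1') / 12 = m\<^sup>2 * ((b1 - a1) * (a1 + 2 * b1) / 12)"
  unfolding m(2,3) by (simp add: power2_eq_square algebra_simps)
 then have gb: "B.gb = m\<^sup>2 * A.gb" by (simp only: A.slopes(3) B.slopes(3))
 have "A.ang p = \<alpha>" "B.ang p' = \<alpha>" by (simp_all add: A.ang_def B.ang_def)
 then have "- A.gb * A.c = - B.gb * B.c"
  using A.ang_max[OF p(1)] B.ang_max[OF p(2)] by (simp only: A.c_def B.c_def)
 then have "A.gb * A.c = A.gb * (m\<^sup>2 * B.c)" unfolding gb by simp
 moreover have "A.gb \<noteq> 0" using A.slopes(1,2) by linarith
 ultimately have c: "A.c = m\<^sup>2 * B.c" by simp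
 obtain hh where hh: "\<And>t. t \<in> {a1<..<b1} ==> (hh has_real_derivative 1 / A.G t) (at t)"
  "\<And>s t. s \<in> {a1<..<b1} ==> t \<in> {a1<..<b1} ==> hh s = hh t ==> s = t" by (rule A.primitive) (rule that)
 have in_range: "t / m \<in> {a1<..<b1}" if "t \<in> {a1'<..<b1'}" for t
  using that m(1) unfolding m(2,3) by (simp add: field_simps)
 \<comment> \<open>The primitive for the second metric is a rescaling of the first one, so that both
   level-set formulas speak about the same \<open>hh\<close>.\<close>
 have hh': "((\<lambda>t. hh (t / m) / m\<^sup>2) has_real_derivative 1 / B.G t) (at t)" if t: "t \<in> {a1'<..<b1'}" for t
 proof -
  have "((\<lambda>t. hh (t / m)) has_real_derivative 1 / A.G (t / m) * (1 / m)) (at t)"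
   by (rule DERIV_chain2[where g = "\<lambda>t. t / m", OF hh(1)[OF in_range[OF t]]]) (use m(1) in \<open>auto intro!: derivative_eq_intros\<close>)
  then have "((\<lambda>t. hh (t / m) / m\<^sup>2) has_real_derivative 1 / A.G (t / m) * (1 / m) / m\<^sup>2) (at t)" by (rule DERIV_cdivide)
  moreover have "B.G t = m ^ 3 * A.G (t / m)" using scal[of "t / m"] m(1) by simp
  ultimately show ?thesis by (simp add: power3_eq_cube power2_eq_square mult_ac)
 qed
 obtain s0 where s0: "\<And>w. w \<noteq> 0 ==> hh (kx (A.T (Some w))) = 2 * A.c * ln (cmod w) + s0"
  by (rule A.level_sets[OF hh(1)]) (assumption | rule that)+
 obtain s1 where s1: "\<And>w. w \<noteq> 0 ==> hh (kx' (B.T (Some w)) / m) / m\<^sup>2 = 2 * B.c * ln (cmod w) + s1"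
  by (rule B.level_sets[OF hh']) (assumption | rule that)+
 \<comment> \<open>The dilation by \<open>exp t\<close> shifts \<open>2 * A.c * ln (cmod w)\<close>
   by \<open>2 * A.c * t\<close>, which absorbs the difference of the two constants of
   integration.\<close>
 define t where "t = (s0 - m\<^sup>2 * s1) / (2 * A.c)"
 define \<mu> where "\<mu> = cr (exp t)"
 have mu: "\<mu> \<noteq> 0" by (simp add: \<mu>_def)
 have k: "kx' (B.T (Some (\<mu> * w))) = m * kx (A.T (Some w))" if w: "w \<noteq> 0" for w
 proof -
  have mw: "\<mu> * w \<noteq> 0" using mu w by simp
  have "ln (cmod (\<mu> * w)) = t + ln (cmod w)" using w by (simp add: \<mu>_def norm_mult ln_mult)
  then have "hh (kx' (B.T (Some (\<mu> * w))) / m) = m\<^sup>2 * (2 * B.c * (t + ln (cmod w)) + s1)"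
   using s1[OF mw] m(1) by (simp add: field_simps)
  also have "\<dots> = 2 * A.c * t + 2 * A.c * ln (cmod w) + m\<^sup>2 * s1" unfolding c by (simp add: algebra_simps)
  also have "2 * A.c * t = s0 - m\<^sup>2 * s1" using A.c_nz by (simp add: t_def)
  finally have "hh (kx' (B.T (Some (\<mu> * w))) / m) = hh (kx (A.T (Some w)))" using s0[OF w] by simp
  from hh(2)[OF in_range[OF B.kx_regular[OF mw]] A.kx_regular[OF w] this] show ?thesis using m(1) by (simp add: field_simps)
 qed
 have rel: "cubic c0' c1' (kx' (B.T (Some (\<mu> * w)))) * (Re (L' p'))\<^sup>2 = 1 / m * (cubic c0 c1 (kx (A.T (Some w))) * (Re (L p))\<^sup>2)" if w: "w \<noteq> 0" for w
 proof -
  have "Re (L p) = m\<^sup>2 * Re (L' p')" using c by (simp add: A.c_def B.c_def)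
  then show ?thesis unfolding k[OF w] scal using m(1) by (simp add: power2_eq_square power3_eq_cube)
 qed
 have dm: "\<mu> * 1 - 0 * 0 \<noteq> 0" using mu by simp
 have dA: "md * ma - (- mb) * (- mc) \<noteq> 0" using A.det by (simp add: mult.commute)
 obtain e f g h where D1: "e * h - f * g \<noteq> 0" and m1: "\<And>x. mob e f g h x = B.T (mob \<mu> 0 0 1 x)"
  by (rule mob_comp[OF B.det dm]) (rule that)
 obtain a b c d where D: "a * d - b * c \<noteq> 0" and mm: "\<And>x. mob a b c d x = mob e f g h (mob md (- mb) (- mc) ma x)"
  by (rule mob_comp[OF D1 dA]) (rule that)
 have on: "mob a b c d (A.T x) = B.T (mob \<mu> 0 0 1 x)" for x unfolding mm mob_inverse[OF A.det] m1 ..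
 have onw: "mob a b c d (A.T (Some w)) = B.T (Some (\<mu> * w))" for w unfolding on by (simp add: mob.simps)
 have im: "mob a b c d ` {p, q} = {p', q'}"
  using onw[of 0] on[of None] A.mob_0 A.mob_inf B.mob_0 B.mob_inf by (simp add: mob.simps)
 have hom: "homothety u {p, q} u' (mob a b c d) (1 / m)"
  by (rule football_homothety[OF H H' mu rel D onw])
 have fa: "finite_area u {p, q}" "finite_area u' {p', q'}"
  using A.hcmu B.hcmu unfolding nonCSC_HCMU_def A.dom_eq B.dom_eq by auto
 have "area u' {p', q'} = 1 / m * area u {p, q}" by (rule area_homothety[OF A.conf B.conf fa(2) D im hom])
 then have "m = 1" using ar area_nonzero[OF A.conf fa(1)] m(1) by (simp add: field_simps)
 then have "homothety u {p, q} u' (mob a b c d) 1" using hom by simp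
 from mob_isometry[OF D im this] show ?thesis unfolding isometric_def by blast
qed

section \<open>Assembly of the classification\<close>

lemma football_exists:
 assumes "p \<noteq> q" "nonCSC_HCMU u [p \<mapsto> \<alpha>, q \<mapsto> \<beta>]"
  and "p \<in> extremal_points (curvature_ext u {p, q})" "q \<in> extremal_points (curvature_ext u {p, q})"
 obtains F c0 c1 n L ma mb mc md a1 b1 kx where "hcmu_football u p q \<alpha> \<beta> F c0 c1 n L ma mb mc md a1 b1 kx"
  "curvature_ext u {p, q} = kx"
proof -
 obtain F c0 c1 where S: "hcmu_surface u p q \<alpha> \<beta> F c0 c1" by (rule hcmu_surface_exists[OF assms(1,2)]) (rule that)
 obtain n L ma mb mc md a1 b1 kx where H: "hcmu_sphere u p q \<alpha> \<beta> F c0 c1 n L ma mb mc md a1 b1 kx"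
  by (rule hcmu_sphere_exists[OF S]) (rule that)
 interpret hcmu_sphere u p q \<alpha> \<beta> F c0 c1 n L ma mb mc md a1 b1 kx by (rule H)
 have "n p = 0" "n q = 0" using assms(3,4) unfolding curvature_ext_eq extremal_points_eq by (simp_all add: extr_def)
 then have "hcmu_football u p q \<alpha> \<beta> F c0 c1 n L ma mb mc md a1 b1 kx" by unfold_locales
 then show ?thesis using curvature_ext_eq by (rule that)
qed

lemma swap_marked: "p \<noteq> q ==> [p \<mapsto> \<alpha>, q \<mapsto> \<beta>] = [q \<mapsto> \<beta>, p \<mapsto> \<alpha>]"
 by (rule fun_upd_twist)

text \<open>Of \<open>p'\<close> only extremality is assumed: a maximum at \<open>p\<close> means
  \<open>\<beta> < \<alpha>\<close>, and this forces the maximum of the second surface to be at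
  \<open>p'\<close>.\<close>

lemma isometric_of_max:
 assumes "p \<noteq> q" "nonCSC_HCMU u [p \<mapsto> \<alpha>, q \<mapsto> \<beta>]" "p' \<noteq> q'" "nonCSC_HCMU u' [p' \<mapsto> \<alpha>, q' \<mapsto> \<beta>]"
  and ex: "p \<in> max_points (curvature_ext u {p, q})" "q \<in> extremal_points (curvature_ext u {p, q})"
   "p' \<in> extremal_points (curvature_ext u' {p', q'})" "q' \<in> extremal_points (curvature_ext u' {p', q'})"
  and ar: "area u' {p', q'} = area u {p, q}"
 shows "isometric u {p, q} u' {p', q'}"
proof -
 have pe: "p \<in> extremal_points (curvature_ext u {p, q})" using ex(1) by (simp add: extremal_points_def)
 obtain F c0 c1 n L ma mb mc md a1 b1 kx where H: "hcmu_football u p q \<alpha> \<beta> F c0 c1 n L ma mb mc md a1 b1 kx"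
  "curvature_ext u {p, q} = kx" by (rule football_exists[OF assms(1,2) pe ex(2)]) (rule that)
 obtain F' c0' c1' n' L' ma' mb' mc' md' a1' b1' kx' where H': "hcmu_football u' p' q' \<alpha> \<beta> F' c0' c1' n' L' ma' mb' mc' md' a1' b1' kx'"
  "curvature_ext u' {p', q'} = kx'" by (rule football_exists[OF assms(3,4) ex(3,4)]) (rule that)
 interpret A: hcmu_football u p q \<alpha> \<beta> F c0 c1 n L ma mb mc md a1 b1 kx by (rule H)
 interpret B: hcmu_football u' p' q' \<alpha> \<beta> F' c0' c1' n' L' ma' mb' mc' md' a1' b1' kx' by (rule H')
 have pm: "p \<in> max_points kx" using ex(1) H(2) by simp
 have "max_points kx' \<union> min_points kx' = {p', q'}" using B.extr_split B.extr_eq by simp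
 moreover have "q' \<notin> max_points kx'" using B.max_q A.max_p[OF pm] by auto
 ultimately have "p' \<in> max_points kx'" using B.points_nonempty(1) by auto
 then show ?thesis using football_unique[OF H(1) H'(1) pm] ar by simp
qed

theorem theorem1p6:
  fixes g :: conf_metric and p q :: sphere and \<alpha> \<beta> :: real and K :: "sphere \<Rightarrow> real"
  assumes "0 \<le> \<alpha>" "\<alpha> \<noteq> 1" "0 \<le> \<beta>" "\<beta> \<noteq> 1" "p \<noteq> q"
    and "nonCSC_HCMU g [p \<mapsto> \<alpha>, q \<mapsto> \<beta>]"
    and "K = curvature_ext g {p, q}"
  shows
    "(p \<in> extremal_points K \<and> q \<in> extremal_points K \<longrightarrow>
        rotationally_symmetric g {p, q} \<and>
        (\<forall>g' p' q'. p' \<noteq> q' \<and> nonCSC_HCMU g' [p' \<mapsto> \<alpha>, q' \<mapsto> \<beta>] \<and>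
            p' \<in> extremal_points (curvature_ext g' {p', q'}) \<and>
            q' \<in> extremal_points (curvature_ext g' {p', q'}) \<and>
            area g' {p', q'} = area g {p, q}
            \<longrightarrow> isometric g {p, q} g' {p', q'}) \<and>
        football g [p \<mapsto> \<alpha>, q \<mapsto> \<beta>])
     \<and>
     (p \<in> saddle_points {p, q} K \<and> q \<in> extremal_points K \<longrightarrow>
        (\<exists>a::int. \<alpha> = of_int a \<and> 2 \<le> a \<and>
          (\<forall>b::int. \<beta> = of_int b \<and> 2 \<le> b \<longrightarrow>
            (q \<in> max_points K \<longrightarrow>
              (\<exists>I1 I2 :: int. has_points (max_points K) (I1 + 1) \<and> I1 + 1 \<ge> 1 \<and>
                 has_points (min_points K) I2 \<and> I2 \<ge> 1 \<and>
                 I1 + I2 = a \<and>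
                 (I2 = 1 \<or>
                  (I2 \<ge> 2 \<and> I2 dvd (I1 + b) \<and> I1 + b > a - 1) \<or>
                  (I2 \<ge> 2 \<and> \<not> I2 dvd (I1 + b))))) \<and>
            (q \<in> min_points K \<longrightarrow>
              (\<exists>I1 I2 :: int. has_points (max_points K) I1 \<and> I1 \<ge> 1 \<and>
                 has_points (min_points K) (I2 + 1) \<and> I2 + 1 \<ge> 1 \<and>
                 I1 + I2 = a \<and>
                 (I2 = 0 \<or>
                  (I2 \<ge> 1 \<and> \<not> (I2 + b) dvd I1 \<and>
                   I1 * (I2 + b) \<ge> (a - 1) * gcd (I2 + b) I1))))) \<and>
          (\<beta> \<notin> \<int> \<longrightarrow>
            (q \<in> max_points K \<longrightarrow>
              (\<exists>I1 I2 :: int. has_points (max_points K) (I1 + 1) \<and> I1 + 1 \<ge> 1 \<and>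
                 has_points (min_points K) I2 \<and> I2 \<ge> 1 \<and>
                 I1 + I2 = a \<and> of_int I1 + \<beta> > of_int I2)) \<and>
            (q \<in> min_points K \<longrightarrow>
              (\<exists>I1 I2 :: int. has_points (max_points K) I1 \<and> I1 \<ge> 1 \<and>
                 has_points (min_points K) (I2 + 1) \<and> I2 + 1 \<ge> 1 \<and>
                 I1 + I2 = a \<and> of_int I1 > of_int I2 + \<beta>)))))
     \<and>
     (p \<in> saddle_points {p, q} K \<and> q \<in> saddle_points {p, q} K \<longrightarrow>
        (\<exists>a b :: int. \<alpha> = of_int a \<and> \<beta> = of_int b \<and> 2 \<le> a \<and> 2 \<le> b \<and>
          (\<exists>I1 I2 :: int. has_points (max_points K) I1 \<and> I1 \<ge> 1 \<and>
             has_points (min_points K) I2 \<and> I2 \<ge> 1 \<and>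
             I1 > I2 \<and> I1 + I2 = a + b \<and>
             (I2 = 1 \<or>
              (I2 \<ge> 2 \<and> I2 dvd I1 \<and> I1 \<ge> max a b) \<or>
              (I2 \<ge> 2 \<and> \<not> I2 dvd I1)))))"
proof -
 obtain F c0 c1 where S: "hcmu_surface g p q \<alpha> \<beta> F c0 c1"
  by (rule hcmu_surface_exists[OF assms(5,6)]) (rule that)
 obtain n L ma mb mc md a1 b1 kx where H: "hcmu_sphere g p q \<alpha> \<beta> F c0 c1 n L ma mb mc md a1 b1 kx"
  by (rule hcmu_sphere_exists[OF S]) (rule that)
 interpret A: hcmu_sphere g p q \<alpha> \<beta> F c0 c1 n L ma mb mc md a1 b1 kx by (rule H)
 have K: "K = kx" using assms(7) A.curvature_ext_eq by simp
 have qp: "q \<noteq> p" "nonCSC_HCMU g [q \<mapsto> \<beta>, p \<mapsto> \<alpha>]" using assms(5,6) unfolding swap_marked[OF assms(5)] by simp_all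
 have sym: "{q, p} = {p, q}" by auto
 have saddle: "\<alpha> = real (n p)" "2 \<le> n p" if "p \<in> saddle_points {p, q} K"
  using A.singular_saddle[of p] that by (simp_all add: K A.ang_def)
 have saddle_q: "\<beta> = real (n q)" "2 \<le> n q" if "q \<in> saddle_points {p, q} K"
  using A.singular_saddle[of q] that assms(5) by (simp_all add: K A.ang_def)
 show ?thesis
 proof ((rule conjI[OF _ conjI]; rule impI; erule conjE), goal_cases)
  case e: 1
  have "n p = 0" "n q = 0" using e by (simp_all add: K A.extremal_points_eq A.extr_def)
  then interpret B: hcmu_football g p q \<alpha> \<beta> F c0 c1 n L ma mb mc md a1 b1 kx by unfold_locales
  have "isometric g {p, q} g' {p', q'}"
   if h: "p' \<noteq> q'" "nonCSC_HCMU g' [p' \<mapsto> \<alpha>, q' \<mapsto> \<beta>]" "p' \<in> extremal_points (curvature_ext g' {p', q'})"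
    "q' \<in> extremal_points (curvature_ext g' {p', q'})" "area g' {p', q'} = area g {p, q}" for g' p' q'
  proof (cases "p \<in> max_points K")
   case True
   show ?thesis
    by (rule isometric_of_max[OF assms(5,6) h(1,2) _ _ h(3-5)]) (use True e in \<open>simp_all add: assms(7)\<close>)
  next
   \<comment> \<open>The maximum is then at \<open>q\<close>; exchanging the marked points together
     with their angles reduces to the first case on both surfaces.\<close>
   case False
   have "q \<in> max_points K" using False A.points_nonempty(1) A.extr_split B.extr_eq K by auto
   have h': "q' \<noteq> p'" "nonCSC_HCMU g' [q' \<mapsto> \<beta>, p' \<mapsto> \<alpha>]" "{q', p'} = {p', q'}"
    using h(1,2) unfolding swap_marked[OF h(1)] by auto
   have "isometric g {q, p} g' {q', p'}"
    by (rule isometric_of_max[OF qp h'(1,2)])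
     (use \<open>q \<in> max_points K\<close> e h in \<open>simp_all add: h'(3) sym assms(7)\<close>)
   then show ?thesis by (simp only: sym h'(3))
  qed
  then show ?case using B.rotationally_symmetric B.football by blast
 next
  case s: 2
  note np = saddle[OF s(1)]
  have np0: "0 < n p" using np by simp
  show ?case
  proof (rule exI[of _ "int (n p)"], intro conjI allI impI, goal_cases)
   case (3 b)
   then show ?case using A.saddle_max_case[OF np0] unfolding K by blast
  next
   case (4 b)
   then show ?case using A.saddle_min_case[OF np0] unfolding K by blast
  next
   case 5
   then show ?case using A.saddle_max_case[OF np0] unfolding K by blast
  next
   case 6
   \<comment> \<open>The strict inequality in \<open>saddle_min_case\<close> is guarded against a
     cusp at \<open>q\<close>, which a non-integral angle is not.\<close>
   then have "\<beta> \<noteq> 0" by auto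
   then show ?case using 6 A.saddle_min_case[OF np0] unfolding K by blast
  qed (use np in simp_all)
 next
  case s: 3
  note np = saddle[OF s(1)] and nq = saddle_q[OF s(2)]
  have pos: "0 < n p" "0 < n q" using np nq by auto
  note A = A.two_saddles_case[OF pos, folded K]
  \<comment> \<open>A second run with the marked points exchanged puts \<open>q\<close> at the
    origin of the Moebius coordinate and supplies the bound on its order.\<close>
  obtain F' c0' c1' where S': "hcmu_surface g q p \<beta> \<alpha> F' c0' c1'"
   by (rule hcmu_surface_exists[OF qp]) (rule that)
  obtain n' L' ma' mb' mc' md' a1' b1' kx' where H': "hcmu_sphere g q p \<beta> \<alpha> F' c0' c1' n' L' ma' mb' mc' md' a1' b1' kx'"
   by (rule hcmu_sphere_exists[OF S']) (rule that)
  interpret B: hcmu_sphere g q p \<beta> \<alpha> F' c0' c1' n' L' ma' mb' mc' md' a1' b1' kx' by (rule H')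
  have K': "K = kx'" using assms(7) B.curvature_ext_eq by (simp add: sym)
  have n': "\<beta> = real (n' q)" "2 \<le> n' q" "2 \<le> n' p"
   using B.singular_saddle[of q] B.singular_saddle[of p] s by (simp_all add: K' sym B.ang_def)
  \<comment> \<open>Both runs read the angle at the saddle \<open>q\<close> as the order there, so
    the orders agree although they come from different choices.\<close>
  have nn: "n' q = n q" using n'(1) nq(1) by simp
  have pos': "0 < n' q" "0 < n' p" using n' by auto
  let ?i = "card (max_points K)" and ?j = "card (min_points K)"
  have d: "n p \<le> ?i" "n q \<le> ?i" if "?j dvd ?i"
   using A(5) B.two_saddles_case(5)[OF pos', folded K'] that nn by simp_all
  have "int ?j dvd int ?i ==> max (int (n p)) (int (n q)) \<le> int ?i" using d by simp
  then have f1: "int ?j = 1 \<or> (int ?j \<ge> 2 \<and> int ?j dvd int ?i \<and> int ?i \<ge> max (int (n p)) (int (n q))) \<or> (int ?j \<ge> 2 \<and> \<not> int ?j dvd int ?i)"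
   using A(2) by linarith
  have f2: "has_points (max_points K) (int ?i)" "has_points (min_points K) (int ?j)"
   using A.finite_max A.finite_min by (simp_all add: has_points_def K)
  have f3: "int ?i + int ?j = int (n p) + int (n q)" "1 \<le> int ?i" "1 \<le> int ?j" "int ?j < int ?i" using A(1-4) by linarith+
  have f4: "\<alpha> = of_int (int (n p))" "\<beta> = of_int (int (n q))" "2 \<le> int (n p)" "2 \<le> int (n q)" using np nq by simp_all
  show ?case
   by (rule exI[of _ "int (n p)"], rule exI[of _ "int (n q)"], intro conjI f4,
     rule exI[of _ "int ?i"], rule exI[of _ "int ?j"], intro conjI f1 f2 f3)
 qed
qed

end
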